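(* Let $n\ge 2$ and $0<\varphi<\frac{\pi}{2}$. (Necessity) Let $\mathcal F$ be a transversely $C^1$ totally umbilical codimension $1$ foliation of $\mathbb H^n$ orthogonal to an arc-length parametrized $\varphi$-hypercycle $\gamma:\mathbb R\to\mathbb H^n$, and let $h(t)$ be the mean curvature of the leaf through $\gamma(t)$ (taken with orientation opposite to $\gamma$). Then $|h|\le\sin\varphi$ and there are $t_-,t_+\in[-\infty,+\infty]$ such that (i) $h\equiv-\sin\varphi$ on $(-\infty,t_-]$; (ii) for all $t\in(t_-,t_+)$, $$h'(t)\ge\frac{(h(t)-\sin\varphi)\left(h(t)\cos\varphi+\sqrt{1-(h(t))^2}\,\sin\varphi\right)\sqrt{1-(h(t))^2}}{1-h(t)\sin\varphi+\sqrt{1-(h(t))^2}\,\cos\varphi};$$ (iii) $h\equiv\sin\varphi$ on $[t_+,+\infty)$. (Sufficiency) Conversely, if $h:\mathbb R\to[-\sin\varphi,\sin\varphi]$ is a $C^1$ function for which there are $t_-,t_+\in[-\infty,+\infty]$ satisfying (i), (ii), (iii), then $h$ is an umbilical route along any $\varphi$-hypercycle in $\mathbb H^n$.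
   Context: $\mathbb H^n$ is the real hyperbolic space of constant curvature $-1$; in the half-space model it is $\Pi^{n,+}=\{x\in\mathbb R^n: x_n>0\}$ with metric $x_n^{-2}\langle\cdot,\cdot\rangle$ and ideal boundary $(\mathbb R^{n-1}\times\{0\})\cup\{\infty\}$. Intervals $(-\infty,t_-]$ and $[t_+,+\infty)$ are taken within $\mathbb R$: for $t_-=-\infty$ (resp. $t_+=+\infty$) condition (i) (resp. (iii)) is empty, and for $t_-=+\infty$ (resp. $t_+=-\infty$) the interval is all of $\mathbb R$. A generalized hypersphere is a complete hypersurface of $\mathbb H^n$ which is a horosphere, a totally geodesic hypersurface, or a hypersphere (a connected component of the set of points at a fixed positive distance from a totally geodesic hypersurface). In the half-space model these are the nonempty intersections with $\Pi^{n,+}$ of spheres or hyperplanes meeting or tangent to the ideal boundary (tangency point removed; hyperplanes parallel to $\mathbb R^{n-1}\times\{0\}$ included as horospheres). A $\varphi$-hypersphere is a generalized hypersphere meeting the ideal boundary at angle $\varphi$ in the half-space model. A $\varphi$-hypercycle is a geodesic line on a $\varphi$-hypersphere (with its induced metric); up to isometry of $\mathbb H^n$ it is the open ray $\{(r\cos\varphi,0,\ldots,0,r\sin\varphi): r>0\}$, with arc-length parametrization $r=e^{t\sin\varphi}$; it has constant geodesic curvature $|\cos\varphi|$. A submanifold is totally umbilical if at each of its points all eigenvalues of the shape operator are equal; a totally umbilical foliation is a foliation all of whose leaves are totally umbilical (for $n=2$, where this condition on curves is vacuous, it is understood that the leaves are generalized hyperspheres, i.e. geodesics, horocycles and equidistant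 curves). A foliation is orthogonal to a curve $\gamma$ if at each $\gamma(t)$ the leaf through $\gamma(t)$ is orthogonal to $\gamma'(t)$. Sign convention: the mean curvature of an oriented totally umbilical hypersurface with unit normal $N$ is the common eigenvalue of $X\mapsto\nabla_XN$ (so a horosphere with normal pointing away from its center at infinity has mean curvature $+1$); "orientation opposite to $\gamma$" means that at $\gamma(t)$ the unit normal of the leaf is $-\gamma'(t)$. A function $h:\mathbb R\to\mathbb R$ is an umbilical route along an arc-length parametrized curve $\gamma:\mathbb R\to\mathbb H^n$ if the family $(L_t)_{t\in\mathbb R}$, where $L_t$ is the generalized hypersphere through $\gamma(t)$, orthogonal to $\gamma$ there and having mean curvature $h(t)$ (orientation opposite to $\gamma$), can be extended to a totally umbilical foliation of $\mathbb H^n$ (i.e. there is such a foliation having every $L_t$ as a leaf). *)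

theory Defs
  imports "HOL-Analysis.Analysis"
begin

text \<open>
  Hyperbolic space of dimension n = DIM('a) + 1 in the half-space model. The first component
  of a point of \<open>'a \<times> real\<close> is its horizontal part, the second one its height. Since
  DIM('a) is an arbitrary positive number, n is an arbitrary integer with n \<ge> 2.
\<close>

definition half_space :: "('a::euclidean_space \<times> real) set" where
  "half_space = {p. 0 < snd p}"

abbreviation e_up :: "'a::euclidean_space \<times> real" where
  "e_up \<equiv> (0, 1)"

definition hyp_inner ::
  "'a::euclidean_space \<times> real \<Rightarrow> 'a \<times> real \<Rightarrow> 'a \<times> real \<Rightarrow> real" where
  "hyp_inner p u v = (u \<bullet> v) / (snd p)\<^sup>2"

text \<open>
  Christoffel term of the Levi-Civita connection. For a conformal metric \<open>exp (2 f) (u \<bullet> v)\<close>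
  the connection is \<open>D_X Y + X(f) Y + Y(f) X - (X \<bullet> Y) grad f\<close>; here \<open>f = - ln y\<close>,
  with y the height.
\<close>

definition hyp_Gamma ::
  "'a::euclidean_space \<times> real \<Rightarrow> 'a \<times> real \<Rightarrow> 'a \<times> real \<Rightarrow> 'a \<times> real" where
  "hyp_Gamma p u v =
     (1 / snd p) *\<^sub>R ((u \<bullet> v) *\<^sub>R e_up - snd u *\<^sub>R v - snd v *\<^sub>R u)"

definition cov_deriv ::
  "('a::euclidean_space \<times> real \<Rightarrow> 'a \<times> real) \<Rightarrow> 'a \<times> real \<Rightarrow> 'a \<times> real \<Rightarrow> 'a \<times> real" where
  "cov_deriv Y p X = frechet_derivative Y (at p) X + hyp_Gamma p X (Y p)"

definition velocity :: "(real \<Rightarrow> 'b::real_normed_vector) \<Rightarrow> real \<Rightarrow> 'b" where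
  "velocity c t = vector_derivative c (at t)"

definition cov_acceleration ::
  "(real \<Rightarrow> 'a::euclidean_space \<times> real) \<Rightarrow> real \<Rightarrow> 'a \<times> real" where
  "cov_acceleration c t =
     velocity (velocity c) t + hyp_Gamma (c t) (velocity c t) (velocity c t)"

text \<open>Maps of class \<open>C^k\<close> on a set S, which is always open below.\<close>

primrec Ck_on ::
  "nat \<Rightarrow> 'b::euclidean_space set \<Rightarrow> ('b \<Rightarrow> 'c::euclidean_space) \<Rightarrow> bool" where
  "Ck_on 0 S f \<longleftrightarrow> continuous_on S f"
| "Ck_on (Suc k) S f \<longleftrightarrow>
     (\<forall>x\<in>S. f differentiable at x) \<and> (\<forall>v. Ck_on k S (\<lambda>x. frechet_derivative f (at x) v))"

definition smooth_on ::
  "'b::euclidean_space set \<Rightarrow> ('b \<Rightarrow> 'c::euclidean_space) \<Rightarrow> bool" where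
  "smooth_on S f \<longleftrightarrow> (\<forall>k. Ck_on k S f)"

text \<open>
  The path component in the next definition singles out the sheet of L through p, so that
  leaves of foliations, which are a priori only injectively immersed, are covered.
\<close>

definition smooth_hypersurface :: "('a::euclidean_space \<times> real) set \<Rightarrow> bool" where
  "smooth_hypersurface L \<longleftrightarrow> L \<subseteq> half_space \<and>
     (\<forall>p\<in>L. \<exists>U (f :: 'a \<times> real \<Rightarrow> real). open U \<and> p \<in> U \<and> smooth_on U f \<and>
        (\<forall>q\<in>U. frechet_derivative f (at q) \<noteq> (\<lambda>v. 0)) \<and>
        path_component_set (L \<inter> U) p = {q\<in>U. f q = 0})"

definition tangent_vectors ::
  "('a::euclidean_space \<times> real) set \<Rightarrow> 'a \<times> real \<Rightarrow> ('a \<times> real) set" where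
  "tangent_vectors L p =
     {v. \<exists>c e. 0 < e \<and> smooth_on {-e<..<e} c \<and> c ` {-e<..<e} \<subseteq> L \<and>
           c 0 = p \<and> velocity c 0 = v}"

text \<open>
  N is an ambient smooth extension of a unit normal field on the sheet of L through p; the
  covariant derivatives of N in directions tangent to L do not depend on the extension.
\<close>

definition unit_normal_field ::
  "('a::euclidean_space \<times> real) set \<Rightarrow> 'a \<times> real \<Rightarrow> ('a \<times> real) set \<Rightarrow>
   ('a \<times> real \<Rightarrow> 'a \<times> real) \<Rightarrow> bool" where
  "unit_normal_field L p U N \<longleftrightarrow> open U \<and> p \<in> U \<and> U \<subseteq> half_space \<and> smooth_on U N \<and>
     (\<forall>q\<in>path_component_set (L \<inter> U) p. hyp_inner q (N q) (N q) = 1 \<and>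
        (\<forall>X\<in>tangent_vectors L q. hyp_inner q (N q) X = 0))"

definition shape_eigenvalues ::
  "('a::euclidean_space \<times> real) set \<Rightarrow> ('a \<times> real \<Rightarrow> 'a \<times> real) \<Rightarrow> 'a \<times> real \<Rightarrow> real set" where
  "shape_eigenvalues L N p =
     {\<kappa>. \<exists>X\<in>tangent_vectors L p. X \<noteq> 0 \<and> cov_deriv N p X = \<kappa> *\<^sub>R X}"

text \<open>
  All eigenvalues of the shape operator of L at p with respect to the unit normal field with
  value \<open>\<nu>\<close> at p are equal, and their common value is \<open>\<kappa>\<close>. Thus \<open>\<kappa>\<close> is the mean curvature of L
  at p, and a horosphere with normal pointing away from its center has mean curvature +1.
\<close>

definition umbilic_with_curvature ::
  "('a::euclidean_space \<times> real) set \<Rightarrow> 'a \<times> real \<Rightarrow> 'a \<times> real \<Rightarrow> real \<Rightarrow> bool" where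
  "umbilic_with_curvature L p \<nu> \<kappa> \<longleftrightarrow>
     (\<exists>U N. unit_normal_field L p U N \<and> N p = \<nu> \<and> shape_eigenvalues L N p = {\<kappa>})"

definition totally_umbilical :: "('a::euclidean_space \<times> real) set \<Rightarrow> bool" where
  "totally_umbilical L \<longleftrightarrow>
     smooth_hypersurface L \<and> (\<forall>p\<in>L. \<exists>\<nu> \<kappa>. umbilic_with_curvature L p \<nu> \<kappa>)"

text \<open>
  A hyperplane that does not meet the boundary is parallel to it and gives a horosphere, so
  only spheres need a condition.
\<close>

definition generalized_hypersphere :: "('a::euclidean_space \<times> real) set \<Rightarrow> bool" where
  "generalized_hypersphere S \<longleftrightarrow> S \<noteq> {} \<and>
     ((\<exists>c r. 0 < r \<and> (\<exists>q\<in>sphere c r. snd q = 0) \<and> S = sphere c r \<inter> half_space) \<or>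
      (\<exists>a d. a \<noteq> 0 \<and> S = {p. a \<bullet> p = d} \<inter> half_space))"

text \<open>Angle, between 0 and \<open>pi/2\<close>, of two hyperplanes with normal vectors u and v.\<close>

definition hyperplane_angle :: "'b::real_inner \<Rightarrow> 'b \<Rightarrow> real" where
  "hyperplane_angle u v = arccos (\<bar>u \<bullet> v\<bar> / (norm u * norm v))"

definition phi_hypersphere :: "real \<Rightarrow> ('a::euclidean_space \<times> real) set \<Rightarrow> bool" where
  "phi_hypersphere \<phi> S \<longleftrightarrow> S \<noteq> {} \<and>
     ((\<exists>c r. 0 < r \<and> (\<exists>q\<in>sphere c r. snd q = 0) \<and> S = sphere c r \<inter> half_space \<and>
         (\<forall>q\<in>sphere c r. snd q = 0 \<longrightarrow> hyperplane_angle (q - c) e_up = \<phi>)) \<or>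
      (\<exists>a d. a \<noteq> 0 \<and> S = {p. a \<bullet> p = d} \<inter> half_space \<and> hyperplane_angle a e_up = \<phi>))"

text \<open>
  Unit-speed geodesic line of S with the induced metric: the component tangent to S of the
  ambient covariant acceleration vanishes.
\<close>

definition geodesic_line_on ::
  "('a::euclidean_space \<times> real) set \<Rightarrow> (real \<Rightarrow> 'a \<times> real) \<Rightarrow> bool" where
  "geodesic_line_on S c \<longleftrightarrow> smooth_on UNIV c \<and> range c \<subseteq> S \<and>
     (\<forall>t. hyp_inner (c t) (velocity c t) (velocity c t) = 1 \<and>
        (\<forall>X\<in>tangent_vectors S (c t). hyp_inner (c t) (cov_acceleration c t) X = 0))"

definition phi_hypercycle :: "real \<Rightarrow> (real \<Rightarrow> 'a::euclidean_space \<times> real) \<Rightarrow> bool" where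
  "phi_hypercycle \<phi> \<gamma> \<longleftrightarrow> (\<exists>S. phi_hypersphere \<phi> S \<and> geodesic_line_on S \<gamma>)"

text \<open>
  The plaques of a chart are the level sets of the last coordinate; convexity of the image of
  the chart makes them connected.
\<close>

definition foliated_chart ::
  "('a::euclidean_space \<times> real) set set \<Rightarrow> ('a \<times> real) set \<Rightarrow>
   ('a \<times> real \<Rightarrow> 'a \<times> real) \<Rightarrow> bool" where
  "foliated_chart F U \<Phi> \<longleftrightarrow> open U \<and> U \<subseteq> half_space \<and>
     (\<exists>V \<Psi>. open V \<and> convex V \<and> homeomorphism U V \<Phi> \<Psi>) \<and>
     (\<forall>L\<in>F. \<forall>q\<in>L \<inter> U.
        path_component_set (L \<inter> U) q = {x\<in>U. snd (\<Phi> x) = snd (\<Phi> q)})"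

text \<open>Codimension 1 foliations with smooth leaves; no transverse differentiability.\<close>

definition codim1_foliation :: "('a::euclidean_space \<times> real) set set \<Rightarrow> bool" where
  "codim1_foliation F \<longleftrightarrow> partition_on half_space F \<and>
     (\<forall>L\<in>F. path_connected L \<and> smooth_hypersurface L) \<and>
     (\<forall>p\<in>half_space. \<exists>U \<Phi>. p \<in> U \<and> foliated_chart F U \<Phi>)"

text \<open>Locally the leaves are the level sets of a \<open>C^1\<close> submersion to the reals.\<close>

definition transversely_C1_foliation :: "('a::euclidean_space \<times> real) set set \<Rightarrow> bool" where
  "transversely_C1_foliation F \<longleftrightarrow> codim1_foliation F \<and>
     (\<forall>p\<in>half_space. \<exists>U \<Phi>. p \<in> U \<and> foliated_chart F U \<Phi> \<and> Ck_on 1 U (\<lambda>x. snd (\<Phi> x)) \<and>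
        (\<forall>x\<in>U. frechet_derivative (\<lambda>x. snd (\<Phi> x)) (at x) \<noteq> (\<lambda>v. 0)))"

text \<open>For n = 2 umbilicity is vacuous and the leaves are required to be generalized hyperspheres.\<close>

definition totally_umbilical_foliation :: "('a::euclidean_space \<times> real) set set \<Rightarrow> bool" where
  "totally_umbilical_foliation F \<longleftrightarrow> codim1_foliation F \<and>
     (\<forall>L\<in>F. totally_umbilical L \<and> (DIM('a) = 1 \<longrightarrow> generalized_hypersphere L))"

definition orthogonal_at ::
  "('a::euclidean_space \<times> real) set \<Rightarrow> (real \<Rightarrow> 'a \<times> real) \<Rightarrow> real \<Rightarrow> bool" where
  "orthogonal_at L \<gamma> t \<longleftrightarrow>
     (\<forall>X\<in>tangent_vectors L (\<gamma> t). hyp_inner (\<gamma> t) (velocity \<gamma> t) X = 0)"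

definition foliation_orthogonal_to ::
  "('a::euclidean_space \<times> real) set set \<Rightarrow> (real \<Rightarrow> 'a \<times> real) \<Rightarrow> bool" where
  "foliation_orthogonal_to F \<gamma> \<longleftrightarrow> (\<forall>t. \<forall>L\<in>F. \<gamma> t \<in> L \<longrightarrow> orthogonal_at L \<gamma> t)"

definition leaf_curvature_along ::
  "('a::euclidean_space \<times> real) set set \<Rightarrow> (real \<Rightarrow> 'a \<times> real) \<Rightarrow> (real \<Rightarrow> real) \<Rightarrow> bool" where
  "leaf_curvature_along F \<gamma> h \<longleftrightarrow>
     (\<forall>t. \<forall>L\<in>F. \<gamma> t \<in> L \<longrightarrow> umbilic_with_curvature L (\<gamma> t) (- velocity \<gamma> t) (h t))"

text \<open>The leaf L below is the unique generalized hypersphere with the stated properties.\<close>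

definition umbilical_route ::
  "(real \<Rightarrow> real) \<Rightarrow> (real \<Rightarrow> 'a::euclidean_space \<times> real) \<Rightarrow> bool" where
  "umbilical_route h \<gamma> \<longleftrightarrow> (\<exists>F. totally_umbilical_foliation F \<and>
     (\<forall>t. \<exists>L\<in>F. generalized_hypersphere L \<and> \<gamma> t \<in> L \<and> orthogonal_at L \<gamma> t \<and>
        umbilic_with_curvature L (\<gamma> t) (- velocity \<gamma> t) (h t)))"

definition route_conditions ::
  "real \<Rightarrow> (real \<Rightarrow> real) \<Rightarrow> ereal \<Rightarrow> ereal \<Rightarrow> bool" where
  "route_conditions \<phi> h tm tp \<longleftrightarrow>
     (\<forall>t. ereal t \<le> tm \<longrightarrow> h t = - sin \<phi>) \<and>
     (\<forall>t. tm < ereal t \<and> ereal t < tp \<longrightarrow>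
        (\<exists>D. (h has_real_derivative D) (at t) \<and>
           D \<ge> (h t - sin \<phi>) * (h t * cos \<phi> + sqrt (1 - (h t)\<^sup>2) * sin \<phi>) * sqrt (1 - (h t)\<^sup>2)
               / (1 - h t * sin \<phi> + sqrt (1 - (h t)\<^sup>2) * cos \<phi>))) \<and>
     (\<forall>t. tp \<le> ereal t \<longrightarrow> h t = sin \<phi>)"

end

theory Submission
  imports Defs
begin

text \<open>
  Every leaf is a generalized hypersphere, and a generalized hypersphere is the zero set in the
  half-space of a quadratic function with scalar leading part. So the leaf through \<open>\<gamma> t\<close> is known
  from the point, the velocity and the curvature \<open>h t\<close> (lemmas \<open>umbilical_foliation_leaf\<close> and
  \<open>hypersphere_eq_leaf\<close>), and both directions become statements about the order of these quadratic
  functions along the curve.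

  In dimension 2 leaves are hyperspheres by definition. In dimension at least 3 they are hyperspheres
  because an umbilical hypersurface has a unit normal whose derivative is a scalar \<open>l\<close> on each
  tangent space; symmetry of second derivatives makes \<open>l\<close> constant, so a piece of the leaf lies on
  a sphere or a hyperplane. Foliated charts show that the leaf has no boundary in the half-space,
  hence that it is the full trace.

  In Lorentz coordinates a hypercycle solves a linear differential equation with constant
  coefficients. Hence an isometry, composed of translations, scalings and an inversion, takes it to
  a ray \<open>exp (t sin \<phi>) (cos \<phi> u, sin \<phi>)\<close> (lemma \<open>lor_hypercycle_standard\<close>). Put \<open>h = sin \<alpha>\<close>. The
  hypersphere orthogonal to the ray at distance \<open>r\<close> from the origin, of curvature \<open>h\<close>, meets the line
  through \<open>u\<close> in the ideal boundary at the point \<open>- \<zeta> u\<close>, where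
  \<open>\<zeta> = r sin ((\<phi> + \<alpha>) / 2) / sin ((\<phi> - \<alpha>) / 2)\<close>. The condition \<open>\<bar>h\<bar> \<le> sin \<phi>\<close> says that \<open>\<zeta>\<close> lies
  between 0 and infinity, and differentiating the logarithm of \<open>\<zeta>\<close> along the ray turns the
  differential inequality into \<open>\<alpha>' \<ge> - 2 sin ((\<phi> + \<alpha>) / 2) sin ((\<phi> - \<alpha>) / 2)\<close>, that is: \<open>\<zeta>\<close> does
  not decrease.

  Necessity: disjoint leaves cannot cross the ray twice, which bounds \<open>h\<close> (lemma \<open>curvature_bound\<close>),
  and their boundary points are ordered as their points on the ray (lemma \<open>boundary_point_mono\<close>).
  Transverse differentiability of the foliation makes \<open>h\<close> differentiable (lemma
  \<open>leaf_curvature_differentiable\<close>), and the inequality then holds on the whole line, so that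
  infinite ends can be taken for \<open>t\<^sub>-\<close> and \<open>t\<^sub>+\<close>.

  Sufficiency: if \<open>\<zeta>\<close> does not decrease, then at each point of the half-space the quadratic functions
  change sign at most once, from negative to positive, as \<open>t\<close> grows (lemma \<open>bform_order\<close>). If the leaves
  do not shrink to an end of the ray, they converge to a hypersphere there, and tilting it around
  its intersection with the ideal boundary fills the rest of the half-space. The resulting
  one-parameter family has one zero at each point, and its members are the leaves of a foliation by
  invariance of domain (theorem \<open>foliation\<close>).
\<close>

section \<open>Calculus of maps of class C^k\<close>

lemma Ck_on_cong:
  assumes "open S" "\<And>x. x \<in> S \<Longrightarrow> f x = g x" "Ck_on k S f"
  shows "Ck_on k S g"
  using assms(2,3)
proof (induction k arbitrary: f g)
  case 0
  then show ?case using continuous_on_cong[of S S f g] by simp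
next
  case (Suc k)
  have fd: "f differentiable at x" if "x \<in> S" for x
    using Suc.prems(2) that unfolding Ck_on.simps(2) by blast
  have *: "(g has_derivative frechet_derivative f (at x)) (at x)" if "x \<in> S" for x
    by (rule has_derivative_transform_within_open[OF _ \<open>open S\<close> that Suc.prems(1)])
      (use fd[OF that] in \<open>simp add: frechet_derivative_works[symmetric]\<close>)
  then have eq: "frechet_derivative f (at x) v = frechet_derivative g (at x) v" if "x \<in> S" for x v
    using frechet_derivative_at[OF *[OF that]] by simp
  have "Ck_on k S (\<lambda>x. frechet_derivative g (at x) v)" for v
    by (rule Suc.IH[OF eq Suc.prems(2)[unfolded Ck_on.simps(2), THEN conjunct2, THEN spec]])
  moreover have "\<forall>x\<in>S. g differentiable at x" using differentiableI[OF *] by blast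
  ultimately show ?case unfolding Ck_on.simps(2) by blast
qed

lemma Ck_on_has_derivative:
  "Ck_on (Suc k) S f \<Longrightarrow> x \<in> S \<Longrightarrow> (f has_derivative frechet_derivative f (at x)) (at x)"
  by (auto simp: frechet_derivative_works[symmetric])

lemma Ck_on_derivative: "Ck_on (Suc k) S f \<Longrightarrow> Ck_on k S (\<lambda>x. frechet_derivative f (at x) v)"
  by simp

lemma Ck_on_SucI:
  assumes "open S" "\<And>x. x \<in> S \<Longrightarrow> (f has_derivative f' x) (at x)"
    and "\<And>v. Ck_on k S (\<lambda>x. f' x v)"
  shows "Ck_on (Suc k) S f"
proof -
  have "f' x v = frechet_derivative f (at x) v" if "x \<in> S" for x v
    using frechet_derivative_at[OF assms(2)[OF that]] by simp
  then have "\<And>v. Ck_on k S (\<lambda>x. frechet_derivative f (at x) v)"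
    by (rule Ck_on_cong[OF assms(1) _ assms(3)])
  then have "\<forall>v. Ck_on k S (\<lambda>x. frechet_derivative f (at x) v)" by (rule allI)
  moreover have "\<forall>x\<in>S. f differentiable at x"
    using assms(2) by (blast intro: differentiableI)
  ultimately show ?thesis unfolding Ck_on.simps(2) by (rule conjI[rotated])
qed

declare Ck_on.simps(2) [simp del]

lemma Ck_on_continuous: "Ck_on k S f \<Longrightarrow> continuous_on S f"
proof (cases k)
  case (Suc m)
  assume "Ck_on k S f"
  then show ?thesis unfolding Suc
    by (intro has_derivative_continuous_on[of _ _ "\<lambda>x. frechet_derivative f (at x)"])
       (rule has_derivative_at_withinI, rule Ck_on_has_derivative)
qed simp

lemma Ck_on_SucD: "Ck_on (Suc k) S f \<Longrightarrow> Ck_on k S f"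
proof (induction k arbitrary: f)
  case 0
  then show ?case using Ck_on_continuous by (metis Ck_on.simps(1))
next
  case (Suc k)
  then show ?case by (metis Ck_on.simps(2))
qed

lemma Ck_on_const: "open S \<Longrightarrow> Ck_on k S (\<lambda>x. c)"
proof (induction k arbitrary: c)
  case (Suc k)
  show ?case
    by (rule Ck_on_SucI[OF Suc.prems has_derivative_const Suc.IH[OF Suc.prems]])
qed simp

lemma Ck_on_bounded_linear:
  assumes "bounded_linear F" "open S" "Ck_on k S f"
  shows "Ck_on k S (\<lambda>x. F (f x))"
  using assms(3)
proof (induction k arbitrary: f)
  case 0
  then show ?case using bounded_linear.continuous_on[OF assms(1)] by simp
next
  case (Suc k)
  show ?case
    by (rule Ck_on_SucI[OF assms(2) bounded_linear.has_derivative[OF assms(1)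
            Ck_on_has_derivative[OF Suc.prems]]], assumption)
      (rule Suc.IH[OF Ck_on_derivative[OF Suc.prems]])
qed

lemma Ck_on_id: "open S \<Longrightarrow> Ck_on k S (\<lambda>x. x)"
proof (cases k)
  case (Suc m)
  assume "open S"
  then show ?thesis unfolding Suc
    by (intro Ck_on_SucI[OF _ has_derivative_ident Ck_on_const])
qed simp

lemma Ck_on_linear: "bounded_linear F \<Longrightarrow> open S \<Longrightarrow> Ck_on k S F"
  using Ck_on_bounded_linear[OF _ _ Ck_on_id] by auto

lemma Ck_on_add:
  assumes "open S" "Ck_on k S f" "Ck_on k S g"
  shows "Ck_on k S (\<lambda>x. f x + g x)"
  using assms(2,3)
proof (induction k arbitrary: f g)
  case 0
  then show ?case by (simp add: continuous_on_add)
next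
  case (Suc k)
  show ?case
    by (rule Ck_on_SucI[OF assms(1) has_derivative_add[OF
          Ck_on_has_derivative[OF Suc.prems(1)] Ck_on_has_derivative[OF Suc.prems(2)]]], assumption, assumption)
      (rule Suc.IH[OF Ck_on_derivative[OF Suc.prems(1)] Ck_on_derivative[OF Suc.prems(2)]])
qed

lemma Ck_on_bilinear:
  assumes "bounded_bilinear B" "open S" "Ck_on k S f" "Ck_on k S g"
  shows "Ck_on k S (\<lambda>x. B (f x) (g x))"
  using assms(3,4)
proof (induction k arbitrary: f g)
  case 0
  then show ?case by (simp add: bounded_bilinear.continuous_on[OF assms(1)])
next
  case (Suc k)
  show ?case
    by (rule Ck_on_SucI[OF assms(2) bounded_bilinear.FDERIV[OF assms(1)
          Ck_on_has_derivative[OF Suc.prems(1)] Ck_on_has_derivative[OF Suc.prems(2)]]], assumption, assumption)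
      (rule Ck_on_add[OF assms(2) Suc.IH[OF Ck_on_SucD[OF Suc.prems(1)] Ck_on_derivative[OF Suc.prems(2)]]
            Suc.IH[OF Ck_on_derivative[OF Suc.prems(1)] Ck_on_SucD[OF Suc.prems(2)]]])
qed

lemmas Ck_on_scaleR = Ck_on_bilinear[OF bounded_bilinear_scaleR]
lemmas Ck_on_inner = Ck_on_bilinear[OF bounded_bilinear_inner]

lemma Ck_on_mult:
  fixes f g :: "'b::euclidean_space \<Rightarrow> real"
  shows "open S \<Longrightarrow> Ck_on k S f \<Longrightarrow> Ck_on k S g \<Longrightarrow> Ck_on k S (\<lambda>x. f x * g x)"
  by (rule Ck_on_bilinear[OF bounded_bilinear_mult])

lemma Ck_on_diff:
  assumes "open S" "Ck_on k S f" "Ck_on k S g"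
  shows "Ck_on k S (\<lambda>x. f x - g x)"
  using Ck_on_add[OF assms(1,2) Ck_on_bounded_linear[OF bounded_linear_minus[OF bounded_linear_ident] assms(1,3)]]
  by simp

lemma Ck_on_sum:
  assumes "open S" "finite I" "\<And>i. i \<in> I \<Longrightarrow> Ck_on k S (f i)"
  shows "Ck_on k S (\<lambda>x. \<Sum>i\<in>I. f i x)"
  using assms(2,3) by (induction I) (auto intro!: Ck_on_add Ck_on_const assms(1))

lemma linear_eq_sum_Basis:
  fixes F :: "'b::euclidean_space \<Rightarrow> 'c::real_vector"
  assumes "linear F"
  shows "F w = (\<Sum>b\<in>Basis. (w \<bullet> b) *\<^sub>R F b)"
proof -
  have "F w = F (\<Sum>b\<in>Basis. (w \<bullet> b) *\<^sub>R b)" by (simp add: euclidean_representation)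
  also have "\<dots> = (\<Sum>b\<in>Basis. (w \<bullet> b) *\<^sub>R F b)"
    by (simp add: linear_sum[OF assms] linear_scale[OF assms])
  finally show ?thesis .
qed

lemma Ck_on_compose:
  fixes f :: "'b::euclidean_space \<Rightarrow> 'c::euclidean_space" and g :: "'d::euclidean_space \<Rightarrow> 'b"
  assumes "open S" "Ck_on k S g" "Ck_on k T f" "g ` S \<subseteq> T"
  shows "Ck_on k S (\<lambda>x. f (g x))"
  using assms(2,3)
proof (induction k arbitrary: f)
  case 0
  then show ?case using continuous_on_compose2[OF _ _ assms(4)] by simp
next
  case (Suc k)
  have chain: "((\<lambda>x. f (g x)) has_derivative
      (\<lambda>v. \<Sum>b\<in>Basis. (frechet_derivative g (at x) v \<bullet> b) *\<^sub>R frechet_derivative f (at (g x)) b)) (at x)"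
    if "x \<in> S" for x
  proof -
    have f: "(f has_derivative frechet_derivative f (at (g x))) (at (g x))"
      using assms(4) that by (intro Ck_on_has_derivative[OF Suc.prems(2)]) auto
    show ?thesis
      using has_derivative_compose[OF Ck_on_has_derivative[OF Suc.prems(1) that] f]
      by (subst (asm) linear_eq_sum_Basis[OF has_derivative_linear[OF f]])
  qed
  show ?case
  proof (rule Ck_on_SucI[OF assms(1) chain])
    fix v
    show "Ck_on k S (\<lambda>x. \<Sum>b\<in>Basis. (frechet_derivative g (at x) v \<bullet> b) *\<^sub>R frechet_derivative f (at (g x)) b)"
    proof (intro Ck_on_sum Ck_on_scaleR Ck_on_inner assms(1))
      fix b :: 'b
      show "Ck_on k S (\<lambda>x. frechet_derivative g (at x) v)" by (rule Ck_on_derivative[OF Suc.prems(1)])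
      show "Ck_on k S (\<lambda>x. frechet_derivative f (at (g x)) b)"
        by (rule Suc.IH[OF Ck_on_SucD[OF Suc.prems(1)] Ck_on_derivative[OF Suc.prems(2)]])
    qed (auto intro: Ck_on_const assms(1))
  qed
qed

lemma Ck_on_inverse:
  assumes "open S" "Ck_on k S f" "\<And>x. x \<in> S \<Longrightarrow> f x \<noteq> (0::real)"
  shows "Ck_on k S (\<lambda>x. inverse (f x))"
  using assms(2)
proof (induction k)
  case 0
  then show ?case using assms by (simp add: continuous_on_inverse)
next
  case (Suc k)
  show ?case
  proof (rule Ck_on_SucI[OF assms(1)])
    show "((\<lambda>x. inverse (f x)) has_derivative
        (\<lambda>v. (- 1) * (inverse (f x) * (frechet_derivative f (at x) v * inverse (f x))))) (at x)" if "x \<in> S" for x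
      using Deriv.has_derivative_inverse[OF assms(3)[OF that] Ck_on_has_derivative[OF Suc.prems that]]
      by (simp add: mult.assoc)
    show "Ck_on k S (\<lambda>x. (- 1) * (inverse (f x) * (frechet_derivative f (at x) v * inverse (f x))))" for v
      by (intro Ck_on_mult assms(1) Suc.IH Ck_on_SucD[OF Suc.prems] Ck_on_derivative[OF Suc.prems] Ck_on_const)
  qed
qed

lemma Ck_on_real_vector_derivative:
  fixes g :: "real \<Rightarrow> 'c::euclidean_space"
  assumes "open S" "Ck_on (Suc k) S g"
  shows "Ck_on k S (velocity g)"
proof -
  have "frechet_derivative g (at x) 1 = velocity g x" if "x \<in> S" for x
    using Ck_on_has_derivative[OF assms(2) that]
    by (simp add: velocity_def frechet_derivative_eq_vector_derivative differentiableI)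
  then show ?thesis
    by (rule Ck_on_cong[OF assms(1) _ Ck_on_derivative[OF assms(2)]])
qed

text \<open>Symmetry of second derivatives, from the mean value theorem applied twice to the mixed
  second difference.\<close>

lemma second_difference_mean_value:
  fixes f :: "'b::euclidean_space \<Rightarrow> real"
  assumes "Ck_on 2 S f" "0 < h" "\<And>a b. 0 \<le> a \<Longrightarrow> a \<le> h \<Longrightarrow> 0 \<le> b \<Longrightarrow> b \<le> h \<Longrightarrow> p + a *\<^sub>R u + b *\<^sub>R v \<in> S"
  obtains a b where "0 < a" "a < h" "0 < b" "b < h"
    "f (p + h *\<^sub>R u + h *\<^sub>R v) - f (p + h *\<^sub>R u) - f (p + h *\<^sub>R v) + f p
      = h * h * frechet_derivative (\<lambda>x. frechet_derivative f (at x) u) (at (p + a *\<^sub>R u + b *\<^sub>R v)) v"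
proof -
  define D where "D = (\<lambda>x. frechet_derivative f (at x) u)"
  have f: "(f has_derivative frechet_derivative f (at x)) (at x)" if "x \<in> S" for x
    using assms(1) that unfolding numeral_2_eq_2 by (rule Ck_on_has_derivative)
  have D: "(D has_derivative frechet_derivative D (at x)) (at x)" if "x \<in> S" for x
    using that unfolding D_def
    by (rule Ck_on_has_derivative[OF Ck_on_derivative[OF assms(1)[unfolded numeral_2_eq_2]]])
  define F where "F = (\<lambda>a. f (p + a *\<^sub>R u + h *\<^sub>R v) - f (p + a *\<^sub>R u + 0 *\<^sub>R v))"
  have der1: "((\<lambda>a. f (p + a *\<^sub>R u + b *\<^sub>R v)) has_real_derivative D (p + a *\<^sub>R u + b *\<^sub>R v)) (at a)"
    if "0 \<le> a" "a \<le> h" "0 \<le> b" "b \<le> h" for a b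
  proof -
    have "((\<lambda>a. f (p + a *\<^sub>R u + b *\<^sub>R v)) has_derivative
        (\<lambda>t. frechet_derivative f (at (p + a *\<^sub>R u + b *\<^sub>R v)) (t *\<^sub>R u))) (at a)"
      using f[OF assms(3)[OF that]] by (rule has_derivative_compose[rotated]) (auto intro!: derivative_eq_intros)
    then show ?thesis
      using linear_scale[OF has_derivative_linear[OF f[OF assms(3)[OF that]]]]
      by (simp add: has_field_derivative_def D_def mult.commute[of _ "frechet_derivative _ _ _"])
  qed
  have der2: "((\<lambda>b. D (p + a *\<^sub>R u + b *\<^sub>R v)) has_real_derivative
      frechet_derivative D (at (p + a *\<^sub>R u + b *\<^sub>R v)) v) (at b)"
    if "0 \<le> a" "a \<le> h" "0 \<le> b" "b \<le> h" for a b
  proof -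
    have "((\<lambda>b. D (p + a *\<^sub>R u + b *\<^sub>R v)) has_derivative
        (\<lambda>t. frechet_derivative D (at (p + a *\<^sub>R u + b *\<^sub>R v)) (t *\<^sub>R v))) (at b)"
      using D[OF assms(3)[OF that]] by (rule has_derivative_compose[rotated]) (auto intro!: derivative_eq_intros)
    then show ?thesis
      using linear_scale[OF has_derivative_linear[OF D[OF assms(3)[OF that]]]]
      by (simp add: has_field_derivative_def mult.commute[of _ "frechet_derivative _ _ _"])
  qed
  obtain a where a: "0 < a" "a < h"
    "F h - F 0 = (h - 0) * (D (p + a *\<^sub>R u + h *\<^sub>R v) - D (p + a *\<^sub>R u + 0 *\<^sub>R v))"
  proof -
    have "\<exists>z>0. z < h \<and> F h - F 0 = (h - 0) * (D (p + z *\<^sub>R u + h *\<^sub>R v) - D (p + z *\<^sub>R u + 0 *\<^sub>R v))"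
      unfolding F_def using \<open>0 < h\<close>
      by (intro MVT2 DERIV_diff der1) auto
    then show ?thesis using that by blast
  qed
  have "\<exists>z>0. z < h \<and> D (p + a *\<^sub>R u + h *\<^sub>R v) - D (p + a *\<^sub>R u + 0 *\<^sub>R v)
      = (h - 0) * frechet_derivative D (at (p + a *\<^sub>R u + z *\<^sub>R v)) v"
    using \<open>0 < h\<close> a by (intro MVT2 der2) auto
  then obtain b where "0 < b" "b < h" "D (p + a *\<^sub>R u + h *\<^sub>R v) - D (p + a *\<^sub>R u + 0 *\<^sub>R v)
      = (h - 0) * frechet_derivative D (at (p + a *\<^sub>R u + b *\<^sub>R v)) v" by blast
  with a show ?thesis
    by (intro that[of a b]) (auto simp: F_def D_def)
qed

lemma second_derivative_symmetric:
  fixes f :: "'b::euclidean_space \<Rightarrow> real"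
  assumes "open S" "Ck_on 2 S f" "p \<in> S"
  shows "frechet_derivative (\<lambda>x. frechet_derivative f (at x) u) (at p) v
       = frechet_derivative (\<lambda>x. frechet_derivative f (at x) v) (at p) u"
    (is "?A p = ?B p")
proof (rule ccontr)
  assume ne: "?A p \<noteq> ?B p"
  define e where "e = \<bar>?A p - ?B p\<bar> / 2"
  have "e > 0" using ne by (simp add: e_def)
  note C2 = assms(2)[unfolded numeral_2_eq_2]
  have cA: "continuous_on S ?A" and cB: "continuous_on S ?B"
    by (rule Ck_on_continuous[OF Ck_on_derivative[OF Ck_on_derivative[OF C2]]])+
  obtain d1 where d1: "d1 > 0" "\<And>x. x \<in> S \<Longrightarrow> dist x p < d1 \<Longrightarrow> dist (?A x) (?A p) < e"
    using cA \<open>e > 0\<close> assms(3) unfolding continuous_on_iff by metis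
  obtain d2 where d2: "d2 > 0" "\<And>x. x \<in> S \<Longrightarrow> dist x p < d2 \<Longrightarrow> dist (?B x) (?B p) < e"
    using cB \<open>e > 0\<close> assms(3) unfolding continuous_on_iff by metis
  obtain d3 where d3: "d3 > 0" "ball p d3 \<subseteq> S" using assms(1,3) openE by blast
  define d where "d = min d1 (min d2 d3)"
  define h where "h = d / (2 * (norm u + norm v + 1))"
  have dpos: "d > 0" using d1 d2 d3 by (simp add: d_def)
  then have hpos: "h > 0" unfolding h_def
    by (intro divide_pos_pos) (auto intro: add_nonneg_pos)
  have near: "dist (p + a *\<^sub>R u' + b *\<^sub>R v') p < d"
    if "0 \<le> a" "a \<le> h" "0 \<le> b" "b \<le> h" "norm u' + norm v' = norm u + norm v" for a b u' v'
  proof -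
    have "dist (p + a *\<^sub>R u' + b *\<^sub>R v') p \<le> a * norm u' + b * norm v'"
      using that norm_triangle_ineq[of "a *\<^sub>R u'" "b *\<^sub>R v'"] by (simp add: dist_norm add.assoc)
    also have "\<dots> \<le> h * norm u' + h * norm v'"
      using that by (intro add_mono mult_right_mono) auto
    also have "\<dots> = h * (norm u + norm v)" using that by (metis distrib_left)
    also have "\<dots> < h * (2 * (norm u + norm v + 1))"
    proof -
      have "a + b < 2 * (a + b + 1)" if "0 \<le> a" "0 \<le> b" for a b :: real using that by auto
      from this[of "norm u" "norm v"] show ?thesis using hpos by (intro mult_strict_left_mono) auto
    qed
    also have "\<dots> = d"
      using add_nonneg_pos[of "norm u + norm v" 1] unfolding h_def by auto
    finally show ?thesis .
  qed
  have inS: "p + a *\<^sub>R u' + b *\<^sub>R v' \<in> S"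
    if "0 \<le> a" "a \<le> h" "0 \<le> b" "b \<le> h" "norm u' + norm v' = norm u + norm v" for a b u' v'
    using near[OF that] d3 by (auto simp: d_def dist_commute)
  obtain a b where ab: "0 < a" "a < h" "0 < b" "b < h"
    "f (p + h *\<^sub>R u + h *\<^sub>R v) - f (p + h *\<^sub>R u) - f (p + h *\<^sub>R v) + f p
      = h * h * ?A (p + a *\<^sub>R u + b *\<^sub>R v)"
    by (rule second_difference_mean_value[OF assms(2) hpos inS]) auto
  have inS': "p + a *\<^sub>R v + b *\<^sub>R u \<in> S" if "0 \<le> a" "a \<le> h" "0 \<le> b" "b \<le> h" for a b
    using that by (intro inS) (simp_all add: add.commute)
  obtain a' b' where ab': "0 < a'" "a' < h" "0 < b'" "b' < h"
    "f (p + h *\<^sub>R v + h *\<^sub>R u) - f (p + h *\<^sub>R v) - f (p + h *\<^sub>R u) + f p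
      = h * h * ?B (p + a' *\<^sub>R v + b' *\<^sub>R u)"
    by (rule second_difference_mean_value[OF assms(2) hpos inS']) auto
  have "?A (p + a *\<^sub>R u + b *\<^sub>R v) = ?B (p + a' *\<^sub>R v + b' *\<^sub>R u)"
  proof -
    have "h * h * ?A (p + a *\<^sub>R u + b *\<^sub>R v) = h * h * ?B (p + a' *\<^sub>R v + b' *\<^sub>R u)"
      using ab(5) ab'(5) by (simp add: algebra_simps)
    then show ?thesis using hpos by simp
  qed
  moreover have "dist (?A (p + a *\<^sub>R u + b *\<^sub>R v)) (?A p) < e"
    using ab near[of a b u v] inS[of a b u v] by (intro d1) (auto simp: d_def)
  moreover have "dist (?B (p + a' *\<^sub>R v + b' *\<^sub>R u)) (?B p) < e"
    using ab' near[of a' b' v u] inS[of a' b' v u] by (intro d2) (auto simp: d_def)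
  moreover have False if "x = y" "\<bar>x - A\<bar> < \<bar>A - B\<bar> / 2" "\<bar>y - B\<bar> < \<bar>A - B\<bar> / 2" for x y A B :: real
    using that by (auto simp: abs_if split: if_splits)
  ultimately show False unfolding e_def dist_real_def by blast
qed

section \<open>Level sets, their tangent spaces and their normals\<close>

lemma smooth_onD: "smooth_on S f \<Longrightarrow> Ck_on k S f"
  by (simp add: smooth_on_def)

lemma smooth_on_has_derivative:
  "smooth_on S f \<Longrightarrow> x \<in> S \<Longrightarrow> (f has_derivative frechet_derivative f (at x)) (at x)"
  by (rule Ck_on_has_derivative[OF smooth_onD])

text \<open>
  A map that moves points only along the gradient at p and turns f into its linearization at p is
  a local diffeomorphism by the inverse function theorem. Its inverse H has a derivative that is a
  rational expression in the derivative of f at H, so H inherits the smoothness of f.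
\<close>

lemma level_set_straightening:
  fixes f :: "'b::euclidean_space \<Rightarrow> real"
  assumes U: "open U" "p \<in> U" and f: "smooth_on U f" "f p = 0"
    and g: "frechet_derivative f (at p) = (\<lambda>v. g \<bullet> v)" "g \<noteq> 0"
  obtains e H where "e > 0" "\<And>T. open T \<Longrightarrow> T \<subseteq> ball p e \<Longrightarrow> open (H ` T)" "H ` ball p e \<subseteq> U"
    "H p = p" "smooth_on (ball p e) H"
    "\<And>x. x \<in> ball p e \<Longrightarrow> f (H x) = g \<bullet> (x - p)"
    "\<And>x. x \<in> ball p e \<Longrightarrow> \<exists>\<tau>. H x = x + \<tau> *\<^sub>R g"
    "\<And>v. g \<bullet> v = 0 \<Longrightarrow> frechet_derivative H (at p) v = v"
proof -
  define df where "df = (\<lambda>x v. frechet_derivative f (at x) v)"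
  define G where "G = (\<lambda>q. q + ((f q - g \<bullet> (q - p)) / (g \<bullet> g)) *\<^sub>R g)"
  define DG where "DG = (\<lambda>x v. v + ((df x v - g \<bullet> v) / (g \<bullet> g)) *\<^sub>R g)"
  have gg: "g \<bullet> g \<noteq> 0" using g(2) by simp
  have derf: "(f has_derivative df x) (at x)" if "x \<in> U" for x
    using smooth_on_has_derivative[OF f(1) that] by (simp add: df_def)
  have derG: "(G has_derivative DG x) (at x)" if "x \<in> U" for x
    unfolding G_def DG_def by (auto intro!: derivative_eq_intros derf[OF that] simp: divide_inverse gg)
  have DGbl: "blinfun_apply (Blinfun (DG x)) = DG x" if "x \<in> U" for x
    by (rule bounded_linear_Blinfun_apply[OF has_derivative_bounded_linear[OF derG[OF that]]])
  have contDG: "continuous_on U (\<lambda>x. Blinfun (DG x))"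
  proof (rule continuous_on_blinfun_componentwise)
    fix v :: 'b
    have "continuous_on U (\<lambda>x. df x v)"
      unfolding df_def by (rule Ck_on_continuous[OF Ck_on_derivative[OF smooth_onD[OF f(1)]]])
    then have "continuous_on U (\<lambda>x. DG x v)"
      unfolding DG_def using gg by (intro continuous_intros) auto
    then show "continuous_on U (\<lambda>x. blinfun_apply (Blinfun (DG x)) v)"
      by (rule continuous_on_eq) (simp add: DGbl)
  qed
  have DGp: "DG p = (\<lambda>v. v)" using g(1) gg by (auto simp: DG_def df_def)
  have inv: "id_blinfun o\<^sub>L Blinfun (DG p) = id_blinfun"
    by (intro blinfun_eqI) (simp add: DGbl[OF U(2)], simp add: DGp)
  obtain U' V H H' where UV: "open U'" "U' \<subseteq> U" "p \<in> U'" "open V" "G p \<in> V" "homeomorphism U' V G H"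
    and derH: "\<And>y. y \<in> V \<Longrightarrow> (H has_derivative (H' y)) (at y)"
    and H': "\<And>y. y \<in> V \<Longrightarrow> H' y = inv (blinfun_apply (Blinfun (DG (H y))))"
    and bij: "\<And>y. y \<in> V \<Longrightarrow> bij (blinfun_apply (Blinfun (DG (H y))))"
    by (rule inverse_function_theorem[OF U(1), of G "\<lambda>x. Blinfun (DG x)" p id_blinfun])
      (use derG DGbl contDG U(2) inv in auto)
  have Gp: "G p = p" using f(2) by (simp add: G_def)
  obtain e where e: "e > 0" "ball p e \<subseteq> V" using UV(4,5) Gp openE by metis
  have HU: "H x \<in> U" "G (H x) = x" if "x \<in> ball p e" for x
    using UV(2,6) e(2) that by (metis homeomorphism_def imageI subsetD)+
  have Hp: "H p = p" using UV Gp by (metis homeomorphism_apply1)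
  define H2 where "H2 = (\<lambda>y v. v + ((g \<bullet> v - df (H y) v) * inverse (df (H y) g)) *\<^sub>R g)"
  have ndz: "df (H y) g \<noteq> 0" and derH2: "(H has_derivative H2 y) (at y)" if "y \<in> ball p e" for y
  proof -
    have yV: "y \<in> V" using that e by auto
    have b: "bij (DG (H y))" using bij[OF yV] DGbl[OF HU(1)[OF that]] by simp
    have lin: "linear (df (H y))" using derf[OF HU(1)[OF that]] has_derivative_linear by blast
    have "df (H y) 0 = 0" using linear_0[OF lin] .
    then have "DG (H y) 0 = 0" by (simp add: DG_def)
    moreover have "DG (H y) g = 0" if "df (H y) g = 0" using that gg by (simp add: DG_def)
    ultimately show nz: "df (H y) g \<noteq> 0" using b g(2) by (metis bij_def injD)
    have "DG (H y) (H2 y v) = v" for v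
    proof -
      define a where "a = (g \<bullet> v - df (H y) v) * inverse (df (H y) g)"
      have "df (H y) (v + a *\<^sub>R g) = g \<bullet> v"
        using nz by (simp add: linear_add[OF lin] linear_scale[OF lin] a_def mult.assoc)
      then have "DG (H y) (v + a *\<^sub>R g) = v + a *\<^sub>R g + ((g \<bullet> v - g \<bullet> (v + a *\<^sub>R g)) / (g \<bullet> g)) *\<^sub>R g"
        by (simp add: DG_def)
      also have "\<dots> = v" using gg by (simp add: inner_add_right algebra_simps)
      finally show ?thesis by (simp add: H2_def a_def)
    qed
    then have "H' y = H2 y"
      unfolding H'[OF yV] DGbl[OF HU(1)[OF that]] using b by (metis bij_inv_eq_iff ext)
    then show "(H has_derivative H2 y) (at y)" using derH[OF yV] by (simp only:)
  qed
  have smooth: "Ck_on k (ball p e) H" for k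
  proof (induction k)
    case 0
    show ?case unfolding Ck_on.simps
      by (rule has_derivative_continuous_on[of _ _ H2], rule has_derivative_at_withinI, rule derH2)
  next
    case (Suc k)
    have dfH: "Ck_on k (ball p e) (\<lambda>y. df (H y) v)" for v
      unfolding df_def using HU
      by (intro Ck_on_compose[OF open_ball Suc Ck_on_derivative[OF smooth_onD[OF f(1)]]]) auto
    show ?case
    proof (rule Ck_on_SucI[OF open_ball derH2], assumption)
      show "Ck_on k (ball p e) (\<lambda>y. H2 y v)" for v
        unfolding H2_def
        by (intro Ck_on_add[OF open_ball] Ck_on_scaleR[OF open_ball] Ck_on_mult[OF open_ball]
            Ck_on_diff[OF open_ball] Ck_on_const[OF open_ball] dfH Ck_on_inverse[OF open_ball] ndz)
    qed
  qed
  have img: "open (H ` T)" if "open T" "T \<subseteq> ball p e" for T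
  proof -
    have "homeomorphism V U' H G" using UV(6) homeomorphism_symD by blast
    moreover have "openin (top_of_set V) T"
      using that e(2) UV(4) by (meson openin_open_eq order_trans)
    ultimately have "openin (top_of_set U') (H ` T)" by (rule homeomorphism_imp_open_map)
    then show ?thesis using UV(1) openin_open_trans by blast
  qed
  show ?thesis
  proof
    show "e > 0" "H p = p" by fact+
    show "open (H ` T)" if "open T" "T \<subseteq> ball p e" for T using img that .
    show "smooth_on (ball p e) H" using smooth by (simp add: smooth_on_def)
    show "H ` ball p e \<subseteq> U" using HU by auto
    show "\<exists>\<tau>. H x = x + \<tau> *\<^sub>R g" if "x \<in> ball p e" for x
    proof -
      define k where "k = (f (H x) - g \<bullet> (H x - p)) / (g \<bullet> g)"
      have "H x + k *\<^sub>R g = x" using HU(2)[OF that] by (simp only: G_def k_def)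
      then have "H x = x + (- k) *\<^sub>R g" by (simp add: algebra_simps)
      then show ?thesis by blast
    qed
    show "f (H x) = g \<bullet> (x - p)" if "x \<in> ball p e" for x
    proof -
      have "g \<bullet> (G (H x) - p) = f (H x)"
        using gg by (simp add: G_def inner_add_right inner_diff_right)
      then show ?thesis using HU(2)[OF that] by simp
    qed
    show "frechet_derivative H (at p) v = v" if "g \<bullet> v = 0" for v
    proof -
      have "H2 p v = v" using that g(1) Hp by (simp add: H2_def df_def)
      then show ?thesis using frechet_derivative_at[OF derH2[of p]] e by simp
    qed
  qed
qed

lemma curve_in_sheet:
  fixes c :: "real \<Rightarrow> 'b::real_normed_vector"
  assumes "open U" "c 0 \<in> U" "0 < e" "continuous_on {-e<..<e} c" "c ` {-e<..<e} \<subseteq> L"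
  obtains d where "0 < d" "d \<le> e" "\<And>t. \<bar>t\<bar> < d \<Longrightarrow> c t \<in> path_component_set (L \<inter> U) (c 0)"
proof -
  have "open {t \<in> {-e<..<e}. c t \<in> U}"
    using assms continuous_open_preimage[OF assms(4) open_greaterThanLessThan assms(1)]
    by (simp add: vimage_def Int_def)
  moreover have "0 \<in> {t \<in> {-e<..<e}. c t \<in> U}" using assms by auto
  ultimately obtain d where d: "d > 0" "ball 0 d \<subseteq> {t \<in> {-e<..<e}. c t \<in> U}"
    by (meson openE)
  have "x \<in> {-e<..<e} \<and> c x \<in> U" if "x \<in> ball 0 d" for x using d(2) that by auto
  then have sub: "c ` ball 0 d \<subseteq> L \<inter> U" using assms(5) by blast
  have pc: "path_connected (c ` ball 0 d)"
    using d by (intro path_connected_continuous_image continuous_on_subset[OF assms(4)]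
        convex_imp_path_connected) auto
  show ?thesis
  proof (rule that[of "min d e"])
    show "c t \<in> path_component_set (L \<inter> U) (c 0)" if "\<bar>t\<bar> < min d e" for t
    proof -
      have "c t \<in> c ` ball 0 d" "c 0 \<in> c ` ball 0 d" using that d(1) by auto
      then have "path_component (c ` ball 0 d) (c 0) (c t)"
        using pc by (auto simp: path_connected_component)
      then show ?thesis using sub path_component_of_subset by blast
    qed
  qed (use d assms in auto)
qed

lemma smooth_line: "smooth_on S (\<lambda>t::real. p + t *\<^sub>R v)" if "open S" for p v :: "'b::euclidean_space"
  unfolding smooth_on_def
  by (rule allI, rule Ck_on_add[OF that Ck_on_const[OF that] Ck_on_linear[OF bounded_linear_scaleR_left that]])

lemma frechet_derivative_gradient:
  fixes f :: "'b::euclidean_space \<Rightarrow> real"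
  assumes "(f has_derivative D) (at p)"
  obtains g where "frechet_derivative f (at p) = (\<lambda>v. g \<bullet> v)"
proof -
  have "frechet_derivative f (at p) = D" using frechet_derivative_at[OF assms] by simp
  moreover have "D = (\<lambda>v. (\<Sum>b\<in>Basis. D b *\<^sub>R b) \<bullet> v)"
  proof (rule ext, goal_cases)
    case (1 v)
    show ?case
      by (subst linear_eq_sum_Basis[OF has_derivative_linear[OF assms], of v])
        (simp add: inner_sum_left mult.commute inner_commute[of v])
  qed
  ultimately show ?thesis by (intro that[of "\<Sum>b\<in>Basis. D b *\<^sub>R b"]) (rule trans)
qed

text \<open>Every vector in the kernel of the derivative is the velocity of the straightened line.\<close>

lemma level_set_curve:
  fixes f :: "'b::euclidean_space \<Rightarrow> real"
  assumes "open U" "p \<in> U" "smooth_on U f" "f p = 0"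
    and "frechet_derivative f (at p) \<noteq> (\<lambda>v. 0)" "frechet_derivative f (at p) v = 0"
  obtains c e where "0 < e" "smooth_on {-e<..<e} c" "c ` {-e<..<e} \<subseteq> {q \<in> U. f q = 0}" "c 0 = p"
    "(c has_vector_derivative v) (at 0)"
proof -
  obtain g where g: "frechet_derivative f (at p) = (\<lambda>v. g \<bullet> v)"
    using frechet_derivative_gradient[OF smooth_on_has_derivative[OF assms(3,2)]] .
  have "g \<noteq> 0" "g \<bullet> v = 0" using assms(5,6) g by auto
  obtain e H where H: "e > 0" "H ` ball p e \<subseteq> U" "H p = p" "smooth_on (ball p e) H"
    "\<And>x. x \<in> ball p e \<Longrightarrow> f (H x) = g \<bullet> (x - p)"
    "\<And>v. g \<bullet> v = 0 \<Longrightarrow> frechet_derivative H (at p) v = v"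
    using level_set_straightening[OF assms(1-4) g \<open>g \<noteq> 0\<close>] by metis
  define d where "d = e / (norm v + 1)"
  have n1: "norm v + 1 > 0" using norm_ge_zero[of v] by (simp add: add_nonneg_pos)
  have d: "d > 0" unfolding d_def using H(1) n1 by simp
  have inball: "p + t *\<^sub>R v \<in> ball p e" if "\<bar>t\<bar> < d" for t
  proof -
    have "norm (t *\<^sub>R v) \<le> \<bar>t\<bar> * (norm v + 1)" by (simp add: distrib_left)
    also have "\<dots> < d * (norm v + 1)" using that n1 by (rule mult_strict_right_mono)
    also have "\<dots> = e" using n1 by (simp add: d_def)
    finally show ?thesis by (simp add: dist_norm)
  qed
  have "smooth_on {-d<..<d} (\<lambda>t. H (p + t *\<^sub>R v))"
    unfolding smooth_on_def
    using inball by (auto intro!: Ck_on_compose[OF _ smooth_onD[OF smooth_line] smooth_onD[OF H(4)]])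
  moreover have "(\<lambda>t. H (p + t *\<^sub>R v)) ` {-d<..<d} \<subseteq> {q \<in> U. f q = 0}"
    using inball H(2,5) \<open>g \<bullet> v = 0\<close> by force
  moreover have "((\<lambda>t. H (p + t *\<^sub>R v)) has_vector_derivative v) (at 0)"
  proof -
    have H': "(H has_derivative frechet_derivative H (at p)) (at (p + 0 *\<^sub>R v))"
      using smooth_on_has_derivative[OF H(4)] H(1) by simp
    have "((\<lambda>t. p + t *\<^sub>R v) has_derivative (\<lambda>t. t *\<^sub>R v)) (at 0)"
      by (auto intro!: derivative_eq_intros)
    from has_derivative_compose[OF this H']
    show ?thesis
      unfolding has_vector_derivative_def
      using H(6)[OF \<open>g \<bullet> v = 0\<close>] linear_scale[OF has_derivative_linear[OF H']] by simp
  qed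
  ultimately show ?thesis using that[OF d, of "\<lambda>t. H (p + t *\<^sub>R v)"] H(3) by simp
qed

lemma has_vector_derivative_compose:
  assumes "(c has_vector_derivative v) (at t)" "(f has_derivative D) (at (c t))"
  shows "((\<lambda>t. f (c t)) has_vector_derivative D v) (at t)"
  using has_derivative_compose[OF assms(1)[unfolded has_vector_derivative_def] assms(2)]
    linear_scale[OF has_derivative_linear[OF assms(2)]]
  by (simp add: has_vector_derivative_def)

lemma smooth_curve_velocity:
  assumes "smooth_on {-e<..<e} c" "0 < e"
  shows "(c has_vector_derivative velocity c 0) (at 0)"
  unfolding velocity_def vector_derivative_works[symmetric]
  using smooth_on_has_derivative[OF assms(1), of 0] assms(2) by (auto intro: differentiableI)

text \<open>
  Curves in L remain in the sheet through their initial point for a short time, so that the derivative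
  of f annihilates their velocities; the converse is the existence of curves on level sets.
\<close>

lemma tangent_vectors_level_set:
  fixes f :: "'a::euclidean_space \<times> real \<Rightarrow> real"
  assumes "open U" "p \<in> U" "smooth_on U f" "f p = 0"
    and "frechet_derivative f (at p) \<noteq> (\<lambda>v. 0)" "path_component_set (L \<inter> U) p = {q \<in> U. f q = 0}"
  shows "tangent_vectors L p = {v. frechet_derivative f (at p) v = 0}"
proof (intro set_eqI iffI)
  fix v assume "v \<in> tangent_vectors L p"
  then obtain c e where c: "0 < e" "smooth_on {-e<..<e} c" "c ` {-e<..<e} \<subseteq> L" "c 0 = p" "velocity c 0 = v"
    by (auto simp: tangent_vectors_def)
  obtain d where d: "0 < d" "d \<le> e" "\<And>t. \<bar>t\<bar> < d \<Longrightarrow> c t \<in> path_component_set (L \<inter> U) (c 0)"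
    using curve_in_sheet[OF assms(1) _ c(1) Ck_on_continuous[OF smooth_onD[OF c(2)]] c(3)] c(4) assms(2)
    by metis
  have z: "f (c t) = 0" if "\<bar>t\<bar> < d" for t using d(3)[OF that] assms(6) c(4) by auto
  have "((\<lambda>t. f (c t)) has_vector_derivative frechet_derivative f (at p) v) (at 0)"
    using has_vector_derivative_compose[OF smooth_curve_velocity[OF c(2,1)], of f]
      smooth_on_has_derivative[OF assms(3,2)] c(4,5) by simp
  moreover have "((\<lambda>t. f (c t)) has_vector_derivative 0) (at 0)"
    by (rule has_vector_derivative_transform_within_open[of "\<lambda>t. 0" _ _ "{-d<..<d}"])
      (use d(1) z in auto)
  ultimately show "v \<in> {v. frechet_derivative f (at p) v = 0}"
    using vector_derivative_unique_at by blast
next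
  fix v assume "v \<in> {v. frechet_derivative f (at p) v = 0}"
  then obtain c e where "0 < e" "smooth_on {-e<..<e} c" "c ` {-e<..<e} \<subseteq> {q \<in> U. f q = 0}" "c 0 = p"
    "(c has_vector_derivative v) (at 0)"
    using level_set_curve[OF assms(1-5)] by blast
  moreover have "{q \<in> U. f q = 0} \<subseteq> L" using path_component_subset assms(6) by blast
  ultimately show "v \<in> tangent_vectors L p"
    unfolding tangent_vectors_def velocity_def using vector_derivative_at by blast
qed

lemma normal_unique:
  fixes l :: "'b::real_inner \<Rightarrow> real"
  assumes "linear l" "\<And>v. l v = 0 \<Longrightarrow> n \<bullet> v = 0" "\<And>v. l v = 0 \<Longrightarrow> N \<bullet> v = 0" "norm n = 1"
  shows "N = (N \<bullet> n) *\<^sub>R n"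
proof -
  have nn: "n \<bullet> n = 1" using assms(4) by (simp add: dot_square_norm)
  then have ln: "l n \<noteq> 0" using assms(2)[of n] by auto
  define v where "v = N - (l N / l n) *\<^sub>R n"
  have lv: "l v = 0" using ln by (simp add: v_def linear_diff[OF assms(1)] linear_scale[OF assms(1)])
  have "v \<bullet> v = N \<bullet> v - (l N / l n) * (n \<bullet> v)" by (simp add: v_def inner_diff_left)
  then have "v = 0" using assms(2,3)[OF lv] by simp
  then have N: "N = (l N / l n) *\<^sub>R n" by (simp add: v_def)
  then have "N \<bullet> n = l N / l n" using nn by (metis inner_scaleR_left mult.right_neutral)
  then show ?thesis using N by simp
qed

section \<open>Shape operators in the half-space model\<close>

text \<open>
  The data that witness the smoothness of L at p, named so that they can be moved to other points of
  the same sheet.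
\<close>

definition sheet ::
  "('a::euclidean_space \<times> real) set \<Rightarrow> 'a \<times> real \<Rightarrow> ('a \<times> real) set \<Rightarrow> ('a \<times> real \<Rightarrow> real) \<Rightarrow> bool" where
  "sheet L p U f \<longleftrightarrow> L \<subseteq> half_space \<and> p \<in> L \<and> open U \<and> p \<in> U \<and> smooth_on U f \<and>
     (\<forall>q\<in>U. frechet_derivative f (at q) \<noteq> (\<lambda>v. 0)) \<and>
     path_component_set (L \<inter> U) p = {q\<in>U. f q = 0}"

lemma smooth_hypersurface_sheet: "smooth_hypersurface L \<longleftrightarrow> L \<subseteq> half_space \<and> (\<forall>p\<in>L. \<exists>U f. sheet L p U f)"
  unfolding smooth_hypersurface_def sheet_def
  by (rule conj_cong[OF refl], rule ball_cong[OF refl]) simp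

lemma sheet_zero: "sheet L p U f \<Longrightarrow> f p = 0"
proof -
  assume "sheet L p U f"
  then have "p \<in> L \<inter> U" "path_component_set (L \<inter> U) p = {q \<in> U. f q = 0}"
    unfolding sheet_def by blast+
  moreover from this(1) have "p \<in> path_component_set (L \<inter> U) p"
    by (simp only: mem_Collect_eq path_component_refl_eq)
  ultimately show "f p = 0" by blast
qed

lemma sheet_move:
  assumes "sheet L p U f" "q \<in> U" "f q = 0"
  shows "sheet L q U f"
proof -
  have q: "q \<in> path_component_set (L \<inter> U) p" using assms by (simp add: sheet_def)
  then have "path_component_set (L \<inter> U) p = path_component_set (L \<inter> U) q" "q \<in> L"
    using path_component_eq[OF q] path_component_subset[of "L \<inter> U" p] by auto
  then show ?thesis using assms unfolding sheet_def by simp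
qed

lemma sheet_tangent: "sheet L p U f \<Longrightarrow> tangent_vectors L p = {v. frechet_derivative f (at p) v = 0}"
proof -
  assume s: "sheet L p U f"
  show ?thesis
    by (rule tangent_vectors_level_set[of U p f L, OF _ _ _ sheet_zero[OF s]]) (use s in \<open>unfold sheet_def, blast\<close>)+
qed

lemma sheet_derivative:
  "sheet L p U f \<Longrightarrow> q \<in> U \<Longrightarrow> (f has_derivative frechet_derivative f (at q)) (at q)"
  unfolding sheet_def by (blast intro: smooth_on_has_derivative)

lemma half_space_pos: "p \<in> half_space \<Longrightarrow> snd p > 0"
  by (simp add: half_space_def)

text \<open>
  Passing from the Euclidean unit normal n to the hyperbolic one multiplies it by the height, and
  the conformal change of the connection adds a multiple of the identity to the shape operator.
\<close>

lemma cov_deriv_scaled_normal: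
  assumes "snd p > 0" "n \<bullet> X = 0" "N p = (\<sigma> * snd p) *\<^sub>R n"
    and "frechet_derivative N (at p) X = \<sigma> *\<^sub>R (snd X *\<^sub>R n + snd p *\<^sub>R Y)"
  shows "cov_deriv N p X = \<sigma> *\<^sub>R (snd p *\<^sub>R Y - snd n *\<^sub>R X)"
proof -
  have "X \<bullet> n = 0" using assms(2) by (simp add: inner_commute)
  have "cov_deriv N p X = \<sigma> *\<^sub>R (snd X *\<^sub>R n + snd p *\<^sub>R Y) +
      (1 / snd p) *\<^sub>R (- snd X *\<^sub>R (\<sigma> * snd p) *\<^sub>R n - (\<sigma> * snd p * snd n) *\<^sub>R X)"
    unfolding cov_deriv_def hyp_Gamma_def assms(3,4) inner_scaleR_right \<open>X \<bullet> n = 0\<close> snd_scaleR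
    by (simp add: zero_prod_def[symmetric])
  also have "(1 / snd p) *\<^sub>R (- snd X *\<^sub>R (\<sigma> * snd p) *\<^sub>R n - (\<sigma> * snd p * snd n) *\<^sub>R X)
      = \<sigma> *\<^sub>R (- snd X *\<^sub>R n - snd n *\<^sub>R X)"
    using assms(1) by (simp add: scaleR_diff_right mult.commute)
  finally show ?thesis by (simp add: algebra_simps)
qed

lemma cov_deriv_unit_normal:
  fixes n :: "'a::euclidean_space \<times> real \<Rightarrow> 'a \<times> real"
  assumes sh: "sheet L p U f" and N: "unit_normal_field L p U2 N"
    and n: "(n has_derivative n') (at p)" "open W" "p \<in> W"
      "\<And>q. q \<in> W \<Longrightarrow> q \<in> U \<Longrightarrow> f q = 0 \<Longrightarrow> norm (n q) = 1 \<and> (\<forall>v. frechet_derivative f (at q) v = 0 \<longrightarrow> n q \<bullet> v = 0)"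
  obtains \<sigma> where "\<sigma> = 1 \<or> \<sigma> = - 1" "N p = (\<sigma> * snd p) *\<^sub>R n p"
    "\<And>X. frechet_derivative f (at p) X = 0 \<Longrightarrow> cov_deriv N p X = \<sigma> *\<^sub>R (snd p *\<^sub>R n' X - snd (n p) *\<^sub>R X)"
proof -
  have L: "L \<subseteq> half_space" "p \<in> L" "p \<in> U" using sh by (auto simp: sheet_def)
  then have y: "snd p > 0" using half_space_pos[of p] by blast
  have N_on: "N q = (N q \<bullet> n q) *\<^sub>R n q" "(N q \<bullet> n q)\<^sup>2 = (snd q)\<^sup>2"
    if "q \<in> path_component_set (L \<inter> U2) p" "q \<in> W" "q \<in> U" "f q = 0" for q
  proof -
    have sq: "sheet L q U f" using sheet_move[OF sh that(3,4)] .
    have tan: "tangent_vectors L q = {v. frechet_derivative f (at q) v = 0}"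
      by (rule sheet_tangent[OF sq])
    have "q \<in> L" using sq by (simp add: sheet_def)
    then have yq: "snd q > 0" using L half_space_pos by blast
    have ort: "N q \<bullet> X = 0" if X: "frechet_derivative f (at q) X = 0" for X
    proof -
      have "X \<in> tangent_vectors L q" using X tan by simp
      then have "hyp_inner q (N q) X = 0"
        using N \<open>q \<in> path_component_set (L \<inter> U2) p\<close> unfolding unit_normal_field_def by blast
      then show ?thesis using yq by (simp add: hyp_inner_def)
    qed
    show *: "N q = (N q \<bullet> n q) *\<^sub>R n q"
      by (rule normal_unique[OF has_derivative_linear[OF sheet_derivative[OF sh that(3)]] _ ort])
        (use n(4) that in blast)+
    have "hyp_inner q (N q) (N q) = 1" using N that(1) unfolding unit_normal_field_def by blast
    then have "N q \<bullet> N q = (snd q)\<^sup>2" using yq by (simp add: hyp_inner_def)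
    moreover have "N q \<bullet> N q = (N q \<bullet> n q) * (N q \<bullet> n q)"
      by (subst (2) *) simp
    ultimately show "(N q \<bullet> n q)\<^sup>2 = (snd q)\<^sup>2" by (simp add: power2_eq_square)
  qed
  have U2: "open U2" "p \<in> U2" "smooth_on U2 N" using N by (auto simp: unit_normal_field_def)
  have p2: "p \<in> path_component_set (L \<inter> U2) p"
    using L U2 by (simp add: path_component_refl_eq)
  define \<sigma> where "\<sigma> = (N p \<bullet> n p) / snd p"
  have Np: "N p = (\<sigma> * snd p) *\<^sub>R n p" "\<sigma>\<^sup>2 = 1"
    using N_on[OF p2 n(3) L(3) sheet_zero[OF sh]] y by (auto simp: \<sigma>_def power_divide)
  have np: "norm (n p) = 1" "\<And>v. frechet_derivative f (at p) v = 0 \<Longrightarrow> n p \<bullet> v = 0"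
    using n(4)[OF n(3) L(3) sheet_zero[OF sh]] by blast+
  show ?thesis
  proof (rule that[of \<sigma>])
    show "\<sigma> = 1 \<or> \<sigma> = - 1" using Np(2) by (simp add: power2_eq_1_iff)
    show "N p = (\<sigma> * snd p) *\<^sub>R n p" by fact
    fix X assume X: "frechet_derivative f (at p) X = 0"
    then have "X \<in> tangent_vectors L p" using sheet_tangent[OF sh] by blast
    then obtain c e where c: "0 < e" "smooth_on {-e<..<e} c" "c ` {-e<..<e} \<subseteq> L" "c 0 = p" "velocity c 0 = X"
      unfolding tangent_vectors_def by blast
    note cont = Ck_on_continuous[OF smooth_onD[OF c(2)]]
    have c': "(c has_vector_derivative X) (at 0)" using smooth_curve_velocity[OF c(2,1)] c(5) by simp
    obtain d1 where d1: "0 < d1" "d1 \<le> e" "\<And>t. \<bar>t\<bar> < d1 \<Longrightarrow> c t \<in> path_component_set (L \<inter> U2) (c 0)"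
      using curve_in_sheet[OF U2(1) _ c(1) cont c(3)] c(4) U2(2) by metis
    obtain d2 where d2: "0 < d2" "d2 \<le> e" "\<And>t. \<bar>t\<bar> < d2 \<Longrightarrow> c t \<in> path_component_set (L \<inter> (U \<inter> W)) (c 0)"
    proof -
      have "open (U \<inter> W)" using sh n(2) by (auto simp: sheet_def)
      moreover have "c 0 \<in> U \<inter> W" using c(4) L(3) n(3) by simp
      ultimately show ?thesis using curve_in_sheet[OF _ _ c(1) cont c(3)] that by metis
    qed
    define d where "d = min d1 d2"
    have d: "d > 0" using d1 d2 by (simp add: d_def)
    have ct: "c t \<in> path_component_set (L \<inter> U2) p" "c t \<in> W" "c t \<in> U" "f (c t) = 0" if "\<bar>t\<bar> < d" for t
    proof -
      show "c t \<in> path_component_set (L \<inter> U2) p" using d1(3)[of t] that c(4) by (simp add: d_def)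
      have *: "c t \<in> path_component_set (L \<inter> (U \<inter> W)) p" using d2(3)[of t] that c(4) by (simp add: d_def)
      then have "c t \<in> L \<inter> (U \<inter> W)" using path_component_subset by blast
      then show "c t \<in> W" "c t \<in> U" by blast+
      have "c t \<in> path_component_set (L \<inter> U) p"
        using * path_component_of_subset[of "L \<inter> (U \<inter> W)" "L \<inter> U" p "c t"] by blast
      then show "f (c t) = 0" using sh unfolding sheet_def by blast
    qed
    define s where "s = (\<lambda>t. N (c t) \<bullet> n (c t))"
    have Nc: "((\<lambda>t. N (c t)) has_vector_derivative frechet_derivative N (at p) X) (at 0)"
      using has_vector_derivative_compose[OF c', of N] smooth_on_has_derivative[OF U2(3,2)] c(4) by simp
    have nc: "((\<lambda>t. n (c t)) has_vector_derivative n' X) (at 0)"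
      using has_vector_derivative_compose[OF c', of n] n(1) c(4) by simp
    have yc: "((\<lambda>t. snd (c t)) has_vector_derivative snd X) (at 0)"
      by (rule bounded_linear.has_vector_derivative[OF bounded_linear_snd c'])
    define s' where "s' = N (c 0) \<bullet> n' X + frechet_derivative N (at p) X \<bullet> n (c 0)"
    have sc: "(s has_vector_derivative s') (at 0)"
      unfolding s_def s'_def has_vector_derivative_def
      using has_derivative_inner[OF Nc[unfolded has_vector_derivative_def] nc[unfolded has_vector_derivative_def]]
      by (simp add: algebra_simps)
    have s0: "s 0 = \<sigma> * snd p" using y c(4) by (simp add: s_def \<sigma>_def)
    have s'eq: "s' = \<sigma> * snd X"
    proof -
      have "((\<lambda>t. s t * s t) has_vector_derivative 2 * s 0 * s') (at 0)"
        using has_vector_derivative_mult[OF sc sc] by (simp add: algebra_simps)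
      moreover have "((\<lambda>t. s t * s t) has_vector_derivative 2 * snd p * snd X) (at 0)"
      proof (rule has_vector_derivative_transform_within_open[of "\<lambda>t. snd (c t) * snd (c t)" _ _ "{-d<..<d}"])
        show "((\<lambda>t. snd (c t) * snd (c t)) has_vector_derivative 2 * snd p * snd X) (at 0)"
          using has_vector_derivative_mult[OF yc yc] c(4) by (simp add: algebra_simps)
        show "snd (c t) * snd (c t) = s t * s t" if "t \<in> {-d<..<d}" for t
        proof -
          have "\<bar>t\<bar> < d" using that by auto
          from N_on(2)[OF ct[OF this]] show ?thesis by (simp add: s_def power2_eq_square)
        qed
      qed (use d in auto)
      ultimately have "2 * s 0 * s' = 2 * snd p * snd X" using vector_derivative_unique_at by blast
      then have "\<sigma> * s' = snd X" using s0 y by simp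
      then have "\<sigma>\<^sup>2 * s' = \<sigma> * snd X" by (simp add: power2_eq_square mult.assoc)
      then show ?thesis using Np(2) by simp
    qed
    have "((\<lambda>t. N (c t)) has_vector_derivative s 0 *\<^sub>R n' X + s' *\<^sub>R n p) (at 0)"
    proof (rule has_vector_derivative_transform_within_open[of "\<lambda>t. s t *\<^sub>R n (c t)" _ _ "{-d<..<d}"])
      show "((\<lambda>t. s t *\<^sub>R n (c t)) has_vector_derivative s 0 *\<^sub>R n' X + s' *\<^sub>R n p) (at 0)"
        using has_vector_derivative_scaleR[OF _ nc, of s s'] sc c(4)
        by (simp add: has_real_derivative_iff_has_vector_derivative)
      show "s t *\<^sub>R n (c t) = N (c t)" if "t \<in> {-d<..<d}" for t
      proof -
        have "\<bar>t\<bar> < d" using that by auto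
        from N_on(1)[OF ct[OF this]] show ?thesis unfolding s_def by (rule sym)
      qed
    qed (use d in auto)
    then have "frechet_derivative N (at p) X = s 0 *\<^sub>R n' X + s' *\<^sub>R n p"
      using Nc vector_derivative_unique_at by blast
    then have "frechet_derivative N (at p) X = \<sigma> *\<^sub>R (snd X *\<^sub>R n p + snd p *\<^sub>R n' X)"
      by (simp add: s0 s'eq scaleR_add_right)
    then show "cov_deriv N p X = \<sigma> *\<^sub>R (snd p *\<^sub>R n' X - snd (n p) *\<^sub>R X)"
      by (rule cov_deriv_scaled_normal[of p "n p" X N \<sigma> "n' X", OF y np(2)[OF X] Np(1)])
  qed
qed

section \<open>Spheres and hyperplanes as zero sets of quadratic functions\<close>

definition quadric :: "real \<Rightarrow> 'b::real_inner \<Rightarrow> real \<Rightarrow> 'b \<Rightarrow> real" where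
  "quadric \<alpha> b \<delta> q = \<alpha> * (q \<bullet> q) + b \<bullet> q + \<delta>"

lemma quadric_recenter:
  "quadric \<alpha> b \<delta> q = \<alpha> * ((q - p) \<bullet> (q - p)) + (2 * \<alpha>) *\<^sub>R p \<bullet> (q - p) + b \<bullet> (q - p) + quadric \<alpha> b \<delta> p"
  unfolding quadric_def by (simp add: inner_diff_left inner_diff_right inner_commute algebra_simps)

text \<open>
  On the zero set the gradient has constant length, so the discriminant decides whether all its
  points are regular.
\<close>

lemma quadric_gradient_norm:
  "((2 * \<alpha>) *\<^sub>R q + b) \<bullet> ((2 * \<alpha>) *\<^sub>R q + b) = b \<bullet> b - 4 * \<alpha> * \<delta> + 4 * \<alpha> * quadric \<alpha> b \<delta> q"
  unfolding quadric_def by (simp add: inner_add_left inner_add_right inner_commute algebra_simps power2_eq_square)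

lemma quadric_has_derivative:
  "(quadric \<alpha> b \<delta> has_derivative (\<lambda>v. ((2 * \<alpha>) *\<^sub>R q + b) \<bullet> v)) (at q)"
  unfolding quadric_def[abs_def]
  by (auto intro!: derivative_eq_intros simp: inner_add_left inner_commute algebra_simps)

lemma frechet_derivative_quadric:
  "frechet_derivative (quadric \<alpha> b \<delta>) (at q) = (\<lambda>v. ((2 * \<alpha>) *\<^sub>R q + b) \<bullet> v)"
  using frechet_derivative_at[OF quadric_has_derivative] by (rule sym)

lemma smooth_on_quadric: "open S \<Longrightarrow> smooth_on S (quadric \<alpha> b \<delta>)"
  unfolding smooth_on_def quadric_def[abs_def]
  by (rule allI, rule Ck_on_add, assumption, rule Ck_on_add, assumption)
    (rule Ck_on_mult Ck_on_inner Ck_on_const Ck_on_id | assumption)+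

lemma continuous_on_quadric: "continuous_on S (quadric \<alpha> b \<delta>)"
  unfolding quadric_def[abs_def] by (intro continuous_intros)

text \<open>
  Moving from a unit vector x to the pole a, the point (1 - t) x + t a has an angle to a that does not
  increase. Here \<mu> is the inner product of x and a, and B is the norm of the moving point.
\<close>

lemma cap_inequality:
  fixes \<mu> t B :: real
  assumes "- 1 \<le> \<mu>" "\<mu> \<le> 1" "0 \<le> t" "t \<le> 1" "0 \<le> B" "B\<^sup>2 = (1 - t)\<^sup>2 + 2 * t * (1 - t) * \<mu> + t\<^sup>2"
  shows "\<mu> * B \<le> (1 - t) * \<mu> + t"
proof (cases "\<mu> \<ge> 0")
  case True
  have "(2 * t * (1 - t)) * \<mu> \<le> (2 * t * (1 - t)) * 1" using assms by (intro mult_left_mono) auto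
  then have "B\<^sup>2 \<le> 1\<^sup>2" unfolding assms(6) by (simp add: power2_eq_square algebra_simps)
  then have "B \<le> 1" by (rule power2_le_imp_le) simp
  then have "\<mu> * B \<le> \<mu> * 1" using True by (rule mult_left_mono)
  also have "\<dots> \<le> (1 - t) * \<mu> + t" using mult_right_mono[of \<mu> 1 t] assms by (simp add: algebra_simps)
  finally show ?thesis .
next
  case False
  show ?thesis
  proof (cases "(1 - t) * \<mu> + t \<ge> 0")
    case True
    have "\<mu> * B \<le> 0" using False assms by (simp add: mult_nonpos_nonneg)
    then show ?thesis using True by simp
  next
    case neg: False
    have "(1 - t) * \<mu> \<le> 0" using False assms by (simp add: mult_nonneg_nonpos)
    then have w: "2 * ((1 - t) * \<mu>) + t \<le> 0" using neg by linarith
    have "0 \<le> (1 - \<mu>\<^sup>2) * (t * (- (2 * ((1 - t) * \<mu>) + t)))"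
    proof (intro mult_nonneg_nonneg)
      show "0 \<le> 1 - \<mu>\<^sup>2" using assms by (simp add: abs_square_le_1)
    qed (use assms w in auto)
    also have "\<dots> = (- \<mu> * B)\<^sup>2 - (- ((1 - t) * \<mu> + t))\<^sup>2"
      unfolding power_mult_distrib assms(6) by (simp add: power2_eq_square algebra_simps)
    finally have "(- ((1 - t) * \<mu> + t))\<^sup>2 \<le> (- \<mu> * B)\<^sup>2" by simp
    then have "- ((1 - t) * \<mu> + t) \<le> - \<mu> * B"
      by (rule power2_le_imp_le) (use False assms in \<open>simp add: mult_nonpos_nonneg\<close>)
    then show ?thesis by simp
  qed
qed

text \<open>A cap is star-shaped with respect to its pole along great circles, unless it is the whole sphere.\<close>

lemma path_connected_sphere_cap:
  fixes a :: "'b::euclidean_space"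
  assumes "DIM('b) \<ge> 2"
  shows "path_connected {u. norm u = 1 \<and> a \<bullet> u > d}"
proof (cases "\<forall>u. norm u = 1 \<longrightarrow> a \<bullet> u > d")
  case True
  then have "{u. norm u = 1 \<and> a \<bullet> u > d} = sphere 0 1" by (auto simp: dist_norm)
  then show ?thesis using assms by (simp add: path_connected_sphere_eq)
next
  case False
  then obtain z where z: "norm z = 1" "a \<bullet> z \<le> d" by force
  let ?C = "{u. norm u = 1 \<and> a \<bullet> u > d}"
  define k where "k = (1 / norm a) *\<^sub>R a"
  have toT: "path_component ?C u k" if u: "u \<in> ?C" for u
  proof -
    have a: "a \<noteq> 0" using u z by auto
    then have kn: "norm k = 1" by (simp add: k_def)
    then have kk: "k \<bullet> k = 1" by (simp add: dot_square_norm)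
    have uu: "u \<bullet> u = 1" using u by (simp add: dot_square_norm)
    have ak: "a = norm a *\<^sub>R k" using a by (simp add: k_def)
    have akx: "a \<bullet> x = norm a * (k \<bullet> x)" for x by (subst ak) simp
    define \<mu> where "\<mu> = k \<bullet> u"
    have "\<bar>k \<bullet> z\<bar> \<le> 1" "\<bar>\<mu>\<bar> \<le> 1"
      using Cauchy_Schwarz_ineq2[of k z] Cauchy_Schwarz_ineq2[of k u] kn z u by (auto simp: \<mu>_def)
    have "norm a * (k \<bullet> z) < norm a * \<mu>" using u z akx by (simp add: \<mu>_def)
    then have "k \<bullet> z < \<mu>" using a by simp
    then have \<mu>: "- 1 < \<mu>" "\<mu> \<le> 1" using \<open>\<bar>k \<bullet> z\<bar> \<le> 1\<close> \<open>\<bar>\<mu>\<bar> \<le> 1\<close> by linarith+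
    define v where "v = (\<lambda>t::real. (1 - t) *\<^sub>R u + t *\<^sub>R k)"
    have vv: "v t \<bullet> v t = (1 - t)\<^sup>2 + 2 * t * (1 - t) * \<mu> + t\<^sup>2" for t
      by (simp add: v_def inner_add_left inner_add_right uu kk \<mu>_def inner_commute power2_eq_square algebra_simps)
    have vpos: "v t \<noteq> 0" if "0 \<le> t" "t \<le> 1" for t
    proof
      assume "v t = 0"
      then have 0: "(1 - 2 * t)\<^sup>2 + 2 * (t * (1 - t) * (1 + \<mu>)) = 0"
        using vv[of t] by (simp add: power2_eq_square algebra_simps)
      have ge: "0 \<le> t * (1 - t) * (1 + \<mu>)" using that \<mu> by simp
      have "(1 - 2 * t)\<^sup>2 = 0" using 0 ge zero_le_power2[of "1 - 2 * t"] by linarith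
      then have "t = 1 / 2" by simp
      with 0 have "1 + \<mu> = 0" by simp
      then show False using \<mu> by simp
    qed
    define g where "g = (\<lambda>t. (1 / norm (v t)) *\<^sub>R v t)"
    have "continuous_on {0..1} g"
      unfolding g_def v_def using vpos by (intro continuous_intros) (auto simp: v_def)
    then have "path g" by (simp add: path_def)
    moreover have "path_image g \<subseteq> ?C"
    proof -
      have "g t \<in> ?C" if t: "0 \<le> t" "t \<le> 1" for t
      proof -
        have "\<mu> * norm (v t) \<le> (1 - t) * \<mu> + t"
          by (rule cap_inequality) (use \<mu> t vv[of t] in \<open>auto simp: power2_norm_eq_inner\<close>)
        also have "\<dots> = k \<bullet> v t" by (simp add: v_def inner_add_right kk \<mu>_def)
        finally have "\<mu> \<le> k \<bullet> g t" using vpos[OF t] by (simp add: g_def field_simps)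
        then have "a \<bullet> u \<le> a \<bullet> g t" unfolding akx \<mu>_def by (simp add: mult_left_mono)
        then show ?thesis using u vpos[OF t] by (auto simp: g_def)
      qed
      then show ?thesis by (auto simp: path_image_def)
    qed
    moreover have "pathstart g = u" "pathfinish g = k"
      using u kn by (simp_all add: g_def v_def pathstart_def pathfinish_def)
    ultimately show ?thesis unfolding path_component_def by blast
  qed
  then show ?thesis
    unfolding path_connected_component by (meson path_component_sym path_component_trans)
qed

lemma quadric_sphere:
  assumes "\<alpha> \<noteq> 0" "b \<bullet> b - 4 * \<alpha> * \<delta> = K" "K > 0"
  shows "quadric \<alpha> b \<delta> q = 0 \<longleftrightarrow> dist (- (1 / (2 * \<alpha>)) *\<^sub>R b) q = sqrt K / (2 * \<bar>\<alpha>\<bar>)"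
proof -
  define c where "c = - (1 / (2 * \<alpha>)) *\<^sub>R b"
  have b: "b = - (2 * \<alpha>) *\<^sub>R c" using assms(1) by (simp add: c_def)
  have \<delta>: "\<delta> = (b \<bullet> b - K) / (4 * \<alpha>)" using assms(1,2) by (simp add: field_simps)
  have "quadric \<alpha> b \<delta> q = \<alpha> * ((c - q) \<bullet> (c - q) - K / (4 * \<alpha>\<^sup>2))"
    unfolding quadric_def \<delta> unfolding b using assms(1)
    by (simp add: inner_diff_left inner_diff_right inner_commute field_simps power2_eq_square)
  then have "quadric \<alpha> b \<delta> q = 0 \<longleftrightarrow> (dist c q)\<^sup>2 = (sqrt K / (2 * \<bar>\<alpha>\<bar>))\<^sup>2"
    using assms(1,3) by (simp add: dist_norm power2_norm_eq_inner power_divide power_mult_distrib)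
  also have "\<dots> \<longleftrightarrow> dist c q = sqrt K / (2 * \<bar>\<alpha>\<bar>)"
    using assms(3) by (intro power2_eq_iff_nonneg) auto
  finally show ?thesis by (simp add: c_def)
qed

lemma path_connected_quadric_half_space:
  fixes b :: "'b::euclidean_space"
  assumes "DIM('b) \<ge> 2" "b \<bullet> b - 4 * \<alpha> * \<delta> > 0"
  shows "path_connected {q. quadric \<alpha> b \<delta> q = 0 \<and> a \<bullet> q > d}"
proof (cases "\<alpha> = 0")
  case True
  have "{q. quadric \<alpha> b \<delta> q = 0 \<and> a \<bullet> q > d} = {q. b \<bullet> q = - \<delta>} \<inter> {q. a \<bullet> q > d}"
    by (auto simp: quadric_def True)
  moreover have "convex ({q. b \<bullet> q = - \<delta>} \<inter> {q. a \<bullet> q > d})"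
    by (intro convex_Int convex_hyperplane convex_halfspace_gt)
  ultimately show ?thesis by (simp add: convex_imp_path_connected)
next
  case False
  define c where "c = - (1 / (2 * \<alpha>)) *\<^sub>R b"
  define \<rho> where "\<rho> = sqrt (b \<bullet> b - 4 * \<alpha> * \<delta>) / (2 * \<bar>\<alpha>\<bar>)"
  have \<rho>: "\<rho> > 0" using assms(2) False by (simp add: \<rho>_def)
  have Q: "quadric \<alpha> b \<delta> q = 0 \<longleftrightarrow> dist c q = \<rho>" for q
    using quadric_sphere[OF False refl assms(2)] by (simp add: c_def \<rho>_def)
  have "{q. quadric \<alpha> b \<delta> q = 0 \<and> a \<bullet> q > d} = (\<lambda>u. c + \<rho> *\<^sub>R u) ` {u. norm u = 1 \<and> (\<rho> *\<^sub>R a) \<bullet> u > d - a \<bullet> c}"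
    (is "?L = ?R")
  proof (intro equalityI subsetI)
    fix q assume "q \<in> ?L"
    then have "dist c q = \<rho>" "a \<bullet> q > d" using Q by auto
    then have "q = c + \<rho> *\<^sub>R ((1 / \<rho>) *\<^sub>R (q - c))" "norm ((1 / \<rho>) *\<^sub>R (q - c)) = 1"
      using \<rho> by (simp_all add: dist_norm norm_minus_commute)
    moreover have "(\<rho> *\<^sub>R a) \<bullet> ((1 / \<rho>) *\<^sub>R (q - c)) > d - a \<bullet> c"
      using \<rho> \<open>a \<bullet> q > d\<close> by (simp add: inner_diff_right diff_divide_distrib)
    ultimately show "q \<in> ?R" by blast
  next
    fix q assume "q \<in> ?R"
    then obtain u where u: "q = c + \<rho> *\<^sub>R u" "norm u = 1" "(\<rho> *\<^sub>R a) \<bullet> u > d - a \<bullet> c" by blast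
    have "dist c q = \<rho>" using u \<rho> by (simp add: dist_norm)
    moreover have "a \<bullet> q > d" using u(3) by (simp add: u(1) inner_add_right)
    ultimately show "q \<in> ?L" using Q by simp
  qed
  moreover have "path_connected ?R"
    by (intro path_connected_continuous_image path_connected_sphere_cap assms(1) continuous_intros)
  ultimately show ?thesis by simp
qed

text \<open>On a sphere, being close to p is an affine condition.\<close>

lemma path_connected_quadric_ball:
  fixes b :: "'b::euclidean_space"
  assumes "DIM('b) \<ge> 2" "b \<bullet> b - 4 * \<alpha> * \<delta> > 0" "e > 0"
  shows "path_connected {q \<in> ball p e. quadric \<alpha> b \<delta> q = 0}"
proof (cases "\<alpha> = 0")
  case True
  have "{q \<in> ball p e. quadric \<alpha> b \<delta> q = 0} = {q. b \<bullet> q = - \<delta>} \<inter> ball p e"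
    by (auto simp: quadric_def True)
  moreover have "convex ({q. b \<bullet> q = - \<delta>} \<inter> ball p e)"
    by (intro convex_Int convex_hyperplane convex_ball)
  ultimately show ?thesis by (simp add: convex_imp_path_connected)
next
  case False
  have "q \<in> ball p e \<longleftrightarrow> ((1 / \<alpha>) *\<^sub>R b + 2 *\<^sub>R p) \<bullet> q > p \<bullet> p - \<delta> / \<alpha> - e\<^sup>2" if "quadric \<alpha> b \<delta> q = 0" for q
  proof -
    have qq: "q \<bullet> q = - (b \<bullet> q + \<delta>) / \<alpha>" using that False by (simp add: quadric_def field_simps)
    have "q \<in> ball p e \<longleftrightarrow> (norm (p - q))\<^sup>2 < e\<^sup>2"
      using assms(3) by (auto simp: dist_norm intro: power_strict_mono dest: power2_less_imp_less)
    also have "(norm (p - q))\<^sup>2 = p \<bullet> p - 2 * (p \<bullet> q) + q \<bullet> q"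
      by (simp add: power2_norm_eq_inner inner_diff_left inner_diff_right inner_commute)
    also have "\<dots> = p \<bullet> p - 2 * (p \<bullet> q) - (b \<bullet> q + \<delta>) / \<alpha>"
      by (simp only: qq)
    finally show ?thesis by (simp add: inner_add_left add_divide_distrib) argo
  qed
  then have "{q \<in> ball p e. quadric \<alpha> b \<delta> q = 0}
      = {q. quadric \<alpha> b \<delta> q = 0 \<and> ((1 / \<alpha>) *\<^sub>R b + 2 *\<^sub>R p) \<bullet> q > p \<bullet> p - \<delta> / \<alpha> - e\<^sup>2}" by blast
  then show ?thesis using path_connected_quadric_half_space[OF assms(1,2)] by simp
qed

lemma DIM_half_space: "DIM('a::euclidean_space \<times> real) \<ge> 2"
  using DIM_positive[where 'a='a] by simp

lemma open_half_space: "open (half_space :: ('a::euclidean_space \<times> real) set)"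
proof -
  have "open {p :: 'a \<times> real. 0 < snd p}"
    by (rule open_Collect_less[OF continuous_on_const continuous_on_snd[OF continuous_on_id]])
  then show ?thesis by (simp only: half_space_def)
qed

lemma quadric_sheet:
  fixes b :: "'a::euclidean_space \<times> real"
  assumes "L \<subseteq> half_space" "p \<in> L" "open W" "p \<in> W" "L \<inter> W = {q \<in> W. quadric \<alpha> b \<delta> q = 0}"
    and K: "b \<bullet> b - 4 * \<alpha> * \<delta> > 0"
  obtains e where "e > 0" "ball p e \<subseteq> W" "sheet L p (ball p e) (quadric \<alpha> b \<delta>)"
proof -
  let ?g = "\<lambda>q. (2 * \<alpha>) *\<^sub>R q + b"
  have z: "quadric \<alpha> b \<delta> p = 0" using assms by blast
  have "?g p \<noteq> 0" using quadric_gradient_norm[of \<alpha> p b \<delta>] K z by auto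
  moreover have "open {q. ?g q \<noteq> 0}" by (intro open_Collect_neq continuous_intros)
  ultimately have "open (W \<inter> {q. ?g q \<noteq> 0})" "p \<in> W \<inter> {q. ?g q \<noteq> 0}"
    using assms by auto
  then obtain e where e: "e > 0" "ball p e \<subseteq> W \<inter> {q. ?g q \<noteq> 0}" by (meson openE)
  have LB: "L \<inter> ball p e = {q \<in> ball p e. quadric \<alpha> b \<delta> q = 0}" using e(2) assms(5) by blast
  have "path_connected (L \<inter> ball p e)"
    unfolding LB by (rule path_connected_quadric_ball[OF DIM_half_space K e(1)])
  then have pc: "path_component_set (L \<inter> ball p e) p = {q \<in> ball p e. quadric \<alpha> b \<delta> q = 0}"
    unfolding path_connected_component_set using assms(2) e(1) LB centre_in_ball by blast
  have "frechet_derivative (quadric \<alpha> b \<delta>) (at q) \<noteq> (\<lambda>v. 0)" if "q \<in> ball p e" for q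
  proof
    assume "frechet_derivative (quadric \<alpha> b \<delta>) (at q) = (\<lambda>v. 0)"
    then have "?g q \<bullet> ?g q = 0" unfolding frechet_derivative_quadric by meson
    then show False using e(2) that by auto
  qed
  then have "sheet L p (ball p e) (quadric \<alpha> b \<delta>)"
    unfolding sheet_def using assms(1,2) e(1) smooth_on_quadric[OF open_ball] pc
    by (simp only: open_ball centre_in_ball) blast
  then show ?thesis using that e by blast
qed

definition quadric_normal :: "real \<Rightarrow> 'b::real_inner \<Rightarrow> real \<Rightarrow> 'b \<Rightarrow> 'b" where
  "quadric_normal \<alpha> b \<delta> q = (1 / sqrt (b \<bullet> b - 4 * \<alpha> * \<delta>)) *\<^sub>R ((2 * \<alpha>) *\<^sub>R q + b)"

lemma quadric_normal_has_derivative: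
  "(quadric_normal \<alpha> b \<delta> has_derivative (\<lambda>v. (2 * \<alpha> / sqrt (b \<bullet> b - 4 * \<alpha> * \<delta>)) *\<^sub>R v)) (at q)"
  unfolding quadric_normal_def[abs_def] by (auto intro!: derivative_eq_intros)

lemma quadric_normal_unit:
  assumes "b \<bullet> b - 4 * \<alpha> * \<delta> > 0" "quadric \<alpha> b \<delta> q = 0"
  shows "norm (quadric_normal \<alpha> b \<delta> q) = 1"
proof -
  have "(norm ((2 * \<alpha>) *\<^sub>R q + b))\<^sup>2 = b \<bullet> b - 4 * \<alpha> * \<delta>"
    using quadric_gradient_norm[of \<alpha> q b \<delta>] assms(2) by (simp add: power2_norm_eq_inner)
  then have "norm ((2 * \<alpha>) *\<^sub>R q + b) = sqrt (b \<bullet> b - 4 * \<alpha> * \<delta>)"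
    by (metis norm_ge_zero real_sqrt_unique)
  then show ?thesis using assms(1) by (simp add: quadric_normal_def)
qed

lemma quadric_normal_orthogonal:
  assumes "b \<bullet> b - 4 * \<alpha> * \<delta> > 0"
  shows "quadric_normal \<alpha> b \<delta> q \<bullet> v = 0 \<longleftrightarrow> frechet_derivative (quadric \<alpha> b \<delta>) (at q) v = 0"
  using assms by (simp add: quadric_normal_def frechet_derivative_quadric)

text \<open>
  The Euclidean unit normal of a quadric is an affine map with linear part a multiple of the
  identity, so the curvature is the height times the Euclidean curvature minus the vertical
  component of the normal.
\<close>

lemma quadric_curvature_unique:
  fixes b :: "'a::euclidean_space \<times> real"
  assumes sh: "sheet L p U (quadric \<alpha> b \<delta>)" and K: "b \<bullet> b - 4 * \<alpha> * \<delta> > 0"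
    and um: "umbilic_with_curvature L p \<nu> \<kappa>"
  obtains \<sigma> where "\<sigma> = 1 \<or> \<sigma> = - 1" "\<nu> = (\<sigma> * snd p) *\<^sub>R quadric_normal \<alpha> b \<delta> p"
    "\<kappa> = \<sigma> * (snd p * (2 * \<alpha> / sqrt (b \<bullet> b - 4 * \<alpha> * \<delta>)) - snd (quadric_normal \<alpha> b \<delta> p))"
proof -
  obtain U2 N where N: "unit_normal_field L p U2 N" "N p = \<nu>" "shape_eigenvalues L N p = {\<kappa>}"
    using um unfolding umbilic_with_curvature_def by blast
  let ?l = "2 * \<alpha> / sqrt (b \<bullet> b - 4 * \<alpha> * \<delta>)"
  obtain \<sigma> where \<sigma>: "\<sigma> = 1 \<or> \<sigma> = - 1" "N p = (\<sigma> * snd p) *\<^sub>R quadric_normal \<alpha> b \<delta> p"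
    and cov: "\<And>X. frechet_derivative (quadric \<alpha> b \<delta>) (at p) X = 0 \<Longrightarrow>
      cov_deriv N p X = \<sigma> *\<^sub>R (snd p *\<^sub>R ?l *\<^sub>R X - snd (quadric_normal \<alpha> b \<delta> p) *\<^sub>R X)"
    by (rule cov_deriv_unit_normal[OF sh N(1) quadric_normal_has_derivative open_UNIV UNIV_I])
      (use quadric_normal_unit[OF K] quadric_normal_orthogonal[OF K] in blast)+
  have "\<kappa> \<in> shape_eigenvalues L N p" using N(3) by simp
  then obtain X where X: "X \<in> tangent_vectors L p" "X \<noteq> 0" "cov_deriv N p X = \<kappa> *\<^sub>R X"
    unfolding shape_eigenvalues_def by blast
  have "frechet_derivative (quadric \<alpha> b \<delta>) (at p) X = 0" using X(1) sheet_tangent[OF sh] by blast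
  from cov[OF this] have "\<kappa> *\<^sub>R X = (\<sigma> * (snd p * ?l - snd (quadric_normal \<alpha> b \<delta> p))) *\<^sub>R X"
    unfolding X(3) by (simp add: algebra_simps)
  then have "\<kappa> = \<sigma> * (snd p * ?l - snd (quadric_normal \<alpha> b \<delta> p))" using X(2) by simp
  then show ?thesis using that[OF \<sigma>(1)] \<sigma>(2) N(2) by simp
qed

lemma quadric_umbilic:
  fixes b :: "'a::euclidean_space \<times> real"
  assumes sh: "sheet L p U (quadric \<alpha> b \<delta>)" and K: "b \<bullet> b - 4 * \<alpha> * \<delta> > 0"
  shows "umbilic_with_curvature L p (snd p *\<^sub>R quadric_normal \<alpha> b \<delta> p)
    (snd p * (2 * \<alpha> / sqrt (b \<bullet> b - 4 * \<alpha> * \<delta>)) - snd (quadric_normal \<alpha> b \<delta> p))"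
proof -
  let ?n = "quadric_normal \<alpha> b \<delta>"
  let ?l = "2 * \<alpha> / sqrt (b \<bullet> b - 4 * \<alpha> * \<delta>)"
  define N where "N = (\<lambda>q. snd q *\<^sub>R ?n q)"
  define U2 where "U2 = U \<inter> half_space"
  have L: "L \<subseteq> half_space" "p \<in> L" "open U" "p \<in> U" using sh unfolding sheet_def by blast+
  have y: "snd p > 0" using L half_space_pos by blast
  have smooth: "smooth_on U2 N"
  proof -
    have o: "open U2" unfolding U2_def using L(3) open_half_space by blast
    show ?thesis unfolding smooth_on_def N_def quadric_normal_def
      by (rule allI) (rule Ck_on_scaleR Ck_on_add o Ck_on_linear bounded_linear_snd Ck_on_const Ck_on_id)+
  qed
  have "unit_normal_field L p U2 N"
    unfolding unit_normal_field_def
  proof (intro conjI ballI)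
    show "open U2" "p \<in> U2" "U2 \<subseteq> half_space" "smooth_on U2 N"
      using L open_half_space smooth unfolding U2_def by blast+
    fix q assume q: "q \<in> path_component_set (L \<inter> U2) p"
    then have "q \<in> path_component_set (L \<inter> U) p"
      using path_component_of_subset[of "L \<inter> U2" "L \<inter> U" p q] unfolding U2_def by blast
    then have qU: "q \<in> U" "quadric \<alpha> b \<delta> q = 0" using sh unfolding sheet_def by blast+
    have "q \<in> half_space" using q path_component_subset[of "L \<inter> U2" p] unfolding U2_def by blast
    then have yq: "snd q > 0" using half_space_pos by blast
    have "?n q \<bullet> ?n q = 1"
      using quadric_normal_unit[OF K qU(2)] by (simp add: dot_square_norm)
    then show "hyp_inner q (N q) (N q) = 1"
      using yq by (simp add: hyp_inner_def N_def power2_eq_square)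
    fix X assume "X \<in> tangent_vectors L q"
    then have "frechet_derivative (quadric \<alpha> b \<delta>) (at q) X = 0"
      using sheet_tangent[OF sheet_move[OF sh qU]] by blast
    then have "?n q \<bullet> X = 0" using quadric_normal_orthogonal[OF K] by blast
    then show "hyp_inner q (N q) X = 0" by (simp add: hyp_inner_def N_def)
  qed
  moreover have cov: "cov_deriv N p X = (snd p * ?l - snd (?n p)) *\<^sub>R X" if X: "X \<in> tangent_vectors L p" for X
  proof -
    have "frechet_derivative (quadric \<alpha> b \<delta>) (at p) X = 0" using sheet_tangent[OF sh] X by blast
    then have ort: "?n p \<bullet> X = 0" using quadric_normal_orthogonal[OF K] by blast
    have "(N has_derivative (\<lambda>v. snd p *\<^sub>R ?l *\<^sub>R v + snd v *\<^sub>R ?n p)) (at p)"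
      unfolding N_def
      by (rule has_derivative_scaleR[OF bounded_linear.has_derivative[OF bounded_linear_snd has_derivative_ident]
            quadric_normal_has_derivative])
    then have "frechet_derivative N (at p) X = 1 *\<^sub>R (snd X *\<^sub>R ?n p + snd p *\<^sub>R ?l *\<^sub>R X)"
      using frechet_derivative_at[symmetric] by fastforce
    from cov_deriv_scaled_normal[OF y ort _ this] show ?thesis
      by (simp add: N_def algebra_simps)
  qed
  moreover have "shape_eigenvalues L N p = {snd p * ?l - snd (?n p)}"
  proof -
    obtain X where X: "X \<noteq> 0" "orthogonal (?n p) X"
      using orthogonal_to_vector_exists[OF DIM_half_space, of "?n p"] by blast
    then have "frechet_derivative (quadric \<alpha> b \<delta>) (at p) X = 0"
      using quadric_normal_orthogonal[OF K] unfolding orthogonal_def by blast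
    then have "X \<in> tangent_vectors L p" using sheet_tangent[OF sh] by blast
    then have "snd p * ?l - snd (?n p) \<in> shape_eigenvalues L N p"
      unfolding shape_eigenvalues_def using cov X(1) by blast
    moreover have "\<kappa> = snd p * ?l - snd (?n p)" if \<kappa>: "\<kappa> \<in> shape_eigenvalues L N p" for \<kappa>
    proof -
      obtain X where X: "X \<in> tangent_vectors L p" "X \<noteq> 0" "cov_deriv N p X = \<kappa> *\<^sub>R X"
        using \<kappa> unfolding shape_eigenvalues_def by blast
      then have "\<kappa> *\<^sub>R X = (snd p * ?l - snd (?n p)) *\<^sub>R X" using cov[OF X(1)] by simp
      then show ?thesis using X(2) by simp
    qed
    ultimately show ?thesis by blast
  qed
  moreover have "N p = snd p *\<^sub>R ?n p" by (simp add: N_def)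
  ultimately show ?thesis unfolding umbilic_with_curvature_def by blast
qed

section \<open>Generalized hyperspheres\<close>

text \<open>
  The number fst b \<bullet> fst b - 4 \<alpha> \<delta> is the discriminant of the quadric in the ideal boundary; if it is
  nonnegative, a sphere meets the ideal boundary.
\<close>

definition spacelike :: "real \<Rightarrow> 'a::euclidean_space \<times> real \<Rightarrow> real \<Rightarrow> bool" where
  "spacelike \<alpha> b \<delta> \<longleftrightarrow> (\<alpha>, b, \<delta>) \<noteq> (0, 0, 0) \<and> fst b \<bullet> fst b - 4 * \<alpha> * \<delta> \<ge> 0"

lemma spacelike_discriminant:
  assumes "spacelike \<alpha> b \<delta>" "q \<in> half_space" "quadric \<alpha> b \<delta> q = 0"
  shows "b \<bullet> b - 4 * \<alpha> * \<delta> > 0"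
proof (rule ccontr)
  assume neg: "\<not> b \<bullet> b - 4 * \<alpha> * \<delta> > 0"
  have bb: "b \<bullet> b = fst b \<bullet> fst b + snd b * snd b" by (simp add: inner_prod_def)
  have y: "snd q > 0" using assms(2) by (rule half_space_pos)
  have s: "snd b * snd b \<ge> 0" by simp
  have sb: "snd b = 0" and fb: "fst b \<bullet> fst b = 4 * \<alpha> * \<delta>"
  proof -
    have "snd b * snd b = 0" using neg s assms(1) bb unfolding spacelike_def by linarith
    then show "snd b = 0" by simp
    show "fst b \<bullet> fst b = 4 * \<alpha> * \<delta>" using neg s assms(1) bb unfolding spacelike_def by linarith
  qed
  have "((2 * \<alpha>) *\<^sub>R q + b) \<bullet> ((2 * \<alpha>) *\<^sub>R q + b) = 0"
  proof -
    have "b \<bullet> b - 4 * \<alpha> * \<delta> = 0" using bb sb fb by simp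
    then show ?thesis by (rule_tac trans[OF quadric_gradient_norm[of \<alpha> q b \<delta>]]) (simp add: assms(3))
  qed
  then have g: "(2 * \<alpha>) *\<^sub>R q + b = 0" by simp
  have "snd ((2 * \<alpha>) *\<^sub>R q + b) = 0" using g by (metis snd_zero)
  then have "\<alpha> = 0" using sb y by simp
  then have "b = 0" using g by simp
  with \<open>\<alpha> = 0\<close> have "\<delta> = 0" using assms(3) by (simp add: quadric_def)
  then show False using assms(1) \<open>\<alpha> = 0\<close> \<open>b = 0\<close> by (simp add: spacelike_def)
qed

lemma generalized_hypersphere_quadric:
  fixes b :: "'a::euclidean_space \<times> real"
  assumes "spacelike \<alpha> b \<delta>" "q0 \<in> half_space" "quadric \<alpha> b \<delta> q0 = 0"
  shows "generalized_hypersphere {q \<in> half_space. quadric \<alpha> b \<delta> q = 0}"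
proof (cases "\<alpha> = 0")
  case True
  have "b \<noteq> 0"
  proof
    assume "b = 0"
    then have "\<delta> = 0" using assms(3) True by (simp add: quadric_def)
    then show False using assms(1) True \<open>b = 0\<close> by (simp add: spacelike_def)
  qed
  moreover have "{q \<in> half_space. quadric \<alpha> b \<delta> q = 0} = {q. b \<bullet> q = - \<delta>} \<inter> half_space"
    by (auto simp: quadric_def True)
  ultimately show ?thesis unfolding generalized_hypersphere_def using assms(2,3) by blast
next
  case False
  note K = spacelike_discriminant[OF assms]
  define c where "c = - (1 / (2 * \<alpha>)) *\<^sub>R b"
  define \<rho> where "\<rho> = sqrt (b \<bullet> b - 4 * \<alpha> * \<delta>) / (2 * \<bar>\<alpha>\<bar>)"
  have \<rho>: "\<rho> > 0" using K False by (simp add: \<rho>_def)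
  have Q: "quadric \<alpha> b \<delta> q = 0 \<longleftrightarrow> q \<in> sphere c \<rho>" for q
    using quadric_sphere[OF False refl K] by (simp add: c_def \<rho>_def)
  define D where "D = fst b \<bullet> fst b - 4 * \<alpha> * \<delta>"
  have D: "D \<ge> 0" using assms(1) by (simp add: spacelike_def D_def)
  obtain u :: 'a where u: "norm u = 1" using vector_choose_size[of 1] by auto
  define k where "k = sqrt D / (2 * \<alpha>)"
  define z where "z = (fst c + k *\<^sub>R u, 0::real)"
  have "quadric \<alpha> b \<delta> z = 0"
  proof -
    have zz: "z \<bullet> z = fst c \<bullet> fst c + 2 * k * (fst c \<bullet> u) + k\<^sup>2"
    proof -
      have "u \<bullet> u = 1" using u by (simp add: dot_square_norm)
      then show ?thesis
        by (simp add: z_def inner_prod_def inner_add_left inner_add_right inner_commute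
            power2_eq_square algebra_simps)
    qed
    have bz: "b \<bullet> z = - (2 * \<alpha>) * (fst c \<bullet> fst c + k * (fst c \<bullet> u))"
      using False by (simp add: z_def inner_prod_def c_def inner_add_right algebra_simps)
    have cc: "4 * \<alpha>\<^sup>2 * (fst c \<bullet> fst c) = D + 4 * \<alpha> * \<delta>"
      using False by (simp add: c_def D_def power2_eq_square)
    have kk: "4 * \<alpha>\<^sup>2 * k\<^sup>2 = D" using D False by (simp add: k_def power_divide power_mult_distrib)
    have "quadric \<alpha> b \<delta> z = - \<alpha> * (fst c \<bullet> fst c) + \<alpha> * k\<^sup>2 + \<delta>"
      unfolding quadric_def zz bz by (simp add: algebra_simps)
    then have "4 * \<alpha> * quadric \<alpha> b \<delta> z = 4 * \<alpha> * (- \<alpha> * (fst c \<bullet> fst c) + \<alpha> * k\<^sup>2 + \<delta>)" by simp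
    also have "\<dots> = - (4 * \<alpha>\<^sup>2 * (fst c \<bullet> fst c)) + 4 * \<alpha>\<^sup>2 * k\<^sup>2 + 4 * \<alpha> * \<delta>"
      by (simp add: algebra_simps power2_eq_square)
    finally have "4 * \<alpha> * quadric \<alpha> b \<delta> z = - (4 * \<alpha>\<^sup>2 * (fst c \<bullet> fst c)) + 4 * \<alpha>\<^sup>2 * k\<^sup>2 + 4 * \<alpha> * \<delta>" .
    then have "4 * \<alpha> * quadric \<alpha> b \<delta> z = 0" unfolding cc kk by simp
    then show ?thesis using False by simp
  qed
  then have "z \<in> sphere c \<rho>" "snd z = 0" using Q by (auto simp: z_def)
  moreover have eq: "{q \<in> half_space. quadric \<alpha> b \<delta> q = 0} = sphere c \<rho> \<inter> half_space" using Q by blast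
  moreover have "{q \<in> half_space. quadric \<alpha> b \<delta> q = 0} \<noteq> {}" using assms(2,3) by blast
  ultimately show ?thesis unfolding generalized_hypersphere_def using \<rho> by blast
qed

lemma sphere_eq_quadric:
  assumes "r > 0"
  shows "sphere c r = {q. quadric 1 (- 2 *\<^sub>R c) (c \<bullet> c - r\<^sup>2) q = 0}"
    and "(- 2 *\<^sub>R c) \<bullet> (- 2 *\<^sub>R c) - 4 * 1 * (c \<bullet> c - r\<^sup>2) = 4 * r\<^sup>2"
proof -
  have "quadric 1 (- 2 *\<^sub>R c) (c \<bullet> c - r\<^sup>2) q = (dist c q)\<^sup>2 - r\<^sup>2" for q
    by (simp add: quadric_def dist_norm power2_norm_eq_inner inner_diff_left inner_diff_right inner_commute)
  moreover have "(dist c q)\<^sup>2 - r\<^sup>2 = 0 \<longleftrightarrow> dist c q = r" for q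
    using assms power2_eq_iff_nonneg[of "dist c q" r] by auto
  ultimately show "sphere c r = {q. quadric 1 (- 2 *\<^sub>R c) (c \<bullet> c - r\<^sup>2) q = 0}" by auto
  show "(- 2 *\<^sub>R c) \<bullet> (- 2 *\<^sub>R c) - 4 * 1 * (c \<bullet> c - r\<^sup>2) = 4 * r\<^sup>2" by simp
qed

lemma generalized_hypersphere_imp_quadric:
  assumes "generalized_hypersphere S"
  obtains \<alpha> b \<delta> where "b \<bullet> b - 4 * \<alpha> * \<delta> > 0" "S = {q \<in> half_space. quadric \<alpha> b \<delta> q = 0}"
proof -
  consider c r where "0 < r" "S = sphere c r \<inter> half_space"
    | a d where "a \<noteq> 0" "S = {p. a \<bullet> p = d} \<inter> half_space"
    using assms unfolding generalized_hypersphere_def by blast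
  then show ?thesis
  proof cases
    case 1
    show ?thesis
      by (rule that[of "- 2 *\<^sub>R c" 1 "c \<bullet> c - r\<^sup>2"])
        (use 1 sphere_eq_quadric[OF 1(1), of c] in \<open>auto simp del: inner_scaleR_left inner_scaleR_right\<close>)
  next
    case 2
    show ?thesis
      by (rule that[of a 0 "- d"]) (use 2 in \<open>auto simp: quadric_def\<close>)
  qed
qed

lemma path_connected_quadric_leaf:
  fixes b :: "'a::euclidean_space \<times> real"
  assumes "b \<bullet> b - 4 * \<alpha> * \<delta> > 0"
  shows "path_connected {q \<in> half_space. quadric \<alpha> b \<delta> q = 0}"
proof -
  have "{q \<in> half_space. quadric \<alpha> b \<delta> q = 0} = {q. quadric \<alpha> b \<delta> q = 0 \<and> (0, 1) \<bullet> q > 0}"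
    by (auto simp: half_space_def)
  then show ?thesis using path_connected_quadric_half_space[OF DIM_half_space assms] by simp
qed

lemma quadric_leaf_sheet:
  fixes b :: "'a::euclidean_space \<times> real"
  assumes "b \<bullet> b - 4 * \<alpha> * \<delta> > 0" "p \<in> half_space" "quadric \<alpha> b \<delta> p = 0"
  obtains U where "sheet {q \<in> half_space. quadric \<alpha> b \<delta> q = 0} p U (quadric \<alpha> b \<delta>)"
  using quadric_sheet[of "{q \<in> half_space. quadric \<alpha> b \<delta> q = 0}" p half_space \<alpha> b \<delta>] assms open_half_space
  by blast

lemma quadric_leaf_totally_umbilical:
  fixes b :: "'a::euclidean_space \<times> real"
  assumes "b \<bullet> b - 4 * \<alpha> * \<delta> > 0"
  shows "totally_umbilical {q \<in> half_space. quadric \<alpha> b \<delta> q = 0}"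
  unfolding totally_umbilical_def smooth_hypersurface_sheet
proof (intro conjI ballI)
  fix p assume "p \<in> {q \<in> half_space. quadric \<alpha> b \<delta> q = 0}"
  then obtain U where U: "sheet {q \<in> half_space. quadric \<alpha> b \<delta> q = 0} p U (quadric \<alpha> b \<delta>)"
    using quadric_leaf_sheet[OF assms] by blast
  then show "\<exists>U f. sheet {q \<in> half_space. quadric \<alpha> b \<delta> q = 0} p U f" by blast
  show "\<exists>\<nu> \<kappa>. umbilic_with_curvature {q \<in> half_space. quadric \<alpha> b \<delta> q = 0} p \<nu> \<kappa>"
    using quadric_umbilic[OF U assms] by blast
qed blast

text \<open>
  Curves on the first quadric through p are curves on the second one. Their velocities show that
  the gradients at p are proportional, and one further point fixes the ratio of the leading
  coefficients.
\<close>

lemma quadric_germ_unique: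
  fixes b b' :: "'b::euclidean_space"
  assumes dim: "DIM('b) \<ge> 2" and W: "open W" "p \<in> W"
    and z: "quadric \<alpha> b \<delta> p = 0" and K: "b \<bullet> b - 4 * \<alpha> * \<delta> > 0" "b' \<bullet> b' - 4 * \<alpha>' * \<delta>' > 0"
    and sub: "\<And>q. q \<in> W \<Longrightarrow> quadric \<alpha> b \<delta> q = 0 \<Longrightarrow> quadric \<alpha>' b' \<delta>' q = 0"
  obtains k where "k \<noteq> 0" "\<alpha>' = k * \<alpha>" "b' = k *\<^sub>R b" "\<delta>' = k * \<delta>"
proof -
  define g where "g = (2 * \<alpha>) *\<^sub>R p + b"
  define g' where "g' = (2 * \<alpha>') *\<^sub>R p + b'"
  have z': "quadric \<alpha>' b' \<delta>' p = 0" using sub[OF W(2) z] .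
  have gg: "g \<bullet> g > 0" "g' \<bullet> g' > 0"
    using quadric_gradient_norm[of \<alpha> p b \<delta>] quadric_gradient_norm[of \<alpha>' p b' \<delta>'] K z z'
    by (simp_all add: g_def g'_def)
  have fd: "frechet_derivative (quadric \<alpha> b \<delta>) (at p) = (\<lambda>v. g \<bullet> v)"
    by (simp add: frechet_derivative_quadric g_def)
  have fdn: "frechet_derivative (quadric \<alpha> b \<delta>) (at p) \<noteq> (\<lambda>v. 0)"
    using gg(1) unfolding fd by (metis less_irrefl)
  have curve: "\<exists>c e. 0 < e \<and> (\<forall>t. \<bar>t\<bar> < e \<longrightarrow> c t \<in> W \<and> quadric \<alpha> b \<delta> (c t) = 0) \<and> c 0 = p
      \<and> (c has_vector_derivative v) (at 0)" if "g \<bullet> v = 0" for v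
  proof -
    have fdv: "frechet_derivative (quadric \<alpha> b \<delta>) (at p) v = 0" using that fd by simp
    obtain c :: "real \<Rightarrow> 'b" and e where "0 < e" "c ` {-e<..<e} \<subseteq> {q \<in> W. quadric \<alpha> b \<delta> q = 0}" "c 0 = p"
      "(c has_vector_derivative v) (at 0)"
      using level_set_curve[OF W smooth_on_quadric[OF W(1)] z fdn fdv] by blast
    moreover have "t \<in> {-e<..<e}" if "\<bar>t\<bar> < e" for t using that by auto
    ultimately show ?thesis by (intro exI[of _ c] exI[of _ e]) blast
  qed
  have "g' \<bullet> v = 0" if v: "g \<bullet> v = 0" for v
  proof -
    obtain c :: "real \<Rightarrow> 'b" and e where c: "0 < e" "\<And>t. \<bar>t\<bar> < e \<Longrightarrow> c t \<in> W \<and> quadric \<alpha> b \<delta> (c t) = 0" "c 0 = p"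
      "(c has_vector_derivative v) (at 0)" using curve[OF v] by blast
    have "(quadric \<alpha>' b' \<delta>' has_derivative (\<lambda>v. g' \<bullet> v)) (at (c 0))"
      using quadric_has_derivative[of \<alpha>' b' \<delta>' p] c(3) by (simp add: g'_def)
    from has_vector_derivative_compose[OF c(4) this]
    have "((\<lambda>t. quadric \<alpha>' b' \<delta>' (c t)) has_vector_derivative g' \<bullet> v) (at 0)" .
    moreover have "((\<lambda>t. quadric \<alpha>' b' \<delta>' (c t)) has_vector_derivative 0) (at 0)"
      by (rule has_vector_derivative_transform_within_open[of "\<lambda>t. 0" _ _ "{-e<..<e}"])
        (use c(1,2) sub in auto)
    ultimately show ?thesis using vector_derivative_unique_at by blast
  qed
  then have ort: "g' \<bullet> v = 0" if "g \<bullet> v = 0" for v using that .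
  define k where "k = (g' \<bullet> g) / (g \<bullet> g)"
  have "g' = k *\<^sub>R g"
  proof -
    have 1: "g \<bullet> (g' - k *\<^sub>R g) = 0" using gg by (simp add: k_def inner_diff_right inner_commute)
    then have "(g' - k *\<^sub>R g) \<bullet> (g' - k *\<^sub>R g) = 0" using ort[OF 1] by (simp add: inner_diff_left)
    then show ?thesis by simp
  qed
  then have k: "k \<noteq> 0" using gg(2) by auto
  obtain v where v: "v \<noteq> 0" "g \<bullet> v = 0"
    using orthogonal_to_vector_exists[OF dim, of g] unfolding orthogonal_def by blast
  obtain c :: "real \<Rightarrow> 'b" and e where c: "0 < e" "\<And>t. \<bar>t\<bar> < e \<Longrightarrow> c t \<in> W \<and> quadric \<alpha> b \<delta> (c t) = 0" "c 0 = p"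
      "(c has_vector_derivative v) (at 0)" using curve[OF v(2)] by blast
  have "\<exists>t. \<bar>t\<bar> < e \<and> c t \<noteq> p"
  proof (rule ccontr)
    assume "\<not> (\<exists>t. \<bar>t\<bar> < e \<and> c t \<noteq> p)"
    then have const: "c t = p" if "\<bar>t\<bar> < e" for t using that by blast
    have "(c has_vector_derivative 0) (at 0)"
      by (rule has_vector_derivative_transform_within_open[of "\<lambda>t. p" _ _ "{-e<..<e}"])
        (use c(1) const in auto)
    then show False using c(4) v(1) vector_derivative_unique_at by blast
  qed
  then obtain t where t: "\<bar>t\<bar> < e" "c t \<noteq> p" by blast
  define w where "w = c t - p"
  have w: "w \<bullet> w \<noteq> 0" using t by (simp add: w_def)
  have "quadric \<alpha> b \<delta> (c t) = 0" "quadric \<alpha>' b' \<delta>' (c t) = 0" using c(2)[OF t(1)] sub by blast+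
  then have 1: "\<alpha> * (w \<bullet> w) + g \<bullet> w = 0" and 2: "\<alpha>' * (w \<bullet> w) + g' \<bullet> w = 0"
    unfolding quadric_recenter[of \<alpha> b \<delta> "c t" p] quadric_recenter[of \<alpha>' b' \<delta>' "c t" p] z z'
    by (simp_all add: w_def g_def g'_def inner_add_left)
  have "(\<alpha>' - k * \<alpha>) * (w \<bullet> w) = (\<alpha>' * (w \<bullet> w) + g' \<bullet> w) - k * (\<alpha> * (w \<bullet> w) + g \<bullet> w)"
    using \<open>g' = k *\<^sub>R g\<close> by (simp add: algebra_simps)
  then have "(\<alpha>' - k * \<alpha>) * (w \<bullet> w) = 0" by (simp only: 1 2 mult_zero_right diff_zero)
  then have \<alpha>': "\<alpha>' = k * \<alpha>" using w by simp
  have "b' = g' - (2 * \<alpha>') *\<^sub>R p" "b = g - (2 * \<alpha>) *\<^sub>R p" by (simp_all add: g_def g'_def)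
  then have b': "b' = k *\<^sub>R b" using \<open>g' = k *\<^sub>R g\<close> \<alpha>' by (simp add: scaleR_diff_right)
  have d: "\<delta> = - \<alpha> * (p \<bullet> p) - b \<bullet> p" and d': "\<delta>' = - \<alpha>' * (p \<bullet> p) - b' \<bullet> p"
    using z z' unfolding quadric_def by linarith+
  have "\<delta>' = k * \<delta>" by (subst d', subst d) (simp add: \<alpha>' b' algebra_simps)
  then show ?thesis using that[OF k \<alpha>' b'] by blast
qed

text \<open>The generalized hypersphere through p with given conormal and mean curvature.\<close>

definition hypersphere_eq :: "'a::euclidean_space \<times> real \<Rightarrow> 'a \<times> real \<Rightarrow> real \<Rightarrow> 'a \<times> real \<Rightarrow> real" where
  "hypersphere_eq p w h q = (h - snd w / snd p) * ((q - p) \<bullet> (q - p)) - 2 * (w \<bullet> (q - p))"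

lemma hypersphere_eq_quadric:
  "hypersphere_eq p w h = quadric (h - snd w / snd p) (- (2 *\<^sub>R (w + (h - snd w / snd p) *\<^sub>R p)))
     ((h - snd w / snd p) * (p \<bullet> p) + 2 * (w \<bullet> p))"
  unfolding hypersphere_eq_def[abs_def] quadric_def[abs_def]
  by (rule ext) (simp add: inner_diff_left inner_diff_right inner_add_left inner_commute algebra_simps)

lemma quadric_leaf_equation:
  fixes b :: "'a::euclidean_space \<times> real"
  assumes "b \<bullet> b - 4 * \<alpha> * \<delta> > 0" "p \<in> half_space" "quadric \<alpha> b \<delta> p = 0"
    and "umbilic_with_curvature {q \<in> half_space. quadric \<alpha> b \<delta> q = 0} p (- w) h"
  shows "{q \<in> half_space. quadric \<alpha> b \<delta> q = 0} = {q \<in> half_space. hypersphere_eq p w h q = 0}"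
proof -
  obtain U where U: "sheet {q \<in> half_space. quadric \<alpha> b \<delta> q = 0} p U (quadric \<alpha> b \<delta>)"
    using quadric_leaf_sheet[OF assms(1-3)] by blast
  define s where "s = sqrt (b \<bullet> b - 4 * \<alpha> * \<delta>)"
  define y where "y = snd p"
  define g where "g = (2 * \<alpha>) *\<^sub>R p + b"
  have s: "s > 0" using assms(1) by (simp add: s_def)
  have y: "y > 0" using assms(2) half_space_pos unfolding y_def by blast
  have n: "quadric_normal \<alpha> b \<delta> p = (1 / s) *\<^sub>R g" by (simp add: quadric_normal_def s_def g_def)
  obtain \<sigma> where \<sigma>: "\<sigma> = 1 \<or> \<sigma> = - 1" "- w = (\<sigma> * snd p) *\<^sub>R quadric_normal \<alpha> b \<delta> p"
    "h = \<sigma> * (snd p * (2 * \<alpha> / sqrt (b \<bullet> b - 4 * \<alpha> * \<delta>)) - snd (quadric_normal \<alpha> b \<delta> p))"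
    by (rule quadric_curvature_unique[OF U assms(1,4)])
  have w: "w = - ((\<sigma> * y / s) *\<^sub>R g)" using \<sigma>(2) unfolding n y_def[symmetric]
    by (metis minus_minus scaleR_scaleR times_divide_eq_right mult.right_neutral)
  have h: "h = \<sigma> * (y * (2 * \<alpha> / s) - snd g / s)"
    using \<sigma>(3) unfolding n s_def[symmetric] y_def[symmetric] by simp
  have lam: "h - snd w / y = \<sigma> * (2 * y / s) * \<alpha>" unfolding w h using y s by (simp add: field_simps)
  have "hypersphere_eq p w h q = (\<sigma> * (2 * y / s)) * quadric \<alpha> b \<delta> q" for q
  proof -
    have "hypersphere_eq p w h q = \<sigma> * (2 * y / s) * \<alpha> * ((q - p) \<bullet> (q - p)) - 2 * (w \<bullet> (q - p))"
      unfolding hypersphere_eq_def y_def[symmetric] lam ..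
    also have "2 * (w \<bullet> (q - p)) = - (\<sigma> * (2 * y / s)) * (g \<bullet> (q - p))" unfolding w by simp
    finally have 1: "hypersphere_eq p w h q = (\<sigma> * (2 * y / s)) * (\<alpha> * ((q - p) \<bullet> (q - p)) + g \<bullet> (q - p))"
      by (simp only: distrib_left mult.assoc mult_minus_left diff_minus_eq_add)
    have "quadric \<alpha> b \<delta> q = \<alpha> * ((q - p) \<bullet> (q - p)) + g \<bullet> (q - p)"
      unfolding quadric_recenter[of \<alpha> b \<delta> q p] assms(3) by (simp add: g_def inner_add_left)
    then show ?thesis using 1 by simp
  qed
  moreover have "\<sigma> * (2 * y / s) \<noteq> 0" using \<sigma>(1) y s by auto
  ultimately have "hypersphere_eq p w h q = 0 \<longleftrightarrow> quadric \<alpha> b \<delta> q = 0" for q by simp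
  then show ?thesis by blast
qed

lemma hypersphere_eq_leaf:
  fixes p w :: "'a::euclidean_space \<times> real" and h :: real
  assumes "p \<in> half_space" "hyp_inner p w w = 1"
  defines "L \<equiv> {q \<in> half_space. hypersphere_eq p w h q = 0}"
  shows "umbilic_with_curvature L p (- w) h" "\<And>X. X \<in> tangent_vectors L p \<Longrightarrow> w \<bullet> X = 0"
proof -
  define y where "y = snd p"
  define \<alpha> where "\<alpha> = h - snd w / y"
  define b where "b = - (2 *\<^sub>R (w + \<alpha> *\<^sub>R p))"
  define \<delta> where "\<delta> = \<alpha> * (p \<bullet> p) + 2 * (w \<bullet> p)"
  have y: "y > 0" using assms(1) half_space_pos unfolding y_def by blast
  have ww: "w \<bullet> w = y\<^sup>2" using assms(2) y by (simp add: hyp_inner_def y_def)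
  have q: "hypersphere_eq p w h = quadric \<alpha> b \<delta>"
    unfolding hypersphere_eq_quadric \<alpha>_def b_def \<delta>_def y_def ..
  have g: "(2 * \<alpha>) *\<^sub>R p + b = - (2 *\<^sub>R w)" by (simp add: b_def algebra_simps)
  have z: "quadric \<alpha> b \<delta> p = 0" unfolding q[symmetric] by (simp add: hypersphere_eq_def)
  have K: "b \<bullet> b - 4 * \<alpha> * \<delta> = 4 * y\<^sup>2"
    using quadric_gradient_norm[of \<alpha> p b \<delta>] z g ww by simp
  then have K0: "b \<bullet> b - 4 * \<alpha> * \<delta> > 0" using y by simp
  have sq: "sqrt (b \<bullet> b - 4 * \<alpha> * \<delta>) = 2 * y"
    unfolding K using y by (simp add: real_sqrt_mult)
  have n: "quadric_normal \<alpha> b \<delta> p = - ((1 / y) *\<^sub>R w)"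
    unfolding quadric_normal_def g sq using y by simp
  have L: "L = {q \<in> half_space. quadric \<alpha> b \<delta> q = 0}" unfolding L_def q ..
  obtain U where U: "sheet L p U (quadric \<alpha> b \<delta>)"
    using quadric_leaf_sheet[OF K0 assms(1) z] unfolding L by blast
  have "umbilic_with_curvature L p (y *\<^sub>R quadric_normal \<alpha> b \<delta> p)
    (y * (2 * \<alpha> / (2 * y)) - snd (quadric_normal \<alpha> b \<delta> p))"
    using quadric_umbilic[OF U K0] unfolding sq y_def[symmetric] .
  moreover have "y *\<^sub>R quadric_normal \<alpha> b \<delta> p = - w" unfolding n using y by simp
  moreover have "y * (2 * \<alpha> / (2 * y)) - snd (quadric_normal \<alpha> b \<delta> p) = h"
    unfolding n using y by (simp add: \<alpha>_def field_simps)
  ultimately show "umbilic_with_curvature L p (- w) h" by simp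
  show "w \<bullet> X = 0" if "X \<in> tangent_vectors L p" for X
    using that unfolding sheet_tangent[OF U] frechet_derivative_quadric g by simp
qed

section \<open>Totally umbilical leaves are generalized hyperspheres\<close>

text \<open>
  The point x minimizes the quadratic form of B on V, so the first variation at x vanishes.
\<close>

lemma psd_kernel:
  fixes B :: "'b::real_inner \<Rightarrow> 'b"
  assumes B: "linear B" "subspace V" "B ` V \<subseteq> V" "\<And>x y. x \<in> V \<Longrightarrow> y \<in> V \<Longrightarrow> B x \<bullet> y = x \<bullet> B y"
    and psd: "\<And>x. x \<in> V \<Longrightarrow> 0 \<le> B x \<bullet> x" and x: "x \<in> V" "B x \<bullet> x = 0"
  shows "B x = 0"
proof -
  define y where "y = B x"
  have y: "y \<in> V" using B(3) x(1) by (auto simp: y_def)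
  define c where "c = B y \<bullet> y"
  have c: "c \<ge> 0" using psd[OF y] by (simp add: c_def)
  have key: "y = 0"
  proof (rule ccontr)
    assume "y \<noteq> 0"
    then have yy: "y \<bullet> y > 0" by simp
    define s where "s = - (y \<bullet> y) / (c + 1)"
    have "x + s *\<^sub>R y \<in> V" using subspace_add[OF B(2) x(1) subspace_scale[OF B(2) y]] .
    from psd[OF this] have "0 \<le> (y + s *\<^sub>R B y) \<bullet> (x + s *\<^sub>R y)"
      by (simp add: linear_add[OF B(1)] linear_scale[OF B(1)] y_def)
    also have "\<dots> = y \<bullet> x + s * (y \<bullet> y) + s * (B y \<bullet> x) + s * s * c"
      by (simp add: inner_add_left inner_add_right c_def algebra_simps)
    also have "\<dots> = s * (2 * (y \<bullet> y) + s * c)"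
      using B(4)[OF y x(1)] x(2) by (simp add: y_def[symmetric] inner_commute algebra_simps)
    finally have "0 \<le> s * (2 * (y \<bullet> y) + s * c)" .
    moreover have "s < 0" using yy c by (simp add: s_def divide_neg_pos)
    moreover have "2 * (y \<bullet> y) + s * c > 0"
    proof -
      have "s * c = - (y \<bullet> y) * (c / (c + 1))" by (simp add: s_def)
      moreover have "(y \<bullet> y) * (c / (c + 1)) \<le> (y \<bullet> y) * 1"
        using yy c by (intro mult_left_mono) (auto simp: field_simps)
      ultimately show ?thesis using yy by linarith
    qed
    ultimately show False by (simp add: zero_le_mult_iff)
  qed
  then show ?thesis by (simp add: y_def)
qed

text \<open>
  If M is the maximum of the Rayleigh quotient, then M - A is positive semidefinite and its form
  vanishes at a maximizer.
\<close>

lemma rayleigh_maximum: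
  fixes A :: "'b::euclidean_space \<Rightarrow> 'b"
  assumes A: "linear A" "subspace V" "A ` V \<subseteq> V" "\<And>x y. x \<in> V \<Longrightarrow> y \<in> V \<Longrightarrow> A x \<bullet> y = x \<bullet> A y"
    and V: "z \<in> V" "z \<noteq> 0"
  obtains x M where "x \<in> V" "x \<noteq> 0" "A x = M *\<^sub>R x" "\<And>v. v \<in> V \<Longrightarrow> A v \<bullet> v \<le> M * (v \<bullet> v)"
proof -
  let ?S = "V \<inter> sphere 0 1"
  have "compact ?S" using closed_subspace[OF A(2)] by (simp add: closed_Int_compact)
  moreover have "(1 / norm z) *\<^sub>R z \<in> ?S" using V A(2) by (auto intro: subspace_scale)
  moreover have "continuous_on ?S (\<lambda>x. A x \<bullet> x)"
    by (intro continuous_intros linear_continuous_on A(1)[unfolded linear_conv_bounded_linear])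
  ultimately obtain x where x: "x \<in> ?S" "\<And>v. v \<in> ?S \<Longrightarrow> A v \<bullet> v \<le> A x \<bullet> x"
    using continuous_attains_sup[of ?S "\<lambda>x. A x \<bullet> x"] by blast
  define M where "M = A x \<bullet> x"
  have xx: "x \<bullet> x = 1" using x(1) by (simp add: dot_square_norm)
  have le: "A v \<bullet> v \<le> M * (v \<bullet> v)" if v: "v \<in> V" for v
  proof (cases "v = 0")
    case True
    then show ?thesis by simp
  next
    case False
    have "(1 / norm v) *\<^sub>R v \<in> ?S" using False v A(2) by (auto intro: subspace_scale)
    from x(2)[OF this] have "(A v \<bullet> v) / (norm v)\<^sup>2 \<le> M"
      by (simp add: M_def linear_scale[OF A(1)] power2_eq_square)
    then show ?thesis using False by (simp add: divide_le_eq dot_square_norm)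
  qed
  define B where "B = (\<lambda>v. M *\<^sub>R v - A v)"
  have "B x = 0"
  proof (rule psd_kernel[of B V])
    show "linear B" unfolding B_def by (intro linear_compose_sub linear_scaleR A(1))
    show "subspace V" by fact
    show "B ` V \<subseteq> V"
    proof
      fix w assume "w \<in> B ` V"
      then obtain v where "v \<in> V" "w = M *\<^sub>R v - A v" by (auto simp: B_def)
      then show "w \<in> V" using A(2,3) by (auto intro!: subspace_diff subspace_scale)
    qed
    show "B v \<bullet> w = v \<bullet> B w" if "v \<in> V" "w \<in> V" for v w
      using A(4)[OF that] by (simp add: B_def inner_diff_left inner_diff_right)
    show "0 \<le> B v \<bullet> v" if "v \<in> V" for v using le[OF that] by (simp add: B_def inner_diff_left)
    show "x \<in> V" using x(1) by simp
    show "B x \<bullet> x = 0" by (simp add: B_def inner_diff_left M_def xx)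
  qed
  then have "A x = M *\<^sub>R x" by (simp add: B_def)
  moreover have "x \<in> V" "x \<noteq> 0" using x(1) xx by auto
  ultimately show ?thesis using that le by blast
qed

text \<open>
  The maximum and the minimum of the Rayleigh quotient are eigenvalues; if they agree, the quadratic
  form is a multiple of the square of the norm.
\<close>

lemma symmetric_single_eigenvalue_scalar:
  fixes A :: "'b::euclidean_space \<Rightarrow> 'b"
  assumes A: "linear A" "subspace V" "A ` V \<subseteq> V" "\<And>x y. x \<in> V \<Longrightarrow> y \<in> V \<Longrightarrow> A x \<bullet> y = x \<bullet> A y"
    and ev: "\<And>x \<mu>. x \<in> V \<Longrightarrow> x \<noteq> 0 \<Longrightarrow> A x = \<mu> *\<^sub>R x \<Longrightarrow> \<mu> = l" and z: "z \<in> V"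
  shows "A z = l *\<^sub>R z"
proof (cases "z = 0")
  case True
  then show ?thesis by (simp add: linear_0[OF A(1)])
next
  case False
  have up: "A v \<bullet> v \<le> l * (v \<bullet> v)" if "v \<in> V" for v
    using rayleigh_maximum[OF A z False] ev that by metis
  define C where "C = (\<lambda>v. - A v)"
  have C: "linear C" "C ` V \<subseteq> V" "\<And>x y. x \<in> V \<Longrightarrow> y \<in> V \<Longrightarrow> C x \<bullet> y = x \<bullet> C y"
    unfolding C_def using A by (auto intro: linear_compose_neg subspace_neg)
  obtain x M where x: "x \<in> V" "x \<noteq> 0" "C x = M *\<^sub>R x" and M: "\<And>v. v \<in> V \<Longrightarrow> C v \<bullet> v \<le> M * (v \<bullet> v)"
    using rayleigh_maximum[OF C(1) A(2) C(2,3) z False] by metis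
  have "A x = (- M) *\<^sub>R x" using x(3) by (simp add: C_def) (metis minus_minus)
  then have "M = - l" using ev[OF x(1,2)] by (metis minus_minus)
  then have low: "l * (v \<bullet> v) \<le> A v \<bullet> v" if "v \<in> V" for v using M[OF that] by (simp add: C_def)
  define B where "B = (\<lambda>v. l *\<^sub>R v - A v)"
  have "B z = 0"
  proof (rule psd_kernel[of B V])
    show "linear B" unfolding B_def by (intro linear_compose_sub linear_scaleR A(1))
    show "subspace V" by fact
    show "B ` V \<subseteq> V"
    proof
      fix w assume "w \<in> B ` V"
      then obtain v where "v \<in> V" "w = l *\<^sub>R v - A v" by (auto simp: B_def)
      then show "w \<in> V" using A(2,3) by (auto intro!: subspace_diff subspace_scale)
    qed
    show "B v \<bullet> w = v \<bullet> B w" if "v \<in> V" "w \<in> V" for v w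
      using A(4)[OF that] by (simp add: B_def inner_diff_left inner_diff_right)
    show "0 \<le> B v \<bullet> v" if "v \<in> V" for v using up[OF that] by (simp add: B_def inner_diff_left)
    show "z \<in> V" by fact
    show "B z \<bullet> z = 0" using up[OF z] low[OF z] by (simp add: B_def inner_diff_left)
  qed
  then show ?thesis by (simp add: B_def)
qed

definition grad :: "('b::euclidean_space \<Rightarrow> real) \<Rightarrow> 'b \<Rightarrow> 'b" where
  "grad f q = (\<Sum>b\<in>Basis. frechet_derivative f (at q) b *\<^sub>R b)"

lemma grad_inner:
  assumes "(f has_derivative D) (at q)"
  shows "grad f q \<bullet> v = frechet_derivative f (at q) v"
proof -
  have D: "frechet_derivative f (at q) = D" using frechet_derivative_at[OF assms] by simp
  have "D v = (\<Sum>b\<in>Basis. (v \<bullet> b) *\<^sub>R D b)" by (rule linear_eq_sum_Basis[OF has_derivative_linear[OF assms]])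
  then show ?thesis by (simp add: grad_def D inner_sum_left mult.commute inner_commute[of v])
qed

text \<open>
  The derivative of the Euclidean unit normal field is symmetric on the tangent space, because it
  is the second derivative of f up to a factor and a normal component.
\<close>

lemma unit_normal_derivative:
  fixes f :: "'b::euclidean_space \<Rightarrow> real"
  assumes U: "open U" "p \<in> U" and f: "smooth_on U f"
    and nz: "\<And>q. q \<in> U \<Longrightarrow> frechet_derivative f (at q) \<noteq> (\<lambda>v. 0)"
  defines "n \<equiv> (\<lambda>q. inverse (norm (grad f q)) *\<^sub>R grad f q)"
  obtains n' where "(n has_derivative n') (at p)" "\<And>v. n p \<bullet> n' v = 0"
    "\<And>v w. n p \<bullet> v = 0 \<Longrightarrow> n p \<bullet> w = 0 \<Longrightarrow> n' v \<bullet> w = v \<bullet> n' w"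
proof -
  note f2 = smooth_onD[OF f, of 2]
  note fS = f2[unfolded numeral_2_eq_2]
  have gi: "grad f q \<bullet> v = frechet_derivative f (at q) v" if "q \<in> U" for q v
    by (rule grad_inner[OF smooth_on_has_derivative[OF f that]])
  have gnz: "grad f q \<noteq> 0" if "q \<in> U" for q
  proof
    assume "grad f q = 0"
    then have "frechet_derivative f (at q) v = 0" for v using gi[OF that, of v] by simp
    then show False using nz[OF that] by auto
  qed
  define h where "h = (\<lambda>b. frechet_derivative (\<lambda>x. frechet_derivative f (at x) b) (at p))"
  define Hs where "Hs = (\<lambda>v. \<Sum>b\<in>Basis. h b v *\<^sub>R b)"
  have hb: "((\<lambda>x. frechet_derivative f (at x) b) has_derivative h b) (at p)" for b
    unfolding h_def by (rule Ck_on_has_derivative[OF Ck_on_derivative[OF fS] U(2)])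
  have g': "(grad f has_derivative Hs) (at p)"
    unfolding grad_def[abs_def] Hs_def by (intro has_derivative_sum has_derivative_scaleR_left hb)
  have sym: "Hs v \<bullet> w = Hs w \<bullet> v" for v w
  proof -
    have eq: "Hs v \<bullet> w = h w v" for v w
    proof -
      have "((\<lambda>x. grad f x \<bullet> w) has_derivative (\<lambda>v. Hs v \<bullet> w)) (at p)"
        by (rule has_derivative_inner_left[OF g'])
      then have "((\<lambda>x. frechet_derivative f (at x) w) has_derivative (\<lambda>v. Hs v \<bullet> w)) (at p)"
        by (rule has_derivative_transform_within_open[OF _ U]) (rule gi)
      then show ?thesis unfolding h_def using frechet_derivative_at[of _ "\<lambda>v. Hs v \<bullet> w" p] by metis
    qed
    have "h w v = h v w" unfolding h_def by (rule second_derivative_symmetric[OF U(1) f2 U(2)])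
    then show ?thesis by (simp add: eq)
  qed
  have "((\<lambda>q. inverse (sqrt (grad f q \<bullet> grad f q))) differentiable (at p))"
  proof -
    have pos: "grad f p \<bullet> grad f p > 0" using gnz[OF U(2)] by simp
    have "((\<lambda>q. grad f q \<bullet> grad f q) has_derivative (\<lambda>v. grad f p \<bullet> Hs v + Hs v \<bullet> grad f p)) (at p)"
      by (rule has_derivative_inner[OF g' g'])
    from has_derivative_real_sqrt[OF pos this]
    show ?thesis using pos by (intro differentiable_inverse) (auto simp: differentiable_def)
  qed
  then obtain k' where k': "((\<lambda>q. inverse (norm (grad f q))) has_derivative k') (at p)"
    unfolding differentiable_def norm_eq_sqrt_inner by blast
  define n' where "n' = (\<lambda>v. inverse (norm (grad f p)) *\<^sub>R Hs v + k' v *\<^sub>R grad f p)"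
  have n': "(n has_derivative n') (at p)"
    unfolding n_def n'_def by (rule has_derivative_scaleR[OF k' g'])
  have "n p \<bullet> n' v = 0" for v
  proof -
    have "((\<lambda>q. n q \<bullet> n q) has_derivative (\<lambda>v. n p \<bullet> n' v + n' v \<bullet> n p)) (at p)"
      by (rule has_derivative_inner[OF n' n'])
    moreover have "((\<lambda>q. n q \<bullet> n q) has_derivative (\<lambda>v. 0)) (at p)"
    proof (rule has_derivative_transform_within_open[OF _ U])
      show "((\<lambda>q. 1::real) has_derivative (\<lambda>v. 0)) (at p)" by (rule has_derivative_const)
      show "1 = n q \<bullet> n q" if "q \<in> U" for q
        using gnz[OF that] by (simp add: n_def dot_square_norm power2_eq_square)
    qed
    ultimately have "n p \<bullet> n' v + n' v \<bullet> n p = 0" using has_derivative_unique by metis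
    then show ?thesis by (simp add: inner_commute)
  qed
  moreover have "n' v \<bullet> w = v \<bullet> n' w" if "n p \<bullet> v = 0" "n p \<bullet> w = 0" for v w
  proof -
    have "grad f p \<bullet> v = 0" "grad f p \<bullet> w = 0" using that gnz[OF U(2)] by (auto simp: n_def)
    then show ?thesis using sym[of v w]
      by (simp add: n'_def inner_add_left inner_add_right inner_commute)
  qed
  ultimately show ?thesis using that n' by blast
qed

text \<open>
  The hyperbolic shape operator differs from the Euclidean one by a factor and a multiple of the
  identity. Being symmetric with one eigenvalue, the latter is scalar.
\<close>

lemma umbilic_unit_normal_derivative:
  fixes f :: "'a::euclidean_space \<times> real \<Rightarrow> real"
  assumes sh: "sheet L p U f" and um: "umbilic_with_curvature L p \<nu> \<kappa>"
  defines "n \<equiv> (\<lambda>q. inverse (norm (grad f q)) *\<^sub>R grad f q)"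
  obtains n' l where "(n has_derivative n') (at p)"
    "\<And>v. frechet_derivative f (at p) v = 0 \<Longrightarrow> n' v = l *\<^sub>R v"
proof -
  have s: "open U" "p \<in> U" "smooth_on U f" "\<And>q. q \<in> U \<Longrightarrow> frechet_derivative f (at q) \<noteq> (\<lambda>v. 0)"
    "L \<subseteq> half_space" "p \<in> L"
    using sh unfolding sheet_def by blast+
  have y: "snd p > 0" using s(5,6) half_space_pos by blast
  obtain n' where n': "(n has_derivative n') (at p)" "\<And>v. n p \<bullet> n' v = 0"
    "\<And>v w. n p \<bullet> v = 0 \<Longrightarrow> n p \<bullet> w = 0 \<Longrightarrow> n' v \<bullet> w = v \<bullet> n' w"
    using unit_normal_derivative[OF s(1-4)] unfolding n_def by blast
  have gi: "grad f q \<bullet> v = frechet_derivative f (at q) v" if "q \<in> U" for q v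
    by (rule grad_inner[OF smooth_on_has_derivative[OF s(3) that]])
  have gnz: "grad f q \<noteq> 0" if "q \<in> U" for q
  proof
    assume "grad f q = 0"
    then have "frechet_derivative f (at q) v = 0" for v using gi[OF that, of v] by simp
    then show False using s(4)[OF that] by blast
  qed
  have n0: "n q \<bullet> v = 0 \<longleftrightarrow> frechet_derivative f (at q) v = 0" if "q \<in> U" for q v
    using gnz[OF that] gi[OF that] by (simp add: n_def)
  have n1: "norm (n q) = 1" if "q \<in> U" for q using gnz[OF that] by (simp add: n_def)
  obtain U2 N where N: "unit_normal_field L p U2 N" "N p = \<nu>" "shape_eigenvalues L N p = {\<kappa>}"
    using um unfolding umbilic_with_curvature_def by blast
  obtain \<sigma> where \<sigma>: "\<sigma> = 1 \<or> \<sigma> = - 1"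
    and cov: "\<And>X. frechet_derivative f (at p) X = 0 \<Longrightarrow> cov_deriv N p X = \<sigma> *\<^sub>R (snd p *\<^sub>R n' X - snd (n p) *\<^sub>R X)"
    by (rule cov_deriv_unit_normal[OF sh N(1) n'(1) open_UNIV UNIV_I]) (use n0 n1 in blast)+
  define V where "V = {v. n p \<bullet> v = 0}"
  define l where "l = (\<sigma> * \<kappa> + snd (n p)) / snd p"
  have "n' v = l *\<^sub>R v" if "v \<in> V" for v
  proof (rule symmetric_single_eigenvalue_scalar[of n' V])
    show "linear n'" by (rule has_derivative_linear[OF n'(1)])
    show "subspace V" unfolding V_def by (rule subspace_hyperplane)
    show "n' ` V \<subseteq> V" using n'(2) by (auto simp: V_def)
    show "n' v \<bullet> w = v \<bullet> n' w" if "v \<in> V" "w \<in> V" for v w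
      using n'(3) that unfolding V_def by blast
    show "\<mu> = l" if X: "X \<in> V" "X \<noteq> 0" "n' X = \<mu> *\<^sub>R X" for X \<mu>
    proof -
      have d: "frechet_derivative f (at p) X = 0" using X(1) n0[OF s(2)] unfolding V_def by blast
      then have "X \<in> tangent_vectors L p" using sheet_tangent[OF sh] by blast
      moreover have "cov_deriv N p X = (\<sigma> * (snd p * \<mu> - snd (n p))) *\<^sub>R X"
        unfolding cov[OF d] X(3) by (simp add: algebra_simps)
      ultimately have "\<sigma> * (snd p * \<mu> - snd (n p)) \<in> shape_eigenvalues L N p"
        unfolding shape_eigenvalues_def using X(2) by blast
      then have "\<sigma> * (snd p * \<mu> - snd (n p)) = \<kappa>" using N(3) by blast
      then show ?thesis using \<sigma> y unfolding l_def by (auto simp: field_simps)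
    qed
  qed fact
  then show ?thesis using that[OF n'(1), of l] n0[OF s(2)] unfolding V_def by blast
qed

lemma has_derivative_along_line:
  assumes "(F has_derivative F') (at (p + t *\<^sub>R v))"
  shows "((\<lambda>t. F (p + t *\<^sub>R v)) has_vector_derivative F' v) (at t)"
proof -
  have "((\<lambda>t. p + t *\<^sub>R v) has_vector_derivative v) (at t)"
    by (auto intro!: derivative_eq_intros simp: has_vector_derivative_def)
  from has_vector_derivative_compose[OF this assms] show ?thesis .
qed

lemma zero_velocity_constant:
  fixes c :: "real \<Rightarrow> 'b::real_normed_vector"
  assumes "\<And>t. t \<in> {0..1} \<Longrightarrow> (c has_vector_derivative 0) (at t within {0..1})"
  shows "\<exists>k. \<forall>t\<in>{0..1}. c t = k"
proof -
  obtain k where "\<And>t. t \<in> {0..1} \<Longrightarrow> c t = k"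
    by (rule has_vector_derivative_zero_constant[OF _ assms]) auto
  then show ?thesis by blast
qed

text \<open>
  On the hyperplane through p orthogonal to g, the derivative of F is lam times the identity, up to
  multiples of g. The component of F in a direction e is constant
  in every direction orthogonal to e, and its derivative in the direction e is lam. With two
  orthogonal directions available, lam is constant.
\<close>

lemma scalar_derivative_constant:
  fixes F :: "'b::euclidean_space \<Rightarrow> 'b"
  assumes dim: "DIM('b) \<ge> 3"
    and F: "\<And>x. x \<in> ball p r \<Longrightarrow> g \<bullet> (x - p) = 0 \<Longrightarrow> (F has_derivative F' x) (at x)"
    and F': "\<And>x v e. x \<in> ball p r \<Longrightarrow> g \<bullet> (x - p) = 0 \<Longrightarrow> g \<bullet> v = 0 \<Longrightarrow> g \<bullet> e = 0 \<Longrightarrow>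
      F' x v \<bullet> e = lam x * (v \<bullet> e)"
    and x: "x \<in> ball p r" "g \<bullet> (x - p) = 0"
  shows "lam x = lam p"
proof -
  define a where "a = x - p"
  have a: "g \<bullet> a = 0" "norm a < r" using x by (auto simp: a_def dist_norm norm_minus_commute)
  have "dim {g, a} \<le> card {g, a}" by (rule dim_le_card') simp
  also have "\<dots> \<le> 2" by (simp add: card_insert_if)
  finally have "dim {g, a} < DIM('b)" using dim by simp
  then obtain e where e: "e \<noteq> 0" "\<And>y. y \<in> span {g, a} \<Longrightarrow> orthogonal e y"
    using orthogonal_to_subspace_exists by blast
  have eg: "g \<bullet> e = 0" "a \<bullet> e = 0"
    using e(2)[of g] e(2)[of a] by (auto simp: orthogonal_def inner_commute span_base)
  define \<delta> where "\<delta> = (r - norm a) / (norm e + 1)"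
  have n1: "norm e + 1 > 0" using norm_ge_zero[of e] by (simp add: add_nonneg_pos)
  have \<delta>: "\<delta> > 0" using a(2) n1 by (simp add: \<delta>_def)
  have inb: "p + s *\<^sub>R a + t *\<^sub>R e \<in> ball p r" "g \<bullet> (p + s *\<^sub>R a + t *\<^sub>R e - p) = 0"
    if "0 \<le> s" "s \<le> 1" "\<bar>t\<bar> < \<delta>" for s t
  proof -
    have "norm (s *\<^sub>R a + t *\<^sub>R e) \<le> norm (s *\<^sub>R a) + norm (t *\<^sub>R e)" by (rule norm_triangle_ineq)
    also have "norm (s *\<^sub>R a) \<le> norm a" using that by (simp add: mult_left_le_one_le)
    also have "norm (t *\<^sub>R e) \<le> \<bar>t\<bar> * (norm e + 1)" by (simp add: distrib_left)
    also have "\<bar>t\<bar> * (norm e + 1) < \<delta> * (norm e + 1)" using that(3) n1 by (rule mult_strict_right_mono)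
    also have "\<dots> = r - norm a" using n1 by (simp add: \<delta>_def)
    finally have "norm (s *\<^sub>R a + t *\<^sub>R e) < r" by simp
    moreover have "dist p (p + v) = norm v" for v by (simp add: dist_norm)
    then have "dist p (p + s *\<^sub>R a + t *\<^sub>R e) = norm (s *\<^sub>R a + t *\<^sub>R e)" by (simp only: add.assoc)
    ultimately show "p + s *\<^sub>R a + t *\<^sub>R e \<in> ball p r" by simp
    show "g \<bullet> (p + s *\<^sub>R a + t *\<^sub>R e - p) = 0" using a(1) eg(1) by (simp add: inner_add_right)
  qed
  have const: "F (p + 1 *\<^sub>R a + t *\<^sub>R e) \<bullet> e = F (p + 0 *\<^sub>R a + t *\<^sub>R e) \<bullet> e" if t: "\<bar>t\<bar> < \<delta>" for t
  proof -
    have "\<exists>k. \<forall>s\<in>{0..1}. F (p + s *\<^sub>R a + t *\<^sub>R e) \<bullet> e = k"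
    proof (rule zero_velocity_constant)
      fix s :: real assume s: "s \<in> {0..1}"
      have i: "(p + t *\<^sub>R e) + s *\<^sub>R a \<in> ball p r" "g \<bullet> ((p + t *\<^sub>R e) + s *\<^sub>R a - p) = 0"
        using inb[of s t] s t by (simp_all add: add.commute add.left_commute)
      have "((\<lambda>s. F ((p + t *\<^sub>R e) + s *\<^sub>R a)) has_vector_derivative F' ((p + t *\<^sub>R e) + s *\<^sub>R a) a) (at s)"
        by (rule has_derivative_along_line[OF F[OF i]])
      from bounded_linear.has_vector_derivative[OF bounded_linear_inner_left[of e] this]
      have "((\<lambda>s. F ((p + t *\<^sub>R e) + s *\<^sub>R a) \<bullet> e) has_vector_derivative
          F' ((p + t *\<^sub>R e) + s *\<^sub>R a) a \<bullet> e) (at s)" .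
      moreover have "F' ((p + t *\<^sub>R e) + s *\<^sub>R a) a \<bullet> e = 0" using F'[OF i a(1) eg(1)] eg(2) by simp
      ultimately have "((\<lambda>s. F ((p + t *\<^sub>R e) + s *\<^sub>R a) \<bullet> e) has_vector_derivative 0) (at s)" by simp
      then have "((\<lambda>s. F (p + s *\<^sub>R a + t *\<^sub>R e) \<bullet> e) has_vector_derivative 0) (at s)"
        by (simp add: add.commute add.left_commute)
      then show "((\<lambda>s. F (p + s *\<^sub>R a + t *\<^sub>R e) \<bullet> e) has_vector_derivative 0) (at s within {0..1})"
        by (rule has_vector_derivative_at_within)
    qed
    then obtain k where "\<forall>s\<in>{0..1}. F (p + s *\<^sub>R a + t *\<^sub>R e) \<bullet> e = k" by blast
    then show ?thesis by (metis atLeastAtMost_iff order_refl zero_le_one)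
  qed
  have der: "((\<lambda>t. F (p + s *\<^sub>R a + t *\<^sub>R e) \<bullet> e) has_vector_derivative lam (p + s *\<^sub>R a) * (e \<bullet> e)) (at 0)"
    if s: "0 \<le> s" "s \<le> 1" for s
  proof -
    have i: "p + s *\<^sub>R a + 0 *\<^sub>R e \<in> ball p r" "g \<bullet> (p + s *\<^sub>R a + 0 *\<^sub>R e - p) = 0"
      using inb[of s 0] s \<delta> by auto
    from bounded_linear.has_vector_derivative[OF bounded_linear_inner_left[of e]
        has_derivative_along_line[OF F[OF i]]]
    show ?thesis using F'[OF i eg(1) eg(1)] by simp
  qed
  have "((\<lambda>t. F (p + 0 *\<^sub>R a + t *\<^sub>R e) \<bullet> e) has_vector_derivative lam (p + 1 *\<^sub>R a) * (e \<bullet> e)) (at 0)"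
    by (rule has_vector_derivative_transform_within_open[OF der[of 1], of "{-\<delta><..<\<delta>}"])
      (use \<delta> const in auto)
  from vector_derivative_unique_at[OF this der[of 0]]
  have "lam (p + a) * (e \<bullet> e) = lam p * (e \<bullet> e)" by simp
  then show ?thesis using e(1) by (simp add: a_def)
qed

text \<open>
  On an umbilical sheet, the Euclidean unit normal n and the position q satisfy that n - lam q is
  constant, so the sheet lies on the quadric with these data, and near p it fills that quadric.
\<close>

lemma umbilical_sheet_quadric:
  fixes f :: "'a::euclidean_space \<times> real \<Rightarrow> real"
  assumes dim: "DIM('a) \<ge> 2" and sh: "sheet L p U f"
    and um: "\<And>q. q \<in> U \<Longrightarrow> f q = 0 \<Longrightarrow> \<exists>\<nu> \<kappa>. umbilic_with_curvature L q \<nu> \<kappa>"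
  obtains \<alpha> b \<delta> W where "b \<bullet> b - 4 * \<alpha> * \<delta> > 0" "open W" "p \<in> W" "W \<subseteq> U"
    "\<And>q. q \<in> W \<Longrightarrow> f q = 0 \<longleftrightarrow> quadric \<alpha> b \<delta> q = 0"
proof -
  have s: "open U" "p \<in> U" "smooth_on U f" "\<And>q. q \<in> U \<Longrightarrow> frechet_derivative f (at q) \<noteq> (\<lambda>v. 0)"
    using sh unfolding sheet_def by blast+
  define n where "n = (\<lambda>q. inverse (norm (grad f q)) *\<^sub>R grad f q)"
  define g where "g = grad f p"
  have gi: "grad f q \<bullet> v = frechet_derivative f (at q) v" if "q \<in> U" for q v
    by (rule grad_inner[OF smooth_on_has_derivative[OF s(3) that]])
  have gnz: "grad f q \<noteq> 0" if "q \<in> U" for q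
  proof
    assume "grad f q = 0"
    then have "frechet_derivative f (at q) v = 0" for v using gi[OF that, of v] by simp
    then show False using s(4)[OF that] by blast
  qed
  have g0: "g \<noteq> 0" using gnz[OF s(2)] by (simp add: g_def)
  have fdp: "frechet_derivative f (at p) = (\<lambda>v. g \<bullet> v)" using gi[OF s(2)] by (auto simp: g_def)
  obtain e H where e: "e > 0" and openH: "\<And>T. open T \<Longrightarrow> T \<subseteq> ball p e \<Longrightarrow> open (H ` T)"
    and HU: "H ` ball p e \<subseteq> U" and Hp: "H p = p" and Hs: "smooth_on (ball p e) H"
    and fH: "\<And>x. x \<in> ball p e \<Longrightarrow> f (H x) = g \<bullet> (x - p)"
    and Hg: "\<And>x. x \<in> ball p e \<Longrightarrow> \<exists>\<tau>. H x = x + \<tau> *\<^sub>R g"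
    by (rule level_set_straightening[OF s(1-3) sheet_zero[OF sh] fdp g0]) blast
  define DH where "DH = (\<lambda>x. frechet_derivative H (at x))"
  have H': "(H has_derivative DH x) (at x)" if "x \<in> ball p e" for x
    unfolding DH_def by (rule smooth_on_has_derivative[OF Hs that])
  have DHe: "DH x v \<bullet> w = v \<bullet> w" if x: "x \<in> ball p e" and w: "g \<bullet> w = 0" for x v w
  proof -
    have "((\<lambda>x. H x \<bullet> w) has_derivative (\<lambda>v. DH x v \<bullet> w)) (at x)"
      by (rule has_derivative_inner_left[OF H'[OF x]])
    moreover have "((\<lambda>x. H x \<bullet> w) has_derivative (\<lambda>v. v \<bullet> w)) (at x)"
    proof (rule has_derivative_transform_within_open[OF _ open_ball x])
      show "((\<lambda>x. x \<bullet> w) has_derivative (\<lambda>v. v \<bullet> w)) (at x)"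
        by (rule has_derivative_inner_left[OF has_derivative_ident])
      show "z \<bullet> w = H z \<bullet> w" if "z \<in> ball p e" for z
        using Hg[OF that] w by (auto simp: inner_add_left)
    qed
    ultimately show ?thesis using has_derivative_unique by metis
  qed
  have DHt: "frechet_derivative f (at (H x)) (DH x v) = g \<bullet> v" if x: "x \<in> ball p e" for x v
  proof -
    have fHx: "(f has_derivative frechet_derivative f (at (H x))) (at (H x))"
      using smooth_on_has_derivative[OF s(3)] HU x by blast
    have "((\<lambda>x. f (H x)) has_derivative (\<lambda>v. frechet_derivative f (at (H x)) (DH x v))) (at x)"
      by (rule has_derivative_compose[OF H'[OF x] fHx])
    moreover have "((\<lambda>x. f (H x)) has_derivative (\<lambda>v. g \<bullet> v)) (at x)"
    proof (rule has_derivative_transform_within_open[OF _ open_ball x])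
      show "((\<lambda>x. g \<bullet> (x - p)) has_derivative (\<lambda>v. g \<bullet> v)) (at x)"
        by (auto intro!: derivative_eq_intros)
      show "g \<bullet> (z - p) = f (H z)" if "z \<in> ball p e" for z using fH[OF that] by simp
    qed
    ultimately show ?thesis using has_derivative_unique by metis
  qed
  have "\<exists>n' l. (n has_derivative n') (at q) \<and> (\<forall>v. frechet_derivative f (at q) v = 0 \<longrightarrow> n' v = l *\<^sub>R v)"
    if q: "q \<in> U" "f q = 0" for q
  proof -
    obtain \<nu> \<kappa> where "umbilic_with_curvature L q \<nu> \<kappa>" using um[OF q] by blast
    from umbilic_unit_normal_derivative[OF sheet_move[OF sh q] this]
    show ?thesis unfolding n_def by metis
  qed
  then obtain n' l where n': "\<And>q. q \<in> U \<Longrightarrow> f q = 0 \<Longrightarrow> (n has_derivative n' q) (at q)"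
    and l: "\<And>q v. q \<in> U \<Longrightarrow> f q = 0 \<Longrightarrow> frechet_derivative f (at q) v = 0 \<Longrightarrow> n' q v = l q *\<^sub>R v"
    by metis
  define F where "F = (\<lambda>x. n (H x))"
  define F' where "F' = (\<lambda>x v. n' (H x) (DH x v))"
  have disc: "H x \<in> U" "f (H x) = 0" if "x \<in> ball p e" "g \<bullet> (x - p) = 0" for x
    using HU fH that by auto
  have F: "(F has_derivative F' x) (at x)" if "x \<in> ball p e" "g \<bullet> (x - p) = 0" for x
    unfolding F_def F'_def by (rule has_derivative_compose[OF H'[OF that(1)] n'[OF disc[OF that]]])
  have F'l: "F' x v = l (H x) *\<^sub>R DH x v" if "x \<in> ball p e" "g \<bullet> (x - p) = 0" "g \<bullet> v = 0" for x v
    unfolding F'_def by (rule l[OF disc[OF that(1,2)]]) (simp add: DHt[OF that(1)] that(3))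
  define l0 where "l0 = l p"
  have lconst: "l (H x) = l0" if "x \<in> ball p e" "g \<bullet> (x - p) = 0" for x
  proof -
    have "l (H x) = l (H p)"
    proof (rule scalar_derivative_constant[where F = F and F' = F' and g = g and r = e and lam = "\<lambda>x. l (H x)"])
      show "DIM('a \<times> real) \<ge> 3" using dim by simp
      show "F' x v \<bullet> w = l (H x) * (v \<bullet> w)"
        if "x \<in> ball p e" "g \<bullet> (x - p) = 0" "g \<bullet> v = 0" "g \<bullet> w = 0" for x v w
        by (simp add: F'l[OF that(1-3)] DHe[OF that(1,4)])
    qed (use F that in auto)
    then show ?thesis by (simp add: l0_def Hp)
  qed
  define n0 where "n0 = n p"
  have normal: "n q \<bullet> v = 0 \<longleftrightarrow> frechet_derivative f (at q) v = 0" if "q \<in> U" for q v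
    using gnz[OF that] gi[OF that] by (simp add: n_def)
  have on_quadric: "l0 * ((H x - p) \<bullet> (H x - p)) + 2 * (n0 \<bullet> (H x - p)) = 0"
    if x: "x \<in> ball p e" "g \<bullet> (x - p) = 0" for x
  proof -
    define a where "a = x - p"
    have a: "g \<bullet> a = 0" "norm a < e" using x by (auto simp: a_def dist_norm norm_minus_commute)
    have i: "p + t *\<^sub>R a \<in> ball p e" "g \<bullet> (p + t *\<^sub>R a - p) = 0" if "t \<in> {0..1}" for t
    proof -
      have "norm (t *\<^sub>R a) \<le> norm a" using that by (simp add: mult_left_le_one_le)
      then show "p + t *\<^sub>R a \<in> ball p e" using a(2) by (simp add: dist_norm)
      show "g \<bullet> (p + t *\<^sub>R a - p) = 0" using a(1) by simp
    qed
    have cH: "((\<lambda>t. H (p + t *\<^sub>R a)) has_vector_derivative DH (p + t *\<^sub>R a) a) (at t)" if "t \<in> {0..1}" for t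
      by (rule has_derivative_along_line[OF H'[OF i(1)[OF that]]])
    have "\<exists>k. \<forall>t\<in>{0..1}. F (p + t *\<^sub>R a) - l0 *\<^sub>R H (p + t *\<^sub>R a) = k"
    proof (rule zero_velocity_constant)
      fix t :: real assume t: "t \<in> {0..1}"
      have "((\<lambda>t. F (p + t *\<^sub>R a)) has_vector_derivative F' (p + t *\<^sub>R a) a) (at t)"
        by (rule has_derivative_along_line[OF F[OF i[OF t]]])
      from has_vector_derivative_diff[OF this
          bounded_linear.has_vector_derivative[OF bounded_linear_scaleR_right[of l0] cH[OF t]]]
      have "((\<lambda>t. F (p + t *\<^sub>R a) - l0 *\<^sub>R H (p + t *\<^sub>R a)) has_vector_derivative 0) (at t)"
        using F'l[OF i[OF t] a(1)] lconst[OF i[OF t]] by simp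
      then show "((\<lambda>t. F (p + t *\<^sub>R a) - l0 *\<^sub>R H (p + t *\<^sub>R a)) has_vector_derivative 0) (at t within {0..1})"
        by (rule has_vector_derivative_at_within)
    qed
    then obtain k where k: "\<And>t. t \<in> {0..1} \<Longrightarrow> F (p + t *\<^sub>R a) - l0 *\<^sub>R H (p + t *\<^sub>R a) = k" by blast
    have k0: "k = n0 - l0 *\<^sub>R p" using k[of 0] by (simp add: F_def Hp n0_def)
    have "\<exists>k. \<forall>t\<in>{0..1}. l0 * ((H (p + t *\<^sub>R a) - p) \<bullet> (H (p + t *\<^sub>R a) - p)) + 2 * (n0 \<bullet> (H (p + t *\<^sub>R a) - p)) = k"
    proof (rule zero_velocity_constant)
      fix t :: real assume t: "t \<in> {0..1}"
      define q where "q = H (p + t *\<^sub>R a)"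
      define v where "v = DH (p + t *\<^sub>R a) a"
      define Q where "Q = (\<lambda>z. l0 * ((z - p) \<bullet> (z - p)) + 2 * (n0 \<bullet> (z - p)))"
      have "(Q has_derivative (\<lambda>w. 2 * ((l0 *\<^sub>R (q - p) + n0) \<bullet> w))) (at q)"
        unfolding Q_def by (auto intro!: derivative_eq_intros simp: inner_add_left inner_commute algebra_simps)
      from has_vector_derivative_compose[OF cH[OF t], of Q, folded q_def, OF this]
      have "((\<lambda>t. Q (H (p + t *\<^sub>R a))) has_vector_derivative 2 * ((l0 *\<^sub>R (q - p) + n0) \<bullet> v)) (at t)"
        unfolding v_def .
      moreover have "l0 *\<^sub>R (q - p) + n0 = n q"
      proof -
        have "n q - l0 *\<^sub>R q = n0 - l0 *\<^sub>R p" using k[OF t] k0 by (simp add: F_def q_def)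
        then show ?thesis by (simp add: algebra_simps)
      qed
      moreover have "n q \<bullet> v = 0"
        using normal[OF disc(1)[OF i[OF t]]] DHt[OF i(1)[OF t]] a(1) unfolding q_def v_def by simp
      ultimately have "((\<lambda>t. Q (H (p + t *\<^sub>R a))) has_vector_derivative 0) (at t)" by simp
      then show "((\<lambda>t. l0 * ((H (p + t *\<^sub>R a) - p) \<bullet> (H (p + t *\<^sub>R a) - p)) + 2 * (n0 \<bullet> (H (p + t *\<^sub>R a) - p)))
          has_vector_derivative 0) (at t within {0..1})"
        unfolding Q_def by (rule has_vector_derivative_at_within)
    qed
    then obtain k2 where k2: "\<And>t. t \<in> {0..1} \<Longrightarrow>
      l0 * ((H (p + t *\<^sub>R a) - p) \<bullet> (H (p + t *\<^sub>R a) - p)) + 2 * (n0 \<bullet> (H (p + t *\<^sub>R a) - p)) = k2" by blast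
    have "k2 = 0" using k2[of 0] by (simp add: Hp)
    then show ?thesis using k2[of 1] by (simp add: a_def)
  qed
  define \<alpha> where "\<alpha> = l0"
  define b where "b = 2 *\<^sub>R (n0 - l0 *\<^sub>R p)"
  define \<delta> where "\<delta> = l0 * (p \<bullet> p) - 2 * (n0 \<bullet> p)"
  have Q: "quadric \<alpha> b \<delta> q = l0 * ((q - p) \<bullet> (q - p)) + 2 * (n0 \<bullet> (q - p))" for q
    unfolding quadric_def \<alpha>_def b_def \<delta>_def
    by (simp add: inner_diff_left inner_diff_right inner_commute algebra_simps)
  have n01: "norm n0 = 1" unfolding n0_def n_def using gnz[OF s(2)] by simp
  have K: "b \<bullet> b - 4 * \<alpha> * \<delta> > 0"
  proof -
    have "(2 * \<alpha>) *\<^sub>R p + b = 2 *\<^sub>R n0" by (simp add: \<alpha>_def b_def algebra_simps)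
    then have "b \<bullet> b - 4 * \<alpha> * \<delta> = (2 *\<^sub>R n0) \<bullet> (2 *\<^sub>R n0)"
      using quadric_gradient_norm[of \<alpha> p b \<delta>] Q[of p] by simp
    also have "\<dots> = 4" using n01 by (simp add: dot_square_norm)
    finally show ?thesis by simp
  qed
  define \<eta> where "\<eta> = 1 / (\<bar>l0\<bar> + 1)"
  have \<eta>: "\<eta> > 0" by (simp add: \<eta>_def add_nonneg_pos)
  have "continuous_on (ball p e) H" by (rule Ck_on_continuous[OF smooth_onD[OF Hs]])
  then obtain d0 where d0: "d0 > 0" "\<And>x. x \<in> ball p e \<Longrightarrow> dist x p < d0 \<Longrightarrow> dist (H x) (H p) < \<eta>"
    unfolding continuous_on_iff using \<eta> e by (metis centre_in_ball)
  define d where "d = min d0 e"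
  have d: "d > 0" "ball p d \<subseteq> ball p e" using d0 e by (auto simp: d_def)
  have near: "norm (H x - p) < \<eta>" if "x \<in> ball p d" for x
    using d0(2)[of x] that Hp by (auto simp: d_def dist_norm norm_minus_commute)
  show ?thesis
  proof (rule that[OF K])
    show "open (H ` ball p d)" using openH[OF open_ball d(2)] .
    show "p \<in> H ` ball p d" using Hp d(1) by (metis centre_in_ball imageI)
    show "H ` ball p d \<subseteq> U" using HU d(2) by blast
    fix q assume "q \<in> H ` ball p d"
    then obtain x where x: "x \<in> ball p d" "q = H x" by blast
    then have xe: "x \<in> ball p e" using d(2) by blast
    show "f q = 0 \<longleftrightarrow> quadric \<alpha> b \<delta> q = 0"
    proof
      assume "f q = 0"
      then have "g \<bullet> (x - p) = 0" using fH[OF xe] x(2) by simp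
      then show "quadric \<alpha> b \<delta> q = 0" unfolding Q x(2) by (rule on_quadric[OF xe])
    next
      assume q0: "quadric \<alpha> b \<delta> q = 0"
      define x0 where "x0 = x - ((g \<bullet> (x - p)) / (g \<bullet> g)) *\<^sub>R g"
      have gx0: "g \<bullet> (x0 - p) = 0" using g0 by (simp add: x0_def inner_diff_right)
      have "(x - p) \<bullet> (x - p) = (x0 - p) \<bullet> (x0 - p) + ((g \<bullet> (x - p)) / (g \<bullet> g))\<^sup>2 * (g \<bullet> g)"
      proof -
        define m where "m = (g \<bullet> (x - p)) / (g \<bullet> g)"
        have "x - p = (x0 - p) + m *\<^sub>R g" by (simp add: x0_def m_def)
        then have "(x - p) \<bullet> (x - p) = ((x0 - p) + m *\<^sub>R g) \<bullet> ((x0 - p) + m *\<^sub>R g)" by (simp only:)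
        also have "\<dots> = (x0 - p) \<bullet> (x0 - p) + 2 * (m * (g \<bullet> (x0 - p))) + m\<^sup>2 * (g \<bullet> g)"
          unfolding inner_add_left inner_add_right
          by (simp add: inner_commute[of "x0 - p" g] power2_eq_square)
        finally show ?thesis using gx0 by (simp add: m_def)
      qed
      then have "(norm (x0 - p))\<^sup>2 \<le> (norm (x - p))\<^sup>2" by (simp add: power2_norm_eq_inner)
      then have "norm (x0 - p) \<le> norm (x - p)" by (rule power2_le_imp_le) simp
      then have x0: "x0 \<in> ball p d" using x(1) by (simp add: dist_norm norm_minus_commute)
      then have x0e: "x0 \<in> ball p e" using d(2) by blast
      define r where "r = H x0"
      obtain \<tau> \<tau>0 where \<tau>: "H x = x + \<tau> *\<^sub>R g" "H x0 = x0 + \<tau>0 *\<^sub>R g" using Hg[OF xe] Hg[OF x0e] by blast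
      define \<theta> where "\<theta> = \<tau> - \<tau>0 + (g \<bullet> (x - p)) / (g \<bullet> g)"
      have qr: "q - r = \<theta> *\<^sub>R g" unfolding r_def x(2) \<tau> by (simp add: \<theta>_def x0_def algebra_simps)
      have "quadric \<alpha> b \<delta> r = 0" unfolding Q r_def by (rule on_quadric[OF x0e gx0])
      then have "0 = quadric \<alpha> b \<delta> q - quadric \<alpha> b \<delta> r" using q0 by simp
      also have "\<dots> = (q - r) \<bullet> (l0 *\<^sub>R ((q - p) + (r - p)) + 2 *\<^sub>R n0)"
        unfolding Q by (simp add: inner_diff_left inner_diff_right inner_add_right inner_commute algebra_simps)
      also have "\<dots> = \<theta> * (l0 * (g \<bullet> ((q - p) + (r - p))) + 2 * (g \<bullet> n0))"
        unfolding qr by (simp add: inner_add_right algebra_simps)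
      finally have prod: "\<theta> * (l0 * (g \<bullet> ((q - p) + (r - p))) + 2 * (g \<bullet> n0)) = 0" by simp
      have gn: "g \<bullet> n0 = norm g"
        using g0 by (simp add: n0_def n_def g_def[symmetric] dot_square_norm power2_eq_square)
      have "\<bar>l0 * (g \<bullet> ((q - p) + (r - p)))\<bar> \<le> \<bar>l0\<bar> * (norm g * norm ((q - p) + (r - p)))"
        unfolding abs_mult by (intro mult_left_mono Cauchy_Schwarz_ineq2) simp
      also have "\<dots> \<le> \<bar>l0\<bar> * (norm g * (2 * \<eta>))"
        using near[OF x(1)] near[OF x0] norm_triangle_ineq[of "q - p" "r - p"] unfolding r_def x(2)
        by (intro mult_left_mono) auto
      also have "\<dots> = norm g * (2 * (\<bar>l0\<bar> / (\<bar>l0\<bar> + 1)))" by (simp add: \<eta>_def)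
      also have "\<dots> < norm g * 2"
        using g0 by (intro mult_strict_left_mono) (auto simp: divide_less_eq add_nonneg_pos)
      finally have "l0 * (g \<bullet> ((q - p) + (r - p))) + 2 * (g \<bullet> n0) \<noteq> 0" using gn by linarith
      then have "\<theta> = 0" using prod by simp
      then have "q = r" using qr by simp
      then show "f q = 0" using fH[OF x0e] gx0 by (simp add: r_def)
    qed
  qed
qed

lemma connected_locally_constant_predicate:
  assumes "connected S" "a \<in> S" "b \<in> S" "P a"
    and "\<And>x. x \<in> S \<Longrightarrow> \<exists>W. open W \<and> x \<in> W \<and> (\<forall>y\<in>S \<inter> W. P y = P x)"
  shows "P b"
proof -
  have "P a = P b"
  proof (rule connected_local_const[OF assms(1-3)], intro ballI)
    fix x assume "x \<in> S"
    then obtain W where "open W" "x \<in> W" "\<forall>y\<in>S \<inter> W. P y = P x" using assms(5) by blast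
    then show "eventually (\<lambda>y. P x = P y) (at x within S)"
      unfolding eventually_at_topological by blast
  qed
  then show ?thesis using assms(4) by simp
qed

lemma path_connected_subset_component:
  assumes "path_connected T" "T \<subseteq> S" "x \<in> T"
  shows "T \<subseteq> path_component_set S x"
  using path_component_maximal[OF assms(3,1,2)] .

text \<open>
  Moving along a leaf, the quadric that contains it near the current point does not change, so the
  leaf is an open part of the trace of one quadric on the half-space. At a point of that trace
  which is a limit of the leaf, a foliated chart shows that nearby points of the trace lie on one
  plaque of the leaf; so the leaf is also closed in the trace, which is connected.
\<close>

lemma umbilical_leaf_quadric:
  fixes L :: "('a::euclidean_space \<times> real) set"
  assumes dim: "DIM('a) \<ge> 2" and F: "codim1_foliation F" and LF: "L \<in> F" and um: "totally_umbilical L"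
    and p0: "p0 \<in> L"
  obtains \<alpha> b \<delta> where "b \<bullet> b - 4 * \<alpha> * \<delta> > 0" "L = {q \<in> half_space. quadric \<alpha> b \<delta> q = 0}"
proof -
  have LH: "L \<subseteq> half_space" and pcL: "path_connected L" and hyp: "\<And>p. p \<in> L \<Longrightarrow> \<exists>U f. sheet L p U f"
    using F LF um unfolding codim1_foliation_def totally_umbilical_def smooth_hypersurface_sheet by blast+
  define A where "A = (\<lambda>C :: real \<times> ('a \<times> real) \<times> real. fst C)"
  define B where "B = (\<lambda>C :: real \<times> ('a \<times> real) \<times> real. fst (snd C))"
  define D where "D = (\<lambda>C :: real \<times> ('a \<times> real) \<times> real. snd (snd C))"
  define good where "good = (\<lambda>p C W U f. B C \<bullet> B C - 4 * A C * D C > 0 \<and> sheet L p U f \<and> open W \<and> p \<in> W \<and> W \<subseteq> U \<and>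
      (\<forall>q\<in>W. f q = 0 \<longleftrightarrow> quadric (A C) (B C) (D C) q = 0))"
  have loc: "\<forall>p\<in>L. \<exists>T. good p (fst T) (fst (snd T)) (fst (snd (snd T))) (snd (snd (snd T)))"
  proof
    fix p assume p: "p \<in> L"
    obtain U f where sh: "sheet L p U f" using hyp[OF p] by blast
    have umU: "\<exists>\<nu> \<kappa>. umbilic_with_curvature L q \<nu> \<kappa>" if "q \<in> U" "f q = 0" for q
    proof -
      have "q \<in> L" using sheet_move[OF sh that] unfolding sheet_def by blast
      then show ?thesis using um unfolding totally_umbilical_def by blast
    qed
    obtain \<alpha> b \<delta> W where
      "b \<bullet> b - 4 * \<alpha> * \<delta> > 0" "open W" "p \<in> W" "W \<subseteq> U" "\<And>q. q \<in> W \<Longrightarrow> f q = 0 \<longleftrightarrow> quadric \<alpha> b \<delta> q = 0"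
      by (rule umbilical_sheet_quadric[OF dim sh]) ((erule (1) umU) | (rule that; assumption))+
    then show "\<exists>T. good p (fst T) (fst (snd T)) (fst (snd (snd T))) (snd (snd (snd T)))"
      using sh by (intro exI[of _ "((\<alpha>, b, \<delta>), W, U, f)"]) (simp add: good_def A_def B_def D_def)
  qed
  from bchoice[OF loc] obtain T where
    T: "\<forall>p\<in>L. good p (fst (T p)) (fst (snd (T p))) (fst (snd (snd (T p)))) (snd (snd (snd (T p))))" by blast
  define C where "C = (\<lambda>p. fst (T p))"
  define W where "W = (\<lambda>p. fst (snd (T p)))"
  define U where "U = (\<lambda>p. fst (snd (snd (T p))))"
  define f where "f = (\<lambda>p. snd (snd (snd (T p))))"
  have K: "B (C p) \<bullet> B (C p) - 4 * A (C p) * D (C p) > 0" and sh: "sheet L p (U p) (f p)"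
    and W: "open (W p)" "p \<in> W p" "W p \<subseteq> U p"
    and fq: "\<And>q. q \<in> W p \<Longrightarrow> f p q = 0 \<longleftrightarrow> quadric (A (C p)) (B (C p)) (D (C p)) q = 0" if "p \<in> L" for p
    using T[rule_format, OF that] unfolding good_def C_def W_def U_def f_def by blast+
  define Z where "Z = (\<lambda>p. {q. quadric (A (C p)) (B (C p)) (D (C p)) q = 0})"
  have pZ: "p \<in> Z p" if "p \<in> L" for p
    using fq[OF that W(2)[OF that]] sheet_zero[OF sh[OF that]] unfolding Z_def by blast
  have pcZ: "path_connected (Z p \<inter> ball q e)" if "p \<in> L" "e > 0" for p q e
  proof -
    have "Z p \<inter> ball q e = {x \<in> ball q e. quadric (A (C p)) (B (C p)) (D (C p)) x = 0}"
      unfolding Z_def by blast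
    then show ?thesis using path_connected_quadric_ball[OF DIM_half_space K[OF that(1)] that(2)] by simp
  qed
  have ZL: "Z p \<inter> W p \<subseteq> L" if "p \<in> L" for p
  proof
    fix q assume "q \<in> Z p \<inter> W p"
    then have "q \<in> U p" "f p q = 0" using fq[OF that] W(3)[OF that] unfolding Z_def by blast+
    then show "q \<in> L" using sheet_move[OF sh[OF that]] unfolding sheet_def by blast
  qed
  have step: "Z p' = Z p" if p: "p \<in> L" and p': "p' \<in> W p" "p' \<in> U p" "f p p' = 0" for p p'
  proof -
    have p'L: "p' \<in> L" using sheet_move[OF sh[OF p] p'(2,3)] unfolding sheet_def by blast
    have "open (W p \<inter> W p')" "p' \<in> W p \<inter> W p'" using W p p' p'L by blast+
    then obtain e where e: "e > 0" "ball p' e \<subseteq> W p \<inter> W p'" by (meson openE)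
    have "Z p' \<inter> ball p' e \<subseteq> L \<inter> U p" using ZL[OF p'L] e(2) W(3)[OF p] by blast
    then have "Z p' \<inter> ball p' e \<subseteq> path_component_set (L \<inter> U p) p'"
      using path_connected_subset_component[OF pcZ[OF p'L e(1)]] pZ[OF p'L] e(1) by auto
    then have "Z p' \<inter> ball p' e \<subseteq> {q \<in> U p. f p q = 0}"
      using sheet_move[OF sh[OF p] p'(2,3)] unfolding sheet_def by simp
    then have sub: "quadric (A (C p)) (B (C p)) (D (C p)) q = 0"
      if "q \<in> ball p' e" "quadric (A (C p')) (B (C p')) (D (C p')) q = 0" for q
      using that e(2) fq[OF p] unfolding Z_def by blast
    have z: "quadric (A (C p')) (B (C p')) (D (C p')) p' = 0" using pZ[OF p'L] unfolding Z_def by blast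
    have pb: "p' \<in> ball p' e" using e(1) by simp
    obtain k where k: "k \<noteq> 0" "A (C p) = k * A (C p')" "B (C p) = k *\<^sub>R B (C p')" "D (C p) = k * D (C p')"
      using quadric_germ_unique[OF DIM_half_space open_ball pb z K[OF p'L] K[OF p] sub] by metis
    have "quadric (A (C p)) (B (C p)) (D (C p)) q = k * quadric (A (C p')) (B (C p')) (D (C p')) q" for q
      unfolding quadric_def k by (simp add: algebra_simps)
    then show ?thesis using k(1) unfolding Z_def by auto
  qed
  have Zconst: "Z q = Z p0" if q: "q \<in> L" for q
  proof -
    obtain c where c: "path c" "path_image c \<subseteq> L" "pathstart c = p0" "pathfinish c = q"
      using pcL p0 q unfolding path_connected_def by blast
    have cont: "continuous_on {0..1} c" using c(1) by (simp add: path_def)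
    have "Z (c 1) = Z p0"
    proof (rule connected_locally_constant_predicate[where P = "\<lambda>t. Z (c t) = Z p0"])
      show "connected {0..1::real}" by simp
      show "Z (c 0) = Z p0" using c(3) by (simp add: pathstart_def)
      fix t :: real assume t: "t \<in> {0..1}"
      have ct: "c t \<in> L" using c(2) t by (auto simp: path_image_def)
      obtain T where T: "open T" "{s \<in> {0..1}. c s \<in> W (c t)} = {0..1} \<inter> T"
        using continuous_openin_preimage_gen[OF cont W(1)[OF ct]]
        unfolding openin_open vimage_def Int_def by auto
      have "t \<in> {0..1} \<inter> T" using T(2) t W(2)[OF ct] by blast
      then obtain r where r: "r > 0" "ball t r \<subseteq> T" using T(1) by (meson IntD2 openE)
      have eq: "Z (c s) = Z (c t)" if s: "s \<in> {0..1} \<inter> ball t r" for s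
      proof -
        have conv: "path_connected ({0..1} \<inter> ball t r)"
          by (intro convex_imp_path_connected convex_Int convex_ball) auto
        have sub: "c ` ({0..1} \<inter> ball t r) \<subseteq> L \<inter> W (c t)"
          using T(2) r(2) c(2) unfolding path_image_def by blast
        have "path_connected (c ` ({0..1} \<inter> ball t r))"
          by (rule path_connected_continuous_image[OF continuous_on_subset[OF cont] conv]) auto
        moreover have "c ` ({0..1} \<inter> ball t r) \<subseteq> L \<inter> U (c t)" using sub W(3)[OF ct] by blast
        moreover have "c t \<in> c ` ({0..1} \<inter> ball t r)" using t r(1) by (intro imageI) simp
        ultimately have "c ` ({0..1} \<inter> ball t r) \<subseteq> path_component_set (L \<inter> U (c t)) (c t)"
          by (rule path_connected_subset_component)
        then have "c s \<in> path_component_set (L \<inter> U (c t)) (c t)" using s by blast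
        then have "c s \<in> U (c t)" "f (c t) (c s) = 0" using sh[OF ct] unfolding sheet_def by blast+
        moreover have "c s \<in> W (c t)" using sub s by blast
        ultimately show ?thesis by (intro step[OF ct])
      qed
      then show "\<exists>W. open W \<and> t \<in> W \<and> (\<forall>s\<in>{0..1} \<inter> W. (Z (c s) = Z p0) = (Z (c t) = Z p0))"
        using r(1) by (intro exI[of _ "ball t r"]) simp
    qed auto
    then show ?thesis using c(4) by (simp add: pathfinish_def)
  qed
  let ?T = "{q \<in> half_space. quadric (A (C p0)) (B (C p0)) (D (C p0)) q = 0}"
  have LT: "L \<subseteq> ?T"
    using pZ Zconst LH unfolding Z_def by blast
  have openL: "Z p0 \<inter> W q \<subseteq> L" if "q \<in> L" for q using ZL[OF that] Zconst[OF that] by simp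
  have "q \<in> L" if q: "q \<in> ?T" for q
  proof (rule connected_locally_constant_predicate[where P = "\<lambda>q. q \<in> L" and S = ?T])
    show "connected ?T" by (rule path_connected_imp_connected[OF path_connected_quadric_leaf[OF K[OF p0]]])
    show "p0 \<in> ?T" "p0 \<in> L" using p0 LT by blast+
    fix x assume x: "x \<in> ?T"
    show "\<exists>W. open W \<and> x \<in> W \<and> (\<forall>y\<in>?T \<inter> W. (y \<in> L) = (x \<in> L))"
    proof (cases "x \<in> L")
      case True
      have "Z p0 \<inter> W x \<subseteq> L" by (rule openL[OF True])
      then have "\<forall>y\<in>?T \<inter> W x. y \<in> L" unfolding Z_def by blast
      then show ?thesis using W[OF True] True by blast
    next
      case False
      obtain V \<Phi> where V: "x \<in> V" "foliated_chart F V \<Phi>"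
        using F x unfolding codim1_foliation_def by blast
      have Vo: "open V"
        and plaque: "\<And>z. z \<in> L \<inter> V \<Longrightarrow> path_component_set (L \<inter> V) z = {y \<in> V. snd (\<Phi> y) = snd (\<Phi> z)}"
        using V(2) LF unfolding foliated_chart_def by blast+
      have "continuous_on V \<Phi>" using V(2) unfolding foliated_chart_def homeomorphism_def by blast
      then have contP: "continuous_on V (\<lambda>z. snd (\<Phi> z))" by (rule continuous_on_snd)
      obtain e where e: "e > 0" "ball x e \<subseteq> V" using Vo V(1) by (meson openE)
      have "y \<notin> L" if y: "y \<in> ?T \<inter> ball x e" for y
      proof
        assume yL: "y \<in> L"
        have yV: "y \<in> L \<inter> V" using yL y e(2) by blast
        have "snd (\<Phi> x) = snd (\<Phi> y)"
        proof (rule connected_locally_constant_predicate[where P = "\<lambda>z. snd (\<Phi> z) = snd (\<Phi> y)" and S = "Z p0 \<inter> ball x e"])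
          show "connected (Z p0 \<inter> ball x e)" by (rule path_connected_imp_connected[OF pcZ[OF p0 e(1)]])
          show "y \<in> Z p0 \<inter> ball x e" using y unfolding Z_def by blast
          show "x \<in> Z p0 \<inter> ball x e" using x e(1) unfolding Z_def by simp
          fix z assume z: "z \<in> Z p0 \<inter> ball x e"
          show "\<exists>W. open W \<and> z \<in> W \<and> (\<forall>w\<in>Z p0 \<inter> ball x e \<inter> W. (snd (\<Phi> w) = snd (\<Phi> y)) = (snd (\<Phi> z) = snd (\<Phi> y)))"
          proof (cases "snd (\<Phi> z) = snd (\<Phi> y)")
            case True
            have zV: "z \<in> V" using z e(2) by blast
            then have "z \<in> path_component_set (L \<inter> V) y" using plaque[OF yV] True by blast
            then have zL: "z \<in> L \<inter> V" using path_component_subset by blast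
            have "open (W z \<inter> V)" "z \<in> W z \<inter> V" using W zL Vo by blast+
            then obtain d where d: "d > 0" "ball z d \<subseteq> W z \<inter> V" by (meson openE)
            have "Z p0 \<inter> ball z d \<subseteq> L \<inter> V" using openL[of z] zL d(2) by blast
            moreover have "z \<in> Z p0 \<inter> ball z d" using z d(1) by simp
            ultimately have "Z p0 \<inter> ball z d \<subseteq> path_component_set (L \<inter> V) z"
              by (rule path_connected_subset_component[OF pcZ[OF p0 d(1)]])
            then have "\<forall>w\<in>Z p0 \<inter> ball z d. snd (\<Phi> w) = snd (\<Phi> z)" using plaque[OF zL] by blast
            then show ?thesis using True d(1) by (intro exI[of _ "ball z d"]) auto
          next
            case False
            have "open (V \<inter> (\<lambda>z. snd (\<Phi> z)) -` (- {snd (\<Phi> y)}))"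
              by (rule continuous_open_preimage[OF contP Vo open_Compl[OF closed_singleton]])
            moreover have "z \<in> V \<inter> (\<lambda>z. snd (\<Phi> z)) -` (- {snd (\<Phi> y)})" using z e(2) False by blast
            ultimately show ?thesis using False by blast
          qed
        qed simp
        then have "x \<in> path_component_set (L \<inter> V) y" using plaque[OF yV] V(1) by blast
        then show False using False path_component_subset by blast
      qed
      then show ?thesis using e(1) False by (intro exI[of _ "ball x e"]) auto
    qed
  qed fact
  then have "L = ?T" using LT by blast
  then show ?thesis using that[OF K[OF p0]] by blast
qed

lemma umbilical_foliation_leaf_quadric:
  fixes L :: "('a::euclidean_space \<times> real) set"
  assumes F: "totally_umbilical_foliation F" and L: "L \<in> F" "p \<in> L"
  obtains \<alpha> b \<delta> where "b \<bullet> b - 4 * \<alpha> * \<delta> > 0" "L = {q \<in> half_space. quadric \<alpha> b \<delta> q = 0}"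
proof (cases "DIM('a) = 1")
  case True
  then have "generalized_hypersphere L" using F L unfolding totally_umbilical_foliation_def by blast
  then show ?thesis using generalized_hypersphere_imp_quadric that by blast
next
  case False
  then have "DIM('a) \<ge> 2" using DIM_positive[where 'a='a] by linarith
  then show ?thesis
    using umbilical_leaf_quadric[of F L p] F L that unfolding totally_umbilical_foliation_def by blast
qed

text \<open>The leaf through a point of the curve is the hypersphere determined by the data there.\<close>

lemma umbilical_foliation_leaf:
  fixes L :: "('a::euclidean_space \<times> real) set"
  assumes F: "totally_umbilical_foliation F" and L: "L \<in> F" "p \<in> L"
    and um: "umbilic_with_curvature L p (- w) h"
  shows "L = {q \<in> half_space. hypersphere_eq p w h q = 0}"
proof -
  obtain \<alpha> b \<delta> where Q: "b \<bullet> b - 4 * \<alpha> * \<delta> > 0" "L = {q \<in> half_space. quadric \<alpha> b \<delta> q = 0}"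
    by (rule umbilical_foliation_leaf_quadric[OF F L])
  then have "p \<in> half_space" "quadric \<alpha> b \<delta> p = 0" using L(2) by blast+
  from quadric_leaf_equation[OF Q(1) this] um Q(2) show ?thesis by blast
qed

section \<open>Hypercycles\<close>

lemma linear_ode_solution:
  fixes M M1 :: "real \<Rightarrow> real"
  assumes s: "s > 0" and M: "\<And>t. (M has_real_derivative M1 t) (at t)"
    and M1: "\<And>t. (M1 has_real_derivative s\<^sup>2 * M t + k) (at t)"
  obtains a b where "\<And>t. M t = exp (s * t) * a + (1 / exp (s * t)) * b - k / s\<^sup>2"
proof -
  define f where "f = (\<lambda>t. (M1 t - s * (M t + k / s\<^sup>2)) * exp (s * t))"
  define g where "g = (\<lambda>t. (M1 t + s * (M t + k / s\<^sup>2)) * exp (- s * t))"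
  have "(f has_real_derivative 0) (at t)" for t
  proof -
    have "(f has_real_derivative ((s\<^sup>2 * M t + k) - s * M1 t) * exp (s * t)
        + (exp (s * t) * s) * (M1 t - s * (M t + k / s\<^sup>2))) (at t)"
      unfolding f_def by (rule derivative_eq_intros M M1 refl | simp)+
    moreover have "((s\<^sup>2 * M t + k) - s * M1 t) * exp (s * t)
        + (exp (s * t) * s) * (M1 t - s * (M t + k / s\<^sup>2)) = 0"
      using s by (simp add: field_simps power2_eq_square)
    ultimately show ?thesis by simp
  qed
  then have f: "f t = f 0" for t using DERIV_isconst_all by blast
  have "(g has_real_derivative 0) (at t)" for t
  proof -
    have "(g has_real_derivative ((s\<^sup>2 * M t + k) + s * M1 t) * exp (- s * t)
        + (exp (- s * t) * (- s)) * (M1 t + s * (M t + k / s\<^sup>2))) (at t)"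
      unfolding g_def by (rule derivative_eq_intros M M1 refl | simp)+
    moreover have "((s\<^sup>2 * M t + k) + s * M1 t) * exp (- s * t)
        + (exp (- s * t) * (- s)) * (M1 t + s * (M t + k / s\<^sup>2)) = 0"
      using s by (simp add: field_simps power2_eq_square)
    ultimately show ?thesis by simp
  qed
  then have g: "g t = g 0" for t using DERIV_isconst_all by blast
  have "M t = exp (s * t) * (g 0 / (2 * s)) + (1 / exp (s * t)) * (- f 0 / (2 * s)) - k / s\<^sup>2" for t
  proof -
    have "M1 t + s * (M t + k / s\<^sup>2) = g 0 * exp (s * t)"
      using g[of t] by (simp add: g_def exp_minus field_simps)
    moreover have "M1 t - s * (M t + k / s\<^sup>2) = f 0 / exp (s * t)"
      using f[of t] by (simp add: f_def field_simps)
    ultimately have "2 * s * (M t + k / s\<^sup>2) = g 0 * exp (s * t) - f 0 / exp (s * t)" by linarith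
    then have "M t + k / s\<^sup>2 = (g 0 * exp (s * t) - f 0 / exp (s * t)) / (2 * s)"
      using s by (simp add: field_simps)
    then show ?thesis using s by (simp add: diff_divide_distrib algebra_simps)
  qed
  then show ?thesis by (rule that)
qed

text \<open>
  Division by the height y turns the geodesic equation into a linear one with constant coefficients.
\<close>

lemma quotient_ode:
  fixes P P1 y y1 :: "real \<Rightarrow> real"
  assumes y: "\<And>t. y t > 0" "\<And>t. (y has_real_derivative y1 t) (at t)"
      "\<And>t. (y1 has_real_derivative k * y t * (2 * \<alpha> * y t + \<beta>) - y t + 2 * (y1 t)\<^sup>2 / y t) (at t)"
    and P: "\<And>t. (P has_real_derivative P1 t) (at t)"
      "\<And>t. (P1 has_real_derivative k * y t * (2 * \<alpha> * P t + e) + 2 * (y1 t / y t) * P1 t) (at t)"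
    and s: "s > 0" "1 - k * \<beta> = s\<^sup>2"
  obtains a b where "\<And>t. P t / y t = exp (s * t) * a + (1 / exp (s * t)) * b - k * e / s\<^sup>2"
proof (rule linear_ode_solution[OF s(1), of "\<lambda>t. P t / y t" "\<lambda>t. (P1 t * y t - P t * y1 t) / (y t)\<^sup>2" "k * e"])
  fix t
  have y0: "y t \<noteq> 0" using y(1)[of t] by simp
  show "((\<lambda>t. P t / y t) has_real_derivative (P1 t * y t - P t * y1 t) / (y t)\<^sup>2) (at t)"
    using DERIV_divide[OF P(1) y(2) y0] by (simp add: power2_eq_square)
  define P2 where "P2 = k * y t * (2 * \<alpha> * P t + e) + 2 * (y1 t / y t) * P1 t"
  define y2 where "y2 = k * y t * (2 * \<alpha> * y t + \<beta>) - y t + 2 * (y1 t)\<^sup>2 / y t"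
  have "((\<lambda>t. (P1 t * y t - P t * y1 t) / (y t)\<^sup>2) has_real_derivative
      ((P2 * y t - P t * y2) * (y t)\<^sup>2 - (P1 t * y t - P t * y1 t) * (2 * y t * y1 t)) / ((y t)\<^sup>2 * (y t)\<^sup>2)) (at t)"
  proof -
    have dP1: "(P1 has_real_derivative P2) (at t)" unfolding P2_def by (rule P(2))
    have dy1: "(y1 has_real_derivative y2) (at t)" unfolding y2_def by (rule y(3))
    have "(y t)\<^sup>2 \<noteq> 0" using y0 by simp
    from DERIV_divide[OF DERIV_diff[OF DERIV_mult[OF dP1 y(2)] DERIV_mult[OF P(1) dy1]] DERIV_power[OF y(2), of 2] this]
    show ?thesis by (rule DERIV_cong) (simp add: mult.commute add.commute mult.left_commute)
  qed
  moreover have "((P2 * y t - P t * y2) * (y t)\<^sup>2 - (P1 t * y t - P t * y1 t) * (2 * y t * y1 t)) / ((y t)\<^sup>2 * (y t)\<^sup>2)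
      = (1 - k * \<beta>) * (P t / y t) + k * e"
    using y0 unfolding P2_def y2_def by (simp add: divide_simps) (simp add: algebra_simps power2_eq_square power4_eq_xxxx)
  ultimately show "((\<lambda>t. (P1 t * y t - P t * y1 t) / (y t)\<^sup>2) has_real_derivative s\<^sup>2 * (P t / y t) + k * e) (at t)"
    unfolding s(2) by simp
qed (rule that)

text \<open>
  Coordinates of the hyperboloid model: they embed the half-space isometrically into a space with
  the Lorentz form, and motions of the half-space act on them by linear maps.
\<close>

definition lor :: "'a::euclidean_space \<times> real \<Rightarrow> real \<times> 'a \<times> real" where
  "lor p = (1 / snd p, (1 / snd p) *\<^sub>R fst p, (p \<bullet> p) / snd p)"

definition lform :: "real \<times> 'a::euclidean_space \<times> real \<Rightarrow> real \<times> 'a \<times> real \<Rightarrow> real" where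
  "lform X Y = fst (snd X) \<bullet> fst (snd Y) - (fst X * snd (snd Y) + snd (snd X) * fst Y) / 2"

lemma lform_lor: "snd p \<noteq> 0 \<Longrightarrow> lform (lor p) (lor p) = - 1"
  by (simp add: lform_def lor_def inner_prod_def field_simps)

lemma quartic_zero:
  fixes a b c d e :: real
  assumes "\<And>E. E > 0 \<Longrightarrow> a * E^4 + b * E^3 + c * E^2 + d * E + e = 0"
  shows "a = 0" "b = 0" "c = 0"
  using assms[of 1] assms[of 2] assms[of 3] assms[of 4] assms[of 5] by simp_all

lemma lform_expand:
  assumes "E \<noteq> 0"
  shows "E^2 * lform (E *\<^sub>R P + (1 / E) *\<^sub>R Q + R) (E *\<^sub>R P + (1 / E) *\<^sub>R Q + R) =
    lform P P * E^4 + 2 * lform P R * E^3 + (2 * lform P Q + lform R R) * E^2 + 2 * lform Q R * E + lform Q Q"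
  using assms unfolding lform_def
  by (simp add: inner_add_left inner_add_right inner_commute field_simps power2_eq_square power3_eq_cube
      power4_eq_xxxx)

text \<open>A curve of the hypercycle type, seen in the Lorentz space.\<close>

definition lor_hypercycle ::
  "real \<Rightarrow> (real \<Rightarrow> 'a::euclidean_space \<times> real) \<Rightarrow> real \<times> 'a \<times> real \<Rightarrow> real \<times> 'a \<times> real \<Rightarrow> real \<times> 'a \<times> real \<Rightarrow> bool" where
  "lor_hypercycle \<phi> \<gamma> P Q R \<longleftrightarrow> lform R R = (cos \<phi>)\<^sup>2 / (sin \<phi>)\<^sup>2 \<and>
     (\<forall>t. \<gamma> t \<in> half_space \<and>
       lor (\<gamma> t) = exp (sin \<phi> * t) *\<^sub>R P + (1 / exp (sin \<phi> * t)) *\<^sub>R Q + R)"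

text \<open>
  The Lorentz square of a point of the hyperboloid is - 1; compare the coefficients of the powers of
  exp (t sin \<phi>).
\<close>

lemma lor_hypercycle_relations:
  assumes "lor_hypercycle \<phi> \<gamma> P Q R" "sin \<phi> > 0"
  shows "lform P P = 0" "lform P R = 0" "2 * lform P Q = - 1 / (sin \<phi>)\<^sup>2"
proof -
  have *: "lform P P * E^4 + 2 * lform P R * E^3 + (2 * lform P Q + lform R R + 1) * E^2 + 2 * lform Q R * E + lform Q Q = 0"
    if "E > 0" for E
  proof -
    define t where "t = ln E / sin \<phi>"
    have E: "exp (sin \<phi> * t) = E" using that assms(2) by (simp add: t_def)
    have "\<gamma> t \<in> half_space" "lor (\<gamma> t) = E *\<^sub>R P + (1 / E) *\<^sub>R Q + R"
      using assms(1) E unfolding lor_hypercycle_def by metis+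
    then have "lform (E *\<^sub>R P + (1 / E) *\<^sub>R Q + R) (E *\<^sub>R P + (1 / E) *\<^sub>R Q + R) = - 1"
      using lform_lor[of "\<gamma> t"] half_space_pos[of "\<gamma> t"] by simp
    then show ?thesis using lform_expand[of E P Q R] that by (simp add: algebra_simps)
  qed
  note z = quartic_zero[OF *]
  show "lform P P = 0" "lform P R = 0" using z(1,2) by simp_all
  have "lform R R = (cos \<phi>)\<^sup>2 / (sin \<phi>)\<^sup>2" using assms(1) unfolding lor_hypercycle_def by blast
  then have "2 * lform P Q = - (1 + (cos \<phi>)\<^sup>2 / (sin \<phi>)\<^sup>2)" using z(3) by simp
  also have "1 + (cos \<phi>)\<^sup>2 / (sin \<phi>)\<^sup>2 = 1 / (sin \<phi>)\<^sup>2"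
    using assms(2) by (simp add: field_simps)
  finally show "2 * lform P Q = - 1 / (sin \<phi>)\<^sup>2" by simp
qed

lemma phi_hypersphere_quadric:
  assumes "phi_hypersphere \<phi> S"
  obtains \<alpha> b \<delta> where "b \<bullet> b - 4 * \<alpha> * \<delta> > 0" "S = {q \<in> half_space. quadric \<alpha> b \<delta> q = 0}"
    "(snd b)\<^sup>2 = (cos \<phi>)\<^sup>2 * (b \<bullet> b - 4 * \<alpha> * \<delta>)"
proof -
  have angle: "(snd v)\<^sup>2 = (cos \<phi>)\<^sup>2 * (v \<bullet> v)" if "hyperplane_angle v e_up = \<phi>" "v \<noteq> 0" for v :: "'a \<times> real"
  proof -
    have ve: "v \<bullet> e_up = snd v" by (simp add: inner_prod_def)
    have ne: "norm (e_up :: 'a \<times> real) = 1" by (simp add: norm_Pair)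
    have "\<bar>snd v\<bar> \<le> norm v" using Cauchy_Schwarz_ineq2[of v e_up] ve ne by simp
    then have "\<bar>snd v\<bar> / norm v \<le> 1" using that(2) by simp
    moreover have "- 1 \<le> \<bar>snd v\<bar> / norm v" by (rule order_trans[of _ 0]) auto
    ultimately have "cos \<phi> = \<bar>snd v\<bar> / norm v"
      using that(1) unfolding hyperplane_angle_def ve ne by (metis cos_arccos mult.right_neutral)
    then have "(cos \<phi>)\<^sup>2 = (snd v)\<^sup>2 / (v \<bullet> v)" by (simp add: power_divide dot_square_norm)
    then show ?thesis using that(2) by simp
  qed
  consider c r q where "0 < r" "q \<in> sphere c r" "snd q = 0" "S = sphere c r \<inter> half_space" "hyperplane_angle (q - c) e_up = \<phi>"
    | a d where "a \<noteq> 0" "S = {p. a \<bullet> p = d} \<inter> half_space" "hyperplane_angle a e_up = \<phi>"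
    using assms unfolding phi_hypersphere_def by blast
  then show ?thesis
  proof cases
    case 1
    have qc: "q - c \<noteq> 0" "(q - c) \<bullet> (q - c) = r\<^sup>2"
      using 1(1,2) by (auto simp: dist_norm norm_minus_commute dot_square_norm)
    have sc: "(snd c)\<^sup>2 = (cos \<phi>)\<^sup>2 * r\<^sup>2" using angle[OF 1(5) qc(1)] qc(2) 1(3) by simp
    note se = sphere_eq_quadric[OF 1(1), of c]
    show ?thesis
    proof (rule that)
      show "(- 2 *\<^sub>R c) \<bullet> (- 2 *\<^sub>R c) - 4 * 1 * (c \<bullet> c - r\<^sup>2) > 0" unfolding se(2) using 1(1) by simp
      show "S = {q \<in> half_space. quadric 1 (- 2 *\<^sub>R c) (c \<bullet> c - r\<^sup>2) q = 0}" unfolding 1(4) se(1) by blast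
      show "(snd (- 2 *\<^sub>R c))\<^sup>2 = (cos \<phi>)\<^sup>2 * ((- 2 *\<^sub>R c) \<bullet> (- 2 *\<^sub>R c) - 4 * 1 * (c \<bullet> c - r\<^sup>2))"
        unfolding se(2) using sc by (simp add: power_mult_distrib)
    qed
  next
    case 2
    show ?thesis
      by (rule that[of a 0 "- d"]) (use 2 angle[OF 2(3,1)] in \<open>auto simp: quadric_def\<close>)
  qed
qed

lemma smooth_curve_derivatives:
  fixes c :: "real \<Rightarrow> 'b::euclidean_space"
  assumes "smooth_on UNIV c"
  shows "(c has_vector_derivative velocity c t) (at t)"
    "(velocity c has_vector_derivative velocity (velocity c) t) (at t)"
proof -
  have "(c has_derivative frechet_derivative c (at t)) (at t)"
    by (rule smooth_on_has_derivative[OF assms UNIV_I])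
  then show "(c has_vector_derivative velocity c t) (at t)"
    unfolding velocity_def vector_derivative_works[symmetric] by (rule differentiableI)
  have "Ck_on (Suc 0) UNIV (velocity c)"
    by (rule Ck_on_real_vector_derivative[OF open_UNIV smooth_onD[OF assms]])
  then have "(velocity c has_derivative frechet_derivative (velocity c) (at t)) (at t)"
    by (rule Ck_on_has_derivative) simp
  then show "(velocity c has_vector_derivative velocity (velocity c) t) (at t)"
    unfolding velocity_def[of "velocity c"] vector_derivative_works[symmetric] by (rule differentiableI)
qed

text \<open>
  The geodesic equation of the hypersphere. The normal component of the acceleration is found by
  differentiating the equation of the hypersphere twice.
\<close>

lemma hypersphere_geodesic_acceleration:
  fixes \<gamma> :: "real \<Rightarrow> 'a::euclidean_space \<times> real"
  assumes K: "b \<bullet> b - 4 * \<alpha> * \<delta> > 0" and geo: "geodesic_line_on {q \<in> half_space. quadric \<alpha> b \<delta> q = 0} \<gamma>"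
  shows "velocity (velocity \<gamma>) t = (snd b / (b \<bullet> b - 4 * \<alpha> * \<delta>) * snd (\<gamma> t)) *\<^sub>R ((2 * \<alpha>) *\<^sub>R \<gamma> t + b)
      - (0, snd (\<gamma> t)) + (2 * snd (velocity \<gamma> t) / snd (\<gamma> t)) *\<^sub>R velocity \<gamma> t"
    and "velocity \<gamma> t \<bullet> velocity \<gamma> t = (snd (\<gamma> t))\<^sup>2"
proof -
  let ?S = "{q \<in> half_space. quadric \<alpha> b \<delta> q = 0}"
  define K where "K = b \<bullet> b - 4 * \<alpha> * \<delta>"
  define g where "g = (\<lambda>t. (2 * \<alpha>) *\<^sub>R \<gamma> t + b)"
  define y where "y = snd (\<gamma> t)"
  define a where "a = velocity (velocity \<gamma>) t"
  define v where "v = velocity \<gamma> t"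
  have smooth: "smooth_on UNIV \<gamma>" and inS: "\<And>t. \<gamma> t \<in> ?S"
    and unit: "\<And>t. hyp_inner (\<gamma> t) (velocity \<gamma> t) (velocity \<gamma> t) = 1"
    and tan: "\<And>t X. X \<in> tangent_vectors ?S (\<gamma> t) \<Longrightarrow> hyp_inner (\<gamma> t) (cov_acceleration \<gamma> t) X = 0"
    using geo unfolding geodesic_line_on_def by blast+
  have ypos: "snd (\<gamma> t) > 0" for t using inS half_space_pos by blast
  then have y: "y > 0" by (simp add: y_def)
  have zero: "quadric \<alpha> b \<delta> (\<gamma> t) = 0" for t using inS by blast
  note d1 = smooth_curve_derivatives(1)[OF smooth] and d2 = smooth_curve_derivatives(2)[OF smooth]
  show vv: "velocity \<gamma> t \<bullet> velocity \<gamma> t = (snd (\<gamma> t))\<^sup>2"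
    using unit[of t] ypos[of t] by (simp add: hyp_inner_def)
  have gg: "g t \<bullet> g t = K" using quadric_gradient_norm[of \<alpha> "\<gamma> t" b \<delta>] zero[of t] by (simp add: g_def K_def)
  have K0: "K > 0" using K by (simp add: K_def)
  have gv: "g t \<bullet> velocity \<gamma> t = 0" for t
  proof -
    have "((\<lambda>t. quadric \<alpha> b \<delta> (\<gamma> t)) has_vector_derivative ((2 * \<alpha>) *\<^sub>R \<gamma> t + b) \<bullet> velocity \<gamma> t) (at t)"
      by (rule has_vector_derivative_compose[OF d1 quadric_has_derivative])
    moreover have "((\<lambda>t. quadric \<alpha> b \<delta> (\<gamma> t)) has_vector_derivative 0) (at t)" by (simp add: zero)
    ultimately show ?thesis unfolding g_def using vector_derivative_unique_at by blast
  qed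
  have dg: "(g has_vector_derivative (2 * \<alpha>) *\<^sub>R v) (at t)"
  proof -
    have "(g has_vector_derivative ((2 * \<alpha>) *\<^sub>R v + 0)) (at t)"
      unfolding g_def v_def
      by (rule has_vector_derivative_add[OF bounded_linear.has_vector_derivative[OF bounded_linear_scaleR_right d1]
          has_vector_derivative_const])
    then show ?thesis by simp
  qed
  have ga: "(2 * \<alpha>) * y\<^sup>2 + g t \<bullet> a = 0"
  proof -
    have "((\<lambda>t. g t \<bullet> velocity \<gamma> t) has_vector_derivative (g t \<bullet> a + ((2 * \<alpha>) *\<^sub>R v) \<bullet> velocity \<gamma> t)) (at t)"
      unfolding a_def by (rule bounded_bilinear.has_vector_derivative[OF bounded_bilinear_inner dg d2])
    moreover have "((\<lambda>t. g t \<bullet> velocity \<gamma> t) has_vector_derivative 0) (at t)" by (simp add: gv)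
    ultimately have "g t \<bullet> a + ((2 * \<alpha>) *\<^sub>R v) \<bullet> velocity \<gamma> t = 0" using vector_derivative_unique_at by blast
    then show ?thesis using vv by (simp add: v_def y_def)
  qed
  have acc: "cov_acceleration \<gamma> t = a + (0, y) - (2 * snd v / y) *\<^sub>R v"
  proof -
    have "cov_acceleration \<gamma> t = a + (1 / y) *\<^sub>R (y\<^sup>2 *\<^sub>R e_up - snd v *\<^sub>R v - snd v *\<^sub>R v)"
      unfolding cov_acceleration_def hyp_Gamma_def vv a_def v_def y_def ..
    also have "(1 / y) *\<^sub>R (y\<^sup>2 *\<^sub>R e_up - snd v *\<^sub>R v - snd v *\<^sub>R v) = (0, y) - (2 * snd v / y) *\<^sub>R v"
      using y by (simp add: prod_eq_iff power2_eq_square field_simps)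
        (simp add: scaleR_diff_right scaleR_add_left[symmetric])
    finally show ?thesis by simp
  qed
  define A where "A = cov_acceleration \<gamma> t"
  obtain U where U: "sheet ?S (\<gamma> t) U (quadric \<alpha> b \<delta>)"
    using quadric_leaf_sheet[OF K] inS[of t] by blast
  have ort: "A \<bullet> X = 0" if "g t \<bullet> X = 0" for X
  proof -
    have "X \<in> tangent_vectors ?S (\<gamma> t)"
      unfolding sheet_tangent[OF U] frechet_derivative_quadric using that by (simp add: g_def)
    from tan[OF this] show ?thesis using ypos[of t] by (simp add: hyp_inner_def A_def)
  qed
  define k where "k = (A \<bullet> g t) / K"
  have Ak: "A = k *\<^sub>R g t"
  proof -
    have 1: "g t \<bullet> (A - k *\<^sub>R g t) = 0" using K0 gg by (simp add: k_def inner_diff_right inner_commute)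
    then have "(A - k *\<^sub>R g t) \<bullet> (A - k *\<^sub>R g t) = 0" using ort[OF 1] by (simp add: inner_diff_left)
    then show ?thesis by simp
  qed
  have "A \<bullet> g t = y * snd b"
  proof -
    have "A \<bullet> g t = a \<bullet> g t + y * snd (g t)"
      unfolding A_def acc using gv[of t]
      by (simp add: inner_add_left inner_diff_left v_def inner_commute[of "velocity \<gamma> t"] inner_prod_def[of "(0, y)"])
    also have "a \<bullet> g t = - (2 * \<alpha>) * y\<^sup>2" using ga by (simp add: inner_commute)
    finally show ?thesis by (simp add: g_def y_def power2_eq_square algebra_simps)
  qed
  then have k: "k = snd b / K * y" by (simp add: k_def)
  have "a = A - (0, y) + (2 * snd v / y) *\<^sub>R v" unfolding A_def acc by simp
  then show "velocity (velocity \<gamma>) t = (snd b / (b \<bullet> b - 4 * \<alpha> * \<delta>) * snd (\<gamma> t)) *\<^sub>R ((2 * \<alpha>) *\<^sub>R \<gamma> t + b)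
      - (0, snd (\<gamma> t)) + (2 * snd (velocity \<gamma> t) / snd (\<gamma> t)) *\<^sub>R velocity \<gamma> t"
    unfolding Ak k a_def v_def y_def K_def g_def .
qed

text \<open>
  Along a geodesic line of a hypersphere, each Lorentz coordinate solves the same linear equation of
  second order, whose characteristic exponents are \<plusminus> sin \<phi>.
\<close>

lemma phi_hypercycle_lor:
  fixes \<gamma> :: "real \<Rightarrow> 'a::euclidean_space \<times> real"
  assumes "phi_hypercycle \<phi> \<gamma>" "sin \<phi> > 0"
  obtains P Q R where "smooth_on UNIV \<gamma>" "\<And>t. hyp_inner (\<gamma> t) (velocity \<gamma> t) (velocity \<gamma> t) = 1"
    "lor_hypercycle \<phi> \<gamma> P Q R"
proof -
  obtain S where S: "phi_hypersphere \<phi> S" "geodesic_line_on S \<gamma>"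
    using assms(1) unfolding phi_hypercycle_def by blast
  obtain \<alpha> b \<delta> where K: "b \<bullet> b - 4 * \<alpha> * \<delta> > 0" and Sq: "S = {q \<in> half_space. quadric \<alpha> b \<delta> q = 0}"
    and sb: "(snd b)\<^sup>2 = (cos \<phi>)\<^sup>2 * (b \<bullet> b - 4 * \<alpha> * \<delta>)"
    by (rule phi_hypersphere_quadric[OF S(1)])
  define s where "s = sin \<phi>"
  define kap where "kap = snd b / (b \<bullet> b - 4 * \<alpha> * \<delta>)"
  have smooth: "smooth_on UNIV \<gamma>" and inS: "\<And>t. \<gamma> t \<in> S"
    and unit: "\<And>t. hyp_inner (\<gamma> t) (velocity \<gamma> t) (velocity \<gamma> t) = 1"
    using S(2) unfolding geodesic_line_on_def by blast+
  have inH: "\<gamma> t \<in> half_space" and zero: "quadric \<alpha> b \<delta> (\<gamma> t) = 0" for t using inS Sq by blast+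
  have ypos: "snd (\<gamma> t) > 0" for t by (rule half_space_pos[OF inH])
  define v where "v = velocity \<gamma>"
  define a where "a = velocity v"
  note geo = S(2)[unfolded Sq]
  have acc: "a t = (kap * snd (\<gamma> t)) *\<^sub>R ((2 * \<alpha>) *\<^sub>R \<gamma> t + b) - (0, snd (\<gamma> t)) + (2 * snd (v t) / snd (\<gamma> t)) *\<^sub>R v t" for t
    unfolding a_def v_def kap_def by (rule hypersphere_geodesic_acceleration(1)[OF K geo])
  have vv: "v t \<bullet> v t = (snd (\<gamma> t))\<^sup>2" for t
    unfolding v_def by (rule hypersphere_geodesic_acceleration(2)[OF K geo])
  have dg: "(\<gamma> has_vector_derivative v t) (at t)" and dv: "(v has_vector_derivative a t) (at t)" for t
    using smooth_curve_derivatives[OF smooth] unfolding v_def a_def by blast+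
  have dy: "((\<lambda>t. snd (\<gamma> t)) has_real_derivative snd (v t)) (at t)" for t
    unfolding has_real_derivative_iff_has_vector_derivative
    by (rule bounded_linear.has_vector_derivative[OF bounded_linear_snd dg])
  have dy1: "((\<lambda>t. snd (v t)) has_real_derivative
      kap * snd (\<gamma> t) * (2 * \<alpha> * snd (\<gamma> t) + snd b) - snd (\<gamma> t) + 2 * (snd (v t))\<^sup>2 / snd (\<gamma> t)) (at t)" for t
  proof -
    have "((\<lambda>t. snd (v t)) has_real_derivative snd (a t)) (at t)"
      unfolding has_real_derivative_iff_has_vector_derivative
      by (rule bounded_linear.has_vector_derivative[OF bounded_linear_snd dv])
    then show ?thesis by (rule DERIV_cong) (simp add: acc power2_eq_square)
  qed
  have kb: "1 - kap * snd b = s\<^sup>2"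
  proof -
    have "kap * snd b = (snd b)\<^sup>2 / (b \<bullet> b - 4 * \<alpha> * \<delta>)" by (simp add: kap_def power2_eq_square)
    also have "\<dots> = (cos \<phi>)\<^sup>2" unfolding sb using K by simp
    finally show ?thesis by (simp add: s_def cos_squared_eq)
  qed
  have s: "s > 0" using assms(2) by (simp add: s_def)
  have test: "\<exists>c d. \<forall>t. quadric A (\<beta>, 0) C (\<gamma> t) / snd (\<gamma> t) = exp (s * t) * c + (1 / exp (s * t)) * d
      - kap * (\<beta> \<bullet> fst b - 2 * \<alpha> * C - 2 * A * \<delta>) / s\<^sup>2" for A C \<beta>
  proof -
    define e where "e = \<beta> \<bullet> fst b - 2 * \<alpha> * C - 2 * A * \<delta>"
    define P where "P = (\<lambda>t. quadric A (\<beta>, 0) C (\<gamma> t))"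
    define g where "g = (\<lambda>t. (2 * A) *\<^sub>R \<gamma> t + (\<beta>, 0))"
    define P1 where "P1 = (\<lambda>t. g t \<bullet> v t)"
    have dP: "(P has_real_derivative P1 t) (at t)" for t
      unfolding has_real_derivative_iff_has_vector_derivative P_def P1_def g_def
      by (rule has_vector_derivative_compose[OF dg quadric_has_derivative])
    have dgr: "(g has_vector_derivative (2 * A) *\<^sub>R v t) (at t)" for t
    proof -
      have "(g has_vector_derivative ((2 * A) *\<^sub>R v t + 0)) (at t)"
        unfolding g_def
        by (rule has_vector_derivative_add[OF bounded_linear.has_vector_derivative[OF bounded_linear_scaleR_right dg]
            has_vector_derivative_const])
      then show ?thesis by simp
    qed
    have dP1: "(P1 has_real_derivative kap * snd (\<gamma> t) * (2 * \<alpha> * P t + e) + 2 * (snd (v t) / snd (\<gamma> t)) * P1 t) (at t)" for t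
    proof -
      define y where "y = snd (\<gamma> t)"
      have y: "y > 0" using ypos by (simp add: y_def)
      have "(P1 has_real_derivative (g t \<bullet> a t + ((2 * A) *\<^sub>R v t) \<bullet> v t)) (at t)"
        unfolding has_real_derivative_iff_has_vector_derivative P1_def
        by (rule bounded_bilinear.has_vector_derivative[OF bounded_bilinear_inner dgr dv])
      moreover have "g t \<bullet> a t + ((2 * A) *\<^sub>R v t) \<bullet> v t
          = kap * y * (2 * \<alpha> * P t + e) + 2 * (snd (v t) / y) * P1 t"
      proof -
        have "g t \<bullet> ((2 * \<alpha>) *\<^sub>R \<gamma> t + b) = 2 * \<alpha> * P t + e"
        proof -
          have z: "b \<bullet> \<gamma> t = - \<alpha> * (\<gamma> t \<bullet> \<gamma> t) - \<delta>" using zero[of t] unfolding quadric_def by linarith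
          have "g t \<bullet> ((2 * \<alpha>) *\<^sub>R \<gamma> t + b) = 4 * A * \<alpha> * (\<gamma> t \<bullet> \<gamma> t) + 2 * A * (b \<bullet> \<gamma> t)
              + 2 * \<alpha> * ((\<beta>, 0) \<bullet> \<gamma> t) + (\<beta>, 0) \<bullet> b"
            by (simp add: g_def inner_add_left inner_add_right inner_commute algebra_simps)
          also have "(\<beta>, 0) \<bullet> b = \<beta> \<bullet> fst b" by (simp add: inner_prod_def)
          finally show ?thesis unfolding z e_def P_def quadric_def by (simp add: algebra_simps)
        qed
        moreover have "g t \<bullet> (0, y) = 2 * A * y\<^sup>2"
          by (simp add: g_def inner_prod_def y_def power2_eq_square)
        moreover have "g t \<bullet> a t = kap * y * (g t \<bullet> ((2 * \<alpha>) *\<^sub>R \<gamma> t + b)) - g t \<bullet> (0, y) + (2 * snd (v t) / y) * P1 t"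
          unfolding acc y_def[symmetric] P1_def by (simp only: inner_add_right inner_diff_right inner_scaleR_right)
        moreover have "((2 * A) *\<^sub>R v t) \<bullet> v t = 2 * A * y\<^sup>2" using vv by (simp add: y_def)
        ultimately show ?thesis by simp
      qed
      ultimately show ?thesis unfolding y_def by simp
    qed
    obtain c d where "\<And>t. P t / snd (\<gamma> t) = exp (s * t) * c + (1 / exp (s * t)) * d - kap * e / s\<^sup>2"
      by (rule quotient_ode[OF ypos dy dy1 dP dP1 s kb]) blast
    then show ?thesis unfolding P_def e_def by blast
  qed
  obtain u1 u2 where u: "\<And>t. quadric 0 (0, 0) 1 (\<gamma> t) / snd (\<gamma> t) = exp (s * t) * u1 + (1 / exp (s * t)) * u2
      - kap * (0 \<bullet> fst b - 2 * \<alpha> * 1 - 2 * 0 * \<delta>) / s\<^sup>2" using test by blast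
  obtain w1 w2 where w: "\<And>t. quadric 1 (0, 0) 0 (\<gamma> t) / snd (\<gamma> t) = exp (s * t) * w1 + (1 / exp (s * t)) * w2
      - kap * (0 \<bullet> fst b - 2 * \<alpha> * 0 - 2 * 1 * \<delta>) / s\<^sup>2" using test by blast
  have "\<forall>i. \<exists>cd. \<forall>t. quadric 0 (i, 0) 0 (\<gamma> t) / snd (\<gamma> t) = exp (s * t) * fst cd + (1 / exp (s * t)) * snd cd
      - kap * (i \<bullet> fst b - 2 * \<alpha> * 0 - 2 * 0 * \<delta>) / s\<^sup>2"
  proof
    fix i
    obtain c d where "\<forall>t. quadric 0 (i, 0) 0 (\<gamma> t) / snd (\<gamma> t) = exp (s * t) * c + (1 / exp (s * t)) * d
      - kap * (i \<bullet> fst b - 2 * \<alpha> * 0 - 2 * 0 * \<delta>) / s\<^sup>2" using test by blast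
    then show "\<exists>cd. \<forall>t. quadric 0 (i, 0) 0 (\<gamma> t) / snd (\<gamma> t) = exp (s * t) * fst cd + (1 / exp (s * t)) * snd cd
      - kap * (i \<bullet> fst b - 2 * \<alpha> * 0 - 2 * 0 * \<delta>) / s\<^sup>2" by (intro exI[of _ "(c, d)"]) simp
  qed
  from choice[OF this] obtain cd where v: "\<And>i t. quadric 0 (i, 0) 0 (\<gamma> t) / snd (\<gamma> t)
      = exp (s * t) * fst (cd i) + (1 / exp (s * t)) * snd (cd i) - kap * (i \<bullet> fst b - 2 * \<alpha> * 0 - 2 * 0 * \<delta>) / s\<^sup>2"
    by blast
  define P where "P = (u1, (\<Sum>i\<in>Basis. fst (cd i) *\<^sub>R i), w1)"
  define Q where "Q = (u2, (\<Sum>i\<in>Basis. snd (cd i) *\<^sub>R i), w2)"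
  define R where "R = (2 * \<alpha> * kap / s\<^sup>2, - ((kap / s\<^sup>2) *\<^sub>R fst b), 2 * \<delta> * kap / s\<^sup>2)"
  have "lor_hypercycle \<phi> \<gamma> P Q R"
    unfolding lor_hypercycle_def s_def[symmetric]
  proof (intro conjI allI)
    have fb: "fst b \<bullet> fst b - 4 * \<alpha> * \<delta> = (b \<bullet> b - 4 * \<alpha> * \<delta>) * s\<^sup>2"
    proof -
      have "fst b \<bullet> fst b - 4 * \<alpha> * \<delta> = (b \<bullet> b - 4 * \<alpha> * \<delta>) - (snd b)\<^sup>2"
        by (simp add: inner_prod_def[of b b] power2_eq_square)
      then show ?thesis unfolding sb s_def by (simp add: sin_squared_eq algebra_simps)
    qed
    have "lform R R = (kap / s\<^sup>2)\<^sup>2 * (fst b \<bullet> fst b - 4 * \<alpha> * \<delta>)"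
      unfolding lform_def R_def using s by (simp add: field_simps power2_eq_square)
    also have "\<dots> = kap\<^sup>2 * (b \<bullet> b - 4 * \<alpha> * \<delta>) / s\<^sup>2"
      unfolding fb using s by (simp add: field_simps power2_eq_square)
    also have "kap\<^sup>2 * (b \<bullet> b - 4 * \<alpha> * \<delta>) = (cos \<phi>)\<^sup>2"
      unfolding kap_def power_divide sb using K by (simp add: power2_eq_square)
    finally show "lform R R = (cos \<phi>)\<^sup>2 / s\<^sup>2" .
    fix t
    show "\<gamma> t \<in> half_space" by (rule inH)
    have 1: "1 / snd (\<gamma> t) = exp (s * t) * u1 + (1 / exp (s * t)) * u2 + 2 * \<alpha> * kap / s\<^sup>2"
      using u[of t] by (simp add: quadric_def zero_prod_def[symmetric])
    have 3: "(\<gamma> t \<bullet> \<gamma> t) / snd (\<gamma> t) = exp (s * t) * w1 + (1 / exp (s * t)) * w2 + 2 * \<delta> * kap / s\<^sup>2"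
      using w[of t] by (simp add: quadric_def zero_prod_def[symmetric])
    have 2: "(1 / snd (\<gamma> t)) *\<^sub>R fst (\<gamma> t) = exp (s * t) *\<^sub>R (\<Sum>i\<in>Basis. fst (cd i) *\<^sub>R i)
        + (1 / exp (s * t)) *\<^sub>R (\<Sum>i\<in>Basis. snd (cd i) *\<^sub>R i) + - ((kap / s\<^sup>2) *\<^sub>R fst b)"
    proof (rule euclidean_eqI)
      fix i :: 'a assume i: "i \<in> Basis"
      have "(1 / snd (\<gamma> t)) *\<^sub>R fst (\<gamma> t) \<bullet> i = quadric 0 (i, 0) 0 (\<gamma> t) / snd (\<gamma> t)"
        by (simp add: quadric_def inner_prod_def inner_commute)
      also have "\<dots> = exp (s * t) * fst (cd i) + (1 / exp (s * t)) * snd (cd i) - kap * (i \<bullet> fst b) / s\<^sup>2"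
        using v[of i t] by simp
      finally show "(1 / snd (\<gamma> t)) *\<^sub>R fst (\<gamma> t) \<bullet> i = (exp (s * t) *\<^sub>R (\<Sum>i\<in>Basis. fst (cd i) *\<^sub>R i)
        + (1 / exp (s * t)) *\<^sub>R (\<Sum>i\<in>Basis. snd (cd i) *\<^sub>R i) + - ((kap / s\<^sup>2) *\<^sub>R fst b)) \<bullet> i"
        using i by (simp add: inner_add_left inner_diff_left inner_commute[of "fst b"])
    qed
    show "lor (\<gamma> t) = exp (s * t) *\<^sub>R P + (1 / exp (s * t)) *\<^sub>R Q + R"
    proof (intro prod_eqI)
      show "fst (lor (\<gamma> t)) = fst (exp (s * t) *\<^sub>R P + (1 / exp (s * t)) *\<^sub>R Q + R)"
        using 1 by (simp add: lor_def P_def Q_def R_def)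
      show "fst (snd (lor (\<gamma> t))) = fst (snd (exp (s * t) *\<^sub>R P + (1 / exp (s * t)) *\<^sub>R Q + R))"
        using 2 by (simp add: lor_def P_def Q_def R_def)
      show "snd (snd (lor (\<gamma> t))) = snd (snd (exp (s * t) *\<^sub>R P + (1 / exp (s * t)) *\<^sub>R Q + R))"
        using 3 by (simp add: lor_def P_def Q_def R_def)
    qed
  qed
  then show ?thesis using that[OF smooth unit] by blast
qed

section \<open>Motions of the half-space\<close>

text \<open>
  The hyperbolic cosine of the distance, minus 1.
\<close>

definition hdist :: "'a::euclidean_space \<times> real \<Rightarrow> 'a \<times> real \<Rightarrow> real" where
  "hdist p q = ((p - q) \<bullet> (p - q)) / (2 * snd p * snd q)"

definition qc :: "real \<times> ('a::euclidean_space \<times> real) \<times> real \<Rightarrow> 'a \<times> real \<Rightarrow> real" where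
  "qc C = quadric (fst C) (fst (snd C)) (snd (snd C))"

definition spacelike_coeffs :: "real \<times> ('a::euclidean_space \<times> real) \<times> real \<Rightarrow> bool" where
  "spacelike_coeffs C \<longleftrightarrow> spacelike (fst C) (fst (snd C)) (snd (snd C))"

text \<open>
  An isometry, together with its action M on coefficients of quadrics. The positive factor k keeps the two
  sides of a hypersphere apart.
\<close>

definition motion :: "('a::euclidean_space \<times> real \<Rightarrow> 'a \<times> real) \<Rightarrow> bool" where
  "motion T \<longleftrightarrow> bij_betw T half_space half_space \<and>
     (\<forall>p\<in>half_space. \<forall>q\<in>half_space. hdist (T p) (T q) = hdist p q) \<and>
     (\<exists>M. continuous_on UNIV M \<and> (\<forall>C. spacelike_coeffs C \<longrightarrow> spacelike_coeffs (M C) \<and>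
        (\<forall>q\<in>half_space. \<exists>k>0. qc C (T q) = k * qc (M C) q)))"

lemma motion_compose:
  assumes S: "motion S" and T: "motion T"
  shows "motion (\<lambda>q. S (T q))"
proof -
  have b: "bij_betw T half_space half_space" "bij_betw S half_space half_space"
    using S T unfolding motion_def by blast+
  have TH: "T q \<in> half_space" if "q \<in> half_space" for q using b(1) that by (rule bij_betw_apply)
  obtain M where M: "continuous_on UNIV M" "\<And>C. spacelike_coeffs C \<Longrightarrow> spacelike_coeffs (M C)"
    "\<And>C q. spacelike_coeffs C \<Longrightarrow> q \<in> half_space \<Longrightarrow> \<exists>k>0. qc C (S q) = k * qc (M C) q"
    using S unfolding motion_def by blast
  obtain N where N: "continuous_on UNIV N" "\<And>C. spacelike_coeffs C \<Longrightarrow> spacelike_coeffs (N C)"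
    "\<And>C q. spacelike_coeffs C \<Longrightarrow> q \<in> half_space \<Longrightarrow> \<exists>k>0. qc C (T q) = k * qc (N C) q"
    using T unfolding motion_def by blast
  show ?thesis unfolding motion_def
  proof (intro conjI ballI exI[of _ "\<lambda>C. N (M C)"] allI impI)
    show "bij_betw (\<lambda>q. S (T q)) half_space half_space"
      using bij_betw_trans[OF b] by (simp add: comp_def)
    show "hdist (S (T p)) (S (T q)) = hdist p q" if "p \<in> half_space" "q \<in> half_space" for p q
      using S T TH that unfolding motion_def by simp
    show "continuous_on UNIV (\<lambda>C. N (M C))"
      by (rule continuous_on_compose2[OF N(1) M(1)]) simp
    fix C :: "real \<times> ('a \<times> real) \<times> real" assume C: "spacelike_coeffs C"
    show "spacelike_coeffs (N (M C))" using M(2) N(2) C by blast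
    fix q :: "'a \<times> real" assume q: "q \<in> half_space"
    obtain k l where "k > 0" "qc C (S (T q)) = k * qc (M C) (T q)" "l > 0" "qc (M C) (T q) = l * qc (N (M C)) q"
      using M(3)[OF C TH[OF q]] N(3)[OF M(2)[OF C] q] by blast
    then show "\<exists>k>0. qc C (S (T q)) = k * qc (N (M C)) q" by (intro exI[of _ "k * l"]) simp
  qed
qed

lemma motion_translation: "motion (\<lambda>q :: 'a::euclidean_space \<times> real. q - (z, 0))"
  unfolding motion_def
proof (intro conjI ballI exI[of _ "\<lambda>C. (fst C, fst (snd C) - (2 * fst C) *\<^sub>R (z, 0),
    fst C * (z \<bullet> z) - fst (fst (snd C)) \<bullet> z + snd (snd C))"] allI impI)
  show "bij_betw (\<lambda>q :: 'a \<times> real. q - (z, 0)) half_space half_space"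
    by (rule bij_betw_byWitness[where f' = "\<lambda>q. q + (z, 0)"]) (auto simp: half_space_def)
  show "hdist (p - (z, 0)) (q - (z, 0)) = hdist p q" for p q :: "'a \<times> real" by (simp add: hdist_def)
  show "continuous_on UNIV (\<lambda>C :: real \<times> ('a \<times> real) \<times> real. (fst C, fst (snd C) - (2 * fst C) *\<^sub>R (z, 0::real),
    fst C * (z \<bullet> z) - fst (fst (snd C)) \<bullet> z + snd (snd C)))" by (intro continuous_intros)
  fix C :: "real \<times> ('a \<times> real) \<times> real" assume C: "spacelike_coeffs C"
  obtain \<alpha> b \<delta> where Ceq: "C = (\<alpha>, b, \<delta>)" by (cases C)
  show "spacelike_coeffs (fst C, fst (snd C) - (2 * fst C) *\<^sub>R (z, 0),
    fst C * (z \<bullet> z) - fst (fst (snd C)) \<bullet> z + snd (snd C))"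
  proof -
    have "(\<alpha>, b - (2 * \<alpha>) *\<^sub>R (z, 0), \<alpha> * (z \<bullet> z) - fst b \<bullet> z + \<delta>) \<noteq> (0, 0, 0)"
    proof
      assume e: "(\<alpha>, b - (2 * \<alpha>) *\<^sub>R (z, 0), \<alpha> * (z \<bullet> z) - fst b \<bullet> z + \<delta>) = (0, 0, 0)"
      then have 1: "\<alpha> = 0" and 2: "b - (2 * \<alpha>) *\<^sub>R (z, 0) = 0" and 3: "\<alpha> * (z \<bullet> z) - fst b \<bullet> z + \<delta> = 0"
        unfolding prod.inject by blast+
      have "b = (2 * \<alpha>) *\<^sub>R (z, 0)" using 2 by simp
      then have "b = 0" by (simp add: 1 zero_prod_def)
      moreover from this have "\<delta> = 0" using 3 by (simp add: 1)
      ultimately show False using C 1 unfolding Ceq spacelike_coeffs_def spacelike_def by simp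
    qed
    moreover have "fst (b - (2 * \<alpha>) *\<^sub>R (z, 0)) \<bullet> fst (b - (2 * \<alpha>) *\<^sub>R (z, 0::real)) - 4 * \<alpha> * (\<alpha> * (z \<bullet> z) - fst b \<bullet> z + \<delta>)
        = fst b \<bullet> fst b - 4 * \<alpha> * \<delta>"
      by (simp add: inner_diff_left inner_diff_right inner_commute algebra_simps)
    ultimately show ?thesis using C unfolding Ceq spacelike_coeffs_def spacelike_def fst_conv snd_conv by simp
  qed
  fix q :: "'a \<times> real"
  have "qc C (q - (z, 0)) = 1 * qc (fst C, fst (snd C) - (2 * fst C) *\<^sub>R (z, 0),
    fst C * (z \<bullet> z) - fst (fst (snd C)) \<bullet> z + snd (snd C)) q"
    unfolding Ceq qc_def quadric_def fst_conv snd_conv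
    by (simp add: inner_prod_def inner_diff_left inner_diff_right inner_commute algebra_simps)
  then show "\<exists>k>0. qc C (q - (z, 0)) = k * qc (fst C, fst (snd C) - (2 * fst C) *\<^sub>R (z, 0),
    fst C * (z \<bullet> z) - fst (fst (snd C)) \<bullet> z + snd (snd C)) q" by (intro exI[of _ 1]) simp
qed

lemma motion_scaling:
  assumes "l > 0"
  shows "motion (\<lambda>q :: 'a::euclidean_space \<times> real. l *\<^sub>R q)"
  unfolding motion_def
proof (intro conjI ballI exI[of _ "\<lambda>C. (l\<^sup>2 * fst C, l *\<^sub>R fst (snd C), snd (snd C))"] allI impI)
  show "bij_betw (\<lambda>q :: 'a \<times> real. l *\<^sub>R q) half_space half_space"
    by (rule bij_betw_byWitness[where f' = "\<lambda>q. (1 / l) *\<^sub>R q"]) (use assms in \<open>auto simp: half_space_def\<close>)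
  show "hdist (l *\<^sub>R p) (l *\<^sub>R q) = hdist p q" for p q :: "'a \<times> real"
  proof -
    have "l *\<^sub>R p - l *\<^sub>R q = l *\<^sub>R (p - q)" by (simp add: scaleR_diff_right)
    then show ?thesis using assms by (simp add: hdist_def)
  qed
  show "continuous_on UNIV (\<lambda>C :: real \<times> ('a \<times> real) \<times> real. (l\<^sup>2 * fst C, l *\<^sub>R fst (snd C), snd (snd C)))"
    by (intro continuous_intros)
  fix C :: "real \<times> ('a \<times> real) \<times> real" assume C: "spacelike_coeffs C"
  obtain \<alpha> b \<delta> where Ceq: "C = (\<alpha>, b, \<delta>)" by (cases C)
  have "(l *\<^sub>R fst b) \<bullet> (l *\<^sub>R fst b) - 4 * (l\<^sup>2 * \<alpha>) * \<delta> = l\<^sup>2 * (fst b \<bullet> fst b - 4 * \<alpha> * \<delta>)"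
    by (simp add: power2_eq_square algebra_simps)
  then show "spacelike_coeffs (l\<^sup>2 * fst C, l *\<^sub>R fst (snd C), snd (snd C))"
    using C assms unfolding Ceq spacelike_coeffs_def spacelike_def fst_conv snd_conv fst_scaleR by auto
  fix q :: "'a \<times> real"
  have "qc C (l *\<^sub>R q) = 1 * qc (l\<^sup>2 * fst C, l *\<^sub>R fst (snd C), snd (snd C)) q"
    by (simp add: qc_def quadric_def power2_eq_square algebra_simps)
  then show "\<exists>k>0. qc C (l *\<^sub>R q) = k * qc (l\<^sup>2 * fst C, l *\<^sub>R fst (snd C), snd (snd C)) q"
    by (intro exI[of _ 1]) simp
qed

lemma inner_self_pos: "p \<in> half_space \<Longrightarrow> p \<bullet> p > 0"
  using half_space_pos[of p] by auto

lemma motion_inversion: "motion (\<lambda>q :: 'a::euclidean_space \<times> real. (1 / (q \<bullet> q)) *\<^sub>R q)"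
  unfolding motion_def
proof (intro conjI ballI exI[of _ "\<lambda>C. (snd (snd C), fst (snd C), fst C)"] allI impI)
  let ?i = "\<lambda>q :: 'a \<times> real. (1 / (q \<bullet> q)) *\<^sub>R q"
  have inv: "?i (?i q) = q" if "q \<in> half_space" for q
    using inner_self_pos[OF that] by simp
  have img: "?i q \<in> half_space" if "q \<in> half_space" for q
    using inner_self_pos[OF that] half_space_pos[OF that] by (simp add: half_space_def)
  show "bij_betw ?i half_space half_space"
    by (rule bij_betw_byWitness[where f' = ?i]) (use inv img in blast)+
  show "hdist (?i p) (?i q) = hdist p q" if p: "p \<in> half_space" and q: "q \<in> half_space" for p q
  proof -
    have pp: "p \<bullet> p \<noteq> 0" "q \<bullet> q \<noteq> 0" "snd p \<noteq> 0" "snd q \<noteq> 0"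
      using inner_self_pos half_space_pos p q by fastforce+
    have "(?i p - ?i q) \<bullet> (?i p - ?i q) = ((p - q) \<bullet> (p - q)) / ((p \<bullet> p) * (q \<bullet> q))"
      using pp by (simp add: inner_diff_left inner_diff_right inner_commute field_simps)
    then show ?thesis unfolding hdist_def snd_scaleR using pp by (simp add: field_simps)
  qed
  show "continuous_on UNIV (\<lambda>C :: real \<times> ('a \<times> real) \<times> real. (snd (snd C), fst (snd C), fst C))"
    by (intro continuous_intros)
  fix C :: "real \<times> ('a \<times> real) \<times> real" assume C: "spacelike_coeffs C"
  show "spacelike_coeffs (snd (snd C), fst (snd C), fst C)"
    using C by (cases C) (auto simp: spacelike_coeffs_def spacelike_def mult.commute mult.left_commute)
  fix q :: "'a \<times> real" assume q: "q \<in> half_space"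
  have "qc C (?i q) = (1 / (q \<bullet> q)) * qc (snd (snd C), fst (snd C), fst C) q"
    using inner_self_pos[OF q] by (simp add: qc_def quadric_def field_simps)
  then show "\<exists>k>0. qc C (?i q) = k * qc (snd (snd C), fst (snd C), fst C) q"
    using inner_self_pos[OF q] by (intro exI[of _ "1 / (q \<bullet> q)"]) simp
qed

lemma lor_hypercycle_translate:
  fixes z :: "'a::euclidean_space"
  assumes "lor_hypercycle \<phi> \<gamma> P Q R"
  defines "\<Lambda> \<equiv> \<lambda>X. (fst X, fst (snd X) - fst X *\<^sub>R z, snd (snd X) - 2 * (z \<bullet> fst (snd X)) + (z \<bullet> z) * fst X)"
  shows "lor_hypercycle \<phi> (\<lambda>t. \<gamma> t - (z, 0)) (\<Lambda> P) (\<Lambda> Q) (\<Lambda> R)"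
  unfolding lor_hypercycle_def
proof (intro conjI allI)
  have "lform (\<Lambda> R) (\<Lambda> R) = lform R R"
    unfolding lform_def \<Lambda>_def
    by (simp add: inner_diff_left inner_diff_right inner_commute field_simps)
  then show "lform (\<Lambda> R) (\<Lambda> R) = (cos \<phi>)\<^sup>2 / (sin \<phi>)\<^sup>2" using assms(1) unfolding lor_hypercycle_def by simp
  fix t
  have inH: "\<gamma> t \<in> half_space" and l: "lor (\<gamma> t) = exp (sin \<phi> * t) *\<^sub>R P + (1 / exp (sin \<phi> * t)) *\<^sub>R Q + R"
    using assms(1) unfolding lor_hypercycle_def by blast+
  show "\<gamma> t - (z, 0) \<in> half_space" using inH by (simp add: half_space_def)
  have y: "snd (\<gamma> t) > 0" using inH by (rule half_space_pos)
  have "lor (\<gamma> t - (z, 0)) = \<Lambda> (lor (\<gamma> t))"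
    unfolding lor_def \<Lambda>_def using y
    by (simp add: inner_prod_def inner_diff_left inner_diff_right inner_commute scaleR_diff_right field_simps)
  also have "\<dots> = exp (sin \<phi> * t) *\<^sub>R \<Lambda> P + (1 / exp (sin \<phi> * t)) *\<^sub>R \<Lambda> Q + \<Lambda> R"
    unfolding l \<Lambda>_def by (simp add: inner_add_right algebra_simps)
  finally show "lor (\<gamma> t - (z, 0)) = exp (sin \<phi> * t) *\<^sub>R \<Lambda> P + (1 / exp (sin \<phi> * t)) *\<^sub>R \<Lambda> Q + \<Lambda> R" .
qed

lemma lor_hypercycle_invert:
  assumes "lor_hypercycle \<phi> \<gamma> P Q R"
  defines "\<Lambda> \<equiv> \<lambda>X. (snd (snd X), fst (snd X), fst X)"
  shows "lor_hypercycle \<phi> (\<lambda>t. (1 / (\<gamma> t \<bullet> \<gamma> t)) *\<^sub>R \<gamma> t) (\<Lambda> P) (\<Lambda> Q) (\<Lambda> R)"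
  unfolding lor_hypercycle_def
proof (intro conjI allI)
  have "lform (\<Lambda> R) (\<Lambda> R) = lform R R" unfolding lform_def \<Lambda>_def by (simp add: algebra_simps)
  then show "lform (\<Lambda> R) (\<Lambda> R) = (cos \<phi>)\<^sup>2 / (sin \<phi>)\<^sup>2" using assms(1) unfolding lor_hypercycle_def by simp
  fix t
  have inH: "\<gamma> t \<in> half_space" and l: "lor (\<gamma> t) = exp (sin \<phi> * t) *\<^sub>R P + (1 / exp (sin \<phi> * t)) *\<^sub>R Q + R"
    using assms(1) unfolding lor_hypercycle_def by blast+
  have y: "snd (\<gamma> t) > 0" using inH by (rule half_space_pos)
  have g: "\<gamma> t \<bullet> \<gamma> t > 0" by (rule inner_self_pos[OF inH])
  show "(1 / (\<gamma> t \<bullet> \<gamma> t)) *\<^sub>R \<gamma> t \<in> half_space" using y g by (simp add: half_space_def)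
  have "lor ((1 / (\<gamma> t \<bullet> \<gamma> t)) *\<^sub>R \<gamma> t) = \<Lambda> (lor (\<gamma> t))"
    unfolding lor_def \<Lambda>_def using y g by (simp add: field_simps)
  also have "\<dots> = exp (sin \<phi> * t) *\<^sub>R \<Lambda> P + (1 / exp (sin \<phi> * t)) *\<^sub>R \<Lambda> Q + \<Lambda> R"
    unfolding l \<Lambda>_def by simp
  finally show "lor ((1 / (\<gamma> t \<bullet> \<gamma> t)) *\<^sub>R \<gamma> t) = exp (sin \<phi> * t) *\<^sub>R \<Lambda> P + (1 / exp (sin \<phi> * t)) *\<^sub>R \<Lambda> Q + \<Lambda> R" .
qed

text \<open>A hypercycle with an end at infinity is a ray; a translation and a scaling normalize it.\<close>

lemma lor_hypercycle_ray:
  fixes \<gamma> :: "real \<Rightarrow> 'a::euclidean_space \<times> real"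
  assumes h: "lor_hypercycle \<phi> \<gamma> P Q R" and P0: "fst P = 0" and phi: "sin \<phi> > 0" "cos \<phi> > 0"
  obtains T u where "motion T" "norm u = 1" "\<And>t. T (\<gamma> t) = exp (sin \<phi> * t) *\<^sub>R (cos \<phi> *\<^sub>R u, sin \<phi>)"
proof -
  define s where "s = sin \<phi>"
  define c where "c = cos \<phi>"
  note rel = lor_hypercycle_relations[OF h phi(1)]
  have v1: "fst (snd P) = 0" using rel(1) P0 by (simp add: lform_def)
  have "snd (snd P) * fst Q \<noteq> 0"
    using rel(3) P0 v1 phi(1) by (auto simp: lform_def)
  then have w1: "snd (snd P) \<noteq> 0" and u2: "fst Q \<noteq> 0" by auto
  have R0: "fst R = 0" using rel(2) P0 v1 w1 by (simp add: lform_def)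
  have vR: "fst (snd R) \<bullet> fst (snd R) = c\<^sup>2 / s\<^sup>2"
    using h R0 unfolding lor_hypercycle_def lform_def s_def c_def by simp
  define q where "q = fst Q"
  define E where "E = (\<lambda>t. exp (s * t))"
  have E: "E t > 0" for t by (simp add: E_def)
  have inH: "\<gamma> t \<in> half_space" and l: "lor (\<gamma> t) = E t *\<^sub>R P + (1 / E t) *\<^sub>R Q + R" for t
    using h unfolding lor_hypercycle_def E_def s_def by blast+
  have ypos: "snd (\<gamma> t) > 0" for t by (rule half_space_pos[OF inH])
  have "fst (lor (\<gamma> t)) = fst (E t *\<^sub>R P + (1 / E t) *\<^sub>R Q + R)" for t using l by simp
  then have yl: "1 / snd (\<gamma> t) = q / E t" for t using P0 R0 by (simp add: lor_def q_def)
  have qpos: "q > 0" using yl[of 0] ypos[of 0] by (simp add: E_def) (metis zero_less_divide_1_iff)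
  have y: "snd (\<gamma> t) = E t / q" for t using yl[of t] ypos[of t] qpos E[of t] by (simp add: field_simps)
  have "fst (snd (lor (\<gamma> t))) = fst (snd (E t *\<^sub>R P + (1 / E t) *\<^sub>R Q + R))" for t using l by simp
  then have "(1 / snd (\<gamma> t)) *\<^sub>R fst (\<gamma> t) = (1 / E t) *\<^sub>R fst (snd Q) + fst (snd R)" for t
    using v1 by (simp add: lor_def)
  then have "(q / E t) *\<^sub>R fst (\<gamma> t) = (1 / E t) *\<^sub>R fst (snd Q) + fst (snd R)" for t by (simp only: yl)
  then have xe: "E t *\<^sub>R (q / E t) *\<^sub>R fst (\<gamma> t) = E t *\<^sub>R ((1 / E t) *\<^sub>R fst (snd Q) + fst (snd R))" for t by simp
  have x: "q *\<^sub>R fst (\<gamma> t) = fst (snd Q) + E t *\<^sub>R fst (snd R)" for t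
  proof -
    have "E t \<noteq> 0" using E[of t] by simp
    with xe[of t] show ?thesis by (simp add: scaleR_add_right)
  qed
  define z where "z = (1 / q) *\<^sub>R fst (snd Q)"
  define u where "u = (s / c) *\<^sub>R fst (snd R)"
  define T where "T = (\<lambda>p :: 'a \<times> real. (s * q) *\<^sub>R (p - (z, 0)))"
  have sc: "s > 0" "c > 0" using phi by (simp_all add: s_def c_def)
  have "u \<bullet> u = 1" using vR sc by (simp add: u_def power2_eq_square)
  then have "norm u = 1" by (simp add: norm_eq_1)
  moreover have "motion T"
    unfolding T_def using motion_compose[OF motion_scaling[of "s * q"] motion_translation[of z]] sc qpos by simp
  moreover have "T (\<gamma> t) = E t *\<^sub>R (c *\<^sub>R u, s)" for t
  proof (rule prod_eqI)
    have "fst (T (\<gamma> t)) = s *\<^sub>R (q *\<^sub>R fst (\<gamma> t) - fst (snd Q))"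
      using qpos by (simp add: T_def z_def scaleR_diff_right)
    also have "\<dots> = s *\<^sub>R (E t *\<^sub>R fst (snd R))" unfolding x by simp
    also have "\<dots> = fst (E t *\<^sub>R (c *\<^sub>R u, s))" using sc by (simp add: u_def mult.commute)
    finally show "fst (T (\<gamma> t)) = fst (E t *\<^sub>R (c *\<^sub>R u, s))" .
    show "snd (T (\<gamma> t)) = snd (E t *\<^sub>R (c *\<^sub>R u, s))" using y qpos by (simp add: T_def)
  qed
  ultimately show ?thesis using that unfolding E_def s_def c_def by blast
qed

text \<open>
  A hypercycle whose forward end is a finite boundary point is first translated and inverted so that
  this end moves to infinity.
\<close>

lemma lor_hypercycle_standard:
  fixes \<gamma> :: "real \<Rightarrow> 'a::euclidean_space \<times> real"
  assumes h: "lor_hypercycle \<phi> \<gamma> P Q R" and phi: "sin \<phi> > 0" "cos \<phi> > 0"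
  obtains T u where "motion T" "norm u = 1" "\<And>t. T (\<gamma> t) = exp (sin \<phi> * t) *\<^sub>R (cos \<phi> *\<^sub>R u, sin \<phi>)"
proof (cases "fst P = 0")
  case True
  then show ?thesis using lor_hypercycle_ray[OF h _ phi] that by blast
next
  case False
  define z where "z = (1 / fst P) *\<^sub>R fst (snd P)"
  have PP: "fst (snd P) \<bullet> fst (snd P) = fst P * snd (snd P)"
    using lor_hypercycle_relations(1)[OF h phi(1)] by (simp add: lform_def)
  have "snd (snd P) - 2 * (z \<bullet> fst (snd P)) + (z \<bullet> z) * fst P = 0"
    using False PP by (simp add: z_def field_simps power2_eq_square)
  then obtain T u where T: "motion T" "norm u = 1"
    "\<And>t. T ((1 / ((\<gamma> t - (z, 0)) \<bullet> (\<gamma> t - (z, 0)))) *\<^sub>R (\<gamma> t - (z, 0))) = exp (sin \<phi> * t) *\<^sub>R (cos \<phi> *\<^sub>R u, sin \<phi>)"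
    using lor_hypercycle_ray[OF lor_hypercycle_invert[OF lor_hypercycle_translate[OF h, of z]] _ phi] by auto
  show ?thesis
    by (rule that[OF motion_compose[OF T(1) motion_compose[OF motion_inversion motion_translation]] T(2,3)])
qed

text \<open>The equation, up to a positive factor, of the leaf at the point of the standard ray at distance r from the origin.\<close>

definition ell :: "real \<Rightarrow> 'a::euclidean_space \<Rightarrow> real \<Rightarrow> real \<Rightarrow> 'a \<times> real \<Rightarrow> real" where
  "ell \<phi> u h r q = (sin \<phi> + h) * r - (sin \<phi> - h) * (q \<bullet> q) / r - 2 * h * (q \<bullet> (cos \<phi> *\<^sub>R u, sin \<phi>))"

text \<open>
  Up to a positive factor, the equation of the hypersphere is the derivative of the distance function
  along the curve plus h times this function. In this form it is visibly invariant under motions.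
\<close>

lemma hdist_curve_derivative:
  assumes "(\<gamma> has_vector_derivative w) (at t)" "\<gamma> t \<in> half_space" "q \<in> half_space"
  shows "((\<lambda>t. hdist q (\<gamma> t)) has_real_derivative
    hypersphere_eq (\<gamma> t) w h q / (2 * snd q * snd (\<gamma> t)) - h * hdist q (\<gamma> t)) (at t)"
proof -
  have y: "snd (\<gamma> t) > 0" "snd q > 0" using assms(2,3) half_space_pos by blast+
  have d: "((\<lambda>t. q - \<gamma> t) has_vector_derivative (0 - w)) (at t)"
    by (rule has_vector_derivative_diff[OF has_vector_derivative_const assms(1)])
  have n: "((\<lambda>t. (q - \<gamma> t) \<bullet> (q - \<gamma> t)) has_real_derivative ((q - \<gamma> t) \<bullet> (0 - w) + (0 - w) \<bullet> (q - \<gamma> t))) (at t)"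
    unfolding has_real_derivative_iff_has_vector_derivative
    by (rule bounded_bilinear.has_vector_derivative[OF bounded_bilinear_inner d d])
  have s: "((\<lambda>t. snd (\<gamma> t)) has_real_derivative snd w) (at t)"
    unfolding has_real_derivative_iff_has_vector_derivative
    by (rule bounded_linear.has_vector_derivative[OF bounded_linear_snd assms(1)])
  have "2 * snd q * snd (\<gamma> t) \<noteq> 0" using y by simp
  from DERIV_divide[OF n DERIV_cmult[OF s, of "2 * snd q"] this]
  show ?thesis unfolding hdist_def
    by (rule DERIV_cong) (use y in \<open>simp add: hypersphere_eq_def inner_commute field_simps\<close>)
qed

lemma hypersphere_eq_standard:
  fixes \<gamma> :: "real \<Rightarrow> 'a::euclidean_space \<times> real"
  assumes T: "motion T" and u: "norm u = 1" and phi: "sin \<phi> > 0"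
    and std: "\<And>t. T (\<gamma> t) = exp (sin \<phi> * t) *\<^sub>R (cos \<phi> *\<^sub>R u, sin \<phi>)"
    and \<gamma>: "\<And>t. (\<gamma> has_vector_derivative velocity \<gamma> t) (at t)" "\<And>t. \<gamma> t \<in> half_space" and q: "q \<in> half_space"
  obtains k where "k > 0" "hypersphere_eq (\<gamma> t) (velocity \<gamma> t) h q = k * ell \<phi> u h (exp (sin \<phi> * t)) (T q)"
proof -
  define s where "s = sin \<phi>"
  define w where "w = (cos \<phi> *\<^sub>R u, sin \<phi>)"
  define p where "p = T q"
  have p: "p \<in> half_space" unfolding p_def using T q unfolding motion_def by (blast intro: bij_betw_apply)
  have y: "snd p > 0" "snd q > 0" "snd (\<gamma> t) > 0" using p q \<gamma>(2) half_space_pos by blast+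
  have s: "s > 0" using phi by (simp add: s_def)
  have ww: "w \<bullet> w = 1" using u by (simp add: w_def inner_prod_def dot_square_norm power2_eq_square[symmetric])
  have eq: "hdist q (\<gamma> t) = (exp (s * t) + (p \<bullet> p) * exp (- s * t) - 2 * (p \<bullet> w)) / (2 * snd p * s)" for t
  proof -
    have "hdist q (\<gamma> t) = hdist p (exp (s * t) *\<^sub>R w)"
      using T q \<gamma>(2) std unfolding motion_def p_def s_def w_def by metis
    also have "\<dots> = (p \<bullet> p - 2 * exp (s * t) * (p \<bullet> w) + exp (s * t) * exp (s * t) * (w \<bullet> w)) / (2 * snd p * (exp (s * t) * s))"
      unfolding hdist_def snd_scaleR by (simp add: w_def[symmetric] s_def[symmetric] inner_diff_left inner_diff_right inner_commute)
        (simp add: w_def s_def)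
    also have "\<dots> = (exp (s * t) + (p \<bullet> p) * exp (- s * t) - 2 * (p \<bullet> w)) / (2 * snd p * s)"
      unfolding ww using s y(1) by (simp add: exp_minus field_simps)
    finally show ?thesis .
  qed
  define r where "r = exp (s * t)"
  have r: "r > 0" by (simp add: r_def)
  have "((\<lambda>t. hdist q (\<gamma> t)) has_real_derivative (r * s + (p \<bullet> p) * (exp (- s * t) * (- s))) / (2 * snd p * s)) (at t)"
  proof -
    have "((\<lambda>t. exp (s * t) + (p \<bullet> p) * exp (- s * t) - 2 * (p \<bullet> w)) has_real_derivative
        (r * s + (p \<bullet> p) * (exp (- s * t) * (- s)))) (at t)"
      unfolding r_def by (auto intro!: derivative_eq_intros)
    then show ?thesis unfolding eq by (rule DERIV_cdivide)
  qed
  from DERIV_unique[OF this hdist_curve_derivative[OF \<gamma>(1) \<gamma>(2) q, of t h]]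
  have "hypersphere_eq (\<gamma> t) (velocity \<gamma> t) h q / (2 * snd q * snd (\<gamma> t))
      = (r * s + (p \<bullet> p) * (exp (- s * t) * (- s))) / (2 * snd p * s) + h * hdist q (\<gamma> t)" by simp
  also have "exp (- s * t) = 1 / r" by (simp add: r_def exp_minus field_simps)
  also have "hdist q (\<gamma> t) = (r + (p \<bullet> p) / r - 2 * (p \<bullet> w)) / (2 * snd p * s)"
    unfolding eq by (simp add: r_def exp_minus field_simps)
  also have "(r * s + (p \<bullet> p) * (1 / r * (- s))) / (2 * snd p * s) + h * ((r + (p \<bullet> p) / r - 2 * (p \<bullet> w)) / (2 * snd p * s))
      = ell \<phi> u h r p / (2 * snd p * s)"
  proof -
    have "w = (cos \<phi> *\<^sub>R u, s)" by (simp add: w_def s_def)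
    then have e: "ell \<phi> u h r p = (s + h) * r - (s - h) * (p \<bullet> p) / r - 2 * h * (p \<bullet> w)"
      by (simp add: ell_def s_def)
    have "r * s + (p \<bullet> p) * (1 / r * (- s)) + h * (r + (p \<bullet> p) / r - 2 * (p \<bullet> w)) = ell \<phi> u h r p"
      unfolding e using r by (simp add: field_simps)
    then show ?thesis unfolding times_divide_eq_right add_divide_distrib[symmetric] by simp
  qed
  finally have "hypersphere_eq (\<gamma> t) (velocity \<gamma> t) h q = ((2 * snd q * snd (\<gamma> t)) / (2 * snd p * s)) * ell \<phi> u h r p"
    using y s by (simp add: field_simps)
  moreover have "(2 * snd q * snd (\<gamma> t)) / (2 * snd p * s) > 0" using y s by simp
  ultimately show ?thesis using that unfolding r_def p_def s_def by blast
qed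

section \<open>The order of the leaves along the standard ray\<close>

text \<open>
  The leaf that meets the standard ray at distance r and the ideal boundary at distance X / W from
  the origin, on the side away from the ray; p is the inner product with the direction of the ray
  and Q the square of the norm.
\<close>

definition mform :: "real \<Rightarrow> real \<Rightarrow> real \<Rightarrow> real \<Rightarrow> real \<Rightarrow> real \<Rightarrow> real" where
  "mform c r X W p Q = r * X\<^sup>2 + r\<^sup>2 * c * X * W + (r\<^sup>2 * W\<^sup>2 - X\<^sup>2) * p - (r * W\<^sup>2 + c * X * W) * Q"

lemma half_angle_identities:
  fixes \<phi> \<alpha> :: real
  defines "A \<equiv> (\<phi> + \<alpha>) / 2" and "B \<equiv> (\<phi> - \<alpha>) / 2"
  shows "sin \<phi> = sin A * cos B + cos A * sin B"
    "sin \<phi> + sin \<alpha> = 2 * (sin A * cos B)" "sin \<phi> - sin \<alpha> = 2 * (cos A * sin B)"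
    "sin A * (sin A + cos \<phi> * sin B) = sin \<phi> * (sin \<phi> + sin \<alpha>) / 2"
    "sin B * (sin B + cos \<phi> * sin A) = sin \<phi> * (sin \<phi> - sin \<alpha>) / 2"
    "(sin B)\<^sup>2 - (sin A)\<^sup>2 = - (sin \<phi> * sin \<alpha>)"
    "sin (\<phi> + \<alpha>) = 2 * (sin A * cos A)" "1 + cos (\<phi> + \<alpha>) = 2 * (cos A)\<^sup>2"
proof -
  have ph: "\<phi> = A + B" and al: "\<alpha> = A - B" by (simp_all add: A_def B_def field_simps)
  have cA: "cos A * cos A = 1 - sin A * sin A" and cB: "cos B * cos B = 1 - sin B * sin B"
    using sin_cos_squared_add[of A] sin_cos_squared_add[of B] by (simp_all add: power2_eq_square)
  show 1: "sin \<phi> = sin A * cos B + cos A * sin B" unfolding ph by (rule sin_add)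
  have 0: "sin \<alpha> = sin A * cos B - cos A * sin B" unfolding al by (rule sin_diff)
  show 2: "sin \<phi> + sin \<alpha> = 2 * (sin A * cos B)" and 3: "sin \<phi> - sin \<alpha> = 2 * (cos A * sin B)"
    unfolding 1 0 by simp_all
  have c: "cos \<phi> = cos A * cos B - sin A * sin B" unfolding ph by (rule cos_add)
  have "sin A + cos \<phi> * sin B = sin A * (1 - sin B * sin B) + cos A * cos B * sin B"
    unfolding c by (simp add: algebra_simps)
  also have "\<dots> = cos B * sin \<phi>" unfolding cB[symmetric] 1 by (simp add: algebra_simps)
  finally show "sin A * (sin A + cos \<phi> * sin B) = sin \<phi> * (sin \<phi> + sin \<alpha>) / 2" unfolding 2 by simp
  have "sin B + cos \<phi> * sin A = sin B * (1 - sin A * sin A) + cos A * cos B * sin A"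
    unfolding c by (simp add: algebra_simps)
  also have "\<dots> = cos A * sin \<phi>" unfolding cA[symmetric] 1 by (simp add: algebra_simps)
  finally show "sin B * (sin B + cos \<phi> * sin A) = sin \<phi> * (sin \<phi> - sin \<alpha>) / 2" unfolding 3 by simp
  have "sin \<phi> * sin \<alpha> = sin A * sin A * (cos B * cos B) - cos A * cos A * (sin B * sin B)"
    unfolding 1 0 by (simp add: algebra_simps)
  then show "(sin B)\<^sup>2 - (sin A)\<^sup>2 = - (sin \<phi> * sin \<alpha>)" unfolding cA cB
    by (simp add: algebra_simps power2_eq_square)
  have pa: "\<phi> + \<alpha> = 2 * A" by (simp add: A_def)
  show "sin (\<phi> + \<alpha>) = 2 * (sin A * cos A)" "1 + cos (\<phi> + \<alpha>) = 2 * (cos A)\<^sup>2"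
    unfolding pa using sin_double[of A] cos_double_cos[of A] by simp_all
qed

lemma mform_ell:
  assumes "r > 0"
  shows "mform (cos \<phi>) r (r * sin ((\<phi> + \<alpha>) / 2)) (sin ((\<phi> - \<alpha>) / 2)) (q \<bullet> (cos \<phi> *\<^sub>R u, sin \<phi>)) (q \<bullet> q)
    = (sin \<phi> * r\<^sup>2 / 2) * ell \<phi> u (sin \<alpha>) r q"
proof -
  define A where "A = sin ((\<phi> + \<alpha>) / 2)"
  define B where "B = sin ((\<phi> - \<alpha>) / 2)"
  define p where "p = q \<bullet> (cos \<phi> *\<^sub>R u, sin \<phi>)"
  note h = half_angle_identities[of \<phi> \<alpha>, folded A_def B_def]
  have "mform (cos \<phi>) r (r * A) B p (q \<bullet> q)
    = r^3 * (A * (A + cos \<phi> * B)) + r\<^sup>2 * (B\<^sup>2 - A\<^sup>2) * p - r * (B * (B + cos \<phi> * A)) * (q \<bullet> q)"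
    unfolding mform_def by (simp add: power2_eq_square power3_eq_cube algebra_simps)
  also have "\<dots> = (sin \<phi> * r\<^sup>2 / 2) * ((sin \<phi> + sin \<alpha>) * r - (sin \<phi> - sin \<alpha>) * (q \<bullet> q) / r - 2 * sin \<alpha> * p)"
    unfolding h(4,5,6) using assms by (simp add: field_simps power2_eq_square power3_eq_cube)
  finally show ?thesis unfolding ell_def A_def B_def p_def .
qed

text \<open>
  With h = sin \<alpha>, the bound in the differential inequality is a product of half-angle sines and cos \<alpha>.
\<close>

lemma route_bound_half_angle:
  fixes \<phi> \<alpha> :: real
  assumes "cos ((\<phi> + \<alpha>) / 2) \<noteq> 0"
  shows "(sin \<alpha> - sin \<phi>) * (sin \<alpha> * cos \<phi> + cos \<alpha> * sin \<phi>) * cos \<alpha> / (1 - sin \<alpha> * sin \<phi> + cos \<alpha> * cos \<phi>)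
    = - 2 * sin ((\<phi> + \<alpha>) / 2) * sin ((\<phi> - \<alpha>) / 2) * cos \<alpha>"
proof -
  define C where "C = cos ((\<phi> + \<alpha>) / 2)"
  define A where "A = sin ((\<phi> + \<alpha>) / 2)"
  define B where "B = sin ((\<phi> - \<alpha>) / 2)"
  note h = half_angle_identities[of \<phi> \<alpha>, folded A_def B_def C_def]
  have 1: "sin \<alpha> - sin \<phi> = - (2 * (C * B))" using h(3) by linarith
  have 2: "sin \<alpha> * cos \<phi> + cos \<alpha> * sin \<phi> = 2 * (A * C)" using h(7) sin_add[of \<phi> \<alpha>] by (simp add: mult.commute)
  have 3: "1 - sin \<alpha> * sin \<phi> + cos \<alpha> * cos \<phi> = 2 * C\<^sup>2" using h(8) cos_add[of \<phi> \<alpha>] by (simp add: mult.commute)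
  show ?thesis unfolding 1 2 3 using assms unfolding C_def[symmetric] A_def[symmetric] B_def[symmetric]
    by (simp add: field_simps power2_eq_square)
qed

lemma ell_ray:
  assumes "norm u = 1" "r > 0"
  shows "ell \<phi> u h r (\<rho> *\<^sub>R (cos \<phi> *\<^sub>R u, sin \<phi>)) = (r - \<rho>) * ((sin \<phi> + h) * r + (sin \<phi> - h) * \<rho>) / r"
proof -
  have uu: "u \<bullet> u = 1" using assms(1) by (simp add: dot_square_norm)
  have ww: "(cos \<phi> *\<^sub>R u, sin \<phi>) \<bullet> (cos \<phi> *\<^sub>R u, sin \<phi>) = 1"
    by (simp add: inner_prod_def uu power2_eq_square[symmetric])
  show ?thesis unfolding ell_def inner_scaleR_left inner_scaleR_right ww using assms(2)
    by (simp add: field_simps)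
qed

lemma sign_mult_pos: "0 < k \<Longrightarrow> (0 < k * e \<longleftrightarrow> 0 < e) \<and> (k * e < 0 \<longleftrightarrow> e < 0)" for k e :: real
  by (simp add: zero_less_mult_iff mult_less_0_iff)

lemma half_angle_bounds:
  fixes \<phi> \<alpha> :: real
  assumes phi: "0 < \<phi>" "\<phi> < pi / 2" and \<alpha>: "\<bar>\<alpha>\<bar> \<le> \<phi>"
  shows "0 \<le> sin ((\<phi> + \<alpha>) / 2)" "0 \<le> sin ((\<phi> - \<alpha>) / 2)" "0 < cos ((\<phi> + \<alpha>) / 2)" "0 < cos ((\<phi> - \<alpha>) / 2)"
    "0 < sin ((\<phi> + \<alpha>) / 2) \<or> 0 < sin ((\<phi> - \<alpha>) / 2)"
proof -
  have r: "0 \<le> (\<phi> + \<alpha>) / 2" "(\<phi> + \<alpha>) / 2 \<le> \<phi>" "0 \<le> (\<phi> - \<alpha>) / 2" "(\<phi> - \<alpha>) / 2 \<le> \<phi>"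
    using \<alpha> by (simp_all add: abs_le_iff)
  have pi: "\<phi> < pi" using phi pi_gt_zero by linarith
  show "0 \<le> sin ((\<phi> + \<alpha>) / 2)" using r pi by (intro sin_ge_zero) linarith+
  show "0 \<le> sin ((\<phi> - \<alpha>) / 2)" using r pi by (intro sin_ge_zero) linarith+
  show "0 < cos ((\<phi> + \<alpha>) / 2)" using r phi by (intro cos_gt_zero_pi) linarith+
  show "0 < cos ((\<phi> - \<alpha>) / 2)" using r phi by (intro cos_gt_zero_pi) linarith+
  have "(\<phi> + \<alpha>) / 2 + (\<phi> - \<alpha>) / 2 = \<phi>" by (simp add: field_simps)
  then have "(\<phi> + \<alpha>) / 2 > 0 \<or> (\<phi> - \<alpha>) / 2 > 0" using phi by linarith
  then show "0 < sin ((\<phi> + \<alpha>) / 2) \<or> 0 < sin ((\<phi> - \<alpha>) / 2)"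
  proof
    assume "(\<phi> + \<alpha>) / 2 > 0"
    then have "sin ((\<phi> + \<alpha>) / 2) > 0" using r pi by (intro sin_gt_zero) linarith+
    then show ?thesis by blast
  next
    assume "(\<phi> - \<alpha>) / 2 > 0"
    then have "sin ((\<phi> - \<alpha>) / 2) > 0" using r pi by (intro sin_gt_zero) linarith+
    then show ?thesis by blast
  qed
qed

lemma route_angle:
  fixes \<phi> h :: real
  assumes phi: "0 < \<phi>" "\<phi> < pi / 2" and h: "\<bar>h\<bar> \<le> sin \<phi>"
  shows "sin (arcsin h) = h" "\<bar>arcsin h\<bar> \<le> \<phi>" "cos (arcsin h) = sqrt (1 - h\<^sup>2)" "0 < sqrt (1 - h\<^sup>2)"
    "- 1 < h" "h < 1"
proof -
  have s1: "sin \<phi> < 1" using sin_monotone_2pi[of \<phi> "pi / 2"] phi by simp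
  have s0: "sin \<phi> > 0" using phi by (simp add: sin_gt_zero)
  show b: "- 1 < h" "h < 1" using h s1 by linarith+
  show "sin (arcsin h) = h" using b by simp
  show "cos (arcsin h) = sqrt (1 - h\<^sup>2)" using b by (simp add: cos_arcsin)
  show "0 < sqrt (1 - h\<^sup>2)" using b by (simp add: abs_square_less_1)
  have "arcsin h \<le> arcsin (sin \<phi>)" "arcsin (- sin \<phi>) \<le> arcsin h"
    using h s1 s0 b by (intro arcsin_le_arcsin; linarith)+
  moreover have "arcsin (sin \<phi>) = \<phi>" using phi by (simp add: arcsin_sin)
  moreover have "arcsin (- sin \<phi>) = - \<phi>" using calculation(3) s1 s0 by (simp add: arcsin_minus)
  ultimately show "\<bar>arcsin h\<bar> \<le> \<phi>" by linarith
qed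

text \<open>
  The leaves along a hypercycle in standard position, as zero sets of continuous functions G whose
  signs are those of the standard equations.
\<close>

locale ray_leaves =
  fixes \<phi> :: real and u :: "'a::euclidean_space" and T :: "'a \<times> real \<Rightarrow> 'a \<times> real"
    and \<gamma> :: "real \<Rightarrow> 'a \<times> real" and h :: "real \<Rightarrow> real" and G :: "real \<Rightarrow> 'a \<times> real \<Rightarrow> real"
  assumes phi: "0 < \<phi>" "\<phi> < pi / 2" and u: "norm u = 1"
    and T: "bij_betw T half_space half_space"
    and ray: "\<And>t. T (\<gamma> t) = exp (sin \<phi> * t) *\<^sub>R (cos \<phi> *\<^sub>R u, sin \<phi>)"
    and inH: "\<And>t. \<gamma> t \<in> half_space"
    and G: "\<And>t. continuous_on half_space (G t)"
      "\<And>t q. q \<in> half_space \<Longrightarrow> \<exists>k>0. G t q = k * ell \<phi> u (h t) (exp (sin \<phi> * t)) (T q)"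
    and conn: "\<And>t. connected {q \<in> half_space. G t q = 0}"
    and disj: "\<And>t t' q. q \<in> half_space \<Longrightarrow> G t q = 0 \<Longrightarrow> G t' q = 0 \<Longrightarrow>
      {q \<in> half_space. G t q = 0} = {q \<in> half_space. G t' q = 0}"
begin

abbreviation "s \<equiv> sin \<phi>"
abbreviation "rad t \<equiv> exp (s * t)"

lemma s_pos: "s > 0" using phi by (simp add: sin_gt_zero)

lemma G_sign:
  assumes "q \<in> half_space"
  shows "G t q > 0 \<longleftrightarrow> ell \<phi> u (h t) (rad t) (T q) > 0" "G t q < 0 \<longleftrightarrow> ell \<phi> u (h t) (rad t) (T q) < 0"
    "G t q = 0 \<longleftrightarrow> ell \<phi> u (h t) (rad t) (T q) = 0"
  using G(2)[OF assms, of t] by (auto simp: zero_less_mult_iff mult_less_0_iff)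

lemma ell_at: "ell \<phi> u (h t) (rad t) (T (\<gamma> t'))
    = (rad t - rad t') * ((s + h t) * rad t + (s - h t) * rad t') / rad t"
  unfolding ray by (rule ell_ray[OF u exp_gt_zero])

lemma G_self: "G t (\<gamma> t) = 0"
  using G_sign(3)[OF inH] ell_at by simp

lemma connected_sign:
  assumes "q \<in> half_space" "G t q = 0" "q' \<in> half_space" "G t q' = 0" "G t' q > 0" "G t' q' < 0"
  obtains x where "x \<in> half_space" "G t x = 0" "G t' x = 0"
proof -
  let ?L = "{q \<in> half_space. G t q = 0}"
  have "connected (G t' ` ?L)"
    by (rule connected_continuous_image[OF continuous_on_subset[OF G(1)] conn]) blast
  moreover have "G t' q' \<in> G t' ` ?L" "G t' q \<in> G t' ` ?L" using assms by blast+
  ultimately have "0 \<in> G t' ` ?L" using assms(5,6) by (meson connectedD_interval less_imp_le)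
  then show ?thesis using that by force
qed

text \<open>
  A leaf with curvature beyond sin \<phi> would meet the curve twice, with opposite signs of h. By
  continuity a leaf with h = 0 meets the curve in between, once only, and separates the two points.
\<close>

lemma curvature_bound:
  assumes cont: "continuous_on UNIV h"
  shows "\<bar>h t\<bar> \<le> s"
proof (rule ccontr)
  assume "\<not> \<bar>h t\<bar> \<le> s"
  then have big: "h t > s \<or> h t < - s" by linarith
  define r where "r = rad t"
  have r: "r > 0" by (simp add: r_def)
  \<comment> \<open>The other intersection of the leaf with the ray is at distance \<sigma> from the origin.\<close>
  define \<sigma> where "\<sigma> = r * ((h t + s) / (h t - s))"
  have fr: "(h t + s) / (h t - s) > 0"
    using big s_pos by (auto intro: divide_pos_pos divide_neg_neg)
  then have \<sigma>: "\<sigma> > 0" unfolding \<sigma>_def by (rule mult_pos_pos[OF r])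
  have hs: "h t - s \<noteq> 0" using big s_pos by auto
  have \<sigma>eq: "(s + h t) * r + (s - h t) * \<sigma> = 0" using hs by (simp add: \<sigma>_def field_simps)
  define t1 where "t1 = ln \<sigma> / s"
  have r1: "rad t1 = \<sigma>" using \<sigma> s_pos by (simp add: t1_def)
  have "G t (\<gamma> t1) = 0" using G_sign(3)[OF inH] ell_at[of t t1] \<sigma>eq by (simp add: r1 r_def)
  then have same: "{q \<in> half_space. G t q = 0} = {q \<in> half_space. G t1 q = 0}"
    using disj[OF inH _ G_self] by blast
  then have "G t1 (\<gamma> t) = 0" using G_self[of t] inH[of t] by blast
  then have "(\<sigma> - r) * ((s + h t1) * \<sigma> + (s - h t1) * r) / \<sigma> = 0"
    using G_sign(3)[OF inH] ell_at[of t1 t] by (simp add: r1 r_def)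
  moreover have ne: "\<sigma> \<noteq> r"
  proof
    assume "\<sigma> = r"
    then have "2 * s * r = 0" using \<sigma>eq by (simp add: algebra_simps)
    then show False using r s_pos by simp
  qed
  ultimately have "(s + h t1) * \<sigma> + (s - h t1) * r = 0" using \<sigma> by auto
  then have eq1: "(s + h t1) * \<sigma> = (h t1 - s) * r" by (simp add: algebra_simps)
  have opp: "(h t > s \<and> h t1 < - s) \<or> (h t < - s \<and> h t1 > s)"
  proof (cases "h t > s")
    case True
    have "\<sigma> > r" using True s_pos r unfolding \<sigma>_def by (simp add: less_divide_eq)
    have "h t1 < - s"
    proof (rule ccontr)
      assume "\<not> h t1 < - s"
      then have "(s + h t1) * r \<le> (s + h t1) * \<sigma>" using \<open>\<sigma> > r\<close> by (intro mult_left_mono) auto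
      then have "(s + h t1) * r \<le> (h t1 - s) * r" using eq1 by simp
      then have "s + h t1 \<le> h t1 - s" using r by simp
      then show False using s_pos by simp
    qed
    then show ?thesis using True by simp
  next
    case False
    then have neg: "h t < - s" using big by simp
    have "\<sigma> < r" using neg s_pos r unfolding \<sigma>_def by (simp add: divide_less_eq)
    have "h t1 > s"
    proof (rule ccontr)
      assume "\<not> h t1 > s"
      then have "(h t1 - s) * r \<le> (h t1 - s) * \<sigma>" using \<open>\<sigma> < r\<close> by (intro mult_left_mono_neg) auto
      then have "(s + h t1) * \<sigma> \<le> (h t1 - s) * \<sigma>" using eq1 by simp
      then have "s + h t1 \<le> h t1 - s" using \<sigma> by simp
      then show False using s_pos by simp
    qed
    then show ?thesis using neg by simp
  qed
  have "\<exists>t2. (t < t2 \<and> t2 < t1 \<or> t1 < t2 \<and> t2 < t) \<and> h t2 = 0"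
  proof -
    let ?I = "{min t t1..max t t1}"
    have "connected (h ` ?I)"
      by (rule connected_continuous_image[OF continuous_on_subset[OF cont]]) auto
    moreover have "h t \<in> h ` ?I" "h t1 \<in> h ` ?I" by (auto intro!: imageI)
    ultimately have "0 \<in> h ` ?I"
      using opp s_pos connectedD_interval[of "h ` ?I" "h t" "h t1" 0] connectedD_interval[of "h ` ?I" "h t1" "h t" 0]
      by linarith
    then obtain t2 where t2: "t2 \<in> ?I" "h t2 = 0" by auto
    have "t2 \<noteq> t" "t2 \<noteq> t1" using opp s_pos t2(2) by auto
    then have "t < t2 \<and> t2 < t1 \<or> t1 < t2 \<and> t2 < t" using t2(1) by (auto simp: min_def max_def split: if_splits)
    then show ?thesis using t2(2) by blast
  qed
  then obtain t2 where t2: "t < t2 \<and> t2 < t1 \<or> t1 < t2 \<and> t2 < t" "h t2 = 0" by blast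
  have e2: "ell \<phi> u (h t2) (rad t2) (T (\<gamma> t')) = (rad t2 - rad t') * (s * (rad t2 + rad t')) / rad t2" for t'
    using ell_at[of t2 t'] by (simp add: t2(2) distrib_left)
  have sg: "G t2 (\<gamma> t') > 0 \<longleftrightarrow> t' < t2" "G t2 (\<gamma> t') < 0 \<longleftrightarrow> t' > t2" for t'
  proof -
    have pos: "s * (rad t2 + rad t') / rad t2 > 0" using s_pos by (simp add: add_pos_pos)
    have "ell \<phi> u (h t2) (rad t2) (T (\<gamma> t')) = (rad t2 - rad t') * (s * (rad t2 + rad t') / rad t2)"
      unfolding e2 by simp
    then have "(ell \<phi> u (h t2) (rad t2) (T (\<gamma> t')) > 0 \<longleftrightarrow> rad t2 > rad t') \<and>
        (ell \<phi> u (h t2) (rad t2) (T (\<gamma> t')) < 0 \<longleftrightarrow> rad t2 < rad t')"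
      using sign_mult_pos[OF pos, of "rad t2 - rad t'"] by (simp add: mult.commute)
    then show "G t2 (\<gamma> t') > 0 \<longleftrightarrow> t' < t2" "G t2 (\<gamma> t') < 0 \<longleftrightarrow> t' > t2"
      unfolding G_sign(1,2)[OF inH] using s_pos by simp_all
  qed
  have "\<exists>x. x \<in> half_space \<and> G t x = 0 \<and> G t2 x = 0"
    using t2(1)
  proof
    assume "t < t2 \<and> t2 < t1"
    then show ?thesis
      using connected_sign[OF inH G_self inH \<open>G t (\<gamma> t1) = 0\<close>, of t2] sg by metis
  next
    assume "t1 < t2 \<and> t2 < t"
    then show ?thesis
      using connected_sign[OF inH \<open>G t (\<gamma> t1) = 0\<close> inH G_self, of t2] sg by metis
  qed
  then have "{q \<in> half_space. G t q = 0} = {q \<in> half_space. G t2 q = 0}" using disj by blast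
  then have "G t (\<gamma> t2) = 0" using G_self[of t2] inH by blast
  then have "(r - rad t2) * ((s + h t) * r + (s - h t) * rad t2) = 0"
    using G_sign(3)[OF inH] ell_at[of t t2] by (simp add: r_def)
  moreover have "r \<noteq> rad t2" using t2(1) s_pos unfolding r_def by auto
  ultimately have "(s + h t) * r + (s - h t) * rad t2 = 0" by simp
  then have "(s - h t) * rad t2 = (s - h t) * \<sigma>" using \<sigma>eq by linarith
  then have "rad t2 = rad t1" using hs r1 by simp
  then show False using t2(1) s_pos by auto
qed

text \<open>
  If the boundary points were in the opposite order, a point near the mediant of the two would lie
  beyond the later leaf and before the earlier one. As the leaves are disjoint, the set of such points
  would be open and closed in the half-space, but it does not contain the points of the curve.
\<close>

lemma boundary_point_mono:
  assumes bound: "\<And>t. \<bar>h t\<bar> \<le> s" and "t1 < t2"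
  defines "A \<equiv> \<lambda>t. rad t * sin ((\<phi> + arcsin (h t)) / 2)"
    and "B \<equiv> \<lambda>t. sin ((\<phi> - arcsin (h t)) / 2)"
  shows "A t1 * B t2 \<le> A t2 * B t1"
proof (rule ccontr)
  assume neg: "\<not> A t1 * B t2 \<le> A t2 * B t1"
  define c where "c = cos \<phi>"
  define w where "w = (cos \<phi> *\<^sub>R u, sin \<phi>)"
  have c: "c > 0" using phi by (simp add: c_def cos_gt_zero)
  have arc: "sin (arcsin (h t)) = h t" "\<bar>arcsin (h t)\<bar> \<le> \<phi>" for t
    by (rule route_angle[OF phi bound])+
  have A0: "A t \<ge> 0" and B0: "B t \<ge> 0" and AB: "A t + B t > 0" for t
  proof -
    note b = half_angle_bounds[OF phi arc(2)[of t]]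
    show "A t \<ge> 0" "B t \<ge> 0" using b by (simp_all add: A_def B_def)
    moreover have "A t > 0 \<or> B t > 0" using b(5) by (auto simp: A_def B_def)
    ultimately show "A t + B t > 0" by linarith
  qed
  have m_sign: "(mform c (rad t) (A t) (B t) (T q \<bullet> w) (T q \<bullet> T q) > 0 \<longleftrightarrow> G t q > 0) \<and>
      (mform c (rad t) (A t) (B t) (T q \<bullet> w) (T q \<bullet> T q) < 0 \<longleftrightarrow> G t q < 0)" if "q \<in> half_space" for t q
  proof -
    have "mform c (rad t) (A t) (B t) (T q \<bullet> w) (T q \<bullet> T q) = (s * (rad t)\<^sup>2 / 2) * ell \<phi> u (h t) (rad t) (T q)"
      unfolding A_def B_def c_def w_def using mform_ell[of "rad t" \<phi> "arcsin (h t)"] arc(1)[of t] by simp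
    moreover have "s * (rad t)\<^sup>2 / 2 > 0" using s_pos by simp
    ultimately show ?thesis unfolding G_sign(1,2)[OF that] by (simp only: sign_mult_pos)
  qed
  have r12: "rad t1 < rad t2" using \<open>t1 < t2\<close> s_pos by simp
  have lin: "(s + h t) * a + (s - h t) * b > 0" if "a > 0" "b > 0" for t a b
  proof -
    have "s + h t \<ge> 0" "s - h t \<ge> 0" using bound[of t] by linarith+
    moreover have "s + h t > 0 \<or> s - h t > 0" using s_pos by linarith
    ultimately show ?thesis using that by (auto intro: add_pos_nonneg add_nonneg_pos)
  qed
  have g1: "G t2 (\<gamma> t1) > 0"
    unfolding G_sign(1)[OF inH] ell_at using r12 lin[of "rad t2" "rad t1" t2] by simp
  have g2: "G t1 (\<gamma> t2) < 0"
    unfolding G_sign(2)[OF inH] ell_at using r12 lin[of "rad t1" "rad t2" t1] by (simp add: mult_neg_pos divide_neg_pos)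
  have nodup: False if "q \<in> half_space" "G t1 q = 0" "G t2 q = 0" for q
  proof -
    have "\<gamma> t2 \<in> {q \<in> half_space. G t1 q = 0}" using disj[OF that] G_self inH by blast
    then show False using g2 by simp
  qed
  have L1: "G t2 q > 0" if "q \<in> half_space" "G t1 q = 0" for q
  proof (rule ccontr)
    assume "\<not> G t2 q > 0"
    moreover have "G t2 q \<noteq> 0" using nodup[OF that] by blast
    ultimately have "G t2 q < 0" by simp
    from connected_sign[OF inH G_self that g1 this] show False using nodup by blast
  qed
  have L2: "G t1 q < 0" if "q \<in> half_space" "G t2 q = 0" for q
  proof (rule ccontr)
    assume "\<not> G t1 q < 0"
    moreover have "G t1 q \<noteq> 0" using nodup[OF that(1) _ that(2)] by blast
    ultimately have "G t1 q > 0" by simp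
    from connected_sign[OF that inH G_self this g2] show False using nodup by blast
  qed
  \<comment> \<open>The mediant of the two boundary points lies strictly between them.\<close>
  define \<zeta> where "\<zeta> = (A t1 + A t2) / (B t1 + B t2)"
  have "0 < A t1 * B t2" using neg A0[of t2] B0[of t1] mult_nonneg_nonneg[of "A t2" "B t1"] by linarith
  then have pos: "A t1 > 0" "B t2 > 0"
    using A0[of t1] B0[of t2] by (auto simp: zero_less_mult_iff)
  have \<zeta>: "\<zeta> > 0" unfolding \<zeta>_def using pos A0[of t2] B0[of t1] by (intro divide_pos_pos) linarith+
  have z1: "A t1 - \<zeta> * B t1 > 0"
  proof -
    have "(A t1 - \<zeta> * B t1) * (B t1 + B t2) = A t1 * B t2 - A t2 * B t1"
      using pos B0[of t1] unfolding \<zeta>_def by (simp add: field_simps)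
    then have "(A t1 - \<zeta> * B t1) * (B t1 + B t2) > 0" using neg by linarith
    then show ?thesis using pos B0[of t1] by (simp add: zero_less_mult_iff)
  qed
  have z2: "A t2 - \<zeta> * B t2 < 0"
  proof -
    have "(A t2 - \<zeta> * B t2) * (B t1 + B t2) = - (A t1 * B t2 - A t2 * B t1)"
      using pos B0[of t1] unfolding \<zeta>_def by (simp add: field_simps)
    then have "(A t2 - \<zeta> * B t2) * (B t1 + B t2) < 0" using neg by linarith
    then show ?thesis using pos B0[of t1] by (simp add: mult_less_0_iff)
  qed
  define f where "f = (\<lambda>t \<epsilon>. mform c (rad t) (A t) (B t) ((- \<zeta> *\<^sub>R u, \<epsilon>) \<bullet> w) ((- \<zeta> *\<^sub>R u, \<epsilon>) \<bullet> (- \<zeta> *\<^sub>R u, \<epsilon>)))"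
  have uu: "u \<bullet> u = 1" using u by (simp add: dot_square_norm)
  have f0: "f t 0 = (A t - \<zeta> * B t) * (rad t * A t + (rad t)\<^sup>2 * c * B t + (rad t * B t + c * A t) * \<zeta>)" for t
    unfolding f_def w_def mform_def c_def[symmetric]
    by (simp add: inner_prod_def uu power2_eq_square algebra_simps)
  have fac: "rad t * A t + (rad t)\<^sup>2 * c * B t + (rad t * B t + c * A t) * \<zeta> > 0" for t
  proof -
    have "A t > 0 \<or> B t > 0" using AB[of t] by linarith
    then have "rad t * A t + (rad t)\<^sup>2 * c * B t > 0"
      using A0[of t] B0[of t] c by (auto intro: add_pos_nonneg add_nonneg_pos)
    moreover have "(rad t * B t + c * A t) * \<zeta> \<ge> 0" using A0[of t] B0[of t] c \<zeta> by simp
    ultimately show ?thesis by linarith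
  qed
  have "f t1 0 > 0" "f t2 0 < 0" unfolding f0 using z1 z2 fac by (auto intro: mult_pos_pos mult_neg_pos)
  moreover have cf: "continuous_on UNIV (f t)" for t
    unfolding f_def mform_def by (intro continuous_intros)
  have "open ({\<epsilon>. 0 < f t1 \<epsilon>} \<inter> {\<epsilon>. f t2 \<epsilon> < 0})"
    by (intro open_Int open_Collect_less continuous_on_const cf)
  ultimately obtain d where d: "d > 0" "ball 0 d \<subseteq> {\<epsilon>. 0 < f t1 \<epsilon>} \<inter> {\<epsilon>. f t2 \<epsilon> < 0}"
    by (metis (no_types, lifting) IntI mem_Collect_eq openE)
  have "d / 2 \<in> ball 0 d" using d(1) by simp
  then have fd: "0 < f t1 (d / 2)" "f t2 (d / 2) < 0" using d(2) by blast+
  have "(- \<zeta> *\<^sub>R u, d / 2) \<in> half_space" using d(1) by (simp add: half_space_def)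
  then obtain q0 where q0: "q0 \<in> half_space" "T q0 = (- \<zeta> *\<^sub>R u, d / 2)"
    using T by (metis bij_betw_imp_surj_on imageE)
  have q0s: "G t1 q0 > 0" "G t2 q0 < 0" using fd m_sign[OF q0(1)] unfolding f_def q0(2)[symmetric] by blast+
  have "G t1 (\<gamma> t2) > 0 \<and> G t2 (\<gamma> t2) < 0"
  proof (rule connected_locally_constant_predicate[where P = "\<lambda>q. G t1 q > 0 \<and> G t2 q < 0" and S = half_space])
    have "half_space = {p :: 'a \<times> real. (0, 1) \<bullet> p > 0}" by (auto simp: half_space_def)
    moreover have "connected {p :: 'a \<times> real. (0, 1) \<bullet> p > 0}" by (rule convex_connected[OF convex_halfspace_gt])
    ultimately show "connected (half_space :: ('a \<times> real) set)" by (rule ssubst)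
    show "q0 \<in> half_space" "\<gamma> t2 \<in> half_space" "G t1 q0 > 0 \<and> G t2 q0 < 0" using q0 inH q0s by blast+
    fix x :: "'a \<times> real" assume x: "x \<in> half_space"
    have o: "open (half_space \<inter> G t -` {0<..})" "open (half_space \<inter> G t -` {..<0})" for t
      by (intro continuous_open_preimage[OF G(1) open_half_space] open_greaterThan open_lessThan)+
    consider "G t1 x > 0 \<and> G t2 x < 0" | "G t1 x < 0" | "G t2 x > 0"
    proof (cases "G t1 x = 0 \<or> G t2 x = 0")
      case True
      then show ?thesis using L1[OF x] L2[OF x] that by blast
    next
      case False
      then show ?thesis using that by (meson not_less_iff_gr_or_eq)
    qed
    then show "\<exists>W. open W \<and> x \<in> W \<and> (\<forall>y\<in>half_space \<inter> W. (G t1 y > 0 \<and> G t2 y < 0) = (G t1 x > 0 \<and> G t2 x < 0))"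
    proof cases
      case 1
      then show ?thesis using x o
        by (intro exI[of _ "(half_space \<inter> G t1 -` {0<..}) \<inter> (half_space \<inter> G t2 -` {..<0})"]) auto
    next
      case 2
      then show ?thesis using x o by (intro exI[of _ "half_space \<inter> G t1 -` {..<0}"]) auto
    next
      case 3
      then show ?thesis using x o by (intro exI[of _ "half_space \<inter> G t2 -` {0<..}"]) auto
    qed
  qed
  then show False using G_self[of t2] by simp
qed

end

lemma mform_scale: "mform c r (k * X) (k * W) p Q = k\<^sup>2 * mform c r X W p Q"
  unfolding mform_def by (simp add: power2_eq_square algebra_simps)

lemma mform_forms:
  "mform c r x 1 p Q = (r + x * c) * (x\<^sup>2 - Q) + (r\<^sup>2 - x\<^sup>2) * (p + x * c)"
  "mform c r x 1 p Q = (r + x * c) * (r\<^sup>2 - Q) + (r\<^sup>2 - x\<^sup>2) * (p - r)"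
  unfolding mform_def by (simp_all add: power2_eq_square algebra_simps)

text \<open>
  For a fixed boundary point, the quotient of the form by r + x c increases with r where p + x c is
  positive, and elsewhere the form is negative.
\<close>

lemma mform_increasing_radius_aux:
  fixes c n p x r r' :: real
  assumes c: "0 < c" and n: "0 < n" and p: "- c * n < p" and x: "0 \<le> x" and r: "0 \<le> r" "r < r'" "0 < x \<or> 0 < r"
    and m: "mform c r x 1 p (n\<^sup>2) \<ge> 0"
  shows "mform c r' x 1 p (n\<^sup>2) > 0"
proof -
  have "p + x * c > 0"
  proof (rule ccontr)
    assume "\<not> p + x * c > 0"
    then have np: "p + x * c \<le> 0" by simp
    have "x * c \<le> - p" using np by simp
    also have "- p < n * c" using p by (simp add: mult.commute)
    finally have xn: "x < n" using c by simp
    then have xn2: "x\<^sup>2 - n\<^sup>2 < 0" using x by (simp add: power_strict_mono)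
    have 1: "(r + x * c) * (x\<^sup>2 - n\<^sup>2) \<le> (x * c) * (x\<^sup>2 - n\<^sup>2)"
      using r(1) xn2 by (intro mult_right_mono_neg) auto
    have 2: "(r\<^sup>2 - x\<^sup>2) * (p + x * c) \<le> (- x\<^sup>2) * (p + x * c)"
      using np by (intro mult_right_mono_neg) auto
    show False
    proof (cases "x = 0")
      case True
      then have "r > 0" using r(3) by simp
      have "p \<le> 0" using np True by simp
      have "mform c r x 1 p (n\<^sup>2) = - (r * n\<^sup>2) + r\<^sup>2 * p" unfolding mform_forms(1) True by simp
      moreover have "r * n\<^sup>2 > 0" using \<open>r > 0\<close> n by simp
      moreover have "r\<^sup>2 * p \<le> 0" using \<open>p \<le> 0\<close> by (simp add: mult_nonneg_nonpos)
      ultimately show False using m by linarith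
    next
      case False
      then have x0: "x > 0" using x by simp
      have "mform c r x 1 p (n\<^sup>2) \<le> (x * c) * (x\<^sup>2 - n\<^sup>2) + (- x\<^sup>2) * (p + x * c)"
        unfolding mform_forms(1) using 1 2 by linarith
      also have "\<dots> = - (x * (c * n\<^sup>2 + x * p))" by (simp add: power2_eq_square algebra_simps)
      finally have le: "mform c r x 1 p (n\<^sup>2) \<le> - (x * (c * n\<^sup>2 + x * p))" .
      have "x * (- c * n) < x * p" using x0 p by (rule mult_strict_left_mono[rotated])
      moreover have "c * n\<^sup>2 + x * (- c * n) = c * n * (n - x)" by (simp add: power2_eq_square algebra_simps)
      moreover have "c * n * (n - x) \<ge> 0" using c n xn by simp
      ultimately have "c * n\<^sup>2 + x * p > 0" by linarith
      then have "x * (c * n\<^sup>2 + x * p) > 0" using x0 by simp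
      then show False using le m by linarith
    qed
  qed
  then have pc: "p + x * c > 0" .
  have d: "r + x * c > 0" using r c x by (auto intro: add_nonneg_pos add_pos_nonneg)
  have "mform c r' x 1 p (n\<^sup>2) * (r + x * c) - mform c r x 1 p (n\<^sup>2) * (r' + x * c)
      = (p + x * c) * ((r' - r) * (r * r' + x * c * (r + r') + x\<^sup>2))"
    unfolding mform_forms(1) by (simp add: power2_eq_square algebra_simps)
  moreover have "r * r' + x * c * (r + r') + x\<^sup>2 > 0"
  proof -
    have "r * r' \<ge> 0" "x * c * (r + r') \<ge> 0" "x\<^sup>2 \<ge> 0" using r c x by simp_all
    moreover have "r * r' > 0 \<or> x\<^sup>2 > 0" using r by auto
    ultimately show ?thesis by linarith
  qed
  then have "(p + x * c) * ((r' - r) * (r * r' + x * c * (r + r') + x\<^sup>2)) > 0" using pc r(2) by simp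
  moreover have "mform c r x 1 p (n\<^sup>2) * (r' + x * c) \<ge> 0" using m d r(2) by simp
  ultimately have "mform c r' x 1 p (n\<^sup>2) * (r + x * c) > 0" by linarith
  then show ?thesis using d by (simp add: zero_less_mult_iff)
qed

lemma mform_increasing_radius:
  assumes c: "0 < c" and n: "0 < n" and p: "- c * n < p" and XW: "0 \<le> X" "0 \<le> W"
    and r: "0 \<le> r" "r < r'" "0 < X \<or> (0 < r \<and> 0 < W)" and m: "mform c r X W p (n\<^sup>2) \<ge> 0"
  shows "mform c r' X W p (n\<^sup>2) > 0"
proof (cases "W = 0")
  case True
  then have X: "X > 0" using r(3) by simp
  have e: "mform c r X W p (n\<^sup>2) = X\<^sup>2 * (r - p)" for r by (simp add: mform_def True algebra_simps)
  have "r - p \<ge> 0" using m X unfolding e by (simp add: zero_le_mult_iff)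
  then show ?thesis unfolding e using X r(2) by simp
next
  case False
  then have W: "W > 0" using XW by simp
  have e: "mform c r X W p (n\<^sup>2) = W\<^sup>2 * mform c r (X / W) 1 p (n\<^sup>2)" for r
    using mform_scale[of c r W "X / W" 1] W by simp
  have "mform c r (X / W) 1 p (n\<^sup>2) \<ge> 0" using m W unfolding e by (simp add: zero_le_mult_iff)
  moreover have "0 < X / W \<or> 0 < r" "0 \<le> X / W" using r(3) W XW by auto
  ultimately have "mform c r' (X / W) 1 p (n\<^sup>2) > 0"
    using mform_increasing_radius_aux[OF c n p _ r(1,2)] by blast
  then show ?thesis unfolding e using W by simp
qed

text \<open>
  For fixed r, the quotient of the form by r + x c does not decrease with x where p < r, and elsewhere
  the form is not positive.
\<close>

lemma mform_increasing_boundary: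
  assumes c: "0 < c" and n: "0 < n" and p: "p \<le> n" and XW: "0 \<le> X" "0 \<le> W" "0 < X \<or> 0 < W"
    and XW': "0 \<le> X'" "0 \<le> W'" "0 < X' \<or> 0 < W'" and le: "X * W' \<le> X' * W"
    and r: "0 < r" and m: "mform c r X W p (n\<^sup>2) > 0"
  shows "mform c r X' W' p (n\<^sup>2) > 0"
proof -
  have e0: "mform c r X 0 p (n\<^sup>2) = X\<^sup>2 * (r - p)" for X by (simp add: mform_def algebra_simps)
  have e: "mform c r X W p (n\<^sup>2) = W\<^sup>2 * mform c r (X / W) 1 p (n\<^sup>2)" if "W > 0" for X W
    using mform_scale[of c r W "X / W" 1] that by simp
  have pr: "p < r"
  proof (rule ccontr)
    assume "\<not> p < r"
    then have rp: "r \<le> p" by simp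
    show False
    proof (cases "W = 0")
      case True
      have "X\<^sup>2 * (r - p) \<le> 0" using rp by (simp add: mult_nonneg_nonpos)
      then show False using m e0 True by simp
    next
      case False
      then have W: "W > 0" using XW by simp
      define x where "x = X / W"
      have x: "x \<ge> 0" using XW W by (simp add: x_def)
      have "r * p \<le> p * p" using rp r by (intro mult_right_mono) auto
      also have "p * p \<le> n * n" using p rp r by (intro mult_mono) auto
      finally have pn: "r * p \<le> n\<^sup>2" by (simp add: power2_eq_square)
      have "r * r \<le> n * n" using rp p r by (intro mult_mono) auto
      then have rn: "r\<^sup>2 - n\<^sup>2 \<le> 0" by (simp add: power2_eq_square)
      have 1: "(r + x * c) * (r\<^sup>2 - n\<^sup>2) \<le> r * (r\<^sup>2 - n\<^sup>2)"
        using rn x c by (intro mult_right_mono_neg) auto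
      have 2: "(r\<^sup>2 - x\<^sup>2) * (p - r) \<le> r\<^sup>2 * (p - r)" using rp by (intro mult_right_mono) auto
      have "mform c r x 1 p (n\<^sup>2) \<le> r * (r\<^sup>2 - n\<^sup>2) + r\<^sup>2 * (p - r)" unfolding mform_forms(2) using 1 2 by linarith
      also have "\<dots> = r * (r * p - n\<^sup>2)" by (simp add: power2_eq_square algebra_simps)
      also have "\<dots> \<le> 0" using pn r by (simp add: mult_nonneg_nonpos)
      finally have "W\<^sup>2 * mform c r x 1 p (n\<^sup>2) \<le> 0" by (simp add: mult_nonneg_nonpos)
      then show False using m e[OF W] by (simp add: x_def)
    qed
  qed
  show ?thesis
  proof (cases "W' = 0")
    case True
    then have "X' > 0" using XW' by simp
    then show ?thesis using e0 True pr by simp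
  next
    case False
    then have W': "W' > 0" using XW' by simp
    have W: "W > 0"
    proof (rule ccontr)
      assume "\<not> W > 0"
      then have "W = 0" "X > 0" using XW by auto
      then have "X * W' > 0" "X' * W = 0" using W' by auto
      then show False using le by linarith
    qed
    define x where "x = X / W"
    define x' where "x' = X' / W'"
    have x: "x \<ge> 0" "x \<le> x'" using XW W W' le by (simp_all add: x_def x'_def field_simps)
    have mx: "mform c r x 1 p (n\<^sup>2) > 0" using m W unfolding e[OF W] by (simp add: x_def zero_less_mult_iff)
    have d: "r + x * c > 0" "r + x' * c > 0" using r x c by (auto intro: add_pos_nonneg)
    have "mform c r x' 1 p (n\<^sup>2) * (r + x * c) - mform c r x 1 p (n\<^sup>2) * (r + x' * c)
        = (r - p) * ((x' - x) * (r\<^sup>2 * c + r * (x + x') + x * x' * c))"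
      unfolding mform_forms(2) by (simp add: power2_eq_square algebra_simps)
    moreover have "(r - p) * ((x' - x) * (r\<^sup>2 * c + r * (x + x') + x * x' * c)) \<ge> 0"
      using pr x r c by (intro mult_nonneg_nonneg add_nonneg_nonneg) auto
    moreover have "mform c r x 1 p (n\<^sup>2) * (r + x' * c) > 0" using mx d(2) by simp
    ultimately have "mform c r x' 1 p (n\<^sup>2) * (r + x * c) > 0" by linarith
    then have "mform c r x' 1 p (n\<^sup>2) > 0" using d(1) by (simp add: zero_less_mult_iff)
    then show ?thesis unfolding e[OF W'] using W' by (simp add: x'_def)
  qed
qed

text \<open>
  Both parameters in the closed unit interval: r = \<rho> / (1 - \<rho>) and X / W = \<xi> / (1 - \<xi>). The inversion in
  the unit sphere exchanges \<rho> and \<xi> with their complements.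
\<close>

definition bform :: "real \<Rightarrow> real \<Rightarrow> real \<Rightarrow> real \<Rightarrow> real \<Rightarrow> real" where
  "bform c \<rho> \<xi> p Q = \<rho> * (1 - \<rho>) * \<xi>\<^sup>2 + \<rho>\<^sup>2 * c * \<xi> * (1 - \<xi>) + (\<rho>\<^sup>2 * (1 - \<xi>)\<^sup>2 - (1 - \<rho>)\<^sup>2 * \<xi>\<^sup>2) * p
     - (\<rho> * (1 - \<rho>) * (1 - \<xi>)\<^sup>2 + (1 - \<rho>)\<^sup>2 * c * \<xi> * (1 - \<xi>)) * Q"

lemma bform_mform:
  assumes "\<rho> \<noteq> 1"
  shows "bform c \<rho> \<xi> p Q = (1 - \<rho>)\<^sup>2 * mform c (\<rho> / (1 - \<rho>)) \<xi> (1 - \<xi>) p Q"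
proof -
  define k where "k = 1 - \<rho>"
  have k: "k \<noteq> 0" using assms by (simp add: k_def)
  show ?thesis unfolding bform_def mform_def k_def[symmetric] using k
    by (simp add: field_simps power2_eq_square)
qed

lemma bform_inversion:
  assumes "Q \<noteq> 0"
  shows "Q * bform c (1 - \<rho>) (1 - \<xi>) (p / Q) (1 / Q) = - bform c \<rho> \<xi> p Q"
  unfolding bform_def using assms by (simp add: field_simps power2_eq_square)

text \<open>
  Enlarge first the radius, which makes the value positive, and then the boundary point, which keeps it
  positive. The end \<rho> = 1 is reduced to the end \<rho> = 0 by the inversion.
\<close>

lemma bform_order:
  assumes c: "0 < c" and n: "0 < n" and p: "- c * n < p" "p \<le> n"
    and \<rho>: "0 \<le> \<rho>" "\<rho> < \<rho>'" "\<rho>' \<le> 1" and \<xi>: "0 \<le> \<xi>" "\<xi> \<le> \<xi>'" "\<xi>' \<le> 1"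
    and nz: "\<not> (\<rho> = 0 \<and> \<xi> = 0)" "\<not> (\<rho>' = 1 \<and> \<xi>' = 1)"
    and m: "bform c \<rho> \<xi> p (n\<^sup>2) \<ge> 0"
  shows "bform c \<rho>' \<xi>' p (n\<^sup>2) > 0"
proof -
  have fin: "bform c \<rho>' \<xi>' p (n\<^sup>2) > 0"
    if n: "0 < n" and p: "- c * n < p" "p \<le> n" and \<rho>: "0 \<le> \<rho>" "\<rho> < \<rho>'" "\<rho>' < 1" and \<xi>: "0 \<le> \<xi>" "\<xi> \<le> \<xi>'" "\<xi>' \<le> 1"
      and nz: "\<not> (\<rho> = 0 \<and> \<xi> = 0)" and m: "bform c \<rho> \<xi> p (n\<^sup>2) \<ge> 0" for n p \<rho> \<rho>' \<xi> \<xi>' :: real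
  proof -
    define r where "r = \<rho> / (1 - \<rho>)"
    define r' where "r' = \<rho>' / (1 - \<rho>')"
    have r: "0 \<le> r" "r < r'" using \<rho> by (simp_all add: r_def r'_def field_simps)
    have "mform c r \<xi> (1 - \<xi>) p (n\<^sup>2) \<ge> 0"
      using m \<rho> unfolding r_def bform_mform[of \<rho>, OF less_imp_neq[OF less_trans[OF \<rho>(2,3)]]]
      by (simp add: zero_le_mult_iff)
    moreover have "0 < \<xi> \<or> (0 < r \<and> 0 < 1 - \<xi>)"
      using nz \<xi> \<rho> by (cases "\<xi> = 0") (auto simp: r_def)
    ultimately have "mform c r' \<xi> (1 - \<xi>) p (n\<^sup>2) > 0"
      using \<xi> by (intro mform_increasing_radius[OF c n p(1) _ _ r]) auto
    moreover have "\<xi> * (1 - \<xi>') \<le> \<xi>' * (1 - \<xi>)" using \<xi>(2) by (simp add: algebra_simps)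
    moreover have "0 \<le> 1 - \<xi>" "0 < \<xi> \<or> 0 < 1 - \<xi>" "0 \<le> \<xi>'" "0 \<le> 1 - \<xi>'" "0 < \<xi>' \<or> 0 < 1 - \<xi>'" "0 < r'"
      using \<xi> r by linarith+
    ultimately have "mform c r' \<xi>' (1 - \<xi>') p (n\<^sup>2) > 0"
      using mform_increasing_boundary[OF c n p(2) \<xi>(1)] by blast
    then show ?thesis
      using \<rho>(3) unfolding r'_def bform_mform[of \<rho>', OF less_imp_neq[OF \<rho>(3)]] by simp
  qed
  have inf: "bform c 1 \<xi>' p (n\<^sup>2) > 0"
    if "0 < \<rho>" "\<rho> < 1" "0 \<le> \<xi>" "\<xi> \<le> \<xi>'" "\<xi>' < 1" "bform c \<rho> \<xi> p (n\<^sup>2) \<ge> 0" for \<rho> \<xi>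
  proof (rule ccontr)
    assume "\<not> bform c 1 \<xi>' p (n\<^sup>2) > 0"
    then have "- bform c 1 \<xi>' p (n\<^sup>2) \<ge> 0" by simp
    have n2: "n\<^sup>2 \<noteq> 0" "n\<^sup>2 > 0" using n by simp_all
    have q: "1 / n\<^sup>2 = (1 / n)\<^sup>2" by (simp add: power_divide)
    have "n\<^sup>2 * bform c 0 (1 - \<xi>') (p / n\<^sup>2) ((1 / n)\<^sup>2) \<ge> 0"
      using bform_inversion[OF n2(1), of c 1 \<xi>' p] \<open>- bform c 1 \<xi>' p (n\<^sup>2) \<ge> 0\<close> unfolding q by simp
    then have "bform c 0 (1 - \<xi>') (p / n\<^sup>2) ((1 / n)\<^sup>2) \<ge> 0" using n2 by (simp add: zero_le_mult_iff)
    moreover have "- c * (1 / n) < p / n\<^sup>2" "p / n\<^sup>2 \<le> 1 / n"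
      using p n by (simp_all add: field_simps power2_eq_square)
    ultimately have "bform c (1 - \<rho>) (1 - \<xi>) (p / n\<^sup>2) ((1 / n)\<^sup>2) > 0"
      using that n by (intro fin[of "1 / n" "p / n\<^sup>2" 0 "1 - \<rho>" "1 - \<xi>'" "1 - \<xi>"]) auto
    then have "- bform c \<rho> \<xi> p (n\<^sup>2) > 0"
      using bform_inversion[OF n2(1), of c \<rho> \<xi> p] n2 unfolding q by (metis mult_pos_pos)
    then show False using that(6) by simp
  qed
  show ?thesis
  proof (cases "\<rho>' < 1")
    case True
    then show ?thesis using fin[OF n p \<rho>(1,2) True \<xi> nz(1) m] by blast
  next
    case False
    then have 1: "\<rho>' = 1" "\<xi>' < 1" using \<rho> nz \<xi> by auto
    show ?thesis
    proof (cases "\<rho> = 0")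
      case True
      have "bform c (1 / 2) \<xi> p (n\<^sup>2) > 0"
        using fin[OF n p, of 0 "1 / 2" \<xi> \<xi>] \<xi> nz(1) m True by auto
      then show ?thesis using inf[of "1 / 2" \<xi>] \<xi> 1 by simp
    next
      case False
      then show ?thesis using inf[of \<rho> \<xi>] \<rho> \<xi> 1 m by auto
    qed
  qed
qed

text \<open>Near the origin of the ray, every point lies on the far side.\<close>

lemma bform_negative:
  assumes c: "0 < c" "c < 1" and n: "0 < n" and p: "- c * n < p" "p \<le> n"
    and \<rho>: "0 < \<rho>" "\<rho> < 1 / 2" and \<xi>: "0 \<le> \<xi>" "\<xi> < 1 / 2" and small: "2 * \<xi> + \<rho> * n < n\<^sup>2 / 8" "\<xi> < n / 8"
  shows "bform c \<rho> \<xi> p (n\<^sup>2) < 0"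
proof -
  have 1: "\<rho> * (1 - \<rho>) * \<xi>\<^sup>2 \<le> \<rho> * \<xi>"
  proof -
    have "(1 - \<rho>) * \<xi>\<^sup>2 \<le> 1 * \<xi>"
      using \<rho> \<xi> by (intro mult_mono) (auto simp: power2_eq_square mult_left_le_one_le)
    then have "\<rho> * ((1 - \<rho>) * \<xi>\<^sup>2) \<le> \<rho> * (1 * \<xi>)" using \<rho> by (intro mult_left_mono) auto
    then show ?thesis by (simp add: mult.assoc)
  qed
  have 2: "\<rho>\<^sup>2 * c * \<xi> * (1 - \<xi>) \<le> \<rho> * \<xi>"
  proof -
    have a: "\<rho>\<^sup>2 * c \<le> \<rho> * 1" unfolding power2_eq_square mult.assoc
      using \<rho> c mult_mono[of \<rho> 1 c 1] by (intro mult_left_mono) auto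
    have "(\<rho>\<^sup>2 * c) * (\<xi> * (1 - \<xi>)) \<le> (\<rho> * 1) * (\<xi> * 1)"
      using \<rho> \<xi> by (intro mult_mono[OF a] mult_left_mono mult_nonneg_nonneg) auto
    then show ?thesis by (simp add: mult.assoc)
  qed
  have 3: "(\<rho>\<^sup>2 * (1 - \<xi>)\<^sup>2) * p \<le> \<rho>\<^sup>2 * n"
  proof -
    have "(1 - \<xi>)\<^sup>2 \<le> 1" using \<xi> by (simp add: power_le_one)
    have "(\<rho>\<^sup>2 * (1 - \<xi>)\<^sup>2) * p \<le> (\<rho>\<^sup>2 * (1 - \<xi>)\<^sup>2) * n" using p by (intro mult_left_mono) auto
    also have "\<dots> \<le> (\<rho>\<^sup>2 * 1) * n" using \<open>(1 - \<xi>)\<^sup>2 \<le> 1\<close> n by (intro mult_right_mono mult_left_mono) auto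
    finally show ?thesis by simp
  qed
  have 4: "- ((1 - \<rho>)\<^sup>2 * \<xi>\<^sup>2) * p \<le> \<xi>\<^sup>2 * (c * n)"
  proof -
    have "(1 - \<rho>)\<^sup>2 \<le> 1" using \<rho> by (simp add: power_le_one)
    have "((1 - \<rho>)\<^sup>2 * \<xi>\<^sup>2) * (- p) \<le> ((1 - \<rho>)\<^sup>2 * \<xi>\<^sup>2) * (c * n)" using p by (intro mult_left_mono) auto
    also have "\<dots> \<le> (1 * \<xi>\<^sup>2) * (c * n)" using \<open>(1 - \<rho>)\<^sup>2 \<le> 1\<close> c n by (intro mult_right_mono) auto
    finally show ?thesis by simp
  qed
  have 5: "\<rho> * (n\<^sup>2 / 8) \<le> \<rho> * (1 - \<rho>) * (1 - \<xi>)\<^sup>2 * n\<^sup>2"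
  proof -
    have "(1 / 2) * (1 / 2)\<^sup>2 \<le> (1 - \<rho>) * (1 - \<xi>)\<^sup>2"
      using \<rho> \<xi> by (intro mult_mono power_mono) auto
    then have "(1 / 8) * n\<^sup>2 \<le> ((1 - \<rho>) * (1 - \<xi>)\<^sup>2) * n\<^sup>2" by (intro mult_right_mono) (auto simp: power2_eq_square)
    then have "\<rho> * ((1 / 8) * n\<^sup>2) \<le> \<rho> * (((1 - \<rho>) * (1 - \<xi>)\<^sup>2) * n\<^sup>2)" using \<rho> by (intro mult_left_mono) auto
    then show ?thesis by (simp add: mult.assoc)
  qed
  have 6: "c * \<xi> * (n\<^sup>2 / 8) \<le> (1 - \<rho>)\<^sup>2 * c * \<xi> * (1 - \<xi>) * n\<^sup>2"
  proof -
    have "(1 / 2)\<^sup>2 * (1 / 2) \<le> (1 - \<rho>)\<^sup>2 * (1 - \<xi>)"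
      using \<rho> \<xi> by (intro mult_mono power_mono) auto
    then have "(c * \<xi> * n\<^sup>2) * (1 / 8) \<le> (c * \<xi> * n\<^sup>2) * ((1 - \<rho>)\<^sup>2 * (1 - \<xi>))"
      using c \<xi> by (intro mult_left_mono) (auto simp: power2_eq_square)
    then show ?thesis by (simp add: mult.assoc mult.left_commute mult.commute)
  qed
  have "bform c \<rho> \<xi> p (n\<^sup>2) \<le> \<rho> * (2 * \<xi> + \<rho> * n - n\<^sup>2 / 8) + c * \<xi> * (n * (\<xi> - n / 8))"
    using 1 2 3 4 5 6 unfolding bform_def by (simp add: algebra_simps power2_eq_square)
  moreover have "\<rho> * (2 * \<xi> + \<rho> * n - n\<^sup>2 / 8) < 0" using \<rho> small by (simp add: mult_pos_neg)
  moreover have "c * \<xi> * (n * (\<xi> - n / 8)) \<le> 0" using c \<xi> n small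
    by (intro mult_nonneg_nonpos) (auto intro: mult_nonneg_nonpos)
  ultimately show ?thesis by linarith
qed

text \<open>
  By monotonicity, the infimum and the supremum of the values are the one-sided limits at the ends.
\<close>

lemma monotone_extension:
  fixes f :: "real \<Rightarrow> real"
  assumes cont: "continuous_on {0<..<1} f" and mono: "\<And>x y. 0 < x \<Longrightarrow> x \<le> y \<Longrightarrow> y < 1 \<Longrightarrow> f x \<le> f y"
    and range: "\<And>x. 0 < x \<Longrightarrow> x < 1 \<Longrightarrow> 0 \<le> f x \<and> f x \<le> 1"
  obtains g where "continuous_on UNIV g" "\<And>x y. x \<le> y \<Longrightarrow> g x \<le> g y"
    "\<And>x. 0 < x \<Longrightarrow> x < 1 \<Longrightarrow> g x = f x" "\<And>x. 0 \<le> g x \<and> g x \<le> 1"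
    "\<And>x. x \<le> 0 \<Longrightarrow> g x = g 0" "\<And>x. 1 \<le> x \<Longrightarrow> g x = g 1"
proof -
  let ?I = "{0<..<1::real}"
  define l where "l = Inf (f ` ?I)"
  define u where "u = Sup (f ` ?I)"
  have ne: "f ` ?I \<noteq> {}" by auto
  have bb: "bdd_below (f ` ?I)" "bdd_above (f ` ?I)"
    using range by (auto intro!: bdd_belowI[of _ 0] bdd_aboveI[of _ 1])
  have lf: "l \<le> f x" and fu: "f x \<le> u" if "0 < x" "x < 1" for x
    unfolding l_def u_def using that bb by (auto intro!: cInf_lower cSup_upper)
  have l: "0 \<le> l" unfolding l_def using ne range by (intro cInf_greatest) auto
  have u: "u \<le> 1" unfolding u_def using ne range by (intro cSup_least) auto
  have lu: "l \<le> u" using lf[of "1/2"] fu[of "1/2"] by simp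
  define g where "g = (\<lambda>x. if x \<le> 0 then l else if 1 \<le> x then u else f x)"
  have gm: "g x \<le> g y" if "x \<le> y" for x y
    using that lf[of y] fu[of x] lu mono[of x y] by (auto simp: g_def)
  have cts: "isCont g x" if H: "\<And>e. 0 < e \<Longrightarrow> \<exists>a b. a < x \<and> x < b \<and> g b < g x + e \<and> g x - e < g a" for x
    unfolding isCont_def
  proof (rule tendstoI)
    fix e :: real assume "0 < e"
    then obtain a b where ab: "a < x" "x < b" "g b < g x + e" "g x - e < g a" using H by blast
    have "eventually (\<lambda>z. z \<in> {a<..<b}) (at x)"
      using ab by (intro eventually_at_in_open') auto
    then show "eventually (\<lambda>z. dist (g z) (g x) < e) (at x)"
    proof eventually_elim
      case (elim z)
      then have "g a \<le> g z" "g z \<le> g b" using gm by simp_all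
      then show ?case using ab by (simp add: dist_real_def)
    qed
  qed
  have "isCont g x" for x
  proof -
    consider "x < 0" | "x = 0" | "0 < x" "x < 1" | "x = 1" | "1 < x" by linarith
    then show ?thesis
    proof cases
      case 1
      show ?thesis by (rule cts, rule exI[of _ "x - 1"], rule exI[of _ 0]) (use 1 in \<open>simp add: g_def\<close>)
    next
      case 2
      show ?thesis
      proof (rule cts)
        fix e :: real assume "0 < e"
        then obtain y where "y \<in> ?I" "f y < l + e"
          using cInf_lessD[OF ne, of "l + e"] unfolding l_def[symmetric] by auto
        then show "\<exists>a b. a < x \<and> x < b \<and> g b < g x + e \<and> g x - e < g a"
          by (intro exI[of _ "- 1"] exI[of _ y]) (use 2 \<open>0 < e\<close> in \<open>auto simp: g_def\<close>)
      qed
    next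
      case 3
      have "isCont f x" using cont 3 by (simp add: continuous_on_eq_continuous_at)
      moreover have "eventually (\<lambda>z. g z = f z) (nhds x)"
      proof -
        have "eventually (\<lambda>z. z \<in> ?I) (nhds x)" using 3 by (intro eventually_nhds_in_open) auto
        then show ?thesis by eventually_elim (auto simp: g_def)
      qed
      ultimately show ?thesis by (simp add: isCont_cong)
    next
      case 4
      show ?thesis
      proof (rule cts)
        fix e :: real assume "0 < e"
        then obtain y where "y \<in> ?I" "u - e < f y"
          using less_cSupD[OF ne, of "u - e"] unfolding u_def[symmetric] by auto
        then show "\<exists>a b. a < x \<and> x < b \<and> g b < g x + e \<and> g x - e < g a"
          by (intro exI[of _ y] exI[of _ 2]) (use 4 \<open>0 < e\<close> in \<open>auto simp: g_def\<close>)
      qed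
    next
      case 5
      show ?thesis by (rule cts, rule exI[of _ 1], rule exI[of _ "x + 1"]) (use 5 in \<open>simp add: g_def\<close>)
    qed
  qed
  then have "continuous_on UNIV g" by (simp add: continuous_at_imp_continuous_on)
  moreover have "0 \<le> g x \<and> g x \<le> 1" for x using l u lu range[of x] by (auto simp: g_def)
  ultimately show ?thesis using that[of g] gm by (simp add: g_def)
qed

section \<open>Foliations from one-parameter families of hyperspheres\<close>

lemma reflection_to:
  fixes \<nu> e :: "'b::real_inner"
  assumes "norm \<nu> = 1" "norm e = 1"
  obtains R :: "'b \<Rightarrow> 'b" where "bounded_linear R" "\<And>v. R (R v) = v" "R e = \<nu>"
proof -
  define w where "w = \<nu> - e"
  define R where "R = (\<lambda>v. v - (2 * (v \<bullet> w) / (w \<bullet> w)) *\<^sub>R w)"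
  have lin: "bounded_linear R"
    unfolding R_def by (intro bounded_linear_sub bounded_linear_ident bounded_linear_scaleR_const)
      (simp add: bounded_linear_divide[THEN bounded_linear_compose] bounded_linear_mult_right[THEN bounded_linear_compose] bounded_linear_inner_left)
  have inv: "R (R v) = v" for v
  proof (cases "w = 0")
    case False
    then show ?thesis by (simp add: R_def inner_diff_left algebra_simps flip: scaleR_add_left)
  qed (simp add: R_def)
  have "R e = \<nu>"
  proof (cases "w = 0")
    case True
    then show ?thesis by (simp add: R_def w_def)
  next
    case False
    have "w \<bullet> w = - 2 * (e \<bullet> w)"
      using assms by (simp add: w_def norm_eq_1 inner_diff_left inner_diff_right inner_commute)
    moreover have "w \<bullet> w \<noteq> 0" using False by simp
    ultimately have "2 * (e \<bullet> w) / (w \<bullet> w) = - 1" by (simp add: divide_eq_eq)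
    then show ?thesis by (simp add: R_def w_def)
  qed
  then show ?thesis using that lin inv by blast
qed

lemma qc_expand: "qc D q = fst D * (q \<bullet> q) + fst (snd D) \<bullet> q + snd (snd D)"
  by (simp add: qc_def quadric_def)

lemma qc_step:
  "qc D (q + \<epsilon> *\<^sub>R \<nu>) - qc D q = \<epsilon> * (((2 * fst D) *\<^sub>R (q + (\<epsilon> / 2) *\<^sub>R \<nu>) + fst (snd D)) \<bullet> \<nu>)"
  by (simp add: qc_expand inner_add_left inner_add_right inner_commute algebra_simps)

text \<open>In the chart the plaque is a slice of a convex set.\<close>

lemma homeomorphic_plaque:
  fixes f :: "'b::real_normed_vector \<Rightarrow> 'c::euclidean_space \<times> real"
  assumes hom: "homeomorphism U V f g" and V: "convex V" and q: "q \<in> U"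
  shows "path_component_set {x \<in> U. snd (f x) = snd (f q)} q = {x \<in> U. snd (f x) = snd (f q)}"
proof -
  let ?S = "{x \<in> U. snd (f x) = snd (f q)}"
  let ?P = "V \<inter> {y. snd y = snd (f q)}"
  have fg: "f ` U = V" "g ` V = U" "\<And>x. x \<in> U \<Longrightarrow> g (f x) = x" "\<And>y. y \<in> V \<Longrightarrow> f (g y) = y" "continuous_on V g"
    using hom by (auto simp: homeomorphism_def)
  have S: "?S = g ` ?P"
  proof
    show "?S \<subseteq> g ` ?P"
    proof
      fix x assume x: "x \<in> ?S"
      then have "f x \<in> ?P" using fg(1) by blast
      moreover have "x = g (f x)" using fg(3) x by simp
      ultimately show "x \<in> g ` ?P" by blast
    qed
    show "g ` ?P \<subseteq> ?S" using fg by auto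
  qed
  have "convex {y :: 'c \<times> real. snd y = snd (f q)}"
    by (auto simp: convex_def simp flip: distrib_right)
  then have "path_connected ?P" using V by (intro convex_imp_path_connected convex_Int)
  then have "path_connected ?S"
    unfolding S using fg(5) by (intro path_connected_continuous_image) (auto intro: continuous_on_subset)
  then show ?thesis using q unfolding path_connected_component_set by blast
qed

text \<open>
  The strict change of sign at \<tau> q makes the members of the family disjoint and the parameter \<tau>
  continuous.
\<close>

locale hypersphere_family =
  fixes I :: "real set" and C :: "real \<Rightarrow> real \<times> ('a::euclidean_space \<times> real) \<times> real" and \<tau> :: "'a \<times> real \<Rightarrow> real"
  assumes I: "open I" and C: "continuous_on I C" and sp: "\<And>a. a \<in> I \<Longrightarrow> spacelike_coeffs (C a)"
    and \<tau>I: "\<And>q. q \<in> half_space \<Longrightarrow> \<tau> q \<in> I"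
    and qc: "\<And>q. q \<in> half_space \<Longrightarrow> qc (C (\<tau> q)) q = 0"
      "\<And>q a. q \<in> half_space \<Longrightarrow> a \<in> I \<Longrightarrow> a < \<tau> q \<Longrightarrow> qc (C a) q < 0"
      "\<And>q a. q \<in> half_space \<Longrightarrow> a \<in> I \<Longrightarrow> \<tau> q < a \<Longrightarrow> 0 < qc (C a) q"
begin

abbreviation leaf :: "real \<Rightarrow> ('a \<times> real) set" where
  "leaf a \<equiv> {q \<in> half_space. qc (C a) q = 0}"

lemma less_\<tau>: "q \<in> half_space \<Longrightarrow> a \<in> I \<Longrightarrow> a < \<tau> q \<longleftrightarrow> qc (C a) q < 0"
  and \<tau>_less: "q \<in> half_space \<Longrightarrow> a \<in> I \<Longrightarrow> \<tau> q < a \<longleftrightarrow> 0 < qc (C a) q"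
  and \<tau>_eq: "q \<in> half_space \<Longrightarrow> a \<in> I \<Longrightarrow> \<tau> q = a \<longleftrightarrow> qc (C a) q = 0"
proof -
  have *: "(a < \<tau> q \<longleftrightarrow> qc (C a) q < 0) \<and> (\<tau> q < a \<longleftrightarrow> 0 < qc (C a) q) \<and> (\<tau> q = a \<longleftrightarrow> qc (C a) q = 0)"
    if "q \<in> half_space" "a \<in> I" for q a
  proof (cases a "\<tau> q" rule: linorder_cases)
    case less
    then show ?thesis using qc(2)[OF that] by simp
  next
    case equal
    then show ?thesis using qc(1)[OF that(1)] by simp
  next
    case greater
    then show ?thesis using qc(3)[OF that] by simp
  qed
  show "q \<in> half_space \<Longrightarrow> a \<in> I \<Longrightarrow> a < \<tau> q \<longleftrightarrow> qc (C a) q < 0"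
    "q \<in> half_space \<Longrightarrow> a \<in> I \<Longrightarrow> \<tau> q < a \<longleftrightarrow> 0 < qc (C a) q"
    "q \<in> half_space \<Longrightarrow> a \<in> I \<Longrightarrow> \<tau> q = a \<longleftrightarrow> qc (C a) q = 0"
    using * by blast+
qed

text \<open>
  The points between the members with parameters \<tau> q - k and \<tau> q + k form an open set.
\<close>

lemma continuous_\<tau>: "continuous_on half_space \<tau>"
  unfolding continuous_on_iff
proof (intro ballI allI impI)
  fix q :: "'a \<times> real" and e :: real assume q: "q \<in> half_space" and e: "0 < e"
  obtain d where d: "d > 0" "ball (\<tau> q) d \<subseteq> I" using I \<tau>I[OF q] openE by blast
  define k where "k = min e d / 2"
  have k: "k > 0" "k < e" "k < d" using e d by (auto simp: k_def)
  have I2: "\<tau> q - k \<in> I" "\<tau> q + k \<in> I" using k d(2) by (auto simp: subset_iff dist_real_def)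
  have n: "qc (C (\<tau> q - k)) q < 0" "0 < qc (C (\<tau> q + k)) q" using qc(2,3)[OF q] I2 k by simp_all
  have cts: "continuous_on UNIV (qc D)" for D :: "real \<times> ('a \<times> real) \<times> real"
    unfolding qc_def by (rule continuous_on_quadric)
  have "open ({x. qc (C (\<tau> q - k)) x < 0} \<inter> {x. 0 < qc (C (\<tau> q + k)) x})"
    by (intro open_Int open_Collect_less continuous_on_const cts)
  moreover have "q \<in> {x. qc (C (\<tau> q - k)) x < 0} \<inter> {x. 0 < qc (C (\<tau> q + k)) x}" using n by blast
  ultimately obtain r where r: "r > 0" "ball q r \<subseteq> {x. qc (C (\<tau> q - k)) x < 0} \<inter> {x. 0 < qc (C (\<tau> q + k)) x}"
    by (rule openE)
  show "\<exists>r>0. \<forall>x\<in>half_space. dist x q < r \<longrightarrow> dist (\<tau> x) (\<tau> q) < e"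
  proof (intro exI conjI ballI impI)
    show "r > 0" by (rule r(1))
    fix x assume x: "x \<in> half_space" "dist x q < r"
    then have "x \<in> ball q r" by (simp add: dist_commute)
    then have "\<tau> q - k < \<tau> x" "\<tau> x < \<tau> q + k"
      using r(2) less_\<tau>[OF x(1) I2(1)] \<tau>_less[OF x(1) I2(2)] by blast+
    then show "dist (\<tau> x) (\<tau> q) < e" using k by (auto simp: dist_real_def)
  qed
qed

lemma leaf_discriminant:
  assumes "a \<in> I" "q \<in> half_space" "qc (C a) q = 0"
  shows "fst (snd (C a)) \<bullet> fst (snd (C a)) - 4 * fst (C a) * snd (snd (C a)) > 0"
  by (rule spacelike_discriminant[OF sp[OF assms(1), unfolded spacelike_coeffs_def] assms(2) assms(3)[unfolded qc_def]])

text \<open>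
  On a small ball the parameter decreases strictly in the direction of the normal at the center, so
  that the parameter and the projection along this normal form a chart.
\<close>

lemma transverse_direction:
  assumes p: "p \<in> half_space"
  obtains \<nu> e where "norm \<nu> = 1" "e > 0" "ball p e \<subseteq> half_space"
    "\<And>q \<epsilon>. q \<in> ball p e \<Longrightarrow> q + \<epsilon> *\<^sub>R \<nu> \<in> ball p e \<Longrightarrow> \<epsilon> > 0 \<Longrightarrow> \<tau> (q + \<epsilon> *\<^sub>R \<nu>) < \<tau> q"
proof -
  define g where "g = (\<lambda>a q. (2 * fst (C a)) *\<^sub>R q + fst (snd (C a)))"
  let ?n = "g (\<tau> p) p"
  have "?n \<bullet> ?n > 0"
    using leaf_discriminant[OF \<tau>I[OF p] p qc(1)[OF p]] qc(1)[OF p]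
    unfolding g_def qc_def quadric_gradient_norm[of _ _ _ "snd (snd (C (\<tau> p)))"] by simp
  then have n: "?n \<noteq> 0" by auto
  define \<nu> where "\<nu> = (1 / norm ?n) *\<^sub>R ?n"
  have \<nu>: "norm \<nu> = 1" using n by (simp add: \<nu>_def)
  have pos: "g (\<tau> p) p \<bullet> \<nu> > 0" using \<open>?n \<bullet> ?n > 0\<close> n by (simp add: \<nu>_def)
  have "continuous_on (half_space \<times> half_space) (\<lambda>z. g (\<tau> (fst z)) (snd z) \<bullet> \<nu>)"
  proof -
    have "continuous_on (half_space \<times> half_space) (\<lambda>z. \<tau> (fst z))"
      by (rule continuous_on_compose2[OF continuous_\<tau>]) (auto intro!: continuous_intros)
    then have "continuous_on (half_space \<times> half_space) (\<lambda>z. C (\<tau> (fst z)))"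
      by (rule continuous_on_compose2[OF C]) (auto intro: \<tau>I)
    then show ?thesis unfolding g_def by (intro continuous_intros)
  qed
  then have "open ((half_space \<times> half_space) \<inter> (\<lambda>z. g (\<tau> (fst z)) (snd z) \<bullet> \<nu>) -` {0<..})"
    by (rule continuous_open_preimage) (auto intro: open_Times open_half_space)
  moreover have "(p, p) \<in> (half_space \<times> half_space) \<inter> (\<lambda>z. g (\<tau> (fst z)) (snd z) \<bullet> \<nu>) -` {0<..}"
    using p pos by simp
  ultimately obtain A B where AB: "open A" "open B" "(p, p) \<in> A \<times> B"
    "A \<times> B \<subseteq> (half_space \<times> half_space) \<inter> (\<lambda>z. g (\<tau> (fst z)) (snd z) \<bullet> \<nu>) -` {0<..}"
    by (rule open_prod_elim) blast
  then have "open (A \<inter> B)" "p \<in> A \<inter> B" by auto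
  then obtain e where e: "e > 0" "ball p e \<subseteq> A \<inter> B" by (rule openE)
  have H: "ball p e \<subseteq> half_space" using e(2) AB(3,4) by blast
  have gp: "g (\<tau> q) q' \<bullet> \<nu> > 0" if "q \<in> ball p e" "q' \<in> ball p e" for q q'
  proof -
    have "(q, q') \<in> A \<times> B" using that e(2) by blast
    then have "(q, q') \<in> (\<lambda>z. g (\<tau> (fst z)) (snd z) \<bullet> \<nu>) -` {0<..}" using AB(4) by blast
    then show ?thesis by simp
  qed
  show ?thesis
  proof (rule that[OF \<nu> e(1) H])
    fix q \<epsilon> assume q: "q \<in> ball p e" "q + \<epsilon> *\<^sub>R \<nu> \<in> ball p e" and \<epsilon>: "\<epsilon> > (0::real)"
    have "(1 / 2) *\<^sub>R q + (1 / 2) *\<^sub>R (q + \<epsilon> *\<^sub>R \<nu>) \<in> ball p e"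
      by (rule convexD[OF convex_ball q]) auto
    also have "(1 / 2) *\<^sub>R q + (1 / 2) *\<^sub>R (q + \<epsilon> *\<^sub>R \<nu>) = q + (\<epsilon> / 2) *\<^sub>R \<nu>"
      by (simp add: scaleR_add_right flip: scaleR_add_left)
    finally have "g (\<tau> q) (q + (\<epsilon> / 2) *\<^sub>R \<nu>) \<bullet> \<nu> > 0" using gp q by blast
    then have "\<epsilon> * (g (\<tau> q) (q + (\<epsilon> / 2) *\<^sub>R \<nu>) \<bullet> \<nu>) > 0" using \<epsilon> by simp
    then have "qc (C (\<tau> q)) (q + \<epsilon> *\<^sub>R \<nu>) - qc (C (\<tau> q)) q > 0" unfolding qc_step g_def .
    moreover have "q \<in> half_space" "q + \<epsilon> *\<^sub>R \<nu> \<in> half_space" using q H by blast+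
    ultimately show "\<tau> (q + \<epsilon> *\<^sub>R \<nu>) < \<tau> q" using qc(1) \<tau>_less \<tau>I by simp
  qed
qed

lemma parameter_chart:
  assumes p: "p \<in> half_space"
  obtains U V :: "('a \<times> real) set" and \<Phi> \<Psi> where "p \<in> U" "open U" "U \<subseteq> half_space" "open V" "convex V" "homeomorphism U V \<Phi> \<Psi>"
    "\<forall>x. snd (\<Phi> x) = \<tau> x"
proof -
  obtain \<nu> e where \<nu>: "norm \<nu> = 1" and e: "e > 0" "ball p e \<subseteq> half_space"
    and dec: "\<And>q \<epsilon>. q \<in> ball p e \<Longrightarrow> q + \<epsilon> *\<^sub>R \<nu> \<in> ball p e \<Longrightarrow> \<epsilon> > 0 \<Longrightarrow> \<tau> (q + \<epsilon> *\<^sub>R \<nu>) < \<tau> q"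
    using transverse_direction[OF p] by blast
  have "norm (e_up :: 'a \<times> real) = 1" by (simp add: norm_Pair)
  then obtain R where R: "bounded_linear R" "\<And>v. R (R v) = v" "R e_up = \<nu>"
    using reflection_to[OF \<nu>, of e_up] by blast
  define \<Phi> where "\<Phi> = (\<lambda>x. (fst (R x), \<tau> x))"
  have cont: "continuous_on (ball p e) \<Phi>"
    unfolding \<Phi>_def using e(2)
    by (intro continuous_on_Pair continuous_on_fst linear_continuous_on[OF R(1)] continuous_on_subset[OF continuous_\<tau>])
  have inj: "inj_on \<Phi> (ball p e)"
  proof (rule inj_onI)
    fix x y assume x: "x \<in> ball p e" and y: "y \<in> ball p e" and eq: "\<Phi> x = \<Phi> y"
    interpret R: bounded_linear R by (rule R(1))
    define s where "s = snd (R x) - snd (R y)"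
    have "R (x - y) = s *\<^sub>R e_up" using eq by (simp add: R.diff prod_eq_iff \<Phi>_def s_def)
    then have "R (R (x - y)) = s *\<^sub>R \<nu>" by (simp only: R.scaleR R(3))
    then have xy: "x = y + s *\<^sub>R \<nu>" unfolding R(2) by (simp add: algebra_simps)
    have t: "\<tau> x = \<tau> y" using eq by (simp add: \<Phi>_def)
    have "\<not> s > 0" using dec[OF y, of s] x xy t by auto
    moreover have "\<not> s < 0"
    proof
      assume "s < 0"
      have "y = x + (- s) *\<^sub>R \<nu>" using xy by simp
      then show False using dec[OF x, of "- s"] y t \<open>s < 0\<close> by auto
    qed
    ultimately have "s = 0" by linarith
    then show "x = y" using xy by simp
  qed
  obtain g where g: "homeomorphism (ball p e) (\<Phi> ` ball p e) \<Phi> g"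
    using invariance_of_domain_homeomorphism[OF open_ball cont _ inj] by auto
  have "open (\<Phi> ` ball p e)" by (rule invariance_of_domain[OF cont open_ball inj])
  moreover have "\<Phi> p \<in> \<Phi> ` ball p e" using e(1) by simp
  ultimately obtain r where r: "r > 0" "ball (\<Phi> p) r \<subseteq> \<Phi> ` ball p e" by (rule openE)
  define V where "V = ball (\<Phi> p) r"
  define U where "U = ball p e \<inter> \<Phi> -` V"
  have oU: "open U" unfolding U_def V_def by (rule continuous_open_preimage[OF cont open_ball open_ball])
  have "\<Phi> ` U = V" using r(2) unfolding U_def V_def by blast
  then have hom: "homeomorphism U V \<Phi> g"
    using r(2) by (intro homeomorphism_of_subsets[OF g]) (auto simp: U_def V_def)
  show ?thesis
  proof (rule that[of U V \<Phi> g])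
    show "open U" "homeomorphism U V \<Phi> g" by (rule oU hom)+
    show "p \<in> U" using e(1) r(1) by (simp add: U_def V_def)
    show "U \<subseteq> half_space" using e(2) by (auto simp: U_def)
  qed (simp_all add: V_def \<Phi>_def)
qed

theorem foliation: "totally_umbilical_foliation {L. \<exists>a\<in>I. L = leaf a \<and> L \<noteq> {}}" (is "totally_umbilical_foliation ?F")
proof -
  have leaf: "q \<in> leaf a \<longleftrightarrow> q \<in> half_space \<and> \<tau> q = a" if "a \<in> I" for q a
    using that \<tau>_eq by blast
  have part: "partition_on half_space ?F"
  proof (rule partition_onI)
    show "\<Union>?F = half_space"
    proof
      show "half_space \<subseteq> \<Union>?F"
      proof
        fix q :: "'a \<times> real" assume q: "q \<in> half_space"
        then have "q \<in> leaf (\<tau> q)" using qc(1) by blast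
        moreover have "leaf (\<tau> q) \<in> ?F" using \<tau>I[OF q] calculation by blast
        ultimately show "q \<in> \<Union>?F" by blast
      qed
    qed blast
    show "{} \<notin> ?F" by blast
    fix L L' assume "L \<in> ?F" "L' \<in> ?F" "L \<noteq> L'"
    then obtain a a' where a: "a \<in> I" "L = leaf a" "a' \<in> I" "L' = leaf a'" "a \<noteq> a'" by blast
    have "\<tau> x = a" if "x \<in> L" for x using that \<tau>_eq[OF _ a(1)] a(2) by blast
    moreover have "\<tau> x = a'" if "x \<in> L'" for x using that \<tau>_eq[OF _ a(3)] a(4) by blast
    ultimately show "disjnt L L'" unfolding disjnt_iff using a(5) by blast
  qed
  have K: "fst (snd (C a)) \<bullet> fst (snd (C a)) - 4 * fst (C a) * snd (snd (C a)) > 0" if aI: "a \<in> I" and ne: "leaf a \<noteq> {}" for a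
  proof -
    obtain q where "q \<in> half_space" "qc (C a) q = 0" using ne by blast
    then show ?thesis by (rule leaf_discriminant[OF aI])
  qed
  have um: "totally_umbilical L" and pc: "path_connected L" if L: "L \<in> ?F" for L
  proof -
    obtain a where a: "a \<in> I" "L = leaf a" "leaf a \<noteq> {}" using L by blast
    show "totally_umbilical L" unfolding a(2) qc_def by (rule quadric_leaf_totally_umbilical[OF K[OF a(1,3)]])
    show "path_connected L" unfolding a(2) qc_def by (rule path_connected_quadric_leaf[OF K[OF a(1,3)]])
  qed
  have gh: "generalized_hypersphere L" if L: "L \<in> ?F" for L
  proof -
    obtain a where a: "a \<in> I" "L = leaf a" "leaf a \<noteq> {}" using L by blast
    obtain q where q: "q \<in> half_space" "qc (C a) q = 0" using a(3) by blast
    show ?thesis unfolding a(2) qc_def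
      by (rule generalized_hypersphere_quadric[OF sp[OF a(1), unfolded spacelike_coeffs_def] q(1) q(2)[unfolded qc_def]])
  qed
  have charts: "\<exists>U \<Phi>. p \<in> U \<and> foliated_chart ?F U \<Phi>" if p: "p \<in> half_space" for p
  proof -
    obtain U V :: "('a \<times> real) set" and \<Phi> \<Psi> where U: "p \<in> U" "open U" "U \<subseteq> half_space" "open V" "convex V" and hom: "homeomorphism U V \<Phi> \<Psi>"
      and snd\<tau>: "\<forall>x. snd (\<Phi> x) = \<tau> x"
      using parameter_chart[OF p] by blast
    have snd: "\<And>x. snd (\<Phi> x) = \<tau> x" using snd\<tau> by blast
    have plaque: "path_component_set (L \<inter> U) q = {x \<in> U. snd (\<Phi> x) = snd (\<Phi> q)}" if L: "L \<in> ?F" and q: "q \<in> L \<inter> U" for L q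
    proof -
      obtain a where a: "a \<in> I" "L = leaf a" using L by blast
      have "\<tau> q = a" using q leaf[OF a(1)] a(2) by blast
      then have "L \<inter> U = {x \<in> U. snd (\<Phi> x) = snd (\<Phi> q)}" using leaf[OF a(1)] a(2) U(3) unfolding snd by blast
      then show ?thesis using homeomorphic_plaque[OF hom U(5)] q by simp
    qed
    have "foliated_chart ?F U \<Phi>" unfolding foliated_chart_def
    proof (intro conjI ballI)
      show "open U" "U \<subseteq> half_space" by (rule U)+
      show "\<exists>V \<Psi>. open V \<and> convex V \<and> homeomorphism U V \<Phi> \<Psi>"
        by (rule exI[of _ V], rule exI[of _ \<Psi>], intro conjI U hom)
    qed (rule plaque)
    then show ?thesis by (intro exI[of _ U] exI[of _ \<Phi>] conjI U(1))
  qed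
  show ?thesis
    unfolding totally_umbilical_foliation_def codim1_foliation_def
  proof (intro conjI ballI impI)
    show "partition_on half_space ?F" by (rule part)
    fix L assume L: "L \<in> ?F"
    show "path_connected L" "totally_umbilical L" "generalized_hypersphere L" by (rule pc[OF L] um[OF L] gh[OF L])+
    show "smooth_hypersurface L" using um[OF L] unfolding totally_umbilical_def by (rule conjunct1)
  qed (rule charts)
qed

end

section \<open>Extension of the family beyond the ends of the ray\<close>

text \<open>
  The hyperspheres of the half-space with boundary data \<rho> and \<xi>, with an additional multiple y of the
  height, which tilts the quadric around its intersection with the ideal boundary.
\<close>

definition bcoeffs :: "real \<Rightarrow> 'a::euclidean_space \<times> real \<Rightarrow> real \<Rightarrow> real \<Rightarrow> real \<Rightarrow> real \<times> ('a \<times> real) \<times> real" where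
  "bcoeffs c w \<rho> \<xi> y = (- (\<rho> * (1 - \<rho>) * (1 - \<xi>)\<^sup>2 + (1 - \<rho>)\<^sup>2 * c * \<xi> * (1 - \<xi>)),
     (\<rho>\<^sup>2 * (1 - \<xi>)\<^sup>2 - (1 - \<rho>)\<^sup>2 * \<xi>\<^sup>2) *\<^sub>R w + (0, y),
     \<rho> * (1 - \<rho>) * \<xi>\<^sup>2 + \<rho>\<^sup>2 * c * \<xi> * (1 - \<xi>))"

lemma qc_bcoeffs: "qc (bcoeffs c w \<rho> \<xi> y) q = bform c \<rho> \<xi> (q \<bullet> w) (q \<bullet> q) + y * snd q"
  by (simp add: qc_expand bcoeffs_def bform_def inner_add_left inner_commute inner_prod_def algebra_simps)

lemma spacelike_bcoeffs:
  assumes c: "c > 0" and w: "fst w \<noteq> 0" and \<rho>: "0 \<le> \<rho>" "\<rho> \<le> 1" and \<xi>: "0 \<le> \<xi>" "\<xi> \<le> 1"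
    and nz: "\<not> (\<rho> = 0 \<and> \<xi> = 0)" "\<not> (\<rho> = 1 \<and> \<xi> = 1)"
  shows "spacelike_coeffs (bcoeffs c w \<rho> \<xi> y)"
proof -
  define k0 where "k0 = \<rho> * (1 - \<rho>) * \<xi>\<^sup>2 + \<rho>\<^sup>2 * c * \<xi> * (1 - \<xi>)"
  define k1 where "k1 = \<rho>\<^sup>2 * (1 - \<xi>)\<^sup>2 - (1 - \<rho>)\<^sup>2 * \<xi>\<^sup>2"
  define k2 where "k2 = \<rho> * (1 - \<rho>) * (1 - \<xi>)\<^sup>2 + (1 - \<rho>)\<^sup>2 * c * \<xi> * (1 - \<xi>)"
  have k: "k0 \<ge> 0" "k2 \<ge> 0" unfolding k0_def k2_def using c \<rho> \<xi> by (auto intro!: add_nonneg_nonneg mult_nonneg_nonneg)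
  have b: "fst (k1 *\<^sub>R w + (0, y)) = k1 *\<^sub>R fst w" by simp
  have "k0 \<noteq> 0 \<or> k1 \<noteq> 0"
  proof (rule ccontr)
    assume "\<not> (k0 \<noteq> 0 \<or> k1 \<noteq> 0)"
    then have z: "k0 = 0" "k1 = 0" by auto
    have s: "\<rho> * (1 - \<rho>) * \<xi>\<^sup>2 \<ge> 0" "\<rho>\<^sup>2 * c * \<xi> * (1 - \<xi>) \<ge> 0" using c \<rho> \<xi> by (auto intro!: mult_nonneg_nonneg)
    then have "\<rho> * (1 - \<rho>) * \<xi>\<^sup>2 = 0" using z(1) unfolding k0_def by linarith
    then consider "\<rho> = 0" | "\<rho> = 1" | "\<xi> = 0" by auto
    then show False using z(2) nz unfolding k1_def by cases auto
  qed
  then have "(- k2, k1 *\<^sub>R w + (0, y), k0) \<noteq> (0, 0, 0)"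
  proof
    assume "k1 \<noteq> 0"
    then have "fst (k1 *\<^sub>R w + (0, y)) \<noteq> 0" unfolding b using w by simp
    then have "k1 *\<^sub>R w + (0, y) \<noteq> 0" by force
    then show ?thesis by simp
  qed simp
  moreover have "fst (k1 *\<^sub>R w + (0, y)) \<bullet> fst (k1 *\<^sub>R w + (0, y)) - 4 * (- k2) * k0 \<ge> 0"
  proof -
    have "4 * k2 * k0 \<ge> 0" using k by simp
    then show ?thesis unfolding b using inner_ge_zero[of "k1 *\<^sub>R fst w"] by linarith
  qed
  ultimately show ?thesis
    unfolding spacelike_coeffs_def spacelike_def bcoeffs_def k0_def[symmetric] k1_def[symmetric] k2_def[symmetric]
    by (simp only: fst_conv snd_conv) blast
qed

lemma inner_axis_bounds:
  fixes u :: "'a::euclidean_space"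
  assumes u: "norm u = 1" and phi: "0 < \<phi>" "\<phi> < pi / 2" and q: "q \<in> half_space"
  shows "- cos \<phi> * norm q < q \<bullet> (cos \<phi> *\<^sub>R u, sin \<phi>)" "q \<bullet> (cos \<phi> *\<^sub>R u, sin \<phi>) \<le> norm q"
proof -
  have c: "cos \<phi> > 0" using phi by (simp add: cos_gt_zero)
  have s: "sin \<phi> > 0" using phi by (simp add: sin_gt_zero)
  have e: "q \<bullet> (cos \<phi> *\<^sub>R u, sin \<phi>) = cos \<phi> * (fst q \<bullet> u) + sin \<phi> * snd q" by (simp add: inner_prod_def mult.commute)
  have "\<bar>fst q \<bullet> u\<bar> \<le> norm (fst q) * norm u" by (rule Cauchy_Schwarz_ineq2)
  also have "\<dots> \<le> norm q" using u norm_fst_le[of "fst q" "snd q"] by simp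
  finally have "- norm q \<le> fst q \<bullet> u" by linarith
  then have "cos \<phi> * (- norm q) \<le> cos \<phi> * (fst q \<bullet> u)" using c by (intro mult_left_mono) auto
  moreover have "sin \<phi> * snd q > 0" using s q by (simp add: half_space_def)
  ultimately show "- cos \<phi> * norm q < q \<bullet> (cos \<phi> *\<^sub>R u, sin \<phi>)" unfolding e by simp
  have "norm (cos \<phi> *\<^sub>R u, sin \<phi>) = 1" using u by (simp add: norm_Pair)
  then show "q \<bullet> (cos \<phi> *\<^sub>R u, sin \<phi>) \<le> norm q"
    using norm_cauchy_schwarz[of q "(cos \<phi> *\<^sub>R u, sin \<phi>)"] by simp
qed

text \<open>
  The function g gives the boundary points of the leaves in the parameter \<xi>. If g 0 = 0, the leaves shrink
  to the origin and the family ends there; if g 0 > 0, it is continued to negative parameters by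
  tilting its limit. The end at parameter 1 is symmetric.
\<close>

locale boundary_family =
  fixes \<phi> :: real and u :: "'a::euclidean_space" and g :: "real \<Rightarrow> real"
  assumes phi: "0 < \<phi>" "\<phi> < pi / 2" and u: "norm u = 1"
    and g_cont: "continuous_on UNIV g" and g_mono: "\<And>x y. x \<le> y \<Longrightarrow> g x \<le> g y"
    and g_range: "\<And>x. 0 \<le> g x \<and> g x \<le> 1"
    and g_ends: "\<And>x. x \<le> 0 \<Longrightarrow> g x = g 0" "\<And>x. 1 \<le> x \<Longrightarrow> g x = g 1"
begin

definition w :: "'a \<times> real" where "w = (cos \<phi> *\<^sub>R u, sin \<phi>)"
definition cl :: "real \<Rightarrow> real" where "cl a = max 0 (min 1 a)"
definition tilt :: "real \<Rightarrow> real" where "tilt a = min a 0 + max (a - 1) 0"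
definition C :: "real \<Rightarrow> real \<times> ('a \<times> real) \<times> real" where "C a = bcoeffs (cos \<phi>) w (cl a) (g a) (tilt a)"
definition I :: "real set" where "I = {a. 0 < a \<or> g 0 > 0} \<inter> {a. a < 1 \<or> g 1 < 1}"

lemma c: "0 < cos \<phi>" "cos \<phi> < 1"
proof -
  show "0 < cos \<phi>" using phi by (simp add: cos_gt_zero)
  have "sin \<phi> > 0" using phi by (simp add: sin_gt_zero)
  then have "(sin \<phi>)\<^sup>2 > 0" by simp
  then have "(cos \<phi>)\<^sup>2 < 1" using sin_cos_squared_add[of \<phi>] by linarith
  then show "cos \<phi> < 1" by (simp add: abs_square_less_1)
qed

lemma cl: "0 \<le> cl a" "cl a \<le> 1" by (simp_all add: cl_def)

lemma qc_C: "qc (C a) q = bform (cos \<phi>) (cl a) (g a) (q \<bullet> w) ((norm q)\<^sup>2) + tilt a * snd q"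
  by (simp add: C_def qc_bcoeffs power2_norm_eq_inner)

lemma nondegenerate:
  assumes "a \<in> I"
  shows "\<not> (cl a = 0 \<and> g a = 0)" "\<not> (cl a = 1 \<and> g a = 1)"
proof -
  show "\<not> (cl a = 0 \<and> g a = 0)"
  proof
    assume *: "cl a = 0 \<and> g a = 0"
    then have "a \<le> 0" by (auto simp: cl_def max_def min_def split: if_splits)
    then show False using assms * g_ends(1)[of a] by (auto simp: I_def)
  qed
  show "\<not> (cl a = 1 \<and> g a = 1)"
  proof
    assume *: "cl a = 1 \<and> g a = 1"
    then have "1 \<le> a" by (auto simp: cl_def max_def min_def split: if_splits)
    then show False using assms * g_ends(2)[of a] by (auto simp: I_def)
  qed
qed

lemma bounds:
  assumes "q \<in> half_space"
  shows "0 < norm q" "- cos \<phi> * norm q < q \<bullet> w" "q \<bullet> w \<le> norm q" "snd q > 0"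
  using inner_axis_bounds[OF u phi assms] half_space_pos[OF assms] unfolding w_def by auto

text \<open>
  Between 0 and 1 the order is that of the leaves; outside, the boundary data are constant and the tilt
  increases.
\<close>

lemma order:
  assumes q: "q \<in> half_space" and a: "a \<in> I" "a' \<in> I" "a < a'" and pos: "qc (C a) q \<ge> 0"
  shows "qc (C a') q > 0"
proof (cases "cl a < cl a'")
  case True
  then have "a < 1" "a' > 0" using a(3) by (auto simp: cl_def max_def min_def split: if_splits)
  then have t: "tilt a * snd q \<le> 0" "tilt a' * snd q \<ge> 0"
    using bounds(4)[OF q] by (auto simp: tilt_def mult_nonpos_nonneg)
  then have "bform (cos \<phi>) (cl a) (g a) (q \<bullet> w) ((norm q)\<^sup>2) \<ge> 0" using pos unfolding qc_C by linarith
  then have "bform (cos \<phi>) (cl a') (g a') (q \<bullet> w) ((norm q)\<^sup>2) > 0"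
    using True a cl g_range g_mono[of a a'] nondegenerate bounds(1-3)[OF q] c
    by (intro bform_order[of "cos \<phi>" "norm q" "q \<bullet> w" "cl a" "cl a'" "g a" "g a'"]) auto
  then show ?thesis unfolding qc_C using t by linarith
next
  case False
  then have e: "a' \<le> 0 \<or> 1 \<le> a" using a(3) by (auto simp: cl_def max_def min_def split: if_splits)
  then have "cl a = cl a'" "g a = g a'" using a(3) g_ends(1)[of a] g_ends(1)[of a'] g_ends(2)[of a] g_ends(2)[of a']
    by (auto simp: cl_def)
  moreover have "tilt a < tilt a'" using e a(3) by (auto simp: tilt_def)
  then have "tilt a * snd q < tilt a' * snd q" using bounds(4)[OF q] by simp
  ultimately show ?thesis using pos unfolding qc_C by simp
qed

lemma small_value:
  assumes f: "continuous_on UNIV f" "f 0 = 0" and d: "d > (0::real)"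
  obtains a where "0 < a" "a < 1 / 2" "a < d" "f a < (d::real)"
proof -
  have "isCont f 0" using f(1) by (simp add: continuous_on_eq_continuous_at)
  then obtain e where e: "e > 0" "\<And>x. \<bar>x - 0\<bar> < e \<Longrightarrow> \<bar>f x - f 0\<bar> < d"
    using d unfolding continuous_at_eps_delta by (auto simp: dist_real_def)
  define a where "a = min e (min d (1 / 2)) / 2"
  have a: "0 < a" "a < 1 / 2" "a < d" "a < e" using e d by (auto simp: a_def)
  then have "f a < d" using e(2)[of a] f(2) by simp
  then show ?thesis using that a by blast
qed

lemma negative_near_end:
  assumes f: "continuous_on UNIV f" "f 0 = 0" "\<And>x. 0 \<le> f x" and n: "0 < n" and p: "- cos \<phi> * n < p" "p \<le> n"
  obtains a where "0 < a" "a < 1 / 2" "bform (cos \<phi>) a (f a) p (n\<^sup>2) < 0"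
proof -
  define d where "d = min (1 / 2) (min (n / 8) (n\<^sup>2 / (8 * (2 + n))))"
  have d: "d > 0" using n by (simp add: d_def)
  obtain a where a: "0 < a" "a < 1 / 2" "a < d" "f a < d" using small_value[OF f(1,2) d] by blast
  have "2 * f a + a * n < 2 * d + d * n" using a n by (intro add_strict_mono mult_strict_right_mono) auto
  also have "\<dots> = d * (2 + n)" by (simp add: algebra_simps)
  also have "\<dots> \<le> n\<^sup>2 / (8 * (2 + n)) * (2 + n)" using n by (intro mult_right_mono) (auto simp: d_def)
  also have "\<dots> = n\<^sup>2 / 8" using n by (simp add: field_simps)
  finally have "2 * f a + a * n < n\<^sup>2 / 8" .
  moreover have "f a < 1 / 2" "f a < n / 8" using a by (auto simp: d_def)
  ultimately have "bform (cos \<phi>) a (f a) p (n\<^sup>2) < 0"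
    using a f(3) c n p by (intro bform_negative) auto
  then show ?thesis using that a by blast
qed

lemma negative_value:
  assumes q: "q \<in> half_space"
  obtains a where "a \<in> I" "qc (C a) q < 0"
proof (cases "g 0 > 0")
  case True
  \<comment> \<open>Below parameter 0 only the tilt changes, and it tends to minus infinity.\<close>
  define B where "B = bform (cos \<phi>) 0 (g 0) (q \<bullet> w) ((norm q)\<^sup>2)"
  define a where "a = - ((\<bar>B\<bar> + 1) / snd q)"
  have y: "snd q > 0" by (rule bounds(4)[OF q])
  have a: "a < 0" using y by (simp add: a_def field_simps)
  then have "tilt a = a" "cl a = 0" "g a = g 0" using g_ends(1)[of a] by (auto simp: tilt_def cl_def)
  then have "qc (C a) q = B + a * snd q" unfolding qc_C B_def by simp
  also have "\<dots> = B - (\<bar>B\<bar> + 1)" using y by (simp add: a_def)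
  finally have "qc (C a) q < 0" by linarith
  then show ?thesis using that[of a] a True by (auto simp: I_def)
next
  case False
  then have "g 0 = 0" using g_range[of 0] by linarith
  then obtain a where a: "0 < a" "a < 1 / 2" "bform (cos \<phi>) a (g a) (q \<bullet> w) ((norm q)\<^sup>2) < 0"
    using negative_near_end[OF g_cont _ _ bounds(1-3)[OF q]] g_range by blast
  then have "qc (C a) q < 0" unfolding qc_C by (simp add: cl_def tilt_def)
  then show ?thesis using that[of a] a by (auto simp: I_def)
qed

lemma positive_value:
  assumes q: "q \<in> half_space"
  obtains a where "a \<in> I" "qc (C a) q > 0"
proof (cases "g 1 < 1")
  case True
  define B where "B = bform (cos \<phi>) 1 (g 1) (q \<bullet> w) ((norm q)\<^sup>2)"
  define a where "a = 1 + (\<bar>B\<bar> + 1) / snd q"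
  have y: "snd q > 0" by (rule bounds(4)[OF q])
  have a: "a > 1" using y by (simp add: a_def field_simps)
  then have "tilt a = a - 1" "cl a = 1" "g a = g 1" using g_ends(2)[of a] by (auto simp: tilt_def cl_def)
  then have "qc (C a) q = B + (a - 1) * snd q" unfolding qc_C B_def by simp
  also have "\<dots> = B + (\<bar>B\<bar> + 1)" using y by (simp add: a_def)
  finally have "qc (C a) q > 0" by linarith
  then show ?thesis using that[of a] a True by (auto simp: I_def)
next
  case False
  define f where "f = (\<lambda>x. 1 - g (1 - x))"
  define n where "n = norm q"
  have n: "n > 0" "n\<^sup>2 > 0" "n\<^sup>2 \<noteq> 0" using bounds(1)[OF q] by (simp_all add: n_def)
  have "continuous_on UNIV (\<lambda>x. g (1 - x))"
    by (rule continuous_on_compose2[OF g_cont]) (auto intro!: continuous_intros)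
  then have f: "continuous_on UNIV f" "f 0 = 0" "\<And>x. 0 \<le> f x"
    using False g_range[of 1] g_range unfolding f_def by (auto intro!: continuous_intros intro: antisym)
  have "- cos \<phi> * (1 / n) < (q \<bullet> w) / n\<^sup>2" "(q \<bullet> w) / n\<^sup>2 \<le> 1 / n"
    using bounds(2,3)[OF q] n(1) unfolding n_def[symmetric] by (simp_all add: field_simps power2_eq_square)
  then obtain a where a: "0 < a" "a < 1 / 2" "bform (cos \<phi>) a (f a) ((q \<bullet> w) / n\<^sup>2) ((1 / n)\<^sup>2) < 0"
    using negative_near_end[OF f, of "1 / n"] n(1) by auto
  have "bform (cos \<phi>) (1 - a) (g (1 - a)) (q \<bullet> w) (n\<^sup>2) = - (n\<^sup>2 * bform (cos \<phi>) a (f a) ((q \<bullet> w) / n\<^sup>2) ((1 / n)\<^sup>2))"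
    using bform_inversion[OF n(3), of "cos \<phi>" "1 - a" "g (1 - a)" "q \<bullet> w"] by (simp add: f_def power_divide)
  moreover have "n\<^sup>2 * bform (cos \<phi>) a (f a) ((q \<bullet> w) / n\<^sup>2) ((1 / n)\<^sup>2) < 0" using n(2) a(3) by (rule mult_pos_neg)
  ultimately have "bform (cos \<phi>) (1 - a) (g (1 - a)) (q \<bullet> w) (n\<^sup>2) > 0" by linarith
  then have "qc (C (1 - a)) q > 0" unfolding qc_C n_def using a by (simp add: cl_def tilt_def)
  then show ?thesis using that[of "1 - a"] a by (auto simp: I_def)
qed

lemma C_cont: "continuous_on UNIV C"
  unfolding C_def bcoeffs_def cl_def tilt_def by (intro continuous_intros g_cont)

lemma I_interval: "a \<in> I \<Longrightarrow> a' \<in> I \<Longrightarrow> a \<le> x \<Longrightarrow> x \<le> a' \<Longrightarrow> x \<in> I"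
  by (auto simp: I_def)

lemma zero_value:
  assumes q: "q \<in> half_space"
  obtains a where "a \<in> I" "qc (C a) q = 0"
proof -
  obtain a a' where a: "a \<in> I" "qc (C a) q < 0" and a': "a' \<in> I" "qc (C a') q > 0"
    using negative_value[OF q] positive_value[OF q] by metis
  have "a \<le> a'"
  proof (rule ccontr)
    assume "\<not> a \<le> a'"
    then show False using order[OF q a'(1) a(1)] a(2) a'(2) by simp
  qed
  moreover have "continuous_on {a..a'} (\<lambda>a. qc (C a) q)"
    unfolding qc_expand by (intro continuous_intros continuous_on_subset[OF C_cont]) auto
  ultimately obtain x where "a \<le> x" "x \<le> a'" "qc (C x) q = 0"
    using IVT'[of "\<lambda>a. qc (C a) q" a 0 a'] a(2) a'(2) by auto
  then show ?thesis using that I_interval[OF a(1) a'(1)] by blast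
qed

lemma family: "\<exists>\<tau>. hypersphere_family I C \<tau>"
proof -
  have "\<exists>a. q \<in> half_space \<longrightarrow> a \<in> I \<and> qc (C a) q = 0" for q
    using zero_value[of q] by metis
  then obtain \<tau> where \<tau>: "\<And>q. q \<in> half_space \<longrightarrow> \<tau> q \<in> I \<and> qc (C (\<tau> q)) q = 0" by metis
  have "hypersphere_family I C \<tau>"
  proof
    have "open {a :: real. 0 < a \<or> g 0 > 0}" "open {a :: real. a < 1 \<or> g 1 < 1}"
      by (cases "g 0 > 0"; cases "g 1 < 1"; simp add: open_Collect_less continuous_on_const continuous_on_id)+
    then show "open I" unfolding I_def by (rule open_Int)
    show "continuous_on I C" by (rule continuous_on_subset[OF C_cont]) simp
    have "fst w \<noteq> 0" using u c(1) by (auto simp: w_def)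
    then show "spacelike_coeffs (C a)" if "a \<in> I" for a
      unfolding C_def using nondegenerate[OF that] g_range[of a] cl c(1) by (intro spacelike_bcoeffs) auto
    fix q :: "'a \<times> real" assume q: "q \<in> half_space"
    show "\<tau> q \<in> I" "qc (C (\<tau> q)) q = 0" using \<tau> q by blast+
    fix a assume a: "a \<in> I"
    show "qc (C a) q < 0" if "a < \<tau> q" using order[OF q a _ that] \<tau> q by (metis less_irrefl not_less)
    show "0 < qc (C a) q" if "\<tau> q < a" using order[OF q _ a that] \<tau> q by simp
  qed
  then show ?thesis by blast
qed

end

lemma hypersphere_family_pullback:
  fixes T :: "'a::euclidean_space \<times> real \<Rightarrow> 'a \<times> real"
  assumes fam: "hypersphere_family I C \<tau>" and T: "bij_betw T half_space half_space" and M: "continuous_on UNIV M"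
    "\<And>D. spacelike_coeffs D \<Longrightarrow> spacelike_coeffs (M D)"
    "\<And>D q. spacelike_coeffs D \<Longrightarrow> q \<in> half_space \<Longrightarrow> \<exists>k>0. qc D (T q) = k * qc (M D) q"
  shows "hypersphere_family I (\<lambda>a. M (C a)) (\<lambda>q. \<tau> (T q))"
proof -
  interpret hypersphere_family I C \<tau> by (rule fam)
  have TH: "T q \<in> half_space" if "q \<in> half_space" for q using that T by (rule bij_betw_apply[rotated])
  have sign: "(qc (M (C a)) q < 0 \<longleftrightarrow> qc (C a) (T q) < 0) \<and> (0 < qc (M (C a)) q \<longleftrightarrow> 0 < qc (C a) (T q))"
    if a: "a \<in> I" and q: "q \<in> half_space" for a q
  proof -
    obtain k where k: "k > 0" "qc (C a) (T q) = k * qc (M (C a)) q" using M(3)[OF sp[OF a] q] by blast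
    show ?thesis unfolding k(2) using sign_mult_pos[OF k(1)] by blast
  qed
  show ?thesis
  proof
    show "open I" by (rule I)
    show "continuous_on I (\<lambda>a. M (C a))" by (rule continuous_on_compose2[OF M(1) C]) simp
    show "spacelike_coeffs (M (C a))" if "a \<in> I" for a using M(2) sp that by blast
    fix q :: "'a \<times> real" assume q: "q \<in> half_space"
    show \<tau>q: "\<tau> (T q) \<in> I" by (rule \<tau>I[OF TH[OF q]])
    show "qc (M (C (\<tau> (T q)))) q = 0"
      using sign[OF \<tau>q q] qc(1)[OF TH[OF q]] by linarith
    fix a assume a: "a \<in> I"
    show "qc (M (C a)) q < 0" if "a < \<tau> (T q)" using sign[OF a q] qc(2)[OF TH[OF q] a that] by blast
    show "0 < qc (M (C a)) q" if "\<tau> (T q) < a" using sign[OF a q] qc(3)[OF TH[OF q] a that] by blast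
  qed
qed

section \<open>Sufficiency of the differential inequality\<close>

text \<open>
  After the last time at which Z is nonnegative, the product of Z and exp (- t) would not decrease.
\<close>

lemma nonneg_from_differential_inequality:
  fixes Z :: "real \<Rightarrow> real"
  assumes Z: "\<And>t. (Z has_real_derivative Z' t) (at t)" and k: "\<And>t. k t \<le> 1" and ge: "\<And>t. Z' t \<ge> k t * Z t"
    and "Z t1 \<ge> 0" "t1 \<le> t2"
  shows "Z t2 \<ge> 0"
proof (rule ccontr)
  assume neg: "\<not> Z t2 \<ge> 0"
  have cont: "continuous_on UNIV Z" using Z by (intro DERIV_continuous_on) auto
  have "closed {t. 0 \<le> Z t}" by (intro closed_Collect_le continuous_on_const cont)
  then have "compact ({t1..t2} \<inter> {t. 0 \<le> Z t})" by (intro compact_Int_closed) auto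
  moreover have "{t1..t2} \<inter> {t. 0 \<le> Z t} \<noteq> {}" using assms(4,5) by auto
  ultimately obtain t0 where t0: "t0 \<in> {t1..t2} \<inter> {t. 0 \<le> Z t}" "\<forall>t\<in>{t1..t2} \<inter> {t. 0 \<le> Z t}. t \<le> t0"
    using compact_attains_sup by metis
  have le: "t0 \<le> t2" "0 \<le> Z t0" "t1 \<le> t0" using t0(1) by auto
  define Y where "Y = (\<lambda>t. Z t * exp (- t))"
  have Y: "(Y has_real_derivative (Z' t - Z t) * exp (- t)) (at t)" for t
    unfolding Y_def by (rule derivative_eq_intros Z refl)+ (simp add: algebra_simps)
  have "Y t0 \<le> Y t2"
  proof (rule DERIV_nonneg_imp_increasing_open[OF le(1)])
    fix t assume t: "t0 < t" "t < t2"
    then have "Z t < 0" using t0(2) le(3) by (auto simp: not_le[symmetric])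
    then have "k t * Z t \<ge> 1 * Z t" using k[of t] by (intro mult_right_mono_neg) auto
    then have "Z' t - Z t \<ge> 0" using ge[of t] by simp
    then show "\<exists>y. (Y has_real_derivative y) (at t) \<and> 0 \<le> y" using Y[of t] by (intro exI[of _ "(Z' t - Z t) * exp (- t)"]) simp
  next
    have "continuous_on UNIV Y" using Y by (intro DERIV_continuous_on) auto
    then show "continuous_on {t0..t2} Y" by (rule continuous_on_subset) simp
  qed
  moreover have "Y t0 \<ge> 0" using le(2) by (simp add: Y_def)
  moreover have "Y t2 < 0" using neg by (simp add: Y_def mult_neg_pos)
  ultimately show False by simp
qed

text \<open>
  With angles \<alpha> instead of curvatures the differential inequality says that the ideal boundary points
  of the leaves move outwards.
\<close>

lemma boundary_monotone:
  fixes \<phi> :: real and \<alpha> \<alpha>' :: "real \<Rightarrow> real"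
  assumes phi: "0 < \<phi>" "\<phi> < pi / 2" and \<alpha>: "\<And>t. \<bar>\<alpha> t\<bar> \<le> \<phi>" "\<And>t. (\<alpha> has_real_derivative \<alpha>' t) (at t)"
    and ge: "\<And>t. \<alpha>' t \<ge> - 2 * sin ((\<phi> + \<alpha> t) / 2) * sin ((\<phi> - \<alpha> t) / 2)" and "t1 \<le> t2"
  defines "A \<equiv> \<lambda>t. exp (sin \<phi> * t) * sin ((\<phi> + \<alpha> t) / 2)" and "B \<equiv> \<lambda>t. sin ((\<phi> - \<alpha> t) / 2)"
  shows "A t1 * B t2 \<le> A t2 * B t1"
proof -
  define b where "b = B t1"
  define a where "a = A t1"
  have ab: "a \<ge> 0" "b \<ge> 0" using half_angle_bounds[OF phi \<alpha>(1)] by (simp_all add: a_def b_def A_def B_def)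
  define Z where "Z = (\<lambda>t. b * A t - a * B t)"
  define Z' where "Z' = (\<lambda>t. b * (exp (sin \<phi> * t) * (sin \<phi> * sin ((\<phi> + \<alpha> t) / 2) + cos ((\<phi> + \<alpha> t) / 2) * (\<alpha>' t / 2)))
     + a * (cos ((\<phi> - \<alpha> t) / 2) * (\<alpha>' t / 2)))"
  have "Z t2 \<ge> 0"
  proof (rule nonneg_from_differential_inequality[of Z Z' "\<lambda>t. sin ((\<phi> + \<alpha> t) / 2) * cos ((\<phi> - \<alpha> t) / 2)" t1])
    fix t
    show "(Z has_real_derivative Z' t) (at t)"
      unfolding Z_def Z'_def A_def B_def
      by (auto intro!: derivative_eq_intros \<alpha>(2) simp: field_simps)
    let ?S1 = "sin ((\<phi> + \<alpha> t) / 2)" and ?C1 = "cos ((\<phi> + \<alpha> t) / 2)"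
      and ?S2 = "sin ((\<phi> - \<alpha> t) / 2)" and ?C2 = "cos ((\<phi> - \<alpha> t) / 2)" and ?r = "exp (sin \<phi> * t)"
    note bd = half_angle_bounds[OF phi \<alpha>(1)[of t]]
    show "?S1 * ?C2 \<le> 1" using bd mult_mono[of ?S1 1 ?C2 1] by simp
    have e: "sin \<phi> = ?S1 * ?C2 + ?C1 * ?S2" by (rule half_angle_identities(1))
    have "\<alpha>' t / 2 \<ge> - (?S1 * ?S2)" using ge[of t] by simp
    then have "(b * ?r * ?C1 + a * ?C2) * (\<alpha>' t / 2) \<ge> (b * ?r * ?C1 + a * ?C2) * (- (?S1 * ?S2))"
      using ab bd by (intro mult_left_mono) (auto intro: add_nonneg_nonneg)
    moreover have "Z' t = b * ?r * ?S1 * (?S1 * ?C2 + ?C1 * ?S2) + (b * ?r * ?C1 + a * ?C2) * (\<alpha>' t / 2)"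
      unfolding Z'_def e by (simp add: algebra_simps)
    moreover have "b * ?r * ?S1 * (?S1 * ?C2 + ?C1 * ?S2) + (b * ?r * ?C1 + a * ?C2) * (- (?S1 * ?S2)) = ?S1 * ?C2 * Z t"
      unfolding Z_def A_def B_def by (simp add: algebra_simps)
    ultimately show "Z' t \<ge> ?S1 * ?C2 * Z t" by linarith
  next
    show "Z t1 \<ge> 0" by (simp add: Z_def a_def b_def mult.commute)
    show "t1 \<le> t2" by fact
  qed
  then show ?thesis by (simp add: Z_def a_def b_def mult.commute)
qed

lemma route_bound_angle:
  fixes \<phi> h :: real
  assumes phi: "0 < \<phi>" "\<phi> < pi / 2" and h: "\<bar>h\<bar> \<le> sin \<phi>"
  shows "(h - sin \<phi>) * (h * cos \<phi> + sqrt (1 - h\<^sup>2) * sin \<phi>) * sqrt (1 - h\<^sup>2)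
      / (1 - h * sin \<phi> + sqrt (1 - h\<^sup>2) * cos \<phi>)
    = - 2 * sin ((\<phi> + arcsin h) / 2) * sin ((\<phi> - arcsin h) / 2) * sqrt (1 - h\<^sup>2)"
proof -
  note r = route_angle[OF phi h]
  have "cos ((\<phi> + arcsin h) / 2) \<noteq> 0" using half_angle_bounds(3)[OF phi r(2)] by (simp add: less_imp_neq[THEN not_sym])
  from route_bound_half_angle[OF this] show ?thesis unfolding r(1,3) .
qed

lemma arcsin_route_derivative:
  fixes \<phi> :: real and h :: "real \<Rightarrow> real"
  assumes phi: "0 < \<phi>" "\<phi> < pi / 2" and h: "\<bar>h t\<bar> \<le> sin \<phi>" and D: "(h has_real_derivative D) (at t)"
  shows "((\<lambda>t. arcsin (h t)) has_real_derivative D / sqrt (1 - (h t)\<^sup>2)) (at t)"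
proof -
  note r = route_angle[OF phi h]
  have "((\<lambda>t. arcsin (h t)) has_real_derivative inverse (sqrt (1 - (h t)\<^sup>2)) * D) (at t)"
    by (rule DERIV_chain2[OF DERIV_arcsin D]) (use r(5,6) in auto)
  then show ?thesis by (simp add: divide_inverse mult.commute)
qed

text \<open>
  Where h is \<plusminus> sin \<phi>, it has an extremum, so its derivative vanishes, and so does the bound.
\<close>

lemma route_conditions_angle:
  fixes \<phi> :: real and h :: "real \<Rightarrow> real"
  assumes phi: "0 < \<phi>" "\<phi> < pi / 2" and h: "\<And>t. \<bar>h t\<bar> \<le> sin \<phi>" and D: "\<And>t. (h has_real_derivative D t) (at t)"
    and rc: "route_conditions \<phi> h tm tp"
  shows "D t / sqrt (1 - (h t)\<^sup>2) \<ge> - 2 * sin ((\<phi> + arcsin (h t)) / 2) * sin ((\<phi> - arcsin (h t)) / 2)"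
proof -
  note r = route_angle[OF phi h]
  have phia: "arcsin (sin \<phi>) = \<phi>" "arcsin (- sin \<phi>) = - \<phi>"
    using phi by (simp_all add: arcsin_sin arcsin_minus)
  consider "ereal t \<le> tm" | "tm < ereal t" "ereal t < tp" | "tp \<le> ereal t" by (meson not_le)
  then show ?thesis
  proof cases
    case 1
    then have e: "h t = - sin \<phi>" using rc unfolding route_conditions_def by blast
    have "D t = 0" using h e by (intro DERIV_local_min[OF D zero_less_one]) (metis abs_le_iff minus_le_iff)
    then show ?thesis by (simp add: e phia)
  next
    case 2
    then obtain D' where D': "(h has_real_derivative D') (at t)"
      "D' \<ge> (h t - sin \<phi>) * (h t * cos \<phi> + sqrt (1 - (h t)\<^sup>2) * sin \<phi>) * sqrt (1 - (h t)\<^sup>2)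
               / (1 - h t * sin \<phi> + sqrt (1 - (h t)\<^sup>2) * cos \<phi>)"
      using rc unfolding route_conditions_def by blast
    have "D' = D t" by (rule DERIV_unique[OF D'(1) D])
    then have "D t \<ge> - 2 * sin ((\<phi> + arcsin (h t)) / 2) * sin ((\<phi> - arcsin (h t)) / 2) * sqrt (1 - (h t)\<^sup>2)"
      using D'(2) route_bound_angle[OF phi h, of t] by simp
    then show ?thesis using r(4)[of t] by (simp add: le_divide_eq)
  next
    case 3
    then have e: "h t = sin \<phi>" using rc unfolding route_conditions_def by blast
    have "D t = 0" using h e by (intro DERIV_local_max[OF D zero_less_one]) (metis abs_le_iff)
    then show ?thesis by (simp add: e phia)
  qed
qed

text \<open>
  The family is indexed by a = r / (1 + r), so that both ends of the ray are at finite parameters, and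
  the boundary point is continued to all parameters by its limits.
\<close>

lemma umbilical_route_monotone:
  fixes \<gamma> :: "real \<Rightarrow> 'a::euclidean_space \<times> real" and \<alpha> :: "real \<Rightarrow> real"
  assumes phi: "0 < \<phi>" "\<phi> < pi / 2" and \<gamma>: "phi_hypercycle \<phi> \<gamma>"
    and \<alpha>: "continuous_on UNIV \<alpha>" "\<And>t. \<bar>\<alpha> t\<bar> \<le> \<phi>"
  defines "A \<equiv> \<lambda>t. exp (sin \<phi> * t) * sin ((\<phi> + \<alpha> t) / 2)" and "B \<equiv> \<lambda>t. sin ((\<phi> - \<alpha> t) / 2)"
  assumes mono: "\<And>t1 t2. t1 \<le> t2 \<Longrightarrow> A t1 * B t2 \<le> A t2 * B t1"
  shows "umbilical_route (\<lambda>t. sin (\<alpha> t)) \<gamma>"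
proof -
  define s where "s = sin \<phi>"
  have s: "s > 0" using phi by (simp add: s_def sin_gt_zero)
  have cc: "cos \<phi> > 0" using phi by (simp add: cos_gt_zero)
  note hb = half_angle_bounds[OF phi \<alpha>(2)]
  have A0: "A t \<ge> 0" and B0: "B t \<ge> 0" for t using hb[of t] by (simp_all add: A_def B_def)
  have "A t > 0 \<or> B t > 0" for t using hb(5)[of t] by (auto simp: A_def B_def)
  then have AB: "A t + B t > 0" for t using A0[of t] B0[of t] by (metis add_pos_nonneg add_nonneg_pos)
  have cA: "continuous_on UNIV A" "continuous_on UNIV B" unfolding A_def B_def by (intro continuous_intros \<alpha>; simp)+
  obtain P Q R where sm: "smooth_on UNIV \<gamma>" and unit: "\<And>t. hyp_inner (\<gamma> t) (velocity \<gamma> t) (velocity \<gamma> t) = 1"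
    and lor: "lor_hypercycle \<phi> \<gamma> P Q R"
    using phi_hypercycle_lor[OF \<gamma>] s unfolding s_def by blast
  obtain T u where T: "motion T" and u: "norm u = 1" and std: "\<And>t. T (\<gamma> t) = exp (sin \<phi> * t) *\<^sub>R (cos \<phi> *\<^sub>R u, sin \<phi>)"
    using lor_hypercycle_standard[OF lor s[unfolded s_def] cc] by blast
  have inH: "\<gamma> t \<in> half_space" for t using lor unfolding lor_hypercycle_def by blast
  \<comment> \<open>The position of the boundary point, as a function of the position on the ray.\<close>
  define time where "time = (\<lambda>a. ln (a / (1 - a)) / s)"
  define f where "f = (\<lambda>a. A (time a) / (A (time a) + B (time a)))"
  have time: "time x \<le> time y" if "0 < x" "x \<le> y" "y < 1" for x y
  proof -
    have "x / (1 - x) \<le> y / (1 - y)" using that by (intro frac_le) auto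
    then have "ln (x / (1 - x)) \<le> ln (y / (1 - y))" using that by (subst ln_le_cancel_iff) auto
    then show ?thesis using s by (simp add: time_def divide_right_mono)
  qed
  have "continuous_on {0<..<1} time"
    unfolding time_def using s by (intro continuous_intros) auto
  then have cf: "continuous_on {0<..<1} f"
    unfolding f_def using AB
    by (intro continuous_on_divide continuous_on_add continuous_on_compose2[OF cA(1)] continuous_on_compose2[OF cA(2)])
      (auto simp: less_imp_neq[THEN not_sym])
  have mf: "f x \<le> f y" if "0 < x" "x \<le> y" "y < 1" for x y
  proof -
    have "A (time x) * B (time y) \<le> A (time y) * B (time x)" by (rule mono[OF time[OF that]])
    then have "A (time x) * (A (time y) + B (time y)) \<le> A (time y) * (A (time x) + B (time x))" by (simp add: algebra_simps)
    then show ?thesis unfolding f_def using AB[of "time x"] AB[of "time y"] by (simp add: divide_le_eq le_divide_eq mult.commute pos_divide_le_eq)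
  qed
  have rf: "0 \<le> f x \<and> f x \<le> 1" for x unfolding f_def using A0[of "time x"] B0[of "time x"] AB[of "time x"] by simp
  have "\<exists>g. continuous_on UNIV g \<and> (\<forall>x y. x \<le> y \<longrightarrow> g x \<le> g y) \<and> (\<forall>x. 0 < x \<longrightarrow> x < 1 \<longrightarrow> g x = f x) \<and>
      (\<forall>x. 0 \<le> g x \<and> g x \<le> 1) \<and> (\<forall>x\<le>0. g x = g 0) \<and> (\<forall>x\<ge>1. g x = g 1)"
  proof (rule monotone_extension[of f])
    show "continuous_on {0<..<1} f" by (rule cf)
    show "f x \<le> f y" if "0 < x" "x \<le> y" "y < 1" for x y by (rule mf[OF that])
    show "0 \<le> f x \<and> f x \<le> 1" for x by (rule rf)
  qed blast
  then obtain g where g: "continuous_on UNIV g" "\<And>x y. x \<le> y \<Longrightarrow> g x \<le> g y"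
    "\<And>x. 0 < x \<Longrightarrow> x < 1 \<Longrightarrow> g x = f x" "\<And>x. 0 \<le> g x \<and> g x \<le> 1" "\<And>x. x \<le> 0 \<Longrightarrow> g x = g 0" "\<And>x. 1 \<le> x \<Longrightarrow> g x = g 1"
    by (elim exE conjE) blast
  interpret BF: boundary_family \<phi> u g
    by unfold_locales (fact phi u g)+
  obtain \<tau> where \<tau>: "hypersphere_family BF.I BF.C \<tau>" using BF.family by blast
  obtain M where bij: "bij_betw T half_space half_space" and M: "continuous_on UNIV M"
    and MC: "\<And>D. spacelike_coeffs D \<Longrightarrow> spacelike_coeffs (M D)"
    "\<And>D q. spacelike_coeffs D \<Longrightarrow> q \<in> half_space \<Longrightarrow> \<exists>k>0. qc D (T q) = k * qc (M D) q"
    using T unfolding motion_def by blast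
  define C where "C = (\<lambda>a. M (BF.C a))"
  have fam: "hypersphere_family BF.I C (\<lambda>q. \<tau> (T q))"
    unfolding C_def by (rule hypersphere_family_pullback[OF \<tau> bij M MC])
  interpret HF: hypersphere_family BF.I C "\<lambda>q. \<tau> (T q)" by (rule fam)
  define F where "F = {L. \<exists>a\<in>BF.I. L = {q \<in> half_space. qc (C a) q = 0} \<and> L \<noteq> {}}"
  have F: "totally_umbilical_foliation F" unfolding F_def by (rule HF.foliation)
  have "\<exists>L\<in>F. generalized_hypersphere L \<and> \<gamma> t \<in> L \<and> orthogonal_at L \<gamma> t \<and>
        umbilic_with_curvature L (\<gamma> t) (- velocity \<gamma> t) (sin (\<alpha> t))" for t
  proof -
    define r where "r = exp (sin \<phi> * t)"
    define a where "a = r / (1 + r)"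
    have r: "r > 0" by (simp add: r_def)
    have a: "0 < a" "a < 1" using r by (simp_all add: a_def)
    have ar: "a / (1 - a) = r" "1 - a = 1 / (1 + r)" using r by (simp_all add: a_def field_simps)
    have ta: "time a = t" unfolding time_def ar(1) r_def using s by (simp add: s_def)
    have aI: "a \<in> BF.I" using a by (simp add: BF.I_def)
    have ga: "g a = A t / (A t + B t)" using g(3)[OF a] by (simp add: f_def ta)
    have ga1: "1 - g a = B t / (A t + B t)" unfolding ga using AB[of t] by (simp add: field_simps)
    have eqv: "qc (C a) q = 0 \<longleftrightarrow> hypersphere_eq (\<gamma> t) (velocity \<gamma> t) (sin (\<alpha> t)) q = 0" if q: "q \<in> half_space" for q
    proof -
      let ?p = "T q \<bullet> (cos \<phi> *\<^sub>R u, sin \<phi>)" and ?Q = "T q \<bullet> T q"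
      obtain k where k: "k > 0" "qc (BF.C a) (T q) = k * qc (C a) q"
        unfolding C_def using MC(2)[OF _ q, of "BF.C a"] hypersphere_family.sp[OF \<tau> aI] by blast
      obtain k' where k': "k' > 0" "hypersphere_eq (\<gamma> t) (velocity \<gamma> t) (sin (\<alpha> t)) q = k' * ell \<phi> u (sin (\<alpha> t)) r (T q)"
        using hypersphere_eq_standard[OF T u s[unfolded s_def] std smooth_curve_derivatives(1)[OF sm] inH q] unfolding r_def by blast
      have cla: "BF.cl a = a" "BF.tilt a = 0" using a by (simp_all add: BF.cl_def BF.tilt_def)
      have "qc (BF.C a) (T q) = bform (cos \<phi>) a (g a) ?p ?Q"
        unfolding BF.C_def qc_bcoeffs cla BF.w_def by simp
      also have "\<dots> = (1 - a)\<^sup>2 * mform (cos \<phi>) r (g a) (1 - g a) ?p ?Q"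
        using bform_mform[of a] a ar(1) by simp
      also have "mform (cos \<phi>) r (g a) (1 - g a) ?p ?Q = (1 / (A t + B t))\<^sup>2 * mform (cos \<phi>) r (A t) (B t) ?p ?Q"
        using mform_scale[of "cos \<phi>" r "1 / (A t + B t)" "A t" "B t" ?p ?Q] unfolding ga1 unfolding ga by simp
      also have "mform (cos \<phi>) r (A t) (B t) ?p ?Q = sin \<phi> * r\<^sup>2 / 2 * ell \<phi> u (sin (\<alpha> t)) r (T q)"
        using mform_ell[OF r] unfolding A_def B_def r_def[symmetric] .
      finally have "qc (BF.C a) (T q) = (1 - a)\<^sup>2 * ((1 / (A t + B t))\<^sup>2 * (sin \<phi> * r\<^sup>2 / 2 * ell \<phi> u (sin (\<alpha> t)) r (T q)))" .
      moreover have "(1 - a)\<^sup>2 \<noteq> 0" "(1 / (A t + B t))\<^sup>2 \<noteq> 0" "sin \<phi> * r\<^sup>2 / 2 \<noteq> 0"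
        using a r s AB[of t] by (auto simp: s_def)
      ultimately have "qc (BF.C a) (T q) = 0 \<longleftrightarrow> ell \<phi> u (sin (\<alpha> t)) r (T q) = 0" by (simp only: mult_eq_0_iff) blast
      then show ?thesis unfolding k(2) k'(2) using k(1) k'(1) by simp
    qed
    define L where "L = {q \<in> half_space. hypersphere_eq (\<gamma> t) (velocity \<gamma> t) (sin (\<alpha> t)) q = 0}"
    have L: "L = {q \<in> half_space. qc (C a) q = 0}" unfolding L_def using eqv by blast
    have pL: "\<gamma> t \<in> L" using inH by (simp add: L_def hypersphere_eq_def)
    then have "L \<in> F" unfolding F_def using L aI by blast
    moreover have "generalized_hypersphere L"
    proof -
      have "qc (C a) (\<gamma> t) = 0" using pL unfolding L by blast
      then show ?thesis unfolding L qc_def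
        by (rule generalized_hypersphere_quadric[OF HF.sp[OF aI, unfolded spacelike_coeffs_def] inH])
    qed
    moreover have "umbilic_with_curvature L (\<gamma> t) (- velocity \<gamma> t) (sin (\<alpha> t))"
      unfolding L_def by (rule hypersphere_eq_leaf(1)[OF inH unit])
    moreover have "orthogonal_at L \<gamma> t"
      unfolding orthogonal_at_def hyp_inner_def L_def using hypersphere_eq_leaf(2)[OF inH unit] by simp
    ultimately show ?thesis using pL by blast
  qed
  then show ?thesis unfolding umbilical_route_def using F by blast
qed

lemma route_sufficient:
  fixes \<gamma> :: "real \<Rightarrow> 'a::euclidean_space \<times> real" and h :: "real \<Rightarrow> real"
  assumes phi: "0 < \<phi>" "\<phi> < pi / 2" and \<gamma>: "phi_hypercycle \<phi> \<gamma>"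
    and C1: "h C1_differentiable_on UNIV" and h: "\<And>t. \<bar>h t\<bar> \<le> sin \<phi>" and rc: "route_conditions \<phi> h tm tp"
  shows "umbilical_route h \<gamma>"
proof -
  obtain D where "\<And>t. (h has_vector_derivative D t) (at t)" using C1 unfolding C1_differentiable_on_def by blast
  then have D: "\<And>t. (h has_real_derivative D t) (at t)" by (simp add: has_real_derivative_iff_has_vector_derivative)
  note \<alpha> = arcsin_route_derivative[OF phi h D]
  have "continuous_on UNIV (\<lambda>t. arcsin (h t))" using \<alpha> by (intro DERIV_continuous_on) auto
  then have "umbilical_route (\<lambda>t. sin (arcsin (h t))) \<gamma>"
    by (rule umbilical_route_monotone[of \<phi> \<gamma> "\<lambda>t. arcsin (h t)", OF phi \<gamma> _ route_angle(2)[OF phi h]])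
      (rule boundary_monotone[of \<phi> "\<lambda>t. arcsin (h t)" "\<lambda>t. D t / sqrt (1 - (h t)\<^sup>2)",
          OF phi route_angle(2)[OF phi h] \<alpha> route_conditions_angle[OF phi h D rc]])
  then show ?thesis by (simp only: route_angle(1)[OF phi h])
qed

section \<open>Necessity of the differential inequality\<close>

lemma line_derivative:
  fixes f :: "'b::euclidean_space \<Rightarrow> real"
  assumes "(f has_derivative D) (at (q + \<epsilon> *\<^sub>R \<nu>))"
  shows "((\<lambda>\<epsilon>. f (q + \<epsilon> *\<^sub>R \<nu>)) has_real_derivative D \<nu>) (at \<epsilon>)"
proof -
  have "((\<lambda>\<epsilon>. q + \<epsilon> *\<^sub>R \<nu>) has_vector_derivative \<nu>) (at \<epsilon>)"
    by (auto intro!: derivative_eq_intros)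
  then show ?thesis
    unfolding has_real_derivative_iff_has_vector_derivative by (rule has_vector_derivative_compose) (rule assms)
qed

lemma positive_direction:
  fixes f :: "'b::euclidean_space \<Rightarrow> real"
  assumes "(f has_derivative D) (at p)" "D \<noteq> (\<lambda>v. 0)"
  obtains v where "D v > 0"
proof -
  obtain v where v: "D v \<noteq> 0" using assms(2) by blast
  have "D (- v) = - D v" using linear_neg[OF has_derivative_linear[OF assms(1)]] .
  then show ?thesis using that[of v] that[of "- v"] v by (cases "D v > 0") auto
qed

text \<open>A regular point is not isolated in its level set, since a ball stays connected without its center.\<close>

lemma second_point_on_level:
  fixes f :: "'b::euclidean_space \<Rightarrow> real"
  assumes U: "open U" "p \<in> U" and dim: "2 \<le> DIM('b)" and f: "continuous_on U f"
    and D: "(f has_derivative D) (at p)" "D \<noteq> (\<lambda>v. 0)"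
  obtains q where "q \<in> U" "q \<noteq> p" "f q = f p"
proof -
  obtain v where v: "D v > 0" using positive_direction[OF D] by blast
  have v0: "v \<noteq> 0" using v linear_0[OF has_derivative_linear[OF D(1)]] by auto
  obtain e where e: "e > 0" "ball p e \<subseteq> U" using U by (rule openE)
  have g: "((\<lambda>\<epsilon>. f (p + \<epsilon> *\<^sub>R v)) has_real_derivative D v) (at 0)"
    by (rule line_derivative) (use D(1) in simp)
  obtain d1 where d1: "d1 > 0" "\<And>k. k > 0 \<Longrightarrow> k < d1 \<Longrightarrow> f p < f (p + k *\<^sub>R v)"
    using DERIV_pos_inc_right[OF g v] by auto
  obtain d2 where d2: "d2 > 0" "\<And>k. k > 0 \<Longrightarrow> k < d2 \<Longrightarrow> f (p - k *\<^sub>R v) < f p"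
    using DERIV_pos_inc_left[OF g v] by auto
  define k where "k = min (min d1 d2) (e / norm v) / 2"
  have k: "k > 0" "k < d1" "k < d2" using d1 d2 e v0 by (auto simp: k_def)
  have "k * norm v \<le> (e / norm v) / 2 * norm v" using v0 by (intro mult_right_mono) (auto simp: k_def)
  also have "\<dots> < e" using v0 e by simp
  finally have kv: "k * norm v < e" .
  let ?S = "ball p e - {p}"
  have S: "p + k *\<^sub>R v \<in> ?S" "p - k *\<^sub>R v \<in> ?S" using kv k(1) v0 by (auto simp: dist_norm)
  have "connected ?S" by (rule connected_open_delete) (use dim in auto)
  then have "connected (f ` ?S)" by (rule connected_continuous_image[rotated]) (rule continuous_on_subset[OF f], use e(2) in blast)
  moreover have "f (p - k *\<^sub>R v) \<in> f ` ?S" "f (p + k *\<^sub>R v) \<in> f ` ?S" by (intro imageI S)+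
  ultimately have "f p \<in> f ` ?S"
    using connectedD_interval[of "f ` ?S" "f (p - k *\<^sub>R v)" "f (p + k *\<^sub>R v)" "f p"] d1(2)[OF k(1,2)] d2(2)[OF k(1,3)] by simp
  then obtain q where "q \<in> ?S" "f q = f p" by (metis imageE)
  then show ?thesis using that e(2) by blast
qed

text \<open>
  The inverse function theorem for f on a line through q that is transverse to the level set.
\<close>

lemma transversal_parameter:
  fixes f :: "'b::euclidean_space \<Rightarrow> real"
  assumes U: "open U" "q \<in> U" and f: "Ck_on 1 U f" and ne: "frechet_derivative f (at q) \<noteq> (\<lambda>v. 0)"
  obtains \<nu> \<iota> D a b where "a < f q" "f q < b" "\<iota> (f q) = 0" "(\<iota> has_real_derivative D) (at (f q))"
    "\<forall>y\<in>{a<..<b}. q + \<iota> y *\<^sub>R \<nu> \<in> U \<and> f (q + \<iota> y *\<^sub>R \<nu>) = y"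
proof -
  have der: "(f has_derivative frechet_derivative f (at x)) (at x)" if "x \<in> U" for x
    using Ck_on_has_derivative[of 0 U f x] f that by simp
  obtain \<nu> where \<nu>: "frechet_derivative f (at q) \<nu> > 0" using positive_direction[OF der[OF U(2)] ne] by blast
  define W where "W = U \<inter> (\<lambda>x. frechet_derivative f (at x) \<nu>) -` {0<..}"
  have "Ck_on 0 U (\<lambda>x. frechet_derivative f (at x) \<nu>)" using f by (intro Ck_on_derivative) simp
  then have "continuous_on U (\<lambda>x. frechet_derivative f (at x) \<nu>)" by simp
  then have "open W" unfolding W_def by (rule continuous_open_preimage[OF _ U(1)]) simp
  moreover have "q \<in> W" using U(2) \<nu> by (simp add: W_def)
  ultimately obtain e where e: "e > 0" "ball q e \<subseteq> W" by (rule openE)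
  define d where "d = e / (norm \<nu> + 1)"
  have n1: "norm \<nu> + 1 > 0" using norm_ge_zero[of \<nu>] by linarith
  have d: "d > 0" unfolding d_def using e(1) n1 by (rule divide_pos_pos)
  have inW: "q + \<epsilon> *\<^sub>R \<nu> \<in> W" if "\<epsilon> \<in> {-d..d}" for \<epsilon>
  proof -
    have "\<bar>\<epsilon>\<bar> * norm \<nu> \<le> d * norm \<nu>" using that by (intro mult_right_mono) auto
    also have "\<dots> < d * (norm \<nu> + 1)" using d by simp
    also have "\<dots> = e" using n1 by (simp add: d_def)
    finally have "q + \<epsilon> *\<^sub>R \<nu> \<in> ball q e" by (simp add: dist_norm)
    then show ?thesis using e(2) by blast
  qed
  define g where "g = (\<lambda>\<epsilon>. f (q + \<epsilon> *\<^sub>R \<nu>))"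
  have g: "(g has_real_derivative frechet_derivative f (at (q + \<epsilon> *\<^sub>R \<nu>)) \<nu>) (at \<epsilon>)"
    and gpos: "frechet_derivative f (at (q + \<epsilon> *\<^sub>R \<nu>)) \<nu> > 0" if "\<epsilon> \<in> {-d..d}" for \<epsilon>
  proof -
    have *: "q + \<epsilon> *\<^sub>R \<nu> \<in> U" "frechet_derivative f (at (q + \<epsilon> *\<^sub>R \<nu>)) \<nu> > 0"
      using inW[OF that] by (simp_all add: W_def)
    show "(g has_real_derivative frechet_derivative f (at (q + \<epsilon> *\<^sub>R \<nu>)) \<nu>) (at \<epsilon>)"
      unfolding g_def by (rule line_derivative[OF der[OF *(1)]])
    show "frechet_derivative f (at (q + \<epsilon> *\<^sub>R \<nu>)) \<nu> > 0" by (rule *(2))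
  qed
  have less: "g x < g y" if "x \<in> {-d..d}" "y \<in> {-d..d}" "x < y" for x y
  proof (rule DERIV_pos_imp_increasing[OF that(3)])
    fix z assume "x \<le> z" "z \<le> y"
    then have "z \<in> {-d..d}" using that by simp
    then show "\<exists>D. (g has_real_derivative D) (at z) \<and> D > 0" using g gpos by blast
  qed
  have inj: "inj_on g {-d..d}"
  proof (rule inj_onI)
    fix x y assume "x \<in> {-d..d}" "y \<in> {-d..d}" "g x = g y"
    then show "x = y" using less[of x y] less[of y x] by (cases x y rule: linorder_cases) auto
  qed
  have cg: "continuous_on {-d..d} g"
    using g DERIV_isCont by (intro continuous_at_imp_continuous_on) blast
  define \<iota> where "\<iota> = the_inv_into {-d..d} g"
  have fq: "g 0 = f q" by (simp add: g_def)
  have ab: "g (- d) < f q" "f q < g d" using less[of "- d" 0] less[of 0 d] d by (simp_all add: fq[symmetric])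
  have img: "y \<in> g ` {-d..d}" if "g (- d) < y" "y < g d" for y
    using IVT'[of g "- d" y d] cg that d by auto
  have \<iota>: "\<iota> y \<in> {-d..d}" "g (\<iota> y) = y" if "g (- d) < y" "y < g d" for y
    unfolding \<iota>_def using the_inv_into_into[OF inj img[OF that] subset_refl] f_the_inv_into_f[OF inj img[OF that]] by blast+
  have \<iota>0: "\<iota> (f q) = 0" unfolding \<iota>_def fq[symmetric] using d by (intro the_inv_into_f_f[OF inj]) simp
  have "continuous_on (g ` {-d..d}) \<iota>" unfolding \<iota>_def by (rule continuous_on_inv_into[OF cg _ inj]) simp
  then have "continuous_on {g (- d)<..<g d} \<iota>" by (rule continuous_on_subset) (use img in auto)
  then have cont: "isCont \<iota> (f q)" using ab by (simp add: continuous_on_eq_continuous_at)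
  have z: "0 \<in> {-d..d}" using d by simp
  have "(\<iota> has_real_derivative inverse (frechet_derivative f (at (q + 0 *\<^sub>R \<nu>)) \<nu>)) (at (f q))"
    by (rule DERIV_inverse_function[where f = g and a = "g (- d)" and b = "g d"])
      (use g[OF z] gpos[OF z] ab \<iota>(2) cont in \<open>auto simp: \<iota>0\<close>)
  moreover have "\<forall>y\<in>{g (- d)<..<g d}. q + \<iota> y *\<^sub>R \<nu> \<in> U \<and> f (q + \<iota> y *\<^sub>R \<nu>) = y"
  proof
    fix y assume "y \<in> {g (- d)<..<g d}"
    then have y: "g (- d) < y" "y < g d" by simp_all
    show "q + \<iota> y *\<^sub>R \<nu> \<in> U \<and> f (q + \<iota> y *\<^sub>R \<nu>) = y"
      using inW[OF \<iota>(1)[OF y]] \<iota>(2)[OF y] unfolding g_def W_def by blast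
  qed
  ultimately show ?thesis using that[of "g (- d)" "g d" \<iota> _ \<nu>] ab \<iota>0 by blast
qed

text \<open>
  A second point of the leaf, moved by the transverse parameter, stays on the leaf through \<gamma> t. The
  curvature of the leaf is determined by this point, and depends differentiably on it.
\<close>

lemma leaf_curvature_differentiable:
  fixes \<gamma> :: "real \<Rightarrow> 'a::euclidean_space \<times> real" and h :: "real \<Rightarrow> real" and f :: "'a \<times> real \<Rightarrow> real"
  assumes U: "open U" "\<gamma> t0 \<in> U" and f: "Ck_on 1 U f" "\<And>x. x \<in> U \<Longrightarrow> frechet_derivative f (at x) \<noteq> (\<lambda>v. 0)"
    and \<gamma>: "\<And>t. (\<gamma> has_vector_derivative v t) (at t)" "\<And>t. (v has_vector_derivative v' t) (at t)" "\<And>t. \<gamma> t \<in> half_space"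
    and leaf: "\<And>t x. \<gamma> t \<in> U \<Longrightarrow> x \<in> U \<Longrightarrow> f x = f (\<gamma> t) \<Longrightarrow> hypersphere_eq (\<gamma> t) (v t) (h t) x = 0"
  shows "\<exists>D. (h has_real_derivative D) (at t0)"
proof -
  have der: "(f has_derivative frechet_derivative f (at x)) (at x)" if "x \<in> U" for x
    using Ck_on_has_derivative[of 0 U f x] f that by simp
  have cf: "continuous_on U f" using der by (intro continuous_at_imp_continuous_on) (auto intro: has_derivative_continuous)
  obtain q where q: "q \<in> U" "q \<noteq> \<gamma> t0" "f q = f (\<gamma> t0)"
    using second_point_on_level[OF U DIM_half_space cf der[OF U(2)] f(2)[OF U(2)]] by blast
  obtain \<nu> \<iota> D a b where \<iota>: "a < f q" "f q < b" "\<iota> (f q) = 0" "(\<iota> has_real_derivative D) (at (f q))"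
    "\<forall>y\<in>{a<..<b}. q + \<iota> y *\<^sub>R \<nu> \<in> U \<and> f (q + \<iota> y *\<^sub>R \<nu>) = y"
    using transversal_parameter[OF U(1) q(1) f(1) f(2)[OF q(1)]] .
  define E where "E = (\<lambda>t. q + \<iota> (f (\<gamma> t)) *\<^sub>R \<nu> - \<gamma> t)"
  have fd: "((\<lambda>t. f (\<gamma> t)) has_real_derivative frechet_derivative f (at (\<gamma> t0)) (v t0)) (at t0)"
    unfolding has_real_derivative_iff_has_vector_derivative
    by (rule has_vector_derivative_compose[OF \<gamma>(1) der[OF U(2)]])
  have "((\<lambda>t. \<iota> (f (\<gamma> t))) has_real_derivative D * frechet_derivative f (at (\<gamma> t0)) (v t0)) (at t0)"
    using DERIV_chain2[OF _ fd, of \<iota>] \<iota>(4) by (simp add: q(3))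
  then have "(\<lambda>t. \<iota> (f (\<gamma> t))) differentiable (at t0)" by (auto simp: real_differentiable_def)
  moreover have dg: "\<gamma> differentiable (at t0)" "v differentiable (at t0)"
    using \<gamma>(1,2) unfolding has_vector_derivative_def by (blast intro: differentiableI)+
  ultimately have dE: "E differentiable (at t0)" unfolding E_def by simp
  have ds: "(\<lambda>t. snd (\<gamma> t)) differentiable (at t0)" "(\<lambda>t. snd (v t)) differentiable (at t0)"
    using differentiable_compose[of snd \<gamma>] differentiable_compose[of snd v] dg
    by (simp_all add: bounded_linear_imp_differentiable bounded_linear_snd)
  have E0: "E t0 \<noteq> 0" using q \<iota>(3) by (simp add: E_def)
  define H where "H = (\<lambda>t. snd (v t) / snd (\<gamma> t) + 2 * (v t \<bullet> E t) / (E t \<bullet> E t))"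
  have y0: "snd (\<gamma> t) \<noteq> 0" for t using half_space_pos[OF \<gamma>(3)[of t]] by simp
  have dH: "H differentiable (at t0)"
    unfolding H_def using dE dg ds E0 y0[of t0] by simp
  have c\<gamma>: "isCont \<gamma> t0" using \<gamma>(1) by (rule has_vector_derivative_continuous)
  have cfg: "isCont (\<lambda>t. f (\<gamma> t)) t0" using fd by (rule DERIV_isCont)
  have cE: "isCont E t0" using dE by (rule differentiable_imp_continuous_within)
  have "eventually (\<lambda>t. \<gamma> t \<in> U) (at t0)"
    using c\<gamma> U by (auto simp: isCont_def intro: topological_tendstoD)
  moreover have "eventually (\<lambda>t. f (\<gamma> t) \<in> {a<..<b}) (at t0)"
    using topological_tendstoD[OF cfg[unfolded isCont_def] open_greaterThanLessThan, of a b] \<iota>(1,2) q(3) by simp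
  moreover have "eventually (\<lambda>t. E t \<in> - {0}) (at t0)"
    using tendsto_imp_eventually_ne[OF cE[unfolded isCont_def] E0] by simp
  ultimately have "eventually (\<lambda>t. h t = H t) (at t0)"
  proof eventually_elim
    case (elim t)
    let ?x = "q + \<iota> (f (\<gamma> t)) *\<^sub>R \<nu>"
    have "hypersphere_eq (\<gamma> t) (v t) (h t) ?x = 0" using elim \<iota>(5)[THEN bspec, of "f (\<gamma> t)"] by (intro leaf) auto
    then have "(h t - snd (v t) / snd (\<gamma> t)) * (E t \<bullet> E t) = 2 * (v t \<bullet> E t)" by (simp add: hypersphere_eq_def E_def)
    moreover have "E t \<bullet> E t \<noteq> 0" using elim by simp
    ultimately have "h t - snd (v t) / snd (\<gamma> t) = 2 * (v t \<bullet> E t) / (E t \<bullet> E t)"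
      by (metis nonzero_eq_divide_eq)
    then show ?case by (simp add: H_def)
  qed
  moreover have "h t0 = H t0"
  proof -
    have "hypersphere_eq (\<gamma> t0) (v t0) (h t0) q = 0" using U(2) q by (intro leaf) auto
    then have "(h t0 - snd (v t0) / snd (\<gamma> t0)) * (E t0 \<bullet> E t0) = 2 * (v t0 \<bullet> E t0)"
      using \<iota>(3) q(3) by (simp add: hypersphere_eq_def E_def)
    moreover have "E t0 \<bullet> E t0 \<noteq> 0" using E0 by simp
    ultimately have "h t0 - snd (v t0) / snd (\<gamma> t0) = 2 * (v t0 \<bullet> E t0) / (E t0 \<bullet> E t0)"
      by (metis nonzero_eq_divide_eq)
    then show ?thesis by (simp add: H_def)
  qed
  ultimately have "eventually (\<lambda>t. h t = H t) (nhds t0)" by (simp add: eventually_nhds_conv_at)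
  then obtain d where d: "d > 0" "\<And>t. dist t t0 < d \<Longrightarrow> H t = h t"
    unfolding eventually_nhds_metric by metis
  have "h differentiable (at t0)"
    by (rule differentiable_transform_within[OF dH d(1)]) (auto intro: d(2))
  then show ?thesis by (simp add: real_differentiable_def)
qed

text \<open>
  The comparison of the boundary point at t with later ones is a function that is nonnegative after t
  and vanishes at t, and whose derivative at t is a positive multiple of the asserted difference.
\<close>

lemma monotone_derivative_bound:
  fixes \<phi> :: real and \<alpha> :: "real \<Rightarrow> real"
  assumes phi: "0 < \<phi>" "\<phi> < pi / 2" and D: "(\<alpha> has_real_derivative D) (at t)"
  defines "A \<equiv> \<lambda>t. exp (sin \<phi> * t) * sin ((\<phi> + \<alpha> t) / 2)" and "B \<equiv> \<lambda>t. sin ((\<phi> - \<alpha> t) / 2)"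
  assumes mono: "\<And>t'. t < t' \<Longrightarrow> A t * B t' \<le> A t' * B t"
  shows "D \<ge> - 2 * sin ((\<phi> + \<alpha> t) / 2) * sin ((\<phi> - \<alpha> t) / 2)"
proof -
  let ?S1 = "sin ((\<phi> + \<alpha> t) / 2)" and ?C1 = "cos ((\<phi> + \<alpha> t) / 2)"
    and ?S2 = "sin ((\<phi> - \<alpha> t) / 2)" and ?C2 = "cos ((\<phi> - \<alpha> t) / 2)" and ?r = "exp (sin \<phi> * t)"
  define Z where "Z = (\<lambda>t'. B t * A t' - A t * B t')"
  define Z' where "Z' = B t * (?r * (sin \<phi> * ?S1 + ?C1 * (D / 2))) + A t * (?C2 * (D / 2))"
  have Z: "(Z has_real_derivative Z') (at t)"
    unfolding Z_def Z'_def A_def B_def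
    by (auto intro!: derivative_eq_intros D simp: field_simps)
  have "Z' \<ge> 0"
  proof (rule ccontr)
    assume "\<not> Z' \<ge> 0"
    then obtain d where d: "d > 0" "\<And>k. k > 0 \<Longrightarrow> k < d \<Longrightarrow> Z (t + k) < Z t"
      using DERIV_neg_dec_right[OF Z] by auto
    have "Z (t + d / 2) < Z t" using d by simp
    moreover have "Z t = 0" by (simp add: Z_def)
    moreover have "Z (t + d / 2) \<ge> 0" using mono[of "t + d / 2"] d(1) by (simp add: Z_def mult.commute)
    ultimately show False by simp
  qed
  moreover have "Z' = (?r * sin \<phi>) * (?S1 * ?S2 + D / 2)"
  proof -
    have e: "sin \<phi> = ?S1 * ?C2 + ?C1 * ?S2" by (rule half_angle_identities(1))
    have "Z' = ?r * sin \<phi> * (?S1 * ?S2) + ?r * (?S1 * ?C2 + ?C1 * ?S2) * (D / 2)"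
      unfolding Z'_def A_def B_def by (simp add: algebra_simps)
    then show ?thesis unfolding e[symmetric] by (simp add: algebra_simps)
  qed
  moreover have "?r * sin \<phi> > 0" using phi by (simp add: sin_gt_zero)
  ultimately have "?S1 * ?S2 + D / 2 \<ge> 0" by (simp only: zero_le_mult_iff) linarith
  then show ?thesis by simp
qed

lemma route_necessary:
  fixes F :: "('a::euclidean_space \<times> real) set set" and \<gamma> :: "real \<Rightarrow> 'a \<times> real" and h :: "real \<Rightarrow> real"
  assumes phi: "0 < \<phi>" "\<phi> < pi / 2" and C1: "transversely_C1_foliation F" and F: "totally_umbilical_foliation F"
    and \<gamma>: "phi_hypercycle \<phi> \<gamma>" and curv: "leaf_curvature_along F \<gamma> h"
  shows "\<bar>h t\<bar> \<le> sin \<phi>" "route_conditions \<phi> h (- \<infinity>) \<infinity>"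
proof -
  have s: "sin \<phi> > 0" using phi by (simp add: sin_gt_zero)
  have cc: "cos \<phi> > 0" using phi by (simp add: cos_gt_zero)
  obtain P Q R where sm: "smooth_on UNIV \<gamma>" and unit: "\<And>t. hyp_inner (\<gamma> t) (velocity \<gamma> t) (velocity \<gamma> t) = 1"
    and lor: "lor_hypercycle \<phi> \<gamma> P Q R"
    using phi_hypercycle_lor[OF \<gamma> s] by blast
  obtain T u where T: "motion T" and u: "norm u = 1" and std: "\<And>t. T (\<gamma> t) = exp (sin \<phi> * t) *\<^sub>R (cos \<phi> *\<^sub>R u, sin \<phi>)"
    using lor_hypercycle_standard[OF lor s cc] by blast
  have inH: "\<gamma> t \<in> half_space" for t using lor unfolding lor_hypercycle_def by blast
  note dg = smooth_curve_derivatives[OF sm]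
  define G where "G = (\<lambda>t. hypersphere_eq (\<gamma> t) (velocity \<gamma> t) (h t))"
  have cF: "codim1_foliation F" using F unfolding totally_umbilical_foliation_def by (rule conjunct1)
  then have part: "partition_on half_space F" unfolding codim1_foliation_def by (rule conjunct1)
  have leaf: "L = {q \<in> half_space. G t q = 0}" if L: "L \<in> F" and p: "\<gamma> t \<in> L" for L t
    unfolding G_def using curv L p unfolding leaf_curvature_along_def by (intro umbilical_foliation_leaf[OF F L p]) blast
  have leafF: "{q \<in> half_space. G t q = 0} \<in> F" for t
  proof -
    obtain L where L: "L \<in> F" "\<gamma> t \<in> L" using inH[of t] partition_onD1[OF part] by blast
    then show ?thesis using leaf[OF L] by simp
  qed
  interpret ray_leaves \<phi> u T \<gamma> h G
  proof
    show "0 < \<phi>" "\<phi> < pi / 2" "norm u = 1" by (rule phi u)+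
    show "bij_betw T half_space half_space" using T unfolding motion_def by (rule conjunct1)
    show "T (\<gamma> t) = exp (sin \<phi> * t) *\<^sub>R (cos \<phi> *\<^sub>R u, sin \<phi>)" for t by (rule std)
    show "\<gamma> t \<in> half_space" for t by (rule inH)
    show "continuous_on half_space (G t)" for t unfolding G_def hypersphere_eq_quadric by (rule continuous_on_quadric)
    show "\<exists>k>0. G t q = k * ell \<phi> u (h t) (exp (sin \<phi> * t)) (T q)" if q: "q \<in> half_space" for t q
      unfolding G_def using hypersphere_eq_standard[OF T u s std dg(1) inH q] by blast
    show "connected {q \<in> half_space. G t q = 0}" for t
      using cF leafF unfolding codim1_foliation_def by (intro path_connected_imp_connected) blast
    show "{q \<in> half_space. G t q = 0} = {q \<in> half_space. G t' q = 0}"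
      if q: "q \<in> half_space" "G t q = 0" "G t' q = 0" for t t' q
    proof (rule ccontr)
      assume "{q \<in> half_space. G t q = 0} \<noteq> {q \<in> half_space. G t' q = 0}"
      from disjointD[OF partition_onD2[OF part] leafF leafF this] show False using q by blast
    qed
  qed
  have "\<exists>D. (h has_real_derivative D) (at t0)" for t0
  proof -
    obtain U \<Phi> where U: "\<gamma> t0 \<in> U" and ch: "foliated_chart F U \<Phi>" and f: "Ck_on 1 U (\<lambda>x. snd (\<Phi> x))"
      "\<And>x. x \<in> U \<Longrightarrow> frechet_derivative (\<lambda>x. snd (\<Phi> x)) (at x) \<noteq> (\<lambda>v. 0)"
      using C1 inH[of t0] unfolding transversely_C1_foliation_def by blast
    have oU: "open U" using ch unfolding foliated_chart_def by blast
    have "G t x = 0" if t: "\<gamma> t \<in> U" and x: "x \<in> U" "snd (\<Phi> x) = snd (\<Phi> (\<gamma> t))" for t x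
    proof -
      let ?L = "{q \<in> half_space. G t q = 0}"
      have "\<gamma> t \<in> ?L \<inter> U" using t inH G_self by blast
      then have "path_component_set (?L \<inter> U) (\<gamma> t) = {x \<in> U. snd (\<Phi> x) = snd (\<Phi> (\<gamma> t))}"
        using ch leafF[of t] unfolding foliated_chart_def by blast
      then have "x \<in> path_component_set (?L \<inter> U) (\<gamma> t)" using x by blast
      then have "x \<in> ?L \<inter> U" using path_component_subset by blast
      then show ?thesis by blast
    qed
    then show ?thesis unfolding G_def
      by (intro leaf_curvature_differentiable[OF oU U f dg inH]) blast+
  qed
  then obtain D where D: "\<And>t. (h has_real_derivative D t) (at t)" by metis
  then have "continuous_on UNIV h" by (intro DERIV_continuous_on) auto
  then have bound: "\<bar>h t\<bar> \<le> sin \<phi>" for t by (rule curvature_bound)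
  then show "\<bar>h t\<bar> \<le> sin \<phi>" .
  have "D t / sqrt (1 - (h t)\<^sup>2) \<ge> - 2 * sin ((\<phi> + arcsin (h t)) / 2) * sin ((\<phi> - arcsin (h t)) / 2)" for t
    by (rule monotone_derivative_bound[of \<phi> "\<lambda>t. arcsin (h t)", OF phi arcsin_route_derivative[OF phi bound D]])
      (rule boundary_point_mono[OF bound])
  then have "D t \<ge> - 2 * sin ((\<phi> + arcsin (h t)) / 2) * sin ((\<phi> - arcsin (h t)) / 2) * sqrt (1 - (h t)\<^sup>2)" for t
    by (rule pos_le_divide_eq[OF route_angle(4)[OF phi bound], THEN iffD1])
  then show "route_conditions \<phi> h (- \<infinity>) \<infinity>"
    unfolding route_conditions_def route_bound_angle[OF phi bound] using D by auto
qed

theorem theorem3p5: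
  fixes \<phi> :: real
  assumes "0 < \<phi>" and "\<phi> < pi / 2"
  shows
    "(\<forall>(F :: ('a::euclidean_space \<times> real) set set) (\<gamma> :: real \<Rightarrow> 'a \<times> real) (h :: real \<Rightarrow> real).
        transversely_C1_foliation F \<and> totally_umbilical_foliation F \<and>
        phi_hypercycle \<phi> \<gamma> \<and> foliation_orthogonal_to F \<gamma> \<and> leaf_curvature_along F \<gamma> h \<longrightarrow>
        (\<forall>t. \<bar>h t\<bar> \<le> sin \<phi>) \<and> (\<exists>tm tp :: ereal. route_conditions \<phi> h tm tp)) \<and>
     (\<forall>h :: real \<Rightarrow> real.
        h C1_differentiable_on UNIV \<and> (\<forall>t. h t \<in> {- sin \<phi> .. sin \<phi>}) \<and>
        (\<exists>tm tp :: ereal. route_conditions \<phi> h tm tp) \<longrightarrow>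
        (\<forall>\<gamma> :: real \<Rightarrow> 'a \<times> real. phi_hypercycle \<phi> \<gamma> \<longrightarrow> umbilical_route h \<gamma>))"
proof (intro conjI allI impI; elim conjE exE)
  fix F :: "('a \<times> real) set set" and \<gamma> :: "real \<Rightarrow> 'a \<times> real" and h :: "real \<Rightarrow> real"
  assume F: "transversely_C1_foliation F" "totally_umbilical_foliation F" "phi_hypercycle \<phi> \<gamma>" "leaf_curvature_along F \<gamma> h"
  show "\<bar>h t\<bar> \<le> sin \<phi>" for t by (rule route_necessary(1)[OF assms F])
  show "\<exists>tm tp. route_conditions \<phi> h tm tp" using route_necessary(2)[OF assms F] by blast
next
  fix h :: "real \<Rightarrow> real" and \<gamma> :: "real \<Rightarrow> 'a \<times> real" and tm tp
  assume h: "h C1_differentiable_on UNIV" "\<forall>t. h t \<in> {- sin \<phi> .. sin \<phi>}" "route_conditions \<phi> h tm tp" and \<gamma>: "phi_hypercycle \<phi> \<gamma>"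
  have "\<bar>h t\<bar> \<le> sin \<phi>" for t using h(2)[THEN spec, of t] by (simp add: abs_le_iff)
  then show "umbilical_route h \<gamma>" by (rule route_sufficient[OF assms \<gamma> h(1) _ h(3)])
qed

end
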